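(* Let $R$ be a one-dimensional Cohen-Macaulay local ring with a canonical ideal $\omega_R$. Let $S$ be a finite birational extension of $R$ which is reflexive as an $R$-module. Let $I=R:S$ be the conductor of $S$ in $R$. The following are equivalent: 1. $S$ is Gorenstein. 2. $I$ is $I$-Ulrich and $\omega_R$-Ulrich; that is, $I\cong I^2\cong I\omega_R$ as $R$-modules.
   Context: All rings are commutative Noetherian with unity. $Q(R)$ is the total ring of fractions of $R$. A canonical ideal $\omega_R$ is an ideal of $R$ isomorphic to a canonical module of $R$; it contains a nonzerodivisor. A finite birational extension of $R$ is a ring $S$ with $R\subseteq S\subseteq Q(R)$ that is finitely generated as an $R$-module, and its conductor is $R:S=\{a\in Q(R): aS\subseteq R\}$. An $R$-module $M$ is reflexive if the natural map $M\to M^{**}$ is an isomorphism, with $M^*=\mathrm{Hom}_R(M,R)$. For an ideal $J$ containing a nonzerodivisor and a maximal Cohen-Macaulay $R$-module $M$, $M$ is $J$-Ulrich if $e_J(M)=\ell(M/JM)$, where $\ell$ is length and $e_J(M)$ is the Hilbert-Samuel multiplicity, i.e. the eventual constant value of $\ell(J^nM/J^{n+1}M)$ for $n\gg0$. *)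

theory Defs
  imports "HOL-Algebra.Module" "HOL-Algebra.Ideal_Product" "HOL-Algebra.Ring_Divisibility"
    "HOL-Algebra.Subrings" "HOL-Library.Extended_Nat"
begin

section \<open>Modules\<close>

text \<open>
  An additive subset \<open>X\<close> of a ring \<open>A\<close> that is closed under multiplication by a subring \<open>B\<close> of
  \<open>A\<close> is a \<open>B\<close>-module. The ring operations of \<open>as_module A X\<close> other than addition are irrelevant;
  the record type \<open>module\<close> merely has slots for them.
\<close>

definition as_module :: "('a, 'm) ring_scheme \<Rightarrow> 'a set \<Rightarrow> ('a, 'a) module" where
  "as_module A X = \<lparr>carrier = X, monoid.mult = monoid.mult A, one = \<one>\<^bsub>A\<^esub>,
     zero = \<zero>\<^bsub>A\<^esub>, add = add A, module.smult = monoid.mult A\<rparr>"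

abbreviation self_module :: "('a, 'm) ring_scheme \<Rightarrow> ('a, 'a) module" where
  "self_module A \<equiv> as_module A (carrier A)"

definition mod_hom ::
    "('a, 'm) ring_scheme \<Rightarrow> ('a, 'b) module \<Rightarrow> ('a, 'c) module \<Rightarrow> ('b \<Rightarrow> 'c) set" where
  "mod_hom R M N = {f \<in> carrier M \<rightarrow>\<^sub>E carrier N.
     (\<forall>x\<in>carrier M. \<forall>y\<in>carrier M. f (x \<oplus>\<^bsub>M\<^esub> y) = f x \<oplus>\<^bsub>N\<^esub> f y) \<and>
     (\<forall>r\<in>carrier R. \<forall>x\<in>carrier M. f (r \<odot>\<^bsub>M\<^esub> x) = r \<odot>\<^bsub>N\<^esub> f x)}"

definition module_isomorphic ::
    "('a, 'm) ring_scheme \<Rightarrow> ('a, 'b) module \<Rightarrow> ('a, 'c) module \<Rightarrow> bool" where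
  "module_isomorphic R M N \<longleftrightarrow> (\<exists>f\<in>mod_hom R M N. bij_betw f (carrier M) (carrier N))"

definition Hom_module ::
    "('a, 'm) ring_scheme \<Rightarrow> ('a, 'b) module \<Rightarrow> ('a, 'c) module \<Rightarrow> ('a, 'b \<Rightarrow> 'c) module" where
  "Hom_module R M N = \<lparr>carrier = mod_hom R M N, monoid.mult = undefined, one = undefined,
     zero = (\<lambda>x\<in>carrier M. \<zero>\<^bsub>N\<^esub>),
     add = (\<lambda>f g. \<lambda>x\<in>carrier M. f x \<oplus>\<^bsub>N\<^esub> g x),
     module.smult = (\<lambda>r f. \<lambda>x\<in>carrier M. r \<odot>\<^bsub>N\<^esub> f x)\<rparr>"

definition quot_module ::
    "('a, 'm) ring_scheme \<Rightarrow> ('a, 'b) module \<Rightarrow> 'b set \<Rightarrow> ('a, 'b set) module" where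
  "quot_module R M N = \<lparr>carrier = a_rcosets\<^bsub>M\<^esub> N, monoid.mult = undefined, one = undefined,
     zero = N, add = set_add M,
     module.smult = (\<lambda>r X. \<Union>x\<in>X. N +>\<^bsub>M\<^esub> (r \<odot>\<^bsub>M\<^esub> x))\<rparr>"

definition module_span ::
    "('a, 'm) ring_scheme \<Rightarrow> ('a, 'b) module \<Rightarrow> 'b set \<Rightarrow> 'b set" where
  "module_span R M X = \<Inter>{N. submodule N R M \<and> X \<subseteq> N}"

definition finitely_generated :: "('a, 'm) ring_scheme \<Rightarrow> ('a, 'b) module \<Rightarrow> bool" where
  "finitely_generated R M \<longleftrightarrow>
     module R M \<and> (\<exists>X. X \<subseteq> carrier M \<and> finite X \<and> module_span R M X = carrier M)"

definition module_length :: "('a, 'm) ring_scheme \<Rightarrow> ('a, 'b) module \<Rightarrow> enat" where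
  "module_length R M = Sup {enat n | n. \<exists>X. (\<forall>i\<le>n. submodule (X i) R M) \<and>
     (\<forall>i<n. X i \<subset> X (Suc i))}"

definition dual_module :: "('a, 'm) ring_scheme \<Rightarrow> ('a, 'b) module \<Rightarrow> ('a, 'b \<Rightarrow> 'a) module" where
  "dual_module R M = Hom_module R M (self_module R)"

definition reflexive_module :: "('a, 'm) ring_scheme \<Rightarrow> ('a, 'b) module \<Rightarrow> bool" where
  "reflexive_module R M \<longleftrightarrow>
     bij_betw (\<lambda>x\<in>carrier M. \<lambda>f\<in>carrier (dual_module R M). f x)
       (carrier M) (carrier (dual_module R (dual_module R M)))"


section \<open>Local rings, dimension and depth\<close>

definition nonzerodivisors :: "('a, 'm) ring_scheme \<Rightarrow> 'a set" where
  "nonzerodivisors R = {r \<in> carrier R. \<forall>x\<in>carrier R. r \<otimes>\<^bsub>R\<^esub> x = \<zero>\<^bsub>R\<^esub> \<longrightarrow> x = \<zero>\<^bsub>R\<^esub>}"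

definition noetherian_local_ring :: "('a, 'm) ring_scheme \<Rightarrow> bool" where
  "noetherian_local_ring R \<longleftrightarrow> cring R \<and> noetherian_ring R \<and> (\<exists>!m. maximalideal m R)"

definition max_ideal :: "('a, 'm) ring_scheme \<Rightarrow> 'a set" where
  "max_ideal R = (THE m. maximalideal m R)"

definition residue_field_module :: "('a, 'm) ring_scheme \<Rightarrow> ('a, 'a set) module" where
  "residue_field_module R = quot_module R (self_module R) (max_ideal R)"

definition krull_dim :: "('a, 'm) ring_scheme \<Rightarrow> enat" where
  "krull_dim R = Sup {enat n | n. \<exists>P. (\<forall>i\<le>n. primeideal (P i) R) \<and> (\<forall>i<n. P i \<subset> P (Suc i))}"

text \<open>For \<open>J\<close> a subset of \<open>R\<close> and \<open>X\<close> a subset of \<open>M\<close>, the submodule \<open>JX\<close> of \<open>M\<close>.\<close>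

definition ideal_smult ::
    "('a, 'm) ring_scheme \<Rightarrow> ('a, 'b) module \<Rightarrow> 'a set \<Rightarrow> 'b set \<Rightarrow> 'b set" where
  "ideal_smult R M J X = module_span R M {j \<odot>\<^bsub>M\<^esub> x | j x. j \<in> J \<and> x \<in> X}"

definition regular_sequence ::
    "('a, 'm) ring_scheme \<Rightarrow> ('a, 'b) module \<Rightarrow> 'a list \<Rightarrow> bool" where
  "regular_sequence R M xs \<longleftrightarrow> set xs \<subseteq> carrier R \<and>
     (\<forall>i<length xs. \<forall>v\<in>carrier M.
        (xs ! i) \<odot>\<^bsub>M\<^esub> v \<in> ideal_smult R M (set (take i xs)) (carrier M) \<longrightarrow>
        v \<in> ideal_smult R M (set (take i xs)) (carrier M)) \<and>
     ideal_smult R M (set xs) (carrier M) \<noteq> carrier M"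

definition depth :: "('a, 'm) ring_scheme \<Rightarrow> ('a, 'b) module \<Rightarrow> enat" where
  "depth R M = Sup {enat (length xs) | xs. regular_sequence R M xs \<and> set xs \<subseteq> max_ideal R}"

definition maximal_cohen_macaulay :: "('a, 'm) ring_scheme \<Rightarrow> ('a, 'b) module \<Rightarrow> bool" where
  "maximal_cohen_macaulay R M \<longleftrightarrow>
     finitely_generated R M \<and> carrier M \<noteq> {\<zero>\<^bsub>M\<^esub>} \<and> depth R M = krull_dim R"

definition cohen_macaulay_local_ring :: "('a, 'm) ring_scheme \<Rightarrow> bool" where
  "cohen_macaulay_local_ring R \<longleftrightarrow>
     noetherian_local_ring R \<and> depth R (self_module R) = krull_dim R"


section \<open>Injective resolutions and Ext\<close>

text \<open>
  HOL cannot quantify over modules of all types inside a definition, so injectivity is expressed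
  by Baer's criterion, which only refers to ideals of \<open>R\<close>.
\<close>

definition injective_module :: "('a, 'm) ring_scheme \<Rightarrow> ('a, 'b) module \<Rightarrow> bool" where
  "injective_module R E \<longleftrightarrow> module R E \<and>
     (\<forall>J f. ideal J R \<and> f \<in> mod_hom R (as_module R J) E \<longrightarrow>
        (\<exists>g\<in>mod_hom R (self_module R) E. \<forall>x\<in>J. g x = f x))"

definition injective_resolution ::
    "('a, 'm) ring_scheme \<Rightarrow> ('a, 'b) module \<Rightarrow>
      ('b \<Rightarrow> 'c) \<Rightarrow> (nat \<Rightarrow> ('a, 'c) module) \<Rightarrow> (nat \<Rightarrow> 'c \<Rightarrow> 'c) \<Rightarrow> bool" where
  "injective_resolution R M \<epsilon> E d \<longleftrightarrow>
     (\<forall>i. injective_module R (E i)) \<and>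
     \<epsilon> \<in> mod_hom R M (E 0) \<and> inj_on \<epsilon> (carrier M) \<and>
     (\<forall>i. d i \<in> mod_hom R (E i) (E (Suc i))) \<and>
     \<epsilon> ` carrier M = {x \<in> carrier (E 0). d 0 x = \<zero>\<^bsub>E 1\<^esub>} \<and>
     (\<forall>i. d i ` carrier (E i) = {x \<in> carrier (E (Suc i)). d (Suc i) x = \<zero>\<^bsub>E (Suc (Suc i))\<^esub>})"

text \<open>
  The modules of a resolution have to live on a fixed type. Over a Noetherian ring \<open>R\<close> every module
  \<open>M\<close> embeds in an injective module of cardinality at most the maximum of the cardinalities of \<open>R\<close>,
  \<open>M\<close> and the natural numbers: every ideal is finitely generated, so there are few enough maps from
  ideals to \<open>M\<close>, and extending all of them countably many times suffices. Hence, up to isomorphism, the type below has room for an injective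
  resolution of every \<open>M\<close>, and for a finite one whenever \<open>M\<close> has finite injective dimension.
\<close>

type_synonym ('a, 'b) res = "('a + 'b) list"

definition finite_injective_dimension :: "('a, 'm) ring_scheme \<Rightarrow> ('a, 'b) module \<Rightarrow> bool" where
  "finite_injective_dimension R M \<longleftrightarrow>
     (\<exists>(\<epsilon> :: 'b \<Rightarrow> ('a, 'b) res) E d n. injective_resolution R M \<epsilon> E d \<and>
        (\<forall>i>n. carrier (E i) = {\<zero>\<^bsub>E i\<^esub>}))"

definition Hom_cocycles ::
    "('a, 'm) ring_scheme \<Rightarrow> ('a, 'b) module \<Rightarrow> (nat \<Rightarrow> ('a, 'c) module) \<Rightarrow> (nat \<Rightarrow> 'c \<Rightarrow> 'c) \<Rightarrow>
      nat \<Rightarrow> ('b \<Rightarrow> 'c) set" where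
  "Hom_cocycles R N E d i =
     {f \<in> mod_hom R N (E i). \<forall>x\<in>carrier N. d i (f x) = \<zero>\<^bsub>E (Suc i)\<^esub>}"

fun Hom_coboundaries ::
    "('a, 'm) ring_scheme \<Rightarrow> ('a, 'b) module \<Rightarrow> (nat \<Rightarrow> ('a, 'c) module) \<Rightarrow> (nat \<Rightarrow> 'c \<Rightarrow> 'c) \<Rightarrow>
      nat \<Rightarrow> ('b \<Rightarrow> 'c) set" where
  "Hom_coboundaries R N E d 0 = {\<lambda>x\<in>carrier N. \<zero>\<^bsub>E 0\<^esub>}"
| "Hom_coboundaries R N E d (Suc i) = (\<lambda>f. compose (carrier N) (d i) f) ` mod_hom R N (E i)"

text \<open>
  \<open>Ext_module R i N M\<close> is the module Ext of \<open>N\<close> and \<open>M\<close> in degree \<open>i\<close>, computed from an arbitrarily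
  chosen injective resolution of \<open>M\<close>; up to isomorphism it does not depend on the choice.
\<close>

definition Ext_module ::
    "('a, 'm) ring_scheme \<Rightarrow> nat \<Rightarrow> ('a, 'n) module \<Rightarrow> ('a, 'b) module \<Rightarrow>
      ('a, ('n \<Rightarrow> ('a, 'b) res) set) module" where
  "Ext_module R i N M =
     (let (\<epsilon>, E, d) =
        (SOME (\<epsilon> :: 'b \<Rightarrow> ('a, 'b) res, E, d). injective_resolution R M \<epsilon> E d)
      in quot_module R ((Hom_module R N (E i))\<lparr>carrier := Hom_cocycles R N E d i\<rparr>)
           (Hom_coboundaries R N E d i))"


section \<open>Canonical modules and Gorenstein rings\<close>

text \<open>
  The type of \<open>M\<close> is the dimension over the residue field \<open>k\<close> of Ext of \<open>k\<close> and \<open>M\<close> in degree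
  \<open>depth M\<close>. This Ext module is annihilated by the maximal ideal, so its dimension over \<open>k\<close> is its
  length over \<open>R\<close>.
\<close>

definition cm_type :: "('a, 'm) ring_scheme \<Rightarrow> ('a, 'b) module \<Rightarrow> enat" where
  "cm_type R M =
     module_length R (Ext_module R (the_enat (depth R M)) (residue_field_module R) M)"

definition canonical_module :: "('a, 'm) ring_scheme \<Rightarrow> ('a, 'b) module \<Rightarrow> bool" where
  "canonical_module R C \<longleftrightarrow>
     maximal_cohen_macaulay R C \<and> finite_injective_dimension R C \<and> cm_type R C = 1"

definition canonical_ideal :: "('a, 'm) ring_scheme \<Rightarrow> 'a set \<Rightarrow> bool" where
  "canonical_ideal R \<omega> \<longleftrightarrow>
     ideal \<omega> R \<and> canonical_module R (as_module R \<omega>) \<and> \<omega> \<inter> nonzerodivisors R \<noteq> {}"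

definition loc_rel :: "('a, 'm) ring_scheme \<Rightarrow> 'a set \<Rightarrow> (('a \<times> 'a) \<times> ('a \<times> 'a)) set" where
  "loc_rel R P = {((a, s), (b, t)). a \<in> carrier R \<and> b \<in> carrier R \<and>
     s \<in> carrier R - P \<and> t \<in> carrier R - P \<and>
     (\<exists>u\<in>carrier R - P. u \<otimes>\<^bsub>R\<^esub> (a \<otimes>\<^bsub>R\<^esub> t \<ominus>\<^bsub>R\<^esub> b \<otimes>\<^bsub>R\<^esub> s) = \<zero>\<^bsub>R\<^esub>)}"

definition loc_frac :: "('a, 'm) ring_scheme \<Rightarrow> 'a set \<Rightarrow> 'a \<Rightarrow> 'a \<Rightarrow> ('a \<times> 'a) set" where
  "loc_frac R P a s = loc_rel R P `` {(a, s)}"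

definition localization :: "('a, 'm) ring_scheme \<Rightarrow> 'a set \<Rightarrow> ('a \<times> 'a) set ring" where
  "localization R P =
     \<lparr>carrier = (carrier R \<times> (carrier R - P)) // loc_rel R P,
      monoid.mult = (\<lambda>X Y. \<Union>(a, s)\<in>X. \<Union>(b, t)\<in>Y. loc_frac R P (a \<otimes>\<^bsub>R\<^esub> b) (s \<otimes>\<^bsub>R\<^esub> t)),
      one = loc_frac R P \<one>\<^bsub>R\<^esub> \<one>\<^bsub>R\<^esub>,
      zero = loc_frac R P \<zero>\<^bsub>R\<^esub> \<one>\<^bsub>R\<^esub>,
      add = (\<lambda>X Y. \<Union>(a, s)\<in>X. \<Union>(b, t)\<in>Y.
               loc_frac R P (a \<otimes>\<^bsub>R\<^esub> t \<oplus>\<^bsub>R\<^esub> b \<otimes>\<^bsub>R\<^esub> s) (s \<otimes>\<^bsub>R\<^esub> t))\<rparr>"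

definition gorenstein_local_ring :: "('a, 'm) ring_scheme \<Rightarrow> bool" where
  "gorenstein_local_ring A \<longleftrightarrow>
     noetherian_local_ring A \<and> finite_injective_dimension A (self_module A)"

definition gorenstein_ring :: "('a, 'm) ring_scheme \<Rightarrow> bool" where
  "gorenstein_ring A \<longleftrightarrow> cring A \<and> noetherian_ring A \<and>
     (\<forall>m. maximalideal m A \<longrightarrow> gorenstein_local_ring (localization A m))"


section \<open>Birational extensions and conductors\<close>

text \<open>
  The total ring of fractions of \<open>R\<close> is unique up to unique isomorphism over \<open>R\<close>; as usual, \<open>R\<close> is
  identified with its image in it.
\<close>

definition subring_of :: "'a ring \<Rightarrow> 'a ring \<Rightarrow> bool" where
  "subring_of R Q \<longleftrightarrow> subring (carrier R) Q \<and> R = Q\<lparr>carrier := carrier R\<rparr>"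

definition total_ring_of_fractions :: "'a ring \<Rightarrow> 'a ring \<Rightarrow> bool" where
  "total_ring_of_fractions R Q \<longleftrightarrow> cring Q \<and> subring_of R Q \<and>
     nonzerodivisors R \<subseteq> Units Q \<and>
     carrier Q = {a \<otimes>\<^bsub>Q\<^esub> inv\<^bsub>Q\<^esub> b | a b. a \<in> carrier R \<and> b \<in> nonzerodivisors R}"

definition finite_birational_extension :: "'a ring \<Rightarrow> 'a ring \<Rightarrow> 'a ring \<Rightarrow> bool" where
  "finite_birational_extension R Q S \<longleftrightarrow> subring_of S Q \<and> carrier R \<subseteq> carrier S \<and>
     finitely_generated R (self_module S)"

definition conductor :: "'a ring \<Rightarrow> 'a ring \<Rightarrow> 'a ring \<Rightarrow> 'a set" where
  "conductor R Q S = {a \<in> carrier Q. \<forall>s\<in>carrier S. a \<otimes>\<^bsub>Q\<^esub> s \<in> carrier R}"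


section \<open>Multiplicity and Ulrich modules\<close>

definition ideal_power_smult ::
    "('a, 'm) ring_scheme \<Rightarrow> 'a set \<Rightarrow> nat \<Rightarrow> ('a, 'b) module \<Rightarrow> 'b set" where
  "ideal_power_smult R J n M = (ideal_smult R M J ^^ n) (carrier M)"

text \<open>
  The multiplicity as the eventual value of the length of \<open>J^n M / J^(n+1) M\<close> is the
  Hilbert-Samuel multiplicity for rings of dimension one only.
\<close>

definition multiplicity_dim1 :: "('a, 'm) ring_scheme \<Rightarrow> 'a set \<Rightarrow> ('a, 'b) module \<Rightarrow> enat" where
  "multiplicity_dim1 R J M = (THE e. \<exists>N. \<forall>n\<ge>N.
     module_length R (quot_module R (M\<lparr>carrier := ideal_power_smult R J n M\<rparr>)
       (ideal_power_smult R J (Suc n) M)) = e)"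

definition ulrich_module :: "('a, 'm) ring_scheme \<Rightarrow> 'a set \<Rightarrow> ('a, 'b) module \<Rightarrow> bool" where
  "ulrich_module R J M \<longleftrightarrow>
     ideal J R \<and> J \<inter> nonzerodivisors R \<noteq> {} \<and> maximal_cohen_macaulay R M \<and>
     multiplicity_dim1 R J M =
       module_length R (quot_module R M (ideal_smult R M J (carrier M)))"

end

(* Everything takes place among the R-submodules of Q. Write X : Y for a colon module in Q and l for
  length. As w = omega is dualizing, X = w : (w : X) for all fractional ideals X. Reflexivity of S gives
  S = R : I = w : wI, so wI = w : S =: K is the canonical module of S.
  If S is Gorenstein, then K = uS; hence I is invertible over the semilocal ring S, so I = vS, and I, I^2 and
  wI are isomorphic, which makes I Ulrich for I and w. Conversely l(M/JM) is at most the multiplicity of J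
  for every fractional ideal M, with equality exactly if M is J-Ulrich. Counting lengths, the Ulrich
  conditions give w : I = wS and then I(wS : I) = wS; so wS and I are principal over S, and so is K.
  S is Gorenstein in the sense of finite injective dimension of its localizations A iff the socle of A/sA is
  simple for a regular s: if it is, then Q(A) and Q(A)/A are injective and resolve A; conversely a finite
  resolution yields Ext^2(A/J, A) = 0 for all J containing s, which forces a simple socle. *)
theory Submission
 imports Defs
begin

text \<open>The residue field may be finite, so an ideal \<open>J\<close> need not have a principal
  reduction. In its place stands a unit \<open>f\<close> of \<open>Q\<close> in some power
  \<open>J^d\<close> with \<open>J^(d+n) = f J^n\<close> for large \<open>n\<close>; it is a form of
  largest stable rank on the pieces \<open>J^n/sJ^n\<close>, all of which have the length of
  \<open>A/sA\<close>. For \<open>g\<close> a power of \<open>f\<close>, the ring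
  \<open>g^-1 J^D\<close> makes \<open>J\<close> invertible; the common value of
  \<open>l(N/JN)\<close> over its modules \<open>N\<close> is the multiplicity of every fractional
  ideal. Hence an Ulrich module is one that maximises \<open>l(M/JM)\<close>, and each Ulrich
  condition on \<open>I\<close> can be played against other fractional ideals. All finiteness comes
  from one regular element \<open>s\<close> in the Jacobson radical with \<open>A/sA\<close> of
  finite length. \<open>curve\<close> states this for a ring inside \<open>Q\<close>; it passes to
  \<open>S\<close> and to localizations, so duality over \<open>R\<close> and over \<open>S\<close>
  is one theory. Ideals need not contain a regular element and \<open>Q\<close> need not be reduced.
  Therefore the injectivity of \<open>Q\<close> and \<open>Q/A\<close> goes beyond fractional ideals
  and needs Krull's intersection theorem and a double annihilator theorem in
  \<open>Q\<close>.\<close>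

section \<open>Lengths of chains in a family of sets\<close>

text \<open>Lengths of quotients are measured by chains of intermediate submodules, so that
  \<open>X/Y\<close> itself is never formed. The shape is that of \<open>module_length\<close>, for
  an arbitrary family of sets.\<close>

definition clen :: "'c set set => enat" where
 "clen \<F> = Sup {enat n | n. \<exists>Z. (\<forall>i\<le>n. Z i \<in> \<F>) \<and> (\<forall>i<n. Z i \<subset> Z (Suc i))}"

lemma clen_ge:
 assumes "\<And>i. i <= n ==> Z i \<in> \<F>" "\<And>i. i < n ==> Z i \<subset> Z (Suc i)"
 shows "enat n <= clen \<F>" unfolding clen_def using assms by (intro Sup_upper) blast

lemma clen_le:
 assumes "\<And>n Z. (\<And>i. i <= n ==> Z i \<in> \<F>) ==> (\<And>i. i < n ==> Z i \<subset> Z (Suc i)) ==> enat n <= c"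
 shows "clen \<F> <= c" unfolding clen_def using assms by (intro Sup_least) blast

lemma clen_map:
 assumes "\<And>T. T \<in> \<F> ==> \<Phi> T \<in> \<G>"
  and "\<And>T T'. T \<in> \<F> ==> T' \<in> \<F> ==> T \<subset> T' ==> \<Phi> T \<subset> \<Phi> T'"
 shows "clen \<F> <= clen \<G>" proof (rule clen_le)
 fix n :: nat and Z
 assume "\<And>i. i <= n ==> Z i \<in> \<F>" "\<And>i. i < n ==> Z i \<subset> Z (Suc i)"
 then show "enat n <= clen \<G>" using assms by (intro clen_ge[where Z = "\<lambda>i. \<Phi> (Z i)"]) auto
qed

lemma enat_Sup_add_le:
 fixes c d :: enat
 assumes "S \<noteq> {}" "\<And>m. m \<in> S ==> m + c <= d" shows "Sup S + c <= d"
proof (cases c)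
 case (enat k)
 show ?thesis proof (cases d)
  case (enat e)
  have "m <= enat (e - k)" if "m \<in> S" for m
   using assms(2)[OF that] \<open>c = enat k\<close> enat by (cases m) auto
  then have "Sup S <= enat (e - k)" by (rule Sup_least)
  moreover have "k <= e"
   using assms \<open>c = enat k\<close> enat by (metis all_not_in_conv enat_ord_simps(1) le_iff_add add.commute order_trans)
  ultimately show ?thesis using \<open>c = enat k\<close> enat by (cases "Sup S") auto
 qed simp
next
 case infinity
 then show ?thesis using assms by auto
qed

text \<open>A function that grows by at least one along every strict inclusion bounds all chains.
  This takes the place of the Jordan-Hoelder theorem: additivity of length comes from a good choice
  of \<open>f\<close>.\<close>

lemma clen_rank:
 fixes f :: "'c set => enat"
 assumes bot: "B \<in> \<F>" "\<And>T. T \<in> \<F> ==> f B <= f T"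
  and top: "\<And>T. T \<in> \<F> ==> f T <= c"
  and step: "\<And>T T'. T \<in> \<F> ==> T' \<in> \<F> ==> T \<subset> T' ==> f T + 1 <= f T'"
 shows "clen \<F> + f B <= c" unfolding clen_def proof (rule enat_Sup_add_le)
 show "{enat n |n. \<exists>Z. (\<forall>i\<le>n. Z i \<in> \<F>) \<and> (\<forall>i<n. Z i \<subset> Z (Suc i))} \<noteq> {}"
  using bot(1) by (auto intro!: exI[of _ 0] exI[of _ "\<lambda>_. B"])
next
 fix m assume "m \<in> {enat n |n. \<exists>Z. (\<forall>i\<le>n. Z i \<in> \<F>) \<and> (\<forall>i<n. Z i \<subset> Z (Suc i))}"
 then obtain n Z where m: "m = enat n"
  and Z: "\<And>i. i <= n ==> Z i \<in> \<F>" "\<And>i. i < n ==> Z i \<subset> Z (Suc i)" by auto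
 have "enat k + f B <= f (Z k)" if "k <= n" for k using that proof (induction k)
  case 0
  then show ?case using bot(2) Z by (simp flip: zero_enat_def)
 next
  case (Suc k)
  have "enat (Suc k) + f B = enat k + f B + 1" by (metis add.commute add.assoc eSuc_enat plus_1_eSuc(1))
  also have "\<dots> <= f (Z k) + 1" using Suc by (intro add_right_mono) auto
  also have "\<dots> <= f (Z (Suc k))" using step Z Suc by auto
  finally show ?case .
 qed
 then show "m + f B <= c" using m top Z by (meson order_refl order_trans)
qed

text \<open>\<open>ideal_prod\<close> uses the operations of a ring but never its carrier; hence
  products of ideals formed in \<open>R\<close> and in \<open>Q\<close> are the same sets.\<close>

lemma ideal_prod_carrier_update [simp]: "ideal_prod (R\<lparr>carrier := C\<rparr>) X Y = ideal_prod R X Y"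
proof -
 have "z \<in> ideal_prod R X Y" if "z \<in> ideal_prod (R\<lparr>carrier := C\<rparr>) X Y" for z
  using that by induction (auto intro: ideal_prod.intros)
 moreover have "z \<in> ideal_prod (R\<lparr>carrier := C\<rparr>) X Y" if "z \<in> ideal_prod R X Y" for z
  using that proof induction
  case (prod i j)
  then show ?case using ideal_prod.prod[of i X j Y "R\<lparr>carrier := C\<rparr>"] by simp
 next
  case (sum s1 s2)
  then show ?case using ideal_prod.sum[of s1 "R\<lparr>carrier := C\<rparr>" X Y s2] by simp
 qed
 ultimately show ?thesis by blast
qed

lemma ideal_prod_minimal:
 fixes R (structure)
 assumes "\<And>x y. x \<in> X ==> y \<in> Y ==> x \<otimes> y \<in> Z" "\<And>x y. x \<in> Z ==> y \<in> Z ==> x \<oplus> y \<in> Z"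
 shows "X \<cdot> Y <= Z" proof
 fix z assume "z \<in> X \<cdot> Y"
 then show "z \<in> Z" by induction (use assms in auto)
qed

abbreviation msum :: "('a, 'm) ring_scheme => 'a set => 'a set => 'a set" (infixl "\<boxplus>\<index>" 65)
 where "X \<boxplus>\<^bsub>G\<^esub> Y \<equiv> set_add G X Y"

section \<open>Submodules, colons and products inside an ambient ring\<close>

context cring
begin

text \<open>The ambient ring is later the total ring of fractions, and \<open>A\<close> is the ring
  of scalars. Closure under negatives comes from the scalars: \<open>-1\<close> lies in
  \<open>A\<close> once \<open>A\<close> is a subring.\<close>

definition smod :: "'a set => 'a set => bool" where
 "smod A X \<longleftrightarrow> X <= carrier R \<and> \<zero> \<in> X \<and> (\<forall>x\<in>X. \<forall>y\<in>X. x \<oplus> y \<in> X) \<and>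
   (\<forall>a\<in>A. \<forall>x\<in>X. a \<otimes> x \<in> X)"

text \<open>For fractional ideals this is \<open>Hom(Y, X)\<close>, realised as the set of
  multiplications that carry \<open>Y\<close> into \<open>X\<close>.\<close>

definition colon :: "'a set => 'a set => 'a set" where
 "colon X Y = {q \<in> carrier R. \<forall>y\<in>Y. q \<otimes> y \<in> X}"

definition scale :: "'a => 'a set => 'a set" where
 "scale a X = (\<lambda>x. a \<otimes> x) ` X"

text \<open>For \<open>Y\<close> inside \<open>X\<close> this is the length of \<open>X/Y\<close>
  over \<open>A\<close>, by the correspondence theorem.\<close>

definition len :: "'a set => 'a set => 'a set => enat" where
 "len A X Y = clen {T. smod A T \<and> Y <= T \<and> T <= X}"

lemma smodI:
 assumes "X <= carrier R" "\<zero> \<in> X" "\<And>x y. x \<in> X ==> y \<in> X ==> x \<oplus> y \<in> X"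
  "\<And>a x. a \<in> A ==> x \<in> X ==> a \<otimes> x \<in> X" shows "smod A X"
 using assms unfolding smod_def by blast

lemma smodD:
 assumes "smod A X"
 shows "X <= carrier R" "\<zero> \<in> X" "x \<in> X ==> y \<in> X ==> x \<oplus> y \<in> X"
  "a \<in> A ==> x \<in> X ==> a \<otimes> x \<in> X" "x \<in> X ==> x \<in> carrier R"
 using assms unfolding smod_def by blast+

lemma smod_subring: "smod B X ==> A <= B ==> smod A X"
 unfolding smod_def by blast

lemma smod_neg:
 assumes "smod A X" "subring A R" "x \<in> X" shows "\<ominus> x \<in> X" proof -
 have "\<ominus> \<one> \<in> A" using subringE(3,5)[OF assms(2)] by blast
 then have "\<ominus> \<one> \<otimes> x \<in> X" using smodD(4)[OF assms(1)] assms(3) by blast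
 then show ?thesis using smodD(5)[OF assms(1,3)] by (simp add: l_minus)
qed

lemma smod_minus:
 assumes "smod A X" "subring A R" "x \<in> X" "y \<in> X" shows "x \<ominus> y \<in> X"
 using smod_neg[OF assms(1,2,4)] smodD(3)[OF assms(1,3)] by (simp add: a_minus_def)

lemma smod_inter: "smod A X ==> smod A Y ==> smod A (X \<inter> Y)"
 unfolding smod_def by blast

lemma mem_set_add: "z \<in> X \<boxplus> Y \<longleftrightarrow> (\<exists>x\<in>X. \<exists>y\<in>Y. z = x \<oplus> y)"
 unfolding set_add_def' by blast

lemma set_addI: "x \<in> X ==> y \<in> Y ==> x \<oplus> y \<in> X \<boxplus> Y"
 unfolding mem_set_add by blast

lemma smod_add:
 assumes "smod A X" "smod A Y" "A <= carrier R" shows "smod A (X \<boxplus> Y)" proof (rule smodI)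
 note X = smodD[OF assms(1)] and Y = smodD[OF assms(2)]
 show "X \<boxplus> Y <= carrier R" using X Y by (auto simp: mem_set_add)
 show "\<zero> \<in> X \<boxplus> Y" using set_addI[OF X(2) Y(2)] by simp
 show "x \<oplus> y \<in> X \<boxplus> Y" if "x \<in> X \<boxplus> Y" "y \<in> X \<boxplus> Y" for x y proof -
  obtain a b c d where *: "a \<in> X" "b \<in> Y" "x = a \<oplus> b" "c \<in> X" "d \<in> Y" "y = c \<oplus> d"
   using \<open>x \<in> X \<boxplus> Y\<close> \<open>y \<in> X \<boxplus> Y\<close> by (auto simp: mem_set_add)
  then have "x \<oplus> y = (a \<oplus> c) \<oplus> (b \<oplus> d)" using X(5) Y(5) by (simp add: a_ac)
  then show ?thesis using * X(3) Y(3) by (simp add: set_addI)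
 qed
 show "a \<otimes> x \<in> X \<boxplus> Y" if "a \<in> A" "x \<in> X \<boxplus> Y" for a x proof -
  obtain b c where *: "b \<in> X" "c \<in> Y" "x = b \<oplus> c" using \<open>x \<in> X \<boxplus> Y\<close> by (auto simp: mem_set_add)
  then have "a \<otimes> x = a \<otimes> b \<oplus> a \<otimes> c" using X(5) Y(5) assms(3) that by (auto simp: r_distr)
  then show ?thesis using * that X(4) Y(4) by (simp add: set_addI)
 qed
qed

lemma set_add_upper:
 assumes "smod A X" "smod A' Y" shows "X <= X \<boxplus> Y" "Y <= X \<boxplus> Y" proof -
 show "X <= X \<boxplus> Y" proof
  fix x assume "x \<in> X"
  moreover have "x = x \<oplus> \<zero>" using smodD(5)[OF assms(1)] \<open>x \<in> X\<close> by simp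
  ultimately show "x \<in> X \<boxplus> Y" using smodD(2)[OF assms(2)] by (metis set_addI)
 qed
 show "Y <= X \<boxplus> Y" proof
  fix y assume "y \<in> Y"
  moreover have "y = \<zero> \<oplus> y" using smodD(5)[OF assms(2)] \<open>y \<in> Y\<close> by simp
  ultimately show "y \<in> X \<boxplus> Y" using smodD(2)[OF assms(1)] by (metis set_addI)
 qed
qed

lemma set_add_least: "smod A Z ==> X <= Z ==> Y <= Z ==> X \<boxplus> Y <= Z"
 using smodD(3) by (auto simp: mem_set_add subset_iff)

lemma set_add_mono: "X <= X' ==> Y <= Y' ==> X \<boxplus> Y <= X' \<boxplus> Y'"
 unfolding mem_set_add subset_iff by blast

lemma scaleI: "x \<in> X ==> a \<otimes> x \<in> scale a X" unfolding scale_def by blast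

lemma mem_scale: "z \<in> scale a X \<longleftrightarrow> (\<exists>x\<in>X. z = a \<otimes> x)"
 unfolding scale_def by blast

lemma smod_scale:
 assumes "smod A X" "a \<in> carrier R" "A <= carrier R" shows "smod A (scale a X)"
proof (rule smodI)
 note X = smodD[OF assms(1)]
 show "scale a X <= carrier R" using X(5) assms by (auto simp: mem_scale)
 show "\<zero> \<in> scale a X" using X(2) assms by (metis r_null scaleI)
 show "x \<oplus> y \<in> scale a X" if xy: "x \<in> scale a X" "y \<in> scale a X" for x y proof -
  obtain u v where "u \<in> X" "v \<in> X" "x = a \<otimes> u" "y = a \<otimes> v" using xy by (auto simp: mem_scale)
  then show ?thesis using X(3,5) assms(2) by (metis r_distr scaleI)
 qed
 show "b \<otimes> x \<in> scale a X" if bx: "b \<in> A" "x \<in> scale a X" for b x proof -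
  obtain u where "u \<in> X" "x = a \<otimes> u" using bx by (auto simp: mem_scale)
  then have "b \<otimes> x = a \<otimes> (b \<otimes> u)" using X(5) assms(2,3) bx by (metis m_lcomm subsetD)
  then show ?thesis using X(4) \<open>u \<in> X\<close> bx by (simp add: scaleI)
 qed
qed

lemma scale_mono: "X <= Y ==> scale a X <= scale a Y"
 unfolding scale_def by blast

lemma scale_scale:
 "X <= carrier R ==> a \<in> carrier R ==> b \<in> carrier R ==> scale a (scale b X) = scale (a \<otimes> b) X"
 unfolding scale_def image_image by (rule image_cong) (auto simp: m_assoc)

lemma scale_one: "X <= carrier R ==> scale \<one> X = X"
 unfolding scale_def using l_one by force

lemma Units_inv_cancel [simp]:
 assumes "u \<in> Units R" "x \<in> carrier R"
 shows "inv u \<otimes> (u \<otimes> x) = x" "u \<otimes> (inv u \<otimes> x) = x"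
 using assms by (simp_all add: Units_closed flip: m_assoc)

lemma scale_inv:
 assumes "X <= carrier R" "u \<in> Units R"
 shows "scale u (scale (inv u) X) = X" "scale (inv u) (scale u X) = X"
 using assms by (simp_all add: scale_scale scale_one Units_closed)

lemma scale_subset_iff:
 assumes "X <= carrier R" "Y <= carrier R" "u \<in> Units R"
 shows "scale u X <= scale u Y \<longleftrightarrow> X <= Y"
 using assms by (metis scale_inv(2) scale_mono)

lemma smod_colon:
 assumes "smod A X" "A <= carrier R" "Y <= carrier R" shows "smod A (colon X Y)"
proof (rule smodI)
 note X = smodD[OF assms(1)]
 show "colon X Y <= carrier R" unfolding colon_def by blast
 show "\<zero> \<in> colon X Y" using X(2) assms(3) by (auto simp: colon_def subset_iff)
 show "x \<oplus> y \<in> colon X Y" if "x \<in> colon X Y" "y \<in> colon X Y" for x y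
  using that X(3) assms(3) by (auto simp: colon_def l_distr subset_iff)
 show "a \<otimes> x \<in> colon X Y" if "a \<in> A" "x \<in> colon X Y" for a x
  using that X(4) assms(2,3) by (auto simp: colon_def m_assoc subset_iff)
qed

text \<open>A colon inherits scalars from its second argument as well: \<open>A : S\<close> is an
  \<open>S\<close>-module although \<open>A\<close> is not.\<close>

lemma smod_colon':
 assumes "smod A Y" "smod B X" "A <= carrier R" shows "smod A (colon X Y)" proof (rule smodI)
 note X = smodD[OF assms(2)] and Y = smodD[OF assms(1)]
 show "colon X Y <= carrier R" unfolding colon_def by blast
 show "\<zero> \<in> colon X Y" using X(2) Y(5) by (auto simp: colon_def subset_iff)
 show "x \<oplus> y \<in> colon X Y" if "x \<in> colon X Y" "y \<in> colon X Y" for x y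
  using that X(3) Y(5) by (auto simp: colon_def l_distr subset_iff)
 show "a \<otimes> x \<in> colon X Y" if ax: "a \<in> A" "x \<in> colon X Y" for a x proof -
  have "a \<otimes> x \<otimes> y \<in> X" if "y \<in> Y" for y proof -
   have "a \<otimes> x \<otimes> y = x \<otimes> (a \<otimes> y)"
    using ax assms(3) Y(5) that by (auto simp: colon_def m_ac subset_iff)
   then show ?thesis using ax Y(4) that by (auto simp: colon_def)
  qed
  then show ?thesis using ax assms(3) by (auto simp: colon_def)
 qed
qed

lemma colon_mono: "X <= X' ==> Y' <= Y ==> colon X Y <= colon X' Y'"
 unfolding colon_def by blast

lemma colon_scale:
 assumes "u \<in> Units R" "X <= carrier R" "Y <= carrier R"
 shows "colon X (scale u Y) = scale (inv u) (colon X Y)" proof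
 show "colon X (scale u Y) <= scale (inv u) (colon X Y)" proof
  fix q assume q: "q \<in> colon X (scale u Y)"
  then have "u \<otimes> q \<in> colon X Y"
   using assms by (auto simp: colon_def scale_def m_ac Units_closed subset_iff)
  moreover have "q = inv u \<otimes> (u \<otimes> q)"
   using q assms by (simp add: colon_def Units_closed flip: m_assoc)
  ultimately show "q \<in> scale (inv u) (colon X Y)" by (metis scaleI)
 qed
 show "scale (inv u) (colon X Y) <= colon X (scale u Y)" proof
  fix q assume "q \<in> scale (inv u) (colon X Y)"
  then obtain p where p: "p \<in> colon X Y" "q = inv u \<otimes> p" by (auto simp: mem_scale)
  have "q \<otimes> (u \<otimes> y) = p \<otimes> y" if "y \<in> Y" for y proof -
   have c: "p \<in> carrier R" "y \<in> carrier R" "u \<in> carrier R" "inv u \<in> carrier R"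
    using p assms that by (auto simp: colon_def)
   have "q \<otimes> (u \<otimes> y) = (inv u \<otimes> u) \<otimes> (p \<otimes> y)"
    unfolding p(2) using c by algebra
   then show ?thesis using p assms that by (simp add: colon_def subset_iff)
  qed
  then show "q \<in> colon X (scale u Y)" using p assms by (auto simp: colon_def scale_def Units_closed)
 qed
qed

lemma colon_scale_left:
 assumes "u \<in> Units R" "X <= carrier R" "Y <= carrier R"
 shows "colon (scale u X) Y = scale u (colon X Y)" proof
 show "scale u (colon X Y) <= colon (scale u X) Y"
  using assms by (auto simp: colon_def scale_def m_assoc Units_closed subset_iff)
 show "colon (scale u X) Y <= scale u (colon X Y)" proof
  fix q assume q: "q \<in> colon (scale u X) Y"
  have "inv u \<otimes> q \<otimes> y \<in> X" if y: "y \<in> Y" for y proof -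
   obtain x where x: "x \<in> X" "q \<otimes> y = u \<otimes> x" using q y by (auto simp: colon_def scale_def)
   have "inv u \<otimes> q \<otimes> y = x"
    using q y x assms by (simp add: colon_def m_assoc Units_closed subset_iff)
   then show ?thesis using x assms by (simp add: subset_iff)
  qed
  then have "inv u \<otimes> q \<in> colon X Y" using q assms by (auto simp: colon_def)
  moreover have "q = u \<otimes> (inv u \<otimes> q)"
   using q assms by (simp add: colon_def Units_closed flip: m_assoc)
  ultimately show "q \<in> scale u (colon X Y)" by (metis scaleI)
 qed
qed

lemma prod_incl: "x \<in> X ==> y \<in> Y ==> x \<otimes> y \<in> X \<cdot> Y"
 by (rule ideal_prod.prod)

lemma prod_mono: "X <= X' ==> Y <= Y' ==> X \<cdot> Y <= X' \<cdot> Y'"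
 by (rule ideal_prod_minimal) (auto intro: ideal_prod.intros)

lemma prod_carrier: "X <= carrier R ==> Y <= carrier R ==> X \<cdot> Y <= carrier R"
 by (rule ideal_prod_minimal) auto

lemma prod_comm:
 assumes "X <= carrier R" "Y <= carrier R" shows "X \<cdot> Y = Y \<cdot> X" proof -
 have "X \<cdot> Y <= Y \<cdot> X" if "X <= carrier R" "Y <= carrier R" for X Y
 proof (rule ideal_prod_minimal)
  fix x y assume *: "x \<in> X" "y \<in> Y"
  then have "x \<otimes> y = y \<otimes> x" using that by (auto intro: m_comm)
  then show "x \<otimes> y \<in> Y \<cdot> X" using ideal_prod.prod[of y Y x X R] * by simp
 qed (rule ideal_prod.sum)
 then show ?thesis using assms by blast
qed

lemma prod_mult_closed:
 assumes "\<And>b x. b \<in> S ==> x \<in> X ==> b \<otimes> x \<in> X" "X <= carrier R" "Y <= carrier R" "S <= carrier R"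
  "a \<in> S" "z \<in> X \<cdot> Y" shows "a \<otimes> z \<in> X \<cdot> Y" using assms(6) proof induction
 case (prod i j)
 then have "a \<otimes> (i \<otimes> j) = a \<otimes> i \<otimes> j" using assms by (auto simp: m_assoc subset_iff)
 then show ?case using prod assms by (auto intro: ideal_prod.intros)
next
 case (sum s1 s2)
 then have "a \<otimes> (s1 \<oplus> s2) = a \<otimes> s1 \<oplus> a \<otimes> s2"
  using prod_carrier[OF assms(2,3)] assms(4,5) by (auto simp: r_distr subset_iff)
 then show ?case using sum by (auto intro: ideal_prod.intros)
qed

lemma smod_prod:
 assumes "smod A X" "Y <= carrier R" "y \<in> Y" "A <= carrier R"
 shows "smod A (X \<cdot> Y)" proof (rule smodI)
 note X = smodD[OF assms(1)]
 show "X \<cdot> Y <= carrier R" using X(1) assms(2) by (rule prod_carrier)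
 show "\<zero> \<in> X \<cdot> Y" using ideal_prod.prod[of \<zero> X y Y R] X(2) assms(2,3) by auto
 show "a \<otimes> x \<in> X \<cdot> Y" if "a \<in> A" "x \<in> X \<cdot> Y" for a x
  using prod_mult_closed[of A X Y a x] X assms that by blast
qed (rule ideal_prod.sum)

lemma smod_prod2:
 assumes "smod A X" "smod B Y" "A <= carrier R" shows "smod A (X \<cdot> Y)"
 using smod_prod[OF assms(1)] smodD(1,2)[OF assms(2)] assms(3) by blast

lemma prod_assoc:
 assumes "X <= carrier R" "Y <= carrier R" "Z <= carrier R"
 shows "X \<cdot> Y \<cdot> Z = X \<cdot> (Y \<cdot> Z)" proof -
 have *: "X \<cdot> Y \<cdot> Z <= X \<cdot> (Y \<cdot> Z)"
  if XYZ: "X <= carrier R" "Y <= carrier R" "Z <= carrier R" for X Y Z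
 proof (rule ideal_prod_minimal)
  fix w z assume w: "w \<in> X \<cdot> Y" and z: "z \<in> Z"
  show "w \<otimes> z \<in> X \<cdot> (Y \<cdot> Z)" using w proof induction
   case (prod i j)
   then have "i \<otimes> j \<otimes> z = i \<otimes> (j \<otimes> z)" using XYZ z by (auto simp: m_assoc subset_iff)
   then show ?case using prod z by (auto intro!: ideal_prod.prod)
  next
   case (sum s1 s2)
   have "(s1 \<oplus> s2) \<otimes> z = s1 \<otimes> z \<oplus> s2 \<otimes> z"
    using sum(1,2) prod_carrier[OF XYZ(1,2)] XYZ z by (auto simp: l_distr subset_iff)
   then show ?case using sum by (auto intro: ideal_prod.intros)
  qed
 qed (rule ideal_prod.sum)
 have "X \<cdot> (Y \<cdot> Z) = Z \<cdot> Y \<cdot> X" using assms prod_comm prod_carrier by metis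
 also have "\<dots> <= Z \<cdot> (Y \<cdot> X)" using * assms by blast
 also have "\<dots> = X \<cdot> Y \<cdot> Z" using assms prod_comm prod_carrier by metis
 finally show ?thesis using *[OF assms] by blast
qed

lemma prod_one:
 assumes "smod A X" "\<one> \<in> A" "A <= carrier R" shows "A \<cdot> X = X" proof
 show "A \<cdot> X <= X" by (rule ideal_prod_minimal) (use smodD[OF assms(1)] in auto)
 show "X <= A \<cdot> X" proof
  fix x assume "x \<in> X"
  then show "x \<in> A \<cdot> X" using ideal_prod.prod[of \<one> A x X R] assms smodD(5)[OF assms(1)] by simp
 qed
qed

lemma scale_prod:
 assumes "X <= carrier R" "Y <= carrier R" "a \<in> carrier R"
 shows "scale a X \<cdot> Y = scale a (X \<cdot> Y)" proof
 show "scale a X \<cdot> Y <= scale a (X \<cdot> Y)" proof (rule ideal_prod_minimal)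
  fix x y assume "x \<in> scale a X" "y \<in> Y"
  then obtain u where u: "u \<in> X" "x = a \<otimes> u" by (auto simp: mem_scale)
  then have "x \<otimes> y = a \<otimes> (u \<otimes> y)" using assms \<open>y \<in> Y\<close> by (auto simp: m_assoc subset_iff)
  then show "x \<otimes> y \<in> scale a (X \<cdot> Y)" using u \<open>y \<in> Y\<close> by (auto intro!: scaleI ideal_prod.prod)
 next
  fix x y assume "x \<in> scale a (X \<cdot> Y)" "y \<in> scale a (X \<cdot> Y)"
  then obtain u v where u: "u \<in> X \<cdot> Y" "x = a \<otimes> u" "v \<in> X \<cdot> Y" "y = a \<otimes> v" by (auto simp: mem_scale)
  then have "x \<oplus> y = a \<otimes> (u \<oplus> v)"
   using assms(3) prod_carrier[OF assms(1,2)] by (simp add: r_distr subset_iff)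
  then show "x \<oplus> y \<in> scale a (X \<cdot> Y)" using u by (auto intro!: scaleI ideal_prod.sum)
 qed
 show "scale a (X \<cdot> Y) <= scale a X \<cdot> Y" proof -
  have "X \<cdot> Y <= {w \<in> carrier R. a \<otimes> w \<in> scale a X \<cdot> Y}"
  proof (rule ideal_prod_minimal)
   show "x \<otimes> y \<in> {w \<in> carrier R. a \<otimes> w \<in> scale a X \<cdot> Y}" if "x \<in> X" "y \<in> Y" for x y
    using that assms prod_incl[OF scaleI[OF that(1), of a] that(2)] by (auto simp: m_assoc subset_iff)
  qed (use assms in \<open>auto simp: r_distr intro: ideal_prod.sum\<close>)
  then show ?thesis by (auto simp: mem_scale)
 qed
qed

lemma prod_subset_iff_colon:
 assumes "smod A X" "Y <= carrier R" "Z <= carrier R"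
 shows "Z \<cdot> Y <= X \<longleftrightarrow> Z <= colon X Y" proof
 assume "Z \<cdot> Y <= X"
 then show "Z <= colon X Y" using assms by (auto simp: colon_def intro: ideal_prod.prod)
next
 assume "Z <= colon X Y"
 then show "Z \<cdot> Y <= X"
  by (intro ideal_prod_minimal) (use smodD(3)[OF assms(1)] in \<open>auto simp: colon_def\<close>)
qed

text \<open>The adjunction between tensor product and \<open>Hom\<close>, for multiplication maps.
  All computations with iterated duals rest on it.\<close>

lemma colon_prod:
 assumes "smod A X" "Y <= carrier R" "Z <= carrier R"
 shows "colon X (Y \<cdot> Z) = colon (colon X Y) Z" proof -
 have "q \<in> colon X (Y \<cdot> Z) \<longleftrightarrow> q \<in> colon (colon X Y) Z" if q: "q \<in> carrier R" for q
 proof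
  assume L: "q \<in> colon X (Y \<cdot> Z)"
  have "q \<otimes> z \<otimes> y \<in> X" if "y \<in> Y" "z \<in> Z" for y z proof -
   have "q \<otimes> z \<otimes> y = q \<otimes> (y \<otimes> z)" using q that assms by (auto simp: m_ac subset_iff)
   then show ?thesis using L that by (auto simp: colon_def intro: ideal_prod.prod)
  qed
  then show "q \<in> colon (colon X Y) Z" using q assms by (auto simp: colon_def)
 next
  assume Rt: "q \<in> colon (colon X Y) Z"
  have "Y \<cdot> Z <= {w \<in> carrier R. q \<otimes> w \<in> X}" proof (rule ideal_prod_minimal)
   show "y \<otimes> z \<in> {w \<in> carrier R. q \<otimes> w \<in> X}" if "y \<in> Y" "z \<in> Z" for y z
   proof -
    have "q \<otimes> (y \<otimes> z) = q \<otimes> z \<otimes> y" using that q assms by (auto simp: m_ac subset_iff)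
    then show ?thesis using that assms Rt by (auto simp: colon_def subset_iff)
   qed
  qed (use q smodD(3)[OF assms(1)] in \<open>auto simp: r_distr\<close>)
  then show "q \<in> colon X (Y \<cdot> Z)" using q by (auto simp: colon_def)
 qed
 then show ?thesis unfolding colon_def by blast
qed

lemma modular_law:
 assumes "smod A X" "smod A Y" "smod A Z" "subring A R" "Z <= X"
 shows "X \<inter> (Y \<boxplus> Z) <= (X \<inter> Y) \<boxplus> Z" proof
 fix w assume "w \<in> X \<inter> (Y \<boxplus> Z)"
 then obtain y z where w: "w \<in> X" "y \<in> Y" "z \<in> Z" "w = y \<oplus> z" by (auto simp: mem_set_add)
 have c: "y \<in> carrier R" "z \<in> carrier R" using w smodD(5) assms by blast+
 have "y = w \<ominus> z" using w(4) c by (simp add: a_minus_def a_assoc r_neg)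
 then have "y \<in> X" using smod_minus[OF assms(1,4) w(1), of z] w(3) assms(5) by auto
 then show "w \<in> (X \<inter> Y) \<boxplus> Z" using w by (simp add: set_addI)
qed

text \<open>The modular law gives \<open>T' = T' \<inter> (Y + T) = (T' \<inter> Y) + T = T\<close>.
  The use is in the additivity of length: a strict inclusion must show either in the sum or in the
  intersection with \<open>Y\<close>.\<close>

lemma modular_cut:
 assumes "smod A T" "smod A T'" "smod A Y" "subring A R" "T <= T'"
  "T \<inter> Y = T' \<inter> Y" "T \<boxplus> Y = T' \<boxplus> Y" shows "T = T'" proof -
 have "T' <= T' \<inter> (Y \<boxplus> T)"
  using assms set_add_upper[OF assms(2,3)] smodD(1) set_add_comm by (metis Int_greatest order_refl)
 also have "\<dots> <= (T' \<inter> Y) \<boxplus> T" using modular_law assms by blast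
 also have "\<dots> <= T" using set_add_least assms by (metis Int_lower1 order_refl)
 finally show ?thesis using assms(5) by blast
qed

end

section \<open>Length of quotients of submodules\<close>

context cring begin

text \<open>Lengths are compared through strictly monotone maps between intervals of submodules; the
  map may also change the ring of scalars.\<close>

lemma len_map:
 assumes "\<And>T. smod A T ==> Y <= T ==> T <= X ==> smod A' (\<Phi> T) \<and> Y' <= \<Phi> T \<and> \<Phi> T <= X'"
  and "\<And>T T'. smod A T ==> smod A T' ==> Y <= T ==> T \<subset> T' ==> T' <= X ==> \<Phi> T \<subset> \<Phi> T'"
 shows "len A X Y <= len A' X' Y'" unfolding len_def proof (rule clen_map[where \<Phi> = \<Phi>])
 fix T assume "T \<in> {T. smod A T \<and> Y <= T \<and> T <= X}"
 then show "\<Phi> T \<in> {T. smod A' T \<and> Y' <= T \<and> T <= X'}" using assms(1)[of T] by blast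
next
 fix T T'
 assume "T \<in> {T. smod A T \<and> Y <= T \<and> T <= X}" "T' \<in> {T. smod A T \<and> Y <= T \<and> T <= X}" "T \<subset> T'"
 then show "\<Phi> T \<subset> \<Phi> T'" using assms(2)[of T T'] by blast
qed

lemma len_mono: "X <= X' ==> Y' <= Y ==> len A X Y <= len A X' Y'"
 by (rule len_map[where \<Phi> = id]) auto

lemma len_subring: "A <= B ==> len B X Y <= len A X Y"
 by (rule len_map[where \<Phi> = id]) (auto intro: smod_subring)

lemma len_self: "len A X X = 0" proof -
 have "enat n <= 0" if "\<And>i. i <= n ==> Z i \<in> {T. smod A T \<and> X <= T \<and> T <= X}"
  "\<And>i. i < n ==> Z i \<subset> Z (Suc i)" for n and Z :: "nat => 'a set"
 proof (cases n)
  case (Suc k)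
  have "Z 0 = X" using that(1)[of 0] by auto
  moreover have "Z (Suc 0) = X" using that(1)[of "Suc 0"] Suc by auto
  ultimately show ?thesis using that(2)[of 0] Suc by auto
 qed (simp add: zero_enat_def)
 then have "len A X X <= 0" unfolding len_def by (intro clen_le) blast
 then show ?thesis by simp
qed

lemma len_step:
 assumes "smod A T" "smod A T'" "Y <= T" "T \<subset> T'" shows "len A T Y + 1 <= len A T' Y"
 unfolding len_def clen_def[of "{V. smod A V \<and> Y <= V \<and> V <= T}"]
proof (rule enat_Sup_add_le)
 let ?F = "{V. smod A V \<and> Y <= V \<and> V <= T}"
 show "{enat n |n. \<exists>Z. (\<forall>i\<le>n. Z i \<in> ?F) \<and> (\<forall>i<n. Z i \<subset> Z (Suc i))} \<noteq> {}"
  using assms by (auto intro!: exI[of _ 0] exI[of _ "\<lambda>_. T"])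
 fix m assume "m \<in> {enat n |n. \<exists>Z. (\<forall>i\<le>n. Z i \<in> ?F) \<and> (\<forall>i<n. Z i \<subset> Z (Suc i))}"
 then obtain n Z where m: "m = enat n"
  and Z: "\<And>i. i <= n ==> Z i \<in> ?F" "\<And>i. i < n ==> Z i \<subset> Z (Suc i)" by blast
 have "enat (Suc n) <= clen {V. smod A V \<and> Y <= V \<and> V <= T'}"
 proof (rule clen_ge[where Z = "\<lambda>i. if i <= n then Z i else T'"])
  fix i show "(if i <= n then Z i else T') \<in> {V. smod A V \<and> Y <= V \<and> V <= T'}"
   using Z(1)[of i] assms by auto
 next
  fix i assume i: "i < Suc n"
  show "(if i <= n then Z i else T') \<subset> (if Suc i <= n then Z (Suc i) else T')"
  proof (cases "i < n")
   case False
   then have "i = n" using i by simp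
   then show ?thesis using Z(1)[of n] assms(4) by auto
  qed (use Z(2) in auto)
 qed
 then show "m + 1 <= clen {V. smod A V \<and> Y <= V \<and> V <= T'}"
  using m by (simp add: one_enat_def)
qed

lemma len_rank:
 fixes f :: "'a set => enat"
 assumes "smod A X" "smod A Y" "Y <= X"
  and "\<And>T T'. smod A T ==> smod A T' ==> Y <= T ==> T \<subset> T' ==> T' <= X ==> f T + 1 <= f T'"
 shows "len A X Y + f Y <= f X" unfolding len_def proof (rule clen_rank)
 have mono: "f T <= f T'" if "smod A T" "smod A T'" "Y <= T" "T <= T'" "T' <= X" for T T'
 proof (cases "T = T'")
  case False
  then have "f T + 1 <= f T'" using assms(4)[of T T'] that by blast
  then show ?thesis by (cases "f T"; cases "f T'") (simp_all add: one_enat_def)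
 qed simp
 show "f Y <= f T" if "T \<in> {T. smod A T \<and> Y <= T \<and> T <= X}" for T
  using mono that assms by blast
 show "f T <= f X" if "T \<in> {T. smod A T \<and> Y <= T \<and> T <= X}" for T
  using mono that assms by blast
qed (use assms in auto)

text \<open>By \<open>modular_cut\<close>, \<open>l((T+Y)/Y) + l((T \<inter> Y)/Z)\<close> grows at
  every strict inclusion of \<open>T\<close>, which bounds \<open>l(X/Z)\<close> from above; for the
  other bound the rank function is \<open>l(T/Z)\<close>. Infinite lengths are included.\<close>

lemma len_add:
 assumes "subring A R" "smod A X" "smod A Y" "smod A Z" "Z <= Y" "Y <= X"
 shows "len A X Z = len A X Y + len A Y Z" proof (rule antisym)
 have AR: "A <= carrier R" using subringE(1)[OF assms(1)] .
 have XY: "X \<boxplus> Y = X" "X \<inter> Y = Y"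
  using set_add_least[OF assms(2), of X Y] set_add_upper[OF assms(2,3)] assms(6) by auto
 have ZY: "Z \<boxplus> Y = Y" "Z \<inter> Y = Z"
  using set_add_least[OF assms(3), of Z Y] set_add_upper[OF assms(4,3)] assms(5) by auto
 have "len A X Z + (len A (Z \<boxplus> Y) Y + len A (Z \<inter> Y) Z) <= len A (X \<boxplus> Y) Y + len A (X \<inter> Y) Z"
 proof (rule len_rank)
  fix T T' assume T: "smod A T" "smod A T'" "Z <= T" "T \<subset> T'" "T' <= X"
  have s: "smod A (T \<boxplus> Y)" "smod A (T' \<boxplus> Y)" "smod A (T \<inter> Y)" "smod A (T' \<inter> Y)"
   using T assms AR smod_add smod_inter by auto
  have le: "T \<boxplus> Y <= T' \<boxplus> Y" "T \<inter> Y <= T' \<inter> Y" using T set_add_mono[of T T' Y Y] by auto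
  have bot: "Y <= T \<boxplus> Y" "Z <= T \<inter> Y" using set_add_upper(2)[OF T(1) assms(3)] T assms by auto
  consider "T \<boxplus> Y \<subset> T' \<boxplus> Y" | "T \<inter> Y \<subset> T' \<inter> Y"
   using modular_cut[OF T(1,2) assms(3,1)] T(4) le by blast
  then show "len A (T \<boxplus> Y) Y + len A (T \<inter> Y) Z + 1 <= len A (T' \<boxplus> Y) Y + len A (T' \<inter> Y) Z"
  proof cases
   case 1
   then have "len A (T \<boxplus> Y) Y + 1 <= len A (T' \<boxplus> Y) Y" using len_step s bot by blast
   moreover have "len A (T \<inter> Y) Z <= len A (T' \<inter> Y) Z" using len_mono le by blast
   ultimately show ?thesis by (metis add.assoc add.commute add_mono)
  next
   case 2
   then have "len A (T \<inter> Y) Z + 1 <= len A (T' \<inter> Y) Z" using len_step s bot by blast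
   moreover have "len A (T \<boxplus> Y) Y <= len A (T' \<boxplus> Y) Y" using len_mono le by blast
   ultimately show ?thesis by (metis add.assoc add_mono)
  qed
 qed (use assms in auto)
 then show "len A X Z <= len A X Y + len A Y Z" using XY ZY by (simp add: len_self)
 show "len A X Y + len A Y Z <= len A X Z" by (rule len_rank) (use assms len_step in auto)
qed

lemma len_eq_0:
 assumes "smod A X" "smod A Y" "Y <= X" "len A X Y = 0" shows "X = Y" proof (rule ccontr)
 assume "X \<noteq> Y"
 then have "len A Y Y + 1 <= len A X Y" using len_step assms by blast
 then show False using assms(4) by (simp add: len_self)
qed

lemma len_scale:
 assumes "smod A X" "smod A Y" "u \<in> Units R" "A <= carrier R"
 shows "len A (scale u X) (scale u Y) = len A X Y" proof -
 have *: "len A X Y <= len A (scale u X) (scale u Y)" if "smod A X" "smod A Y" "u \<in> Units R" for u X Y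
 proof (rule len_map[where \<Phi> = "scale u"])
  fix T assume "smod A T" "Y <= T" "T <= X"
  then show "smod A (scale u T) \<and> scale u Y <= scale u T \<and> scale u T <= scale u X"
   using that assms(4) smod_scale scale_mono Units_closed by auto
 next
  fix T T' assume "smod A T" "smod A T'" "Y <= T" "T \<subset> T'" "T' <= X"
  then show "scale u T \<subset> scale u T'"
   using scale_subset_iff[of T T' u] scale_subset_iff[of T' T u] smodD(1) that(3)
   unfolding psubset_eq by blast
 qed
 have "len A (scale u X) (scale u Y) <= len A (scale (inv u) (scale u X)) (scale (inv u) (scale u Y))"
  using * smod_scale assms Units_closed by auto
 then show ?thesis using *[OF assms(1-3)] scale_inv smodD(1) assms by (metis antisym)
qed

text \<open>The second isomorphism theorem: intersecting with \<open>X\<close> and adding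
  \<open>Y\<close> are strictly monotone between the two intervals.\<close>

lemma len_inter_add:
 assumes "subring A R" "smod A X" "smod A Y" shows "len A (X \<boxplus> Y) Y = len A X (X \<inter> Y)"
proof (rule antisym)
 have AR: "A <= carrier R" using subringE(1)[OF assms(1)] .
 have [simp]: "X \<boxplus> Y = Y \<boxplus> X" using set_add_comm smodD(1) assms by auto
 show "len A (X \<boxplus> Y) Y <= len A X (X \<inter> Y)"
 proof (rule len_map[where \<Phi> = "\<lambda>T. X \<inter> T"])
  fix T T' assume T: "smod A T" "smod A T'" "Y <= T" "T \<subset> T'" "T' <= X \<boxplus> Y"
  have "T' <= (T' \<inter> X) \<boxplus> Y" using modular_law[OF T(2) assms(2,3,1)] T by auto
  moreover have "(T \<inter> X) \<boxplus> Y <= T" using set_add_least T by auto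
  ultimately have "X \<inter> T \<noteq> X \<inter> T'" using T(4) by (metis Int_commute psubsetE subset_trans)
  then show "X \<inter> T \<subset> X \<inter> T'" using T(4) by blast
 qed (use assms smod_inter in auto)
 show "len A X (X \<inter> Y) <= len A (X \<boxplus> Y) Y"
 proof (rule len_map[where \<Phi> = "\<lambda>T. T \<boxplus> Y"])
  fix T assume T: "smod A T" "X \<inter> Y <= T" "T <= X"
  then show "smod A (T \<boxplus> Y) \<and> Y <= T \<boxplus> Y \<and> T \<boxplus> Y <= X \<boxplus> Y"
   using smod_add[OF T(1) assms(3) AR] set_add_upper[OF T(1) assms(3)] set_add_mono[of T X Y Y] by auto
 next
  fix T T' assume T: "smod A T" "smod A T'" "X \<inter> Y <= T" "T \<subset> T'" "T' <= X"
  have "T \<inter> Y = T' \<inter> Y" using T by blast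
  then have "T \<boxplus> Y \<noteq> T' \<boxplus> Y" using modular_cut[OF T(1,2) assms(3,1)] T by blast
  then show "T \<boxplus> Y \<subset> T' \<boxplus> Y" using set_add_mono[of T T' Y Y] T by auto
 qed
qed

text \<open>The kernel of multiplication by \<open>a\<close> from \<open>X\<close> to
  \<open>(aX + Y')/Y'\<close> lies in \<open>Y\<close>, so its image is at least as long as
  \<open>X/Y\<close>.\<close>

lemma len_mult_inj:
 assumes "subring A R" "smod A X" "smod A Y" "smod A Y'" "a \<in> carrier R" "Y <= X"
  and inj: "\<And>x. x \<in> X ==> a \<otimes> x \<in> Y' ==> x \<in> Y"
 shows "len A X Y <= len A (scale a X \<boxplus> Y') Y'"
proof (rule len_map[where \<Phi> = "\<lambda>T. scale a T \<boxplus> Y'"])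
 have AR: "A <= carrier R" using subringE(1)[OF assms(1)] .
 fix T assume T: "smod A T" "Y <= T" "T <= X"
 have sT: "smod A (scale a T)" using smod_scale T assms AR by auto
 show "smod A (scale a T \<boxplus> Y') \<and> Y' <= scale a T \<boxplus> Y' \<and> scale a T \<boxplus> Y' <= scale a X \<boxplus> Y'"
  using smod_add[OF sT assms(4) AR] set_add_upper[OF sT assms(4)]
   set_add_mono[OF scale_mono[OF T(3), of a], of Y' Y'] by auto
next
 have AR: "A <= carrier R" using subringE(1)[OF assms(1)] .
 fix T T' assume T: "smod A T" "smod A T'" "Y <= T" "T \<subset> T'" "T' <= X"
 then obtain x where x: "x \<in> T'" "x \<notin> T" by blast
 have sT: "smod A (scale a T')" using smod_scale T assms AR by auto
 have "a \<otimes> x \<in> scale a T' \<boxplus> Y'" using set_add_upper[OF sT assms(4)] x scaleI by blast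
 moreover have "a \<otimes> x \<notin> scale a T \<boxplus> Y'" proof
  assume "a \<otimes> x \<in> scale a T \<boxplus> Y'"
  then obtain t y where t: "t \<in> T" "y \<in> Y'" "a \<otimes> x = a \<otimes> t \<oplus> y" by (auto simp: mem_set_add mem_scale)
  have c: "t \<in> carrier R" "y \<in> carrier R" "x \<in> carrier R" using t x smodD(5) T assms by blast+
  have "a \<otimes> (x \<ominus> t) = a \<otimes> x \<ominus> a \<otimes> t" using c assms(5) by algebra
  also have "\<dots> = y" unfolding t(3) using c assms(5) by algebra
  finally have "a \<otimes> (x \<ominus> t) \<in> Y'" using t(2) by simp
  moreover have "x \<ominus> t \<in> X" using smod_minus[OF assms(2,1)] x t T by blast
  ultimately have "x \<ominus> t \<in> T" using inj T by blast
  then have "(x \<ominus> t) \<oplus> t \<in> T" using smodD(3)[OF T(1)] t by blast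
  moreover have "(x \<ominus> t) \<oplus> t = x" using c by algebra
  ultimately show False using x by simp
 qed
 ultimately show "scale a T \<boxplus> Y' \<subset> scale a T' \<boxplus> Y'"
  using set_add_mono[OF scale_mono[of T T' a], of Y' Y'] T by blast
qed

end

section \<open>Maximal ideals and simple quotients\<close>

context cring begin

definition maxl :: "'a set => 'a set => bool" where
 "maxl A n \<longleftrightarrow> smod A n \<and> n \<subset> A \<and> (\<forall>X. smod A X \<and> n <= X \<and> X \<subset> A --> X = n)"

lemma smod_self: "subring A R ==> smod A A" using subringE[of A R] by (intro smodI) auto

lemma smod_cyclic:
 assumes "subring A R" "x \<in> carrier R" shows "smod A (scale x A)" "x \<in> scale x A" proof -
 show "smod A (scale x A)"
  using smod_scale[OF smod_self[OF assms(1)] assms(2)] subringE(1)[OF assms(1)] by blast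
 show "x \<in> scale x A" using scaleI[of \<one> A x] subringE(3)[OF assms(1)] assms(2) by simp
qed

lemma mem_cyclic: "subring A R ==> x \<in> carrier R ==> z \<in> scale x A \<longleftrightarrow> (\<exists>a\<in>A. z = a \<otimes> x)"
 using subringE(1)[of A R] by (auto simp: mem_scale m_comm subset_iff)

lemma cyclic_least:
 assumes "subring A R" "smod A X" "x \<in> X" shows "scale x A <= X"
 using assms smodD[OF assms(2)] by (auto simp: mem_cyclic)

text \<open>A cover \<open>X' \<subset> X\<close> of submodules has \<open>X/X'\<close> isomorphic to the quotient by a maximal ideal.\<close>

lemma cover_maxl:
 assumes A: "subring A R" and X: "smod A X" "smod A X'" "X' \<subset> X"
  and cover: "\<And>T. smod A T ==> X' <= T ==> T <= X ==> T = X' \<or> T = X"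
  and z: "z \<in> X" "z \<notin> X'"
 shows "X = X' \<boxplus> scale z A" "maxl A {a \<in> A. a \<otimes> z \<in> X'}"
  "a \<in> A ==> a \<otimes> z \<in> X' ==> x \<in> X ==> a \<otimes> x \<in> X'"
proof -
 have AR: "A <= carrier R" using subringE(1)[OF A] .
 have zc: "z \<in> carrier R" using z X smodD by blast
 note AD = subringE(2-7)[OF A] and X1 = smodD[OF X(2)]
 have gen: "X = X' \<boxplus> scale w A" if w: "w \<in> X" "w \<notin> X'" for w proof -
  have wc: "w \<in> carrier R" using w X smodD by blast
  have s: "smod A (X' \<boxplus> scale w A)" using smod_add X smod_cyclic A wc AR by blast
  have "X' \<boxplus> scale w A <= X" using set_add_least[OF X(1)] cyclic_least[OF A X(1) w(1)] X(3) by blast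
  moreover have "X' <= X' \<boxplus> scale w A" "w \<in> X' \<boxplus> scale w A"
   using set_add_upper[OF X(2) smod_cyclic(1)[OF A wc]] smod_cyclic(2)[OF A wc] by auto
  ultimately show ?thesis using cover[OF s] w by blast
 qed
 then show Xz: "X = X' \<boxplus> scale z A" using z by blast
 show *: "a \<otimes> x \<in> X'" if "a \<in> A" "a \<otimes> z \<in> X'" "x \<in> X" for a x proof -
  obtain y b where y: "y \<in> X'" "b \<in> A" "x = y \<oplus> b \<otimes> z"
   using \<open>x \<in> X\<close> Xz A zc by (auto simp: mem_set_add mem_cyclic)
  have c: "a \<in> carrier R" "b \<in> carrier R" "y \<in> carrier R" using y that AR X1(5) by auto
  have "a \<otimes> x = a \<otimes> y \<oplus> b \<otimes> (a \<otimes> z)" unfolding y(3) using c zc by algebra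
  then show ?thesis using X1(3,4) y that by simp
 qed
 let ?n = "{a \<in> A. a \<otimes> z \<in> X'}"
 have sn: "smod A ?n" proof (rule smodI)
  show "\<zero> \<in> ?n" using AD(1) X1(2) zc by simp
  show "x \<oplus> y \<in> ?n" if "x \<in> ?n" "y \<in> ?n" for x y
   using that AD X1(3) zc AR by (auto simp: l_distr subset_iff)
  show "a \<otimes> x \<in> ?n" if "a \<in> A" "x \<in> ?n" for a x
   using that AD X1(4) zc AR by (auto simp: m_assoc subset_iff)
 qed (use AR in auto)
 have "\<one> \<notin> ?n" using z zc by simp
 then have nA: "?n \<subset> A" using AD(2) by blast
 have "J = ?n" if J: "smod A J" "?n <= J" "J \<subset> A" for J proof (rule ccontr)
  assume "J \<noteq> ?n"
  then obtain a where a: "a \<in> J" "a \<in> A" "a \<otimes> z \<notin> X'" using J by blast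
  have "a \<otimes> z \<in> X" using smodD(4)[OF X(1)] a z by blast
  \<comment> \<open>The element \<open>az\<close> generates \<open>X\<close> modulo
    \<open>X'\<close> as well, so \<open>z = y + b(az)\<close>. Then \<open>1 - ba\<close> carries
    \<open>z\<close> into \<open>X'\<close> and belongs to \<open>J\<close>, as does
    \<open>ba\<close>; hence \<open>J\<close> contains \<open>1\<close>.\<close>
  then have "z \<in> X' \<boxplus> scale (a \<otimes> z) A" using gen a z by blast
  then obtain y w where y: "y \<in> X'" "w \<in> scale (a \<otimes> z) A" "z = y \<oplus> w"
   unfolding mem_set_add by blast
  moreover have "a \<otimes> z \<in> carrier R" using a zc AR by auto
  ultimately obtain b where "b \<in> A" "w = b \<otimes> (a \<otimes> z)" using mem_cyclic[OF A] by blast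
  note y = y(1) this(1) y(3)[unfolded this(2)]
  have c: "a \<in> carrier R" "b \<in> carrier R" "y \<in> carrier R" using y a AR X1(5) by auto
  have "(\<one> \<ominus> b \<otimes> a) \<otimes> z = z \<ominus> b \<otimes> (a \<otimes> z)" using c zc by algebra
  also have "\<dots> = (y \<oplus> b \<otimes> (a \<otimes> z)) \<ominus> b \<otimes> (a \<otimes> z)" using y(3) by simp
  also have "\<dots> = y" using c zc by algebra
  finally have "\<one> \<ominus> b \<otimes> a \<in> ?n"
   using y smod_minus[OF smod_self[OF A] A AD(2), of "b \<otimes> a"] AD(5) a by simp
  then have "\<one> \<ominus> b \<otimes> a \<in> J" using J by blast
  moreover have "b \<otimes> a \<in> J" using smodD(4)[OF J(1)] y a by blast
  ultimately have "(\<one> \<ominus> b \<otimes> a) \<oplus> b \<otimes> a \<in> J" using smodD(3)[OF J(1)] by blast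
  moreover have "(\<one> \<ominus> b \<otimes> a) \<oplus> b \<otimes> a = \<one>" using c by algebra
  ultimately have "\<one> \<in> J" by simp
  then have "A <= J" using smodD(4)[OF J(1)] AR by (metis r_one subsetD subsetI)
  then show False using J by blast
 qed
 then show "maxl A ?n" using sn nA unfolding maxl_def by blast
qed

lemma maxl_prime:
 assumes A: "subring A R" and n: "maxl A n" and ab: "a \<in> A" "b \<in> A" "a \<otimes> b \<in> n" "a \<notin> n"
 shows "b \<in> n" proof -
 have AR: "A <= carrier R" using subringE(1)[OF A] .
 have sn: "smod A n" using n by (simp add: maxl_def)
 have ac: "a \<in> carrier R" "b \<in> carrier R" using ab AR by auto
 have s: "smod A (n \<boxplus> scale a A)" using smod_add[OF sn smod_cyclic(1)[OF A ac(1)] AR] .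
 have "n <= n \<boxplus> scale a A" "a \<in> n \<boxplus> scale a A"
  using set_add_upper[OF sn smod_cyclic(1)[OF A ac(1)]] smod_cyclic(2)[OF A ac(1)] by auto
 moreover have "n \<boxplus> scale a A <= A"
  using set_add_least[OF smod_self[OF A]] cyclic_least[OF A smod_self[OF A] ab(1)] n by (auto simp: maxl_def)
 ultimately have "n \<boxplus> scale a A = A" using n s ab(4) unfolding maxl_def by blast
 then have "\<one> \<in> n \<boxplus> scale a A" using subringE(3)[OF A] by simp
 then obtain y c where y: "y \<in> n" "c \<in> A" "\<one> = y \<oplus> c \<otimes> a"
  using A ac by (auto simp: mem_set_add mem_cyclic)
 have yc: "y \<in> carrier R" "c \<in> carrier R" using y AR smodD(5)[OF sn] by auto
 have "b = b \<otimes> (y \<oplus> c \<otimes> a)" using y(3)[symmetric] ac by simp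
 also have "\<dots> = b \<otimes> y \<oplus> c \<otimes> (a \<otimes> b)" using yc ac by algebra
 finally show ?thesis using smodD(3,4)[OF sn] y ab by metis
qed

text \<open>\<open>c\<close> is an inverse of \<open>a\<close> in the field
  \<open>A/n\<close>.\<close>

lemma maxl_inverse:
 assumes A: "subring A R" and n: "maxl A n" and a: "a \<in> A" "a \<notin> n"
 obtains y c where "y \<in> n" "c \<in> A" "\<one> = y \<oplus> c \<otimes> a" proof -
 have AR: "A <= carrier R" using subringE(1)[OF A] .
 have sn: "smod A n" using n by (simp add: maxl_def)
 have ac: "a \<in> carrier R" using a AR by auto
 have s: "smod A (n \<boxplus> scale a A)" using smod_add[OF sn smod_cyclic(1)[OF A ac(1)] AR] .
 have "n <= n \<boxplus> scale a A" "a \<in> n \<boxplus> scale a A"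
  using set_add_upper[OF sn smod_cyclic(1)[OF A ac(1)]] smod_cyclic(2)[OF A ac(1)] by auto
 moreover have "n \<boxplus> scale a A <= A"
  using set_add_least[OF smod_self[OF A]] cyclic_least[OF A smod_self[OF A] a(1)] n by (auto simp: maxl_def)
 ultimately have "n \<boxplus> scale a A = A" using n s a(2) unfolding maxl_def by blast
 then have "\<one> \<in> n \<boxplus> scale a A" using subringE(3)[OF A] by simp
 then show thesis using that A ac by (auto simp: mem_set_add mem_cyclic)
qed

end

section \<open>One-dimensional rings inside their ring of fractions\<close>

text \<open>A model of Noetherian semilocal rings of dimension one: \<open>s\<close> is a regular
  element of the Jacobson radical, \<open>A/sA\<close> has finite length and \<open>Q\<close> is
  \<open>A[1/s]\<close>. Finite generation of ideals is stated through the submodules above a finite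
  set. The ring need not be local, so the locale serves for \<open>R\<close>, for \<open>S\<close>
  and for localizations of \<open>S\<close>.\<close>

locale curve = cring Q for Q (structure) +
 fixes A :: "'a set" and s :: 'a
 assumes A: "subring A Q" and s_A: "s \<in> A" and s_unit: "s \<in> Units Q"
  and denom: "q \<in> carrier Q ==> \<exists>k::nat. s [^] k \<otimes> q \<in> A"
  and noeth: "smod A I ==> I <= A ==> \<exists>F. finite F \<and> F <= I \<and> (\<forall>X. smod A X \<and> F <= X --> I <= X)"
  and jac: "maxl A n ==> s \<in> n" and fin: "len A A (scale s A) \<noteq> \<infinity>"
begin

lemma AQ: "A <= carrier Q" using subringE(1)[OF A] .
lemma one_A: "\<one> \<in> A" using subringE(3)[OF A] .
lemma A_mult: "a \<in> A ==> b \<in> A ==> a \<otimes> b \<in> A" using subringE(6)[OF A] .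
lemma A_add: "a \<in> A ==> b \<in> A ==> a \<oplus> b \<in> A" using subringE(7)[OF A] .
lemma A_closed: "a \<in> A ==> a \<in> carrier Q" using AQ by blast
lemma smod_A: "smod A A" using smod_self[OF A] .
lemma s_closed: "s \<in> carrier Q" using s_unit by (rule Units_closed)

lemma pow_unit: "u \<in> Units Q ==> u [^] (k::nat) \<in> Units Q" by (rule Units_pow_closed)

lemma spow_A: "s [^] (k::nat) \<in> A" by (induction k) (auto simp: one_A A_mult s_A)

lemma spow_unit: "s [^] (k::nat) \<in> Units Q" using s_unit by (rule pow_unit)

lemma spow_closed: "s [^] (k::nat) \<in> carrier Q" using s_closed by simp

text \<open>Regular fractional ideals. As \<open>Q = A[1/s]\<close>, containing a unit of
  \<open>Q\<close> and having a common denominator are both expressed by powers of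
  \<open>s\<close>.\<close>

definition frac :: "'a set => bool" where
 "frac X \<longleftrightarrow> smod A X \<and> (\<exists>k::nat. s [^] k \<in> X) \<and> (\<exists>k::nat. scale (s [^] k) X <= A)"

lemma frac_smod: "frac X ==> smod A X" by (simp add: frac_def)
lemma frac_carrier: "frac X ==> X <= carrier Q" using frac_smod smodD(1) by blast

lemma frac_A: "frac A" using smod_A one_A scale_one[OF AQ] unfolding frac_def by (metis nat_pow_0 order_refl)

lemma spow_mono:
 assumes "smod A X" "s [^] (k::nat) \<in> X" "k <= l" shows "s [^] l \<in> X" proof -
 have "s [^] l = s [^] (l - k) \<otimes> s [^] k" using assms(3) s_closed by (simp add: nat_pow_mult)
 then show ?thesis using smodD(4)[OF assms(1) spow_A assms(2)] by simp
qed

lemma scale_spow_mono: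
 assumes "smod A X" "k <= l" shows "scale (s [^] (l::nat)) X <= scale (s [^] k) X" proof -
 have "scale (s [^] l) X = scale (s [^] k) (scale (s [^] (l - k)) X)"
  using assms s_closed smodD(1)[OF assms(1)] by (simp add: scale_scale nat_pow_mult)
 moreover have "scale (s [^] (l - k)) X <= X"
  using smodD(4)[OF assms(1) spow_A] by (auto simp: mem_scale)
 ultimately show ?thesis using scale_mono by metis
qed

lemma scale_A_subset: "smod A X ==> x \<in> X ==> scale x A <= X"
 using cyclic_least[OF A] .

lemma frac_between:
 assumes "frac X" "frac Y" "smod A T" "X <= T" "T <= Y" shows "frac T"
 using assms scale_mono unfolding frac_def by (meson subset_iff order_trans)

lemma frac_comparable:
 assumes "frac X" "frac Y"
 obtains k :: nat where "scale (s [^] k) X <= Y" proof -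
 obtain i j :: nat where i: "scale (s [^] i) X <= A" and j: "s [^] j \<in> Y"
  using assms unfolding frac_def by blast
 have "scale (s [^] (j + i)) X = scale (s [^] j) (scale (s [^] i) X)"
  using s_closed frac_carrier[OF assms(1)] by (simp add: scale_scale nat_pow_mult)
 also have "\<dots> <= scale (s [^] j) A" using i scale_mono by blast
 also have "\<dots> <= Y" using scale_A_subset j assms frac_smod by blast
 finally show thesis using that by blast
qed

lemma scale_spow_frac_subset: "smod A X ==> scale (s [^] (k::nat)) X <= X"
 using smodD(4)[OF _ spow_A] by (auto simp: mem_scale)

lemma frac_scale:
 assumes "frac X" "u \<in> Units Q" shows "frac (scale u X)" proof -
 have X: "smod A X" "X <= carrier Q" using assms frac_smod frac_carrier by auto
 have uc: "u \<in> carrier Q" "inv u \<in> carrier Q" using assms by auto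
 obtain i j where i: "s [^] (i::nat) \<in> X" and j: "scale (s [^] (j::nat)) X <= A"
  using assms unfolding frac_def by blast
 obtain k l where k: "s [^] (k::nat) \<otimes> u \<in> A" and l: "s [^] (l::nat) \<otimes> inv u \<in> A"
  using denom uc by blast
 have "s [^] (l + i) = u \<otimes> (s [^] l \<otimes> inv u \<otimes> s [^] i)" proof -
  have "u \<otimes> (s [^] l \<otimes> inv u \<otimes> s [^] i) = (u \<otimes> inv u) \<otimes> (s [^] l \<otimes> s [^] i)"
   using uc spow_closed[of l] spow_closed[of i] by algebra
  then show ?thesis using assms s_closed by (simp add: nat_pow_mult)
 qed
 then have "s [^] (l + i) \<in> scale u X" using smodD(4)[OF X(1) l i] scaleI by metis
 moreover have "scale (s [^] (k + j)) (scale u X) <= A" proof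
  fix z assume "z \<in> scale (s [^] (k + j)) (scale u X)"
  then obtain x where x: "x \<in> X" "z = s [^] (k + j) \<otimes> (u \<otimes> x)" by (auto simp: mem_scale)
  have "z = (s [^] k \<otimes> u) \<otimes> (s [^] j \<otimes> x)" proof -
   have "x \<in> carrier Q" using x X by blast
   then have "(s [^] k \<otimes> s [^] j) \<otimes> (u \<otimes> x) = (s [^] k \<otimes> u) \<otimes> (s [^] j \<otimes> x)"
    using uc spow_closed[of k] spow_closed[of j] by algebra
   then show ?thesis using x s_closed by (simp add: nat_pow_mult)
  qed
  moreover have "s [^] j \<otimes> x \<in> A" using j x scaleI by blast
  ultimately show "z \<in> A" using A_mult k by simp
 qed
 moreover have "smod A (scale u X)" using smod_scale X uc AQ by blast
 ultimately show ?thesis unfolding frac_def by blast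
qed

lemma frac_inter:
 assumes "frac X" "frac Y" shows "frac (X \<inter> Y)" proof -
 obtain i j where ij: "s [^] (i::nat) \<in> X" "s [^] (j::nat) \<in> Y" using assms unfolding frac_def by blast
 then have "s [^] (max i j) \<in> X \<inter> Y"
  using spow_mono[OF frac_smod[OF assms(1)] ij(1)] spow_mono[OF frac_smod[OF assms(2)] ij(2)] by simp
 moreover obtain k where "scale (s [^] (k::nat)) X <= A" using assms unfolding frac_def by blast
 then have "scale (s [^] k) (X \<inter> Y) <= A" using scale_mono[of "X \<inter> Y" X] by blast
 ultimately show ?thesis using smod_inter frac_smod assms unfolding frac_def by blast
qed

lemma frac_prod:
 assumes "frac X" "frac Y" shows "frac (X \<cdot> Y)" proof -
 have X: "smod A X" "X <= carrier Q" and Y: "smod A Y" "Y <= carrier Q"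
  using assms frac_smod frac_carrier by auto
 obtain i j where ij: "s [^] (i::nat) \<in> X" "s [^] (j::nat) \<in> Y" using assms unfolding frac_def by blast
 have low: "s [^] (i + j) \<in> X \<cdot> Y" using prod_incl[OF ij] s_closed by (simp add: nat_pow_mult)
 obtain k l where kl: "scale (s [^] (k::nat)) X <= A" "scale (s [^] (l::nat)) Y <= A"
  using assms unfolding frac_def by blast
 have "scale (s [^] k \<otimes> s [^] l) (X \<cdot> Y) = scale (s [^] k) X \<cdot> scale (s [^] l) Y" proof -
  have "scale (s [^] k) X \<cdot> scale (s [^] l) Y = scale (s [^] k) (X \<cdot> scale (s [^] l) Y)"
   using scale_prod[OF X(2) smodD(1)[OF smod_scale[OF Y(1) spow_closed AQ]] spow_closed] .
  also have "X \<cdot> scale (s [^] l) Y = scale (s [^] l) Y \<cdot> X"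
   using prod_comm[OF X(2) smodD(1)[OF smod_scale[OF Y(1) spow_closed AQ]]] .
  also have "\<dots> = scale (s [^] l) (X \<cdot> Y)"
   using scale_prod[OF Y(2) X(2) spow_closed] prod_comm[OF X(2) Y(2)] by simp
  finally show ?thesis using scale_scale[OF prod_carrier[OF X(2) Y(2)] spow_closed spow_closed] by simp
 qed
 also have "\<dots> <= A \<cdot> A" using kl by (rule prod_mono)
 also have "\<dots> = A" using prod_one[OF smod_A one_A AQ] .
 finally have "scale (s [^] (k + l)) (X \<cdot> Y) <= A" using s_closed by (simp add: nat_pow_mult)
 then show ?thesis using low smod_prod2[OF X(1) Y(1) AQ] unfolding frac_def by blast
qed

lemma frac_colon:
 assumes "frac X" "frac Y" shows "frac (colon X Y)" proof -
 have X: "smod A X" "X <= carrier Q" and Y: "smod A Y" "Y <= carrier Q"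
  using assms frac_smod frac_carrier by auto
 have sm: "smod A (colon X Y)" using smod_colon[OF X(1) AQ Y(2)] .
 obtain k where k: "scale (s [^] (k::nat)) Y <= X" using frac_comparable[OF assms(2,1)] .
 then have low: "s [^] k \<in> colon X Y" using spow_closed by (auto simp: colon_def scale_def)
 obtain j where j: "s [^] (j::nat) \<in> Y" using assms unfolding frac_def by blast
 have "scale (s [^] j) (colon X Y) <= X"
  using j spow_closed by (auto simp: mem_scale colon_def m_comm)
 moreover obtain l where l: "scale (s [^] (l::nat)) X <= A" using assms unfolding frac_def by blast
 ultimately have "scale (s [^] l) (scale (s [^] j) (colon X Y)) <= A" using scale_mono by blast
 then have "scale (s [^] (l + j)) (colon X Y) <= A"
  using s_closed smodD(1)[OF sm] by (simp add: scale_scale nat_pow_mult)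
 then show ?thesis using low sm unfolding frac_def by blast
qed

subsection \<open>Length\<close>

lemma len_A_spow: "len A A (scale (s [^] (k::nat)) A) \<noteq> \<infinity>" proof (induction k)
 case 0
 then show ?case by (simp add: scale_one[OF AQ] len_self)
next
 case (Suc k)
 have sm: "smod A (scale (s [^] k) A)" "smod A (scale (s [^] Suc k) A)"
  using smod_scale smod_A spow_closed AQ by blast+
 have eq: "scale (s [^] Suc k) A = scale (s [^] k) (scale s A)"
  using scale_scale[OF AQ spow_closed s_closed] by simp
 have "len A A (scale (s [^] Suc k) A) =
   len A A (scale (s [^] k) A) + len A (scale (s [^] k) A) (scale (s [^] Suc k) A)"
  using len_add[OF A smod_A sm(1,2)] scale_spow_mono[OF smod_A, of k "Suc k"]
   scale_spow_frac_subset[OF smod_A] by simp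
 also have "len A (scale (s [^] k) A) (scale (s [^] Suc k) A) = len A A (scale s A)"
  unfolding eq using len_scale[OF smod_A _ spow_unit AQ] smod_scale[OF smod_A s_closed AQ] by simp
 finally show ?case using Suc fin by (metis plus_eq_infty_iff_enat)
qed

lemma len_finite:
 assumes "frac X" "frac Y" shows "len A X Y \<noteq> \<infinity>" proof -
 obtain j where j: "scale (s [^] (j::nat)) X <= A" using assms unfolding frac_def by blast
 have Y': "frac (scale (s [^] j) Y)" using frac_scale assms spow_unit by blast
 obtain k where k: "scale (s [^] (k::nat)) A <= scale (s [^] j) Y" using frac_comparable[OF frac_A Y'] .
 have "len A X Y = len A (scale (s [^] j) X) (scale (s [^] j) Y)"
  using len_scale frac_smod assms spow_unit AQ by metis
 also have "\<dots> <= len A A (scale (s [^] k) A)" using len_mono j k by blast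
 finally show ?thesis using len_A_spow[of k] by (metis enat_ord_simps(5))
qed

lemma frac_len_add:
 assumes "frac X" "frac Y" "frac Z" "Z <= Y" "Y <= X"
 shows "len A X Z = len A X Y + len A Y Z" using len_add[OF A] frac_smod assms by blast

text \<open>Both \<open>l(X/Y) + l(Y/uY)\<close> and \<open>l(X/uX) + l(uX/uY)\<close> compute
  \<open>l(X/uY)\<close>, and \<open>l(uX/uY) = l(X/Y)\<close> is finite.\<close>

lemma len_unit_const_aux:
 assumes "frac X" "frac Y" "Y <= X" "u \<in> Units Q" "scale u X <= X" "scale u Y <= Y"
 shows "len A X (scale u X) = len A Y (scale u Y)" proof -
 have F: "frac (scale u X)" "frac (scale u Y)" using frac_scale assms by auto
 have "len A X Y + len A Y (scale u Y) = len A X (scale u Y)"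
  using frac_len_add[OF assms(1,2) F(2)] assms by simp
 also have "\<dots> = len A X (scale u X) + len A (scale u X) (scale u Y)"
  using frac_len_add[OF assms(1) F] assms scale_mono by simp
 also have "len A (scale u X) (scale u Y) = len A X Y" using len_scale frac_smod assms AQ by blast
 finally have "len A X Y + len A Y (scale u Y) = len A X Y + len A X (scale u X)" by (simp add: add.commute)
 then show ?thesis using len_finite[OF assms(1,2)] by (simp add: enat_add_left_cancel)
qed

text \<open>Two modules are compared through their intersection, which is again stable under
  \<open>u\<close>. In particular \<open>l(X/sX) = l(A/sA)\<close> for every fractional ideal: all
  of them have rank one.\<close>

lemma len_unit_const:
 assumes "frac X" "frac Y" "u \<in> Units Q" "scale u X <= X" "scale u Y <= Y"
 shows "len A X (scale u X) = len A Y (scale u Y)" proof -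
 have "scale u (X \<inter> Y) <= X \<inter> Y" using assms(4,5) scale_mono by (metis Int_greatest Int_lower1 Int_lower2 order_trans)
 then show ?thesis
  using len_unit_const_aux[of X "X \<inter> Y" u] len_unit_const_aux[of Y "X \<inter> Y" u] frac_inter assms by simp
qed

subsection \<open>Chain conditions\<close>

lemma finitely_gen:
 assumes "frac Y" "smod A T" "T <= Y"
 obtains F where "finite F" "F <= T" "\<And>X. smod A X ==> F <= X ==> T <= X"
proof -
 obtain k where k: "scale (s [^] (k::nat)) Y <= A" using assms unfolding frac_def by blast
 let ?u = "s [^] k"
 have sT: "smod A (scale ?u T)" using smod_scale assms spow_closed AQ by blast
 have "scale ?u T <= A" using k scale_mono assms by blast
 then obtain F where F: "finite F" "F <= scale ?u T" "\<And>X. smod A X ==> F <= X ==> scale ?u T <= X"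
  using noeth[OF sT] by meson
 have Tc: "T <= carrier Q" using assms smodD by blast
 show thesis proof (rule that[of "scale (inv ?u) F"])
  show "finite (scale (inv ?u) F)" using F unfolding scale_def by simp
  show "scale (inv ?u) F <= T" using F(2) scale_mono[of F _ "inv ?u"] scale_inv(2)[OF Tc spow_unit] by metis
  fix X assume X: "smod A X" "scale (inv ?u) F <= X"
  have Fc: "F <= carrier Q" using F(2) smodD(1)[OF sT] by blast
  have "F <= scale ?u X" using scale_mono[OF X(2), of ?u] scale_inv(1)[OF Fc spow_unit] by simp
  then have "scale ?u T <= scale ?u X" using F(3) smod_scale X spow_closed AQ by blast
  then show "T <= X" using scale_subset_iff[OF Tc smodD(1)[OF X(1)] spow_unit] by blast
 qed
qed

text \<open>The union of a chain of submodules has finitely many generators, which already lie in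
  one member; so chains have upper bounds in the family and Zorn's lemma applies.\<close>

lemma acc:
 assumes "frac Y" "\<F> \<noteq> {}" "\<And>T. T \<in> \<F> ==> smod A T \<and> T <= Y"
 obtains M where "M \<in> \<F>" "\<And>T. T \<in> \<F> ==> M <= T ==> T = M"
proof -
 have "\<exists>U\<in>\<F>. \<forall>X\<in>C. X <= U" if C: "C \<noteq> {}" "subset.chain \<F> C" for C
 proof -
  have CF: "C <= \<F>" and lin: "\<And>X Z. X \<in> C ==> Z \<in> C ==> X <= Z \<or> Z <= X"
   using C unfolding pred_on.chain_def by auto
  have sC: "\<And>T. T \<in> C ==> smod A T \<and> T <= Y" using CF assms by blast
  have sU: "smod A (\<Union>C)" proof (rule smodI)
   show "\<Union>C <= carrier Q" using sC smodD(1) by blast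
   show "\<zero> \<in> \<Union>C" using C sC smodD(2) by blast
   show "x \<oplus> y \<in> \<Union>C" if "x \<in> \<Union>C" "y \<in> \<Union>C" for x y proof -
    obtain X Z where XZ: "X \<in> C" "Z \<in> C" "x \<in> X" "y \<in> Z"
     using \<open>x \<in> \<Union>C\<close> \<open>y \<in> \<Union>C\<close> by blast
    then consider "y \<in> X" | "x \<in> Z" using lin by blast
    then show ?thesis using XZ sC smodD(3) by cases blast+
   qed
   show "a \<otimes> x \<in> \<Union>C" if "a \<in> A" "x \<in> \<Union>C" for a x
    using that sC smodD(4) by blast
  qed
  have "\<Union>C <= Y" using sC by blast
  then obtain F where F: "finite F" "F <= \<Union>C" "\<And>X. smod A X ==> F <= X ==> \<Union>C <= X"
   using finitely_gen[OF assms(1) sU] by blast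
  have "\<exists>X\<in>C. F' <= X" if "finite F'" "F' <= \<Union>C" for F' using that
  proof (induction)
   case empty
   then show ?case using C by blast
  next
   case (insert x F')
   then obtain X Z where "X \<in> C" "F' <= X" "Z \<in> C" "x \<in> Z" by blast
   then show ?case using lin by (metis insert_subset subset_eq)
  qed
  from this[OF F(1,2)] obtain X where "X \<in> C" "F <= X" by blast
  then have "\<Union>C <= X" using F(3) sC by blast
  then show ?thesis using \<open>X \<in> C\<close> CF by blast
 qed
 then obtain M where "M \<in> \<F>" "\<forall>X\<in>\<F>. M <= X --> X = M"
  using subset_Zorn_nonempty[OF assms(2)] by (metis subset_Zorn assms(2) all_not_in_conv)
 then show thesis using that by blast
qed

lemma maximal_submodule:
 assumes "frac Y" "smod A X" "X <= Y" "smod A T" "T \<subset> X"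
 obtains M where "smod A M" "T <= M" "M \<subset> X"
  "\<And>Z. smod A Z ==> M <= Z ==> Z <= X ==> Z = M \<or> Z = X"
proof -
 let ?F = "{M. smod A M \<and> T <= M \<and> M \<subset> X}"
 have ne: "?F \<noteq> {}" and bd: "\<And>M. M \<in> ?F ==> smod A M \<and> M <= Y" using assms by blast+
 show thesis proof (rule acc[OF assms(1) ne bd])
  fix M assume M: "M \<in> ?F" "\<And>Z. Z \<in> ?F ==> M <= Z ==> Z = M"
  have "Z = M \<or> Z = X" if "smod A Z" "M <= Z" "Z <= X" for Z
   using M(2)[of Z] that M(1) by blast
  then show thesis using that[of M] M(1) by blast
 qed
qed

text \<open>Nakayama's lemma, in the form: a proper submodule does not surject modulo all maximal ideals.\<close>

lemma nakayama_maxl: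
 assumes "frac Y" "smod A X" "X <= Y" "smod A T" "T \<subset> X"
 obtains M n where "smod A M" "T <= M" "M \<subset> X" "maxl A n" "\<And>a x. a \<in> n ==> x \<in> X ==> a \<otimes> x \<in> M"
proof -
 obtain M where M: "smod A M" "T <= M" "M \<subset> X"
  "\<And>Z. smod A Z ==> M <= Z ==> Z <= X ==> Z = M \<or> Z = X"
  using maximal_submodule[OF assms] by blast
 then obtain z where z: "z \<in> X" "z \<notin> M" by blast
 note cm = cover_maxl[OF A assms(2) M(1,3,4) z]
 show thesis by (rule that[OF M(1-3) cm(2)]) (use cm(3) in auto)
qed

text \<open>If \<open>T\<close> were proper, some \<open>M\<close> above it would have
  \<open>X/M\<close> killed by a maximal ideal, hence by \<open>s\<close>; then
  \<open>X <= T + sX <= M\<close>.\<close>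

lemma nakayama:
 assumes "frac Y" "smod A X" "X <= Y" "smod A T" "T <= X" "X <= T \<boxplus> scale s X"
 shows "X = T" proof (rule ccontr)
 assume "X \<noteq> T"
 then obtain M n where M: "smod A M" "T <= M" "M \<subset> X" "maxl A n" "\<And>a x. a \<in> n ==> x \<in> X ==> a \<otimes> x \<in> M"
  using nakayama_maxl[OF assms(1-4)] assms(5) by (metis psubsetI)
 have "scale s X <= M" using M(5) jac[OF M(4)] by (auto simp: mem_scale)
 then have "X <= M" using assms(6) set_add_least[OF M(1,2)] by blast
 then show False using M by blast
qed

subsection \<open>Duality\<close>

text \<open>As \<open>s\<close> is invertible on \<open>Q\<close> and kills \<open>A/n\<close>, the
  quotient \<open>(W : n)/W = Hom(A/n, Q/W)\<close> is \<open>Ext^1(A/n, W)\<close>. The condition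
  is type at most one at every maximal ideal, and it is all that the duality below uses besides
  \<open>frac W\<close>.\<close>

definition dualizing :: "'a set => bool" where
 "dualizing W \<longleftrightarrow> frac W \<and> (\<forall>n. maxl A n -->
   (\<forall>T. smod A T \<and> W <= T \<and> T <= colon W n --> T = W \<or> T = colon W n))"

lemma maxl_smod: "maxl A n ==> smod A n" by (simp add: maxl_def)

lemma maxl_frac: assumes "maxl A n" shows "frac n" proof -
 have "scale (s [^] (0::nat)) n <= A"
  using assms scale_one smodD(1)[OF maxl_smod[OF assms]] by (auto simp: maxl_def)
 then show ?thesis using jac[OF assms] maxl_smod[OF assms] s_closed unfolding frac_def by (metis nat_pow_eone)
qed

lemma len_le_1:
 assumes "\<And>T. smod A T ==> Y <= T ==> T <= X ==> T = Y \<or> T = X"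
 shows "len A X Y <= 1" proof -
 have "enat k <= 1" if Z: "\<And>i. i <= k ==> Z i \<in> {T. smod A T \<and> Y <= T \<and> T <= X}"
  "\<And>i. i < k ==> Z i \<subset> Z (Suc i)" for k and Z :: "nat => 'a set"
 proof (rule ccontr)
  assume "\<not> enat k <= 1"
  then have k: "2 <= k" by (simp add: one_enat_def)
  have "Z 0 = Y \<or> Z 0 = X" "Z 1 = Y \<or> Z 1 = X" "Z 2 = Y \<or> Z 2 = X"
   using Z(1)[of 0] Z(1)[of 1] Z(1)[of 2] k assms by auto
  moreover have "Z 0 \<subset> Z 1" "Z 1 \<subset> Z 2" using Z(2)[of 0] Z(2)[of 1] k by (auto simp: numeral_2_eq_2)
  ultimately show False by blast
 qed
 then show ?thesis unfolding len_def by (intro clen_le) blast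
qed

lemma len_ge_1:
 assumes "smod A X" "smod A Y" "Y \<subset> X" shows "1 <= len A X Y"
 using len_step[OF assms(2,1) order_refl assms(3)] by (simp add: len_self)

lemma colon_antimono: "X <= Y ==> colon W Y <= colon W X"
 by (rule colon_mono) auto

text \<open>\<open>X/X'\<close> is a copy of \<open>A/n\<close> generated by \<open>z\<close>. An
  element \<open>q\<close> of \<open>W : X'\<close> is determined modulo \<open>W : X\<close> by the
  class of \<open>zq\<close> in \<open>(W : n)/W\<close>.\<close>

lemma dual_cover:
 assumes W: "dualizing W" and X: "smod A X" "smod A X'" "X' \<subset> X"
  and cover: "\<And>T. smod A T ==> X' <= T ==> T <= X ==> T = X' \<or> T = X"
 shows "len A (colon W X') (colon W X) <= 1" proof -
 have sW: "smod A W" using W frac_smod by (simp add: dualizing_def)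
 obtain z where z: "z \<in> X" "z \<notin> X'" using X(3) by blast
 have zc: "z \<in> carrier Q" using z smodD(5)[OF X(1)] by blast
 have Xc: "X <= carrier Q" "X' <= carrier Q" using X smodD(1) by auto
 let ?n = "{a \<in> A. a \<otimes> z \<in> X'}"
 note cm = cover_maxl[OF A X cover z]
 have s: "smod A (colon W X')" "smod A (colon W X)" using smod_colon[OF sW AQ] Xc by auto
 have "len A (colon W X') (colon W X) <= len A (scale z (colon W X') \<boxplus> W) W"
 proof (rule len_mult_inj[OF A s sW zc])
  show "colon W X <= colon W X'" using X(3) by (intro colon_antimono) auto
  fix q assume q: "q \<in> colon W X'" "z \<otimes> q \<in> W"
  have qc: "q \<in> carrier Q" using q by (simp add: colon_def)
  have "q \<otimes> x \<in> W" if x: "x \<in> X" for x proof -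
   obtain y b where y: "y \<in> X'" "b \<in> A" "x = y \<oplus> b \<otimes> z"
    using x cm(1) A zc by (auto simp: mem_set_add mem_cyclic)
   have c: "b \<in> carrier Q" "y \<in> carrier Q" using y AQ Xc by auto
   have "q \<otimes> x = q \<otimes> y \<oplus> b \<otimes> (z \<otimes> q)" unfolding y(3) using c qc zc by algebra
   then show ?thesis using q y smodD(3,4)[OF sW] by (auto simp: colon_def)
  qed
  then show "q \<in> colon W X" using qc by (simp add: colon_def)
 qed
 also have "\<dots> <= len A (colon W ?n) W" proof (rule len_mono[OF _ order_refl])
  have sn: "smod A (colon W ?n)" by (rule smod_colon[OF sW AQ]) (use AQ in auto)
  have "scale z (colon W X') <= colon W ?n" proof
   fix w assume "w \<in> scale z (colon W X')"
   then obtain q where q: "q \<in> colon W X'" "w = z \<otimes> q" by (auto simp: mem_scale)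
   have qc: "q \<in> carrier Q" using q by (simp add: colon_def)
   have "w \<otimes> a \<in> W" if a: "a \<in> A" "a \<otimes> z \<in> X'" for a proof -
    have "a \<in> carrier Q" using a AQ by blast
    then have "w \<otimes> a = q \<otimes> (a \<otimes> z)" unfolding q(2) using qc zc by algebra
    then show ?thesis using q a by (simp add: colon_def)
   qed
   then show "w \<in> colon W ?n" using q zc qc by (simp add: colon_def)
  qed
  moreover have "W <= colon W ?n" proof
   fix w assume w: "w \<in> W"
   have "w \<otimes> a \<in> W" if "a \<in> A" for a
    using smodD(4,5)[OF sW] w that AQ by (metis m_comm subsetD)
   then show "w \<in> colon W ?n" using smodD(5)[OF sW w] by (simp add: colon_def)
  qed
  ultimately show "scale z (colon W X') \<boxplus> W <= colon W ?n" using set_add_least[OF sn] by blast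
 qed
 also have "\<dots> <= 1" using W cm(2) unfolding dualizing_def by (intro len_le_1) blast
 finally show ?thesis .
qed

text \<open>Induction on the length: each simple layer of \<open>X/Y\<close> contributes at most one
  to the dual quotient.\<close>

lemma dual_len_le:
 assumes W: "dualizing W" and X: "frac X" "frac Y" "Y <= X"
 shows "len A (colon W Y) (colon W X) <= len A X Y" proof -
 have fW: "frac W" using W by (simp add: dualizing_def)
 obtain l where "len A X Y = enat l" using len_finite[OF X(1,2)] by auto
 then show ?thesis using X proof (induction l arbitrary: X rule: less_induct)
  case (less l)
  note X = less.prems(2-4)
  show ?case proof (cases "X = Y")
   case False
   obtain M where M: "smod A M" "Y <= M" "M \<subset> X"
    "\<And>Z. smod A Z ==> M <= Z ==> Z <= X ==> Z = M \<or> Z = X"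
    using maximal_submodule[OF X(1) frac_smod[OF X(1)] order_refl frac_smod[OF X(2)]] False X by blast
   have fM: "frac M" using frac_between[OF X(2,1) M(1,2)] M(3) by blast
   have XY: "len A X Y = len A X M + len A M Y" using frac_len_add[OF X(1) fM X(2)] M by blast
   have one: "1 <= len A X M" using len_ge_1 M X frac_smod by blast
   obtain m where m: "len A M Y = enat m" using len_finite[OF fM X(2)] by auto
   have "m < l" using XY one m less.prems(1) by (cases "len A X M") (auto simp: one_enat_def)
   then have IH: "len A (colon W Y) (colon W M) <= len A M Y" using less.IH m fM X M by blast
   have "len A (colon W Y) (colon W X) =
     len A (colon W Y) (colon W M) + len A (colon W M) (colon W X)"
    using frac_len_add[of "colon W Y" "colon W M" "colon W X"] frac_colon fW X fM colon_antimono M(2,3)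
    by (meson psubset_imp_subset)
   also have "\<dots> <= len A M Y + 1"
    using IH dual_cover[OF W frac_smod[OF X(1)] M(1,3,4)] by (intro add_mono) auto
   also have "\<dots> <= len A X Y" using XY one by (simp add: add.commute add_left_mono)
   finally show ?thesis .
  qed (simp add: len_self)
 qed
qed

text \<open>Between \<open>X\<close> and some \<open>s^k X\<close> inside \<open>Y\<close> equality
  is clear: the dual of \<open>s^k X\<close> is \<open>s^-k (W : X)\<close>, and
  \<open>l(X/s^k X)\<close> is the same for all fractional ideals. \<open>dual_len_le\<close> holds
  above and below \<open>Y\<close>, so neither of the two inequalities can be strict.\<close>

lemma dual_len:
 assumes W: "dualizing W" and X: "frac X" "frac Y" "Y <= X"
 shows "len A (colon W Y) (colon W X) = len A X Y" proof -
 have fW: "frac W" using W by (simp add: dualizing_def)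
 obtain k where k: "scale (s [^] (k::nat)) X <= Y" using frac_comparable[OF X(1,2)] .
 let ?u = "s [^] k"
 let ?Z = "scale ?u X"
 have fZ: "frac ?Z" using frac_scale X spow_unit by blast
 have F: "frac (colon W X)" "frac (colon W Y)" "frac (colon W ?Z)" using frac_colon fW X fZ by auto
 have Wc: "W <= carrier Q" "X <= carrier Q" using fW X frac_carrier by auto
 have "len A (colon W ?Z) (colon W X) = len A (scale (inv ?u) (colon W X)) (colon W X)"
  using colon_scale[OF spow_unit Wc] by simp
 also have "\<dots> = len A (scale ?u (scale (inv ?u) (colon W X))) (scale ?u (colon W X))"
  using len_scale[OF _ _ spow_unit AQ] F frac_smod frac_scale spow_unit Units_inv_Units by metis
 also have "\<dots> = len A (colon W X) (scale ?u (colon W X))"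
  using scale_inv(1) spow_unit frac_carrier F by metis
 also have "\<dots> = len A X ?Z"
  using len_unit_const[OF F(1) X(1) spow_unit] scale_spow_frac_subset frac_smod F X by blast
 finally have eq: "len A (colon W ?Z) (colon W X) = len A X ?Z" .
 have 1: "len A (colon W ?Z) (colon W X) = len A (colon W ?Z) (colon W Y) + len A (colon W Y) (colon W X)"
  using frac_len_add F colon_antimono k X(3) by blast
 have 2: "len A X ?Z = len A X Y + len A Y ?Z" using frac_len_add X fZ k by blast
 have 3: "len A (colon W ?Z) (colon W Y) <= len A Y ?Z" "len A (colon W Y) (colon W X) <= len A X Y"
  using dual_len_le W X fZ k by auto
 obtain a b where ab: "len A X Y = enat a" "len A Y ?Z = enat b" using len_finite X fZ by (metis not_enat_eq)
 obtain c d where cd: "len A (colon W ?Z) (colon W Y) = enat c" "len A (colon W Y) (colon W X) = enat d"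
  using len_finite F by (metis not_enat_eq)
 show ?thesis using eq 1 2 3 ab cd by simp
qed

lemma colon_galois:
 assumes "smod A W" "X <= carrier Q" shows "X <= colon W (colon W X)"
 using assms by (auto simp: colon_def m_comm subset_iff)

text \<open>\<open>X\<close> lies in its double dual and has the same dual, so by
  \<open>dual_len\<close> the two differ by length zero.\<close>

lemma double_dual:
 assumes W: "dualizing W" and X: "frac X" shows "colon W (colon W X) = X" proof -
 have fW: "frac W" using W by (simp add: dualizing_def)
 let ?D = "colon W (colon W X)"
 have FD: "frac ?D" using frac_colon fW X by blast
 have le: "X <= ?D" using colon_galois frac_smod fW frac_carrier X by blast
 have "colon W X <= colon W ?D" using colon_galois frac_smod[OF fW] frac_carrier frac_colon fW X by blast
 then have "colon W ?D = colon W X" using colon_antimono[OF le] by blast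
 then have "len A ?D X = 0" using dual_len[OF W FD X le] by (simp add: len_self)
 then show ?thesis using len_eq_0 frac_smod FD X le by blast
qed

end

context cring begin

end

context curve begin

subsection \<open>Invertible modules are principal\<close>

text \<open>The element is a product of one factor from each ideal of \<open>T\<close>, none of them
  in the prime ideal \<open>n\<close>.\<close>

lemma maxl_avoid:
 assumes "finite T" "\<And>n'. n' \<in> T ==> maxl A n'" "maxl A n" "n \<notin> T"
 shows "\<exists>c\<in>A. c \<notin> n \<and> (\<forall>n'\<in>T. c \<in> n')" using assms proof (induction)
 case empty
 then show ?case by (auto simp: maxl_def)
next
 case (insert m T)
 then obtain c where c: "c \<in> A" "c \<notin> n" "\<forall>n'\<in>T. c \<in> n'" by blast
 have m: "maxl A m" "m \<noteq> n" using insert by auto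
 then have "\<not> m <= n" using insert.prems(2) unfolding maxl_def by blast
 then obtain d where d: "d \<in> m" "d \<notin> n" by blast
 have dA: "d \<in> A" using d m by (auto simp: maxl_def)
 have "c \<otimes> d \<notin> n" using maxl_prime[OF A insert.prems(2) c(1) dA] c d by blast
 moreover have "c \<otimes> d \<in> m" using smodD(4)[OF maxl_smod[OF m(1)]] c d by blast
 moreover have "c \<otimes> d \<in> n'" if "n' \<in> T" for n'
  using smodD(4)[OF maxl_smod, of n' d c] insert.prems(1) that c dA A_closed m_comm by fastforce
 ultimately show ?case using A_mult c(1) dA by blast
qed

text \<open>Any \<open>k\<close> distinct maximal ideals contain \<open>s\<close> and have strictly
  decreasing partial intersections, which form a chain of length \<open>k\<close> between
  \<open>sA\<close> and \<open>A\<close>.\<close>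

lemma finite_maxl: "finite {n. maxl A n}" proof (rule ccontr)
 assume inf: "infinite {n. maxl A n}"
 have "enat k <= len A A (scale s A)" for k proof -
  obtain h :: "nat => 'a set" where h: "inj h" "range h <= {n. maxl A n}"
   using infinite_countable_subset[OF inf] by blast
  then have hm: "maxl A (h i)" for i by blast
  define Z where "Z i = {a \<in> A. \<forall>j<k - i. a \<in> h j}" for i
  have sm: "smod A (Z i)" for i proof (rule smodI)
   show "Z i <= carrier Q" using AQ unfolding Z_def by blast
   show "\<zero> \<in> Z i" using smodD(2)[OF maxl_smod[OF hm]] smodD(2)[OF smod_A] unfolding Z_def by blast
   show "x \<oplus> y \<in> Z i" if "x \<in> Z i" "y \<in> Z i" for x y
    using that smodD(3)[OF maxl_smod[OF hm]] A_add unfolding Z_def by blast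
   show "a \<otimes> x \<in> Z i" if "a \<in> A" "x \<in> Z i" for a x
    using that smodD(4)[OF maxl_smod[OF hm]] A_mult unfolding Z_def by blast
  qed
  have "s \<in> Z i" for i using jac[OF hm] s_A unfolding Z_def by blast
  then have "scale s A <= Z i" for i using scale_A_subset[OF sm] by blast
  moreover have "Z i \<subset> Z (Suc i)" if "i < k" for i proof -
   let ?l = "k - Suc i"
   obtain c where c: "c \<in> A" "c \<notin> h ?l" "\<forall>n\<in>h ` {..<?l}. c \<in> n" proof -
    have "h ?l \<notin> h ` {..<?l}" using h(1) by (auto dest: injD)
    then show ?thesis using maxl_avoid[of "h ` {..<?l}" "h ?l"] hm that by blast
   qed
   then have "c \<in> Z (Suc i)" "c \<notin> Z i" using that unfolding Z_def by auto
   moreover have "Z i <= Z (Suc i)" unfolding Z_def by auto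
   ultimately show ?thesis by blast
  qed
  ultimately show ?thesis unfolding len_def using sm by (intro clen_ge[where Z = Z]) (auto simp: Z_def)
 qed
 then have "len A A (scale s A) = \<infinity>"
  by (metis enat_ord_simps(1) enat_ord_simps(5) not_less_eq_eq not_infinity_eq order_refl)
 then show False using fin by blast
qed

text \<open>Local generators are glued by the Chinese remainder theorem over the finitely many
  maximal ideals; by Nakayama's lemma a common generator modulo all \<open>nX\<close> generates
  \<open>X\<close>.\<close>

lemma locally_cyclic_principal:
 assumes X: "frac X" and loc: "\<And>n. maxl A n ==> \<exists>w\<in>X. X <= scale w A \<boxplus> n \<cdot> X"
 obtains w where "w \<in> Units Q" "X = scale w A" proof -
 have sX: "smod A X" "X <= carrier Q" using X frac_smod frac_carrier by auto
 have snX: "smod A (n \<cdot> X)" "n \<cdot> X <= X" if n: "maxl A n" for n proof -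
  show "smod A (n \<cdot> X)" using smod_prod2[OF maxl_smod[OF n] sX(1) AQ] .
  show "n \<cdot> X <= X"
   by (rule ideal_prod_minimal) (use smodD[OF sX(1)] n in \<open>auto simp: maxl_def\<close>)
 qed
 have sS: "smod A (scale w A \<boxplus> n \<cdot> X)" "scale w A <= scale w A \<boxplus> n \<cdot> X" "n \<cdot> X <= scale w A \<boxplus> n \<cdot> X"
   "w \<in> scale w A \<boxplus> n \<cdot> X" if n: "maxl A n" and w: "w \<in> X" for n w proof -
  have wc: "w \<in> carrier Q" using w sX by blast
  note c = smod_cyclic[OF A wc]
  show "smod A (scale w A \<boxplus> n \<cdot> X)" using smod_add[OF c(1) snX(1)[OF n] AQ] .
  show *: "scale w A <= scale w A \<boxplus> n \<cdot> X" "n \<cdot> X <= scale w A \<boxplus> n \<cdot> X"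
   using set_add_upper[OF c(1) snX(1)[OF n]] .
  then show "w \<in> scale w A \<boxplus> n \<cdot> X" using c(2) by blast
 qed
 have transfer: "X <= scale w' A \<boxplus> n \<cdot> X"
  if "maxl A n" "w \<in> X" "w' \<in> X" "X <= scale w A \<boxplus> n \<cdot> X" "w \<in> scale w' A \<boxplus> n \<cdot> X" for n w w'
 proof -
  have "scale w A <= scale w' A \<boxplus> n \<cdot> X" using scale_A_subset sS(1) that by blast
  then have "scale w A \<boxplus> n \<cdot> X <= scale w' A \<boxplus> n \<cdot> X" using set_add_least sS(1,3) that by blast
  then show ?thesis using that by blast
 qed
 have "\<exists>w\<in>X. \<forall>n\<in>T. X <= scale w A \<boxplus> n \<cdot> X" if "finite T" "\<And>n. n \<in> T ==> maxl A n" for T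
  using that proof (induction)
  case empty
  then show ?case using smodD(2)[OF sX(1)] by blast
 next
  case (insert n T)
  then obtain w where w: "w \<in> X" "\<forall>n\<in>T. X <= scale w A \<boxplus> n \<cdot> X" by blast
  have n: "maxl A n" and T: "\<And>n. n \<in> T ==> maxl A n" using insert by auto
  obtain v where v: "v \<in> X" "X <= scale v A \<boxplus> n \<cdot> X" using loc[OF n] by blast
  obtain c where c: "c \<in> A" "c \<notin> n" "\<forall>n'\<in>T. c \<in> n'" using maxl_avoid insert n T by metis
  obtain u b where u: "u \<in> n" "b \<in> A" "\<one> = u \<oplus> b \<otimes> c" using maxl_inverse[OF A n c(1,2)] by blast
  have cc: "w \<in> carrier Q" "v \<in> carrier Q" "c \<in> carrier Q" "u \<in> carrier Q" "b \<in> carrier Q"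
   using w v sX c u AQ n by (auto simp: maxl_def)
  \<comment> \<open>Here \<open>u + bc = 1\<close>, \<open>u\<close> lies in \<open>n\<close> and
    \<open>bc\<close> in every ideal of \<open>T\<close>. So \<open>?w\<close> agrees with
    \<open>v\<close> modulo \<open>nX\<close>, and with \<open>w\<close> modulo \<open>n'X\<close>
    for the ideals \<open>n'\<close> of \<open>T\<close>.\<close>
  let ?w = "u \<otimes> w \<oplus> (b \<otimes> c) \<otimes> v"
  have uA: "u \<in> A" "b \<otimes> c \<in> A" using u c n A_mult by (auto simp: maxl_def)
  have wX: "?w \<in> X" using smodD(3,4)[OF sX(1)] w v uA by blast
  have one: "z = (u \<oplus> b \<otimes> c) \<otimes> z" if "z \<in> carrier Q" for z using u(3)[symmetric] that by simp
  have mem: "?w \<oplus> y \<in> scale ?w A \<boxplus> n' \<cdot> X" if "y \<in> n' \<cdot> X" for y n'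
   using set_addI[OF _ that] smod_cyclic(2)[OF A, of ?w] cc by simp
  have diff: "x \<ominus> y \<in> X" if "x \<in> X" "y \<in> X" for x y using smod_minus[OF sX(1) A that] .
  have "v = ?w \<oplus> u \<otimes> (v \<ominus> w)" proof -
   have "(u \<oplus> b \<otimes> c) \<otimes> v = ?w \<oplus> u \<otimes> (v \<ominus> w)" using cc by algebra
   then show ?thesis using one[OF cc(2)] by simp
  qed
  then have 1: "X <= scale ?w A \<boxplus> n \<cdot> X"
   using transfer[OF n v(1) wX v(2)] mem[OF prod_incl[OF u(1) diff[OF v(1) w(1)]]] by metis
  have "X <= scale ?w A \<boxplus> n' \<cdot> X" if n': "n' \<in> T" for n' proof -
   have "b \<otimes> c \<in> n'" using smodD(4)[OF maxl_smod[OF T[OF n']] u(2)] c(3) n' by blast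
   moreover have "(u \<oplus> b \<otimes> c) \<otimes> w = ?w \<oplus> (b \<otimes> c) \<otimes> (w \<ominus> v)" using cc by algebra
   ultimately show ?thesis
    using transfer[OF T[OF n'] w(1) wX] w(2) n' mem[OF prod_incl[OF _ diff[OF w(1) v(1)]]] one[OF cc(1)] by metis
  qed
  then show ?case using 1 wX by blast
 qed
 from this[OF finite_maxl] obtain w where w: "w \<in> X" "\<And>n. maxl A n ==> X <= scale w A \<boxplus> n \<cdot> X" by blast
 have wc: "w \<in> carrier Q" using w sX by blast
 have "X = scale w A" proof (rule ccontr)
  assume "X \<noteq> scale w A"
  then have "scale w A \<subset> X" using scale_A_subset[OF sX(1) w(1)] by blast
  then obtain M n where M: "smod A M" "scale w A <= M" "M \<subset> X" "maxl A n" "\<And>a x. a \<in> n ==> x \<in> X ==> a \<otimes> x \<in> M"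
   using nakayama_maxl[OF X sX(1) order_refl smod_cyclic(1)[OF A wc]] by blast
  have "n \<cdot> X <= M" by (rule ideal_prod_minimal) (use M(5) smodD(3)[OF M(1)] in auto)
  then have "X <= M" using w(2)[OF M(4)] set_add_least[OF M(1,2)] by blast
  then show False using M(3) by blast
 qed
 moreover have "w \<in> Units Q" proof -
  obtain k where "s [^] (k::nat) \<in> X" using X unfolding frac_def by blast
  then obtain a where "a \<in> A" "s [^] k = w \<otimes> a" using \<open>X = scale w A\<close> by (auto simp: mem_scale)
  then show ?thesis using unit_factor[of w a] spow_unit[of k] wc AQ by auto
 qed
 ultimately show thesis using that by blast
qed

text \<open>Some product \<open>wy\<close> is invertible modulo \<open>n\<close>, say
  \<open>1 = u + b(wy)\<close>. Then \<open>x = w(b(xy)) + ux\<close> with \<open>xy\<close> in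
  \<open>A\<close>, so \<open>w\<close> generates \<open>X\<close> modulo \<open>nX\<close>.\<close>

lemma invertible_principal:
 assumes X: "frac X" and Y: "smod A Y" and XY: "X \<cdot> Y = A"
 obtains w where "w \<in> Units Q" "X = scale w A" proof (rule locally_cyclic_principal[OF X])
 have sX: "smod A X" "X <= carrier Q" "Y <= carrier Q" using X Y frac_smod frac_carrier smodD(1) by auto
 fix n assume n: "maxl A n"
 have "\<not> X \<cdot> Y <= n" using XY n by (auto simp: maxl_def)
 then obtain w y where wy: "w \<in> X" "y \<in> Y" "w \<otimes> y \<notin> n"
  using ideal_prod_minimal[where X = X and Y = Y and Z = n] smodD(3)[OF maxl_smod[OF n]] by blast
 have "w \<otimes> y \<in> A" using XY prod_incl wy by blast
 then obtain u b where u: "u \<in> n" "b \<in> A" "\<one> = u \<oplus> b \<otimes> (w \<otimes> y)" using maxl_inverse[OF A n] wy by blast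
 have c: "u \<in> carrier Q" "b \<in> carrier Q" "w \<in> carrier Q" "y \<in> carrier Q"
  using u wy AQ sX n by (auto simp: maxl_def)
 have "X <= scale w A \<boxplus> n \<cdot> X" proof
  fix x assume x: "x \<in> X"
  then have xc: "x \<in> carrier Q" using sX by blast
  have "x = (u \<oplus> b \<otimes> (w \<otimes> y)) \<otimes> x" using u(3)[symmetric] xc by simp
  also have "\<dots> = w \<otimes> (b \<otimes> (x \<otimes> y)) \<oplus> u \<otimes> x" using c xc by algebra
  also have "\<dots> \<in> scale w A \<boxplus> n \<cdot> X" proof (rule set_addI)
   have "x \<otimes> y \<in> A" using XY prod_incl x wy by blast
   then show "w \<otimes> (b \<otimes> (x \<otimes> y)) \<in> scale w A" using A_mult u by (intro scaleI) auto
   show "u \<otimes> x \<in> n \<cdot> X" using u x by (intro prod_incl)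
  qed
  finally show "x \<in> scale w A \<boxplus> n \<cdot> X" .
 qed
 then show "\<exists>w\<in>X. X <= scale w A \<boxplus> n \<cdot> X" using wy by blast
qed (use that in blast)

end

context cring begin

lemma len_mult_surj:
 assumes "subring A R" "smod A X" "smod A Y" "smod A Y'" "a \<in> carrier R" "Y <= X" "scale a Y <= Y'"
 shows "len A (scale a X \<boxplus> Y') Y' <= len A X Y"
proof (rule len_map[where \<Phi> = "\<lambda>T. {x \<in> X. a \<otimes> x \<in> T}"])
 have AR: "A <= carrier R" using subringE(1)[OF assms(1)] .
 note X = smodD[OF assms(2)]
 fix T assume T: "smod A T" "Y' <= T"
 note TD = smodD[OF T(1)]
 have "smod A {x \<in> X. a \<otimes> x \<in> T}" proof (rule smodI)
  show "\<zero> \<in> {x \<in> X. a \<otimes> x \<in> T}" using X TD assms(5) by simp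
  show "x \<oplus> y \<in> {x \<in> X. a \<otimes> x \<in> T}" if "x \<in> {x \<in> X. a \<otimes> x \<in> T}" "y \<in> {x \<in> X. a \<otimes> x \<in> T}" for x y
   using that X(3,5) TD(3) assms(5) by (simp add: r_distr)
  show "b \<otimes> x \<in> {x \<in> X. a \<otimes> x \<in> T}" if b: "b \<in> A" "x \<in> {x \<in> X. a \<otimes> x \<in> T}" for b x
  proof -
   have "a \<otimes> (b \<otimes> x) = b \<otimes> (a \<otimes> x)" using b AR X(5) assms(5) by (auto intro: m_lcomm)
   then show ?thesis using b X(4) TD(4) by simp
  qed
 qed (use X in blast)
 then show "smod A {x \<in> X. a \<otimes> x \<in> T} \<and> Y <= {x \<in> X. a \<otimes> x \<in> T} \<and> {x \<in> X. a \<otimes> x \<in> T} <= X"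
  using assms(6,7) T(2) by (auto simp: scale_def)
next
 fix T T' assume T: "smod A T" "smod A T'" "Y' <= T" "T \<subset> T'" "T' <= scale a X \<boxplus> Y'"
 then obtain w where w: "w \<in> T'" "w \<notin> T" by blast
 then have "w \<in> scale a X \<boxplus> Y'" using T(5) by blast
 then obtain x y where xy: "x \<in> X" "y \<in> Y'" "w = a \<otimes> x \<oplus> y"
  by (auto simp: mem_set_add mem_scale)
 have c: "a \<otimes> x \<in> carrier R" "y \<in> carrier R"
  using xy smodD(5)[OF assms(2)] smodD(5)[OF assms(4)] assms(5) by auto
 have "a \<otimes> x = w \<ominus> y" unfolding xy(3) using c by algebra
 then have "a \<otimes> x \<in> T'" using smod_minus[OF T(2) assms(1) w(1)] xy(2) T by auto
 moreover have "a \<otimes> x \<notin> T" using w xy smodD(3)[OF T(1)] T(3) by blast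
 ultimately show "{x \<in> X. a \<otimes> x \<in> T} \<subset> {x \<in> X. a \<otimes> x \<in> T'}" using xy(1) T(4) by blast
qed

text \<open>A surjection between modules of the same finite length is injective; the surjection is
  multiplication by \<open>a\<close> from \<open>X/Y\<close> onto
  \<open>(aX + Y')/Y'\<close>.\<close>

lemma len_mult_eq_inj:
 assumes "subring A R" "smod A X" "smod A Y" "smod A Y'" "a \<in> carrier R" "Y <= X" "scale a Y <= Y'"
  and eq: "len A X Y <= len A (scale a X \<boxplus> Y') Y'" and fin: "len A X Y \<noteq> \<infinity>"
  and x: "x \<in> X" "a \<otimes> x \<in> Y'" shows "x \<in> Y" proof -
 note X = smodD[OF assms(2)] and Y' = smodD[OF assms(4)]
 have AR: "A <= carrier R" using subringE(1)[OF assms(1)] .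
 let ?K = "{x \<in> X. a \<otimes> x \<in> Y'}"
 have K: "smod A ?K" proof (rule smodI)
  show "\<zero> \<in> ?K" using X Y' assms(5) by simp
  show "x \<oplus> y \<in> ?K" if "x \<in> ?K" "y \<in> ?K" for x y
   using that X(3,5) Y'(3) assms(5) by (simp add: r_distr)
  show "b \<otimes> x \<in> ?K" if b: "b \<in> A" "x \<in> ?K" for b x proof -
   have "a \<otimes> (b \<otimes> x) = b \<otimes> (a \<otimes> x)" using b AR X(5) assms(5) by (auto intro: m_lcomm)
   then show ?thesis using b X(4) Y'(4) by simp
  qed
 qed (use X in blast)
 have YK: "Y <= ?K" using assms(6,7) by (auto simp: scale_def)
 have "len A X Y <= len A X ?K"
  using eq len_mult_surj[OF assms(1,2) K assms(4,5)] by (auto simp: scale_def intro: order_trans)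
 moreover have "len A X Y = len A X ?K + len A ?K Y" using len_add[OF assms(1,2) K assms(3) YK] by blast
 ultimately have "len A ?K Y = 0" using fin
  by (cases "len A X ?K"; cases "len A ?K Y") (auto simp: zero_enat_def)
 then show ?thesis using len_eq_0[OF K assms(3) YK] x by blast
qed

end

section \<open>Powers of an ideal and stable ranks modulo s\<close>

context curve begin

definition ipow :: "'a set => nat => 'a set" where
 "ipow J n = ((\<cdot>) J ^^ n) A"

lemma ipow_0 [simp]: "ipow J 0 = A" and ipow_Suc [simp]: "ipow J (Suc n) = J \<cdot> ipow J n"
 by (simp_all add: ipow_def)

lemma frac_ipow: "frac J ==> frac (ipow J n)" by (induction n) (auto simp: frac_A frac_prod)

lemma ipow_add:
 assumes "frac J" shows "ipow J m \<cdot> ipow J n = ipow J (m + n)" proof (induction m)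
 case 0
 then show ?case using prod_one[OF _ one_A AQ] frac_smod frac_ipow assms by simp
next
 case (Suc m)
 then show ?case using prod_assoc frac_carrier frac_ipow assms by (metis add_Suc ipow_Suc)
qed

lemma ipow_ipow:
 assumes "frac J" shows "ipow (ipow J n) q = ipow J (q * n)"
 by (induction q) (simp_all add: ipow_add[OF assms])

lemma ipow_subset:
 assumes "frac J" "J <= A" shows "ipow J n <= A" proof (induction n)
 case (Suc n)
 have "ipow J (Suc n) <= A \<cdot> A" using assms Suc prod_mono by simp
 then show ?case using prod_one[OF smod_A one_A AQ] by simp
qed simp

lemma elem_pow_ipow:
 assumes "frac J" "f \<in> ipow J d" shows "f [^] (i::nat) \<in> ipow J (i * d)" proof (induction i)
 case 0
 then show ?case using one_A by simp
next
 case (Suc i)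
 then have "f [^] i \<otimes> f \<in> ipow J (i * d) \<cdot> ipow J d" using assms(2) by (intro prod_incl)
 then show ?case using ipow_add[OF assms(1)] by (simp add: add.commute)
qed

lemma ipow_mult_mem:
 assumes "frac J" "x \<in> ipow J m" "y \<in> ipow J n" shows "x \<otimes> y \<in> ipow J (m + n)"
 using prod_incl[OF assms(2,3)] ipow_add[OF assms(1)] by simp

text \<open>
 The associated graded ring is taken modulo \<open>s\<close>: \<open>J^n / s J^n\<close>. All its graded pieces have the
 same length, that of \<open>A / s A\<close>.
\<close>

definition sip :: "'a set => nat => 'a set" where
 "sip J n = scale s (ipow J n)"

lemma frac_sip: "frac J ==> frac (sip J n)"
 unfolding sip_def using frac_scale frac_ipow s_unit by blast

lemma sip_subset: "frac J ==> sip J n <= ipow J n"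
 unfolding sip_def using smodD(4)[OF frac_smod[OF frac_ipow] s_A] by (auto simp: scale_def)

lemma sip_mult_mem:
 assumes "frac J" "x \<in> ipow J m" "y \<in> sip J n" shows "x \<otimes> y \<in> sip J (m + n)" proof -
 obtain z where z: "z \<in> ipow J n" "y = s \<otimes> z" using assms(3) by (auto simp: sip_def mem_scale)
 have c: "x \<in> carrier Q" "z \<in> carrier Q"
  using frac_carrier[OF frac_ipow[OF assms(1)]] assms z by blast+
 have "x \<otimes> y = s \<otimes> (x \<otimes> z)" unfolding z(2) using c s_closed by algebra
 then show ?thesis using ipow_mult_mem[OF assms(1,2) z(1)] by (simp add: sip_def scaleI)
qed

lemma len_sip: "frac J ==> len A (ipow J n) (sip J n) = len A A (scale s A)" unfolding sip_def
 by (rule len_unit_const[OF _ frac_A s_unit])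
  (auto simp: frac_ipow scale_def smodD(4)[OF frac_smod[OF frac_ipow] s_A] A_mult s_A)

text \<open>Nilpotence of \<open>h\<close> as a form of degree \<open>e\<close> in the graded ring
  with pieces \<open>J^n/sJ^n\<close>.\<close>

definition nil :: "'a set => 'a => nat => bool" where
 "nil J h e \<longleftrightarrow> (\<exists>i::nat. h [^] i \<in> sip J (i * e))"

text \<open>The image of \<open>f^j\<close> on the piece of degree \<open>n\<close>, for
  \<open>f\<close> of degree \<open>d\<close>, represented by its full preimage in
  \<open>J^(jd+n)\<close>.\<close>

definition img :: "'a set => 'a => nat => nat => nat => 'a set" where
 "img J f d j n = scale (f [^] j) (ipow J n) \<boxplus> sip J (j * d + n)"

definition rk :: "'a set => 'a => nat => nat => nat => nat" where
 "rk J f d j n = the_enat (len A (img J f d j n) (sip J (j * d + n)))"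

text \<open>The ranks of the powers of \<open>f\<close> on a fixed piece are decreasing, so that
  their minimum is also their eventual value.\<close>

definition stable_rk :: "'a set => 'a => nat => nat => nat" where
 "stable_rk J f d n = (LEAST r. \<exists>j. rk J f d j n = r)"

context
 fixes J assumes J: "frac J"
begin

lemmas fJ = frac_ipow[OF J] frac_sip[OF J]
lemmas sJ = fJ[THEN frac_smod]
lemmas cJ = fJ[THEN frac_carrier]

lemma ipow_closed: "x \<in> ipow J n ==> x \<in> carrier Q" using cJ(1) by blast

lemma img_props:
 assumes "f \<in> ipow J d"
 shows "smod A (img J f d j n)" "sip J (j * d + n) <= img J f d j n" "img J f d j n <= ipow J (j * d + n)"
  "len A (img J f d j n) (sip J (j * d + n)) = enat (rk J f d j n)"
  "enat (rk J f d j n) <= len A A (scale s A)" proof -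
 have fj: "f [^] j \<in> ipow J (j * d)" using elem_pow_ipow[OF J assms] .
 have s1: "smod A (scale (f [^] j) (ipow J n))" using smod_scale[OF sJ(1) ipow_closed[OF fj] AQ] .
 show sm: "smod A (img J f d j n)" unfolding img_def using smod_add[OF s1 sJ(2) AQ] .
 show le: "sip J (j * d + n) <= img J f d j n" unfolding img_def using set_add_upper(2)[OF s1 sJ(2)] .
 have "scale (f [^] j) (ipow J n) <= ipow J (j * d + n)"
  using ipow_mult_mem[OF J fj] by (auto simp: scale_def)
 then show ge: "img J f d j n <= ipow J (j * d + n)"
  unfolding img_def using set_add_least[OF sJ(1)] sip_subset[OF J] by blast
 have l: "len A (img J f d j n) (sip J (j * d + n)) <= len A A (scale s A)"
  using len_mono[OF ge order_refl] len_sip[OF J] by metis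
 then have "len A (img J f d j n) (sip J (j * d + n)) \<noteq> \<infinity>" using fin by (metis enat_ord_simps(5))
 then show eq: "len A (img J f d j n) (sip J (j * d + n)) = enat (rk J f d j n)" unfolding rk_def by auto
 show "enat (rk J f d j n) <= len A A (scale s A)" using l eq by simp
qed

lemma img_mult:
 assumes "f \<in> ipow J d"
 shows "scale (f [^] i) (img J f d j n) \<boxplus> sip J ((j + i) * d + n) = img J f d (j + i) n" proof -
 have fi: "f [^] i \<in> ipow J (i * d)" "f [^] j \<in> carrier Q" and fc: "f \<in> carrier Q"
  using elem_pow_ipow[OF J assms] ipow_closed assms by auto
 have fic: "f [^] i \<in> carrier Q" using fi ipow_closed by blast
 have eq: "scale (f [^] (j + i)) (ipow J n) = scale (f [^] i) (scale (f [^] j) (ipow J n))"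
  using fc scale_scale[OF cJ(1) fic fi(2)] by (simp add: nat_pow_mult add.commute)
 have s1: "smod A (scale (f [^] j) (ipow J n))" using smod_scale[OF sJ(1) fi(2) AQ] .
 have sub: "scale (f [^] i) (sip J (j * d + n)) <= sip J ((j + i) * d + n)" proof
  fix x assume "x \<in> scale (f [^] i) (sip J (j * d + n))"
  then obtain y where "y \<in> sip J (j * d + n)" "x = f [^] i \<otimes> y" by (auto simp: mem_scale)
  then have "x \<in> sip J (i * d + (j * d + n))" using sip_mult_mem[OF J fi(1)] by blast
  then show "x \<in> sip J ((j + i) * d + n)" by (simp add: algebra_simps)
 qed
 have si: "smod A (img J f d (j + i) n)" using img_props assms by blast
 show ?thesis proof
  have "scale (f [^] i) (img J f d j n) <= img J f d (j + i) n" proof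
   fix x assume "x \<in> scale (f [^] i) (img J f d j n)"
   then obtain u v where uv: "u \<in> scale (f [^] j) (ipow J n)" "v \<in> sip J (j * d + n)" "x = f [^] i \<otimes> (u \<oplus> v)"
    by (auto simp: img_def mem_scale mem_set_add)
   then have "x = f [^] i \<otimes> u \<oplus> f [^] i \<otimes> v"
    using fic smodD(5)[OF s1] smodD(5)[OF sJ(2)] by (simp add: r_distr)
   moreover have "f [^] i \<otimes> v \<in> sip J ((j + i) * d + n)" using sub scaleI uv by blast
   moreover have "f [^] i \<otimes> u \<in> scale (f [^] (j + i)) (ipow J n)" unfolding eq using scaleI uv by blast
   ultimately show "x \<in> img J f d (j + i) n" unfolding img_def by (simp add: set_addI)
  qed
  then show "scale (f [^] i) (img J f d j n) \<boxplus> sip J ((j + i) * d + n) <= img J f d (j + i) n"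
   using set_add_least[OF si] img_props(2)[OF assms] by blast
  have "scale (f [^] j) (ipow J n) <= img J f d j n"
   unfolding img_def using set_add_upper(1)[OF s1 sJ(2)] .
  then show "img J f d (j + i) n <= scale (f [^] i) (img J f d j n) \<boxplus> sip J ((j + i) * d + n)"
   unfolding img_def[of J f d "j + i"] eq by (intro set_add_mono scale_mono order_refl)
 qed
qed

lemma rk_antimono:
 assumes "f \<in> ipow J d" "j <= j'" shows "rk J f d j' n <= rk J f d j n" proof -
 let ?i = "j' - j"
 have fi: "f [^] ?i \<in> ipow J (?i * d)" using elem_pow_ipow[OF J assms(1)] .
 have "len A (scale (f [^] ?i) (img J f d j n) \<boxplus> sip J ((j + ?i) * d + n)) (sip J ((j + ?i) * d + n))
   <= len A (img J f d j n) (sip J (j * d + n))"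
 proof (rule len_mult_surj[OF A img_props(1)[OF assms(1)] sJ(2) sJ(2) ipow_closed[OF fi] img_props(2)[OF assms(1)]])
  show "scale (f [^] ?i) (sip J (j * d + n)) <= sip J ((j + ?i) * d + n)"
   using sip_mult_mem[OF J fi, of _ "j * d + n"] by (auto simp: scale_def algebra_simps)
 qed
 then show ?thesis unfolding img_mult[OF assms(1)] img_props(4)[OF assms(1)] using assms(2) by simp
qed

lemma stable_rk_attained:
 assumes "f \<in> ipow J d"
 obtains j0 where "\<And>j. j0 <= j ==> rk J f d j n = stable_rk J f d n" proof -
 have "\<exists>j. rk J f d j n = stable_rk J f d n" unfolding stable_rk_def by (rule LeastI_ex) blast
 then obtain j0 where j0: "rk J f d j0 n = stable_rk J f d n" by blast
 have "rk J f d j n = stable_rk J f d n" if "j0 <= j" for j proof -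
  have "stable_rk J f d n <= rk J f d j n" unfolding stable_rk_def by (rule Least_le) blast
  then show ?thesis using rk_antimono[OF assms that, of n] j0 by simp
 qed
 then show thesis using that by blast
qed

lemma stable_rk_le: "stable_rk J f d n <= rk J f d j n" unfolding stable_rk_def by (rule Least_le) blast

lemma img_shift:
 assumes "f \<in> ipow J d" shows "img J f d (Suc j) n <= img J f d j (d + n)" proof -
 have fc: "f [^] j \<in> carrier Q" "f \<in> carrier Q" using assms ipow_closed by auto
 have "scale (f [^] Suc j) (ipow J n) <= scale (f [^] j) (ipow J (d + n))" proof
  fix x assume "x \<in> scale (f [^] Suc j) (ipow J n)"
  then obtain y where y: "y \<in> ipow J n" "x = f [^] Suc j \<otimes> y" by (auto simp: mem_scale)
  then have "x = f [^] j \<otimes> (f \<otimes> y)" using fc ipow_closed by (simp add: m_assoc)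
  then show "x \<in> scale (f [^] j) (ipow J (d + n))" using ipow_mult_mem[OF J assms y(1)] by (simp add: scaleI)
 qed
 moreover have "Suc j * d + n = j * d + (d + n)" by simp
 ultimately show ?thesis unfolding img_def by (metis set_add_mono order_refl)
qed

text \<open>As \<open>f\<close> lies in \<open>J^d\<close>, the image of \<open>f^(j+1)\<close> on
  degree \<open>n\<close> is contained in that of \<open>f^j\<close> on degree
  \<open>d + n\<close>.\<close>

lemma stable_rk_shift:
 assumes "f \<in> ipow J d" shows "stable_rk J f d n <= stable_rk J f d (d + n)" proof -
 obtain j where j: "\<And>i. j <= i ==> rk J f d i (d + n) = stable_rk J f d (d + n)"
  using stable_rk_attained[OF assms] by blast
 have "enat (rk J f d (Suc j) n) <= enat (rk J f d j (d + n))"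
  using len_mono[OF img_shift[OF assms, of j n], of "sip J (Suc j * d + n)" "sip J (Suc j * d + n)" A]
   img_props(4)[OF assms, of "Suc j" n] img_props(4)[OF assms, of j "d + n"]
  by (simp add: add.assoc add.left_commute)
 then show ?thesis using stable_rk_le[of f d n "Suc j"] j[of j] by simp
qed

end

end

context curve begin

context
 fixes J assumes J: "frac J"
begin

lemmas sI = frac_smod[OF frac_ipow[OF J]] frac_smod[OF frac_sip[OF J]]
lemmas clI = ipow_closed[OF J]

lemma sip_closed: "x \<in> sip J n ==> x \<in> carrier Q" using smodD(5)[OF sI(2)] .

lemma sip_mult_mem': "x \<in> sip J m ==> y \<in> ipow J n ==> x \<otimes> y \<in> sip J (m + n)"
 using sip_mult_mem[OF J, of y n x m] m_comm[of x y] clI sip_closed by (simp add: add.commute)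

text \<open>Modulo \<open>s\<close> the product \<open>FG\<close> vanishes, so all mixed terms drop
  out.\<close>

lemma pow_sum_mult:
 assumes F: "F \<in> ipow J D" and G: "G \<in> ipow J D" and FG: "F \<otimes> G \<in> sip J (D + D)"
 shows "\<exists>w\<in>sip J (Suc m * D). (F \<oplus> G) [^] (m::nat) \<otimes> F = F [^] Suc m \<oplus> w"
proof (induction m)
 case 0
 have "F \<in> carrier Q" using F clI by blast
 then show ?case using smodD(2)[OF sI(2)] by (intro bexI[of _ \<zero>]) auto
next
 case (Suc m)
 let ?H = "F \<oplus> G"
 obtain w where w: "w \<in> sip J (Suc m * D)" "?H [^] m \<otimes> F = F [^] Suc m \<oplus> w" using Suc by blast
 have c: "F \<in> carrier Q" "G \<in> carrier Q" "w \<in> carrier Q" using F G w clI sip_closed by auto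
 have H: "?H \<in> ipow J D" using smodD(3)[OF sI(1) F G] .
 have "?H [^] Suc m \<otimes> F = (?H [^] m \<otimes> F) \<otimes> ?H" using c by (simp add: m_ac)
 also have "\<dots> = (F [^] Suc m \<oplus> w) \<otimes> ?H" using w by simp
 also have "\<dots> = (F [^] m \<otimes> F \<oplus> w) \<otimes> (F \<oplus> G)" by simp
 also have "\<dots> = F [^] m \<otimes> F \<otimes> F \<oplus> (F [^] m \<otimes> (F \<otimes> G) \<oplus> w \<otimes> (F \<oplus> G))"
  using c nat_pow_closed[OF c(1), of m] by algebra
 finally have eq: "?H [^] Suc m \<otimes> F = F [^] Suc (Suc m) \<oplus> (F [^] m \<otimes> (F \<otimes> G) \<oplus> w \<otimes> ?H)" by simp
 have "F [^] m \<otimes> (F \<otimes> G) \<in> sip J (m * D + (D + D))"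
  using sip_mult_mem[OF J elem_pow_ipow[OF J F] FG] .
 moreover have "w \<otimes> ?H \<in> sip J (Suc m * D + D)" using sip_mult_mem'[OF w(1) H] .
 moreover have "m * D + (D + D) = Suc (Suc m) * D" "Suc m * D + D = Suc (Suc m) * D" by simp_all
 ultimately have "F [^] m \<otimes> (F \<otimes> G) \<oplus> w \<otimes> ?H \<in> sip J (Suc (Suc m) * D)"
  using smodD(3)[OF sI(2)] by metis
 then show ?case using eq by blast
qed

text \<open>
 If \<open>F\<close> annihilates a non-nilpotent \<open>G\<close> of the same degree, then \<open>F + G\<close> has larger stable rank
 than \<open>F\<close>, since the images of high powers of \<open>F\<close> and \<open>G\<close> meet in zero.
\<close>

lemma stable_rk_increase_aux:
 assumes F: "F \<in> ipow J D" and G: "G \<in> ipow J D" and FG: "F \<otimes> G \<in> sip J (D + D)"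
  and non: "\<And>m. \<exists>h\<in>ipow J n. G [^] (m::nat) \<otimes> h \<notin> sip J (m * D + n)"
 shows "stable_rk J F D n < stable_rk J (F \<oplus> G) D (D + n)" proof -
 let ?H = "F \<oplus> G"
 have c: "F \<in> carrier Q" "G \<in> carrier Q" "?H \<in> carrier Q" using F G clI by auto
 have H: "?H \<in> ipow J D" using smodD(3)[OF sI(1) F G] .
 obtain j1 where j1: "\<And>j. j1 <= j ==> rk J F D j n = stable_rk J F D n"
  using stable_rk_attained[OF J F] by blast
 obtain j2 where j2: "\<And>j. j2 <= j ==> rk J ?H D j (D + n) = stable_rk J ?H D (D + n)"
  using stable_rk_attained[OF J H] by blast
 define j where "j = max j1 j2"
 define k where "k = Suc j * D + n"
 let ?T = "img J ?H D j (D + n)" and ?P = "img J F D (Suc j) n"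
 have k: "j * D + (D + n) = k" "Suc j * D + n = k" by (simp_all add: k_def)
 note iT = img_props[OF J H, of j "D + n", unfolded k]
 note iP = img_props[OF J F, of "Suc j" n, unfolded k]
 \<comment> \<open>Used for \<open>X = F\<close> and for \<open>X = G\<close>: modulo
   \<open>s\<close>, \<open>(F+G)^j\<close> sends \<open>Xh\<close> to \<open>X^(j+1) h\<close>, so
   its image contains those of \<open>F^(j+1)\<close> and of \<open>G^(j+1)\<close>.\<close>
 have base: "X [^] Suc j \<otimes> h \<in> ?T" if X: "X \<in> ipow J D" "w \<in> sip J (Suc j * D)" "h \<in> ipow J n"
  "?H [^] j \<otimes> X = X [^] Suc j \<oplus> w" for X w h proof -
  have cc: "X \<in> carrier Q" "w \<in> carrier Q" "h \<in> carrier Q" using X clI sip_closed by auto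
  have "X [^] Suc j \<otimes> h = (X [^] Suc j \<oplus> w) \<otimes> h \<ominus> w \<otimes> h"
   using cc nat_pow_closed[OF cc(1), of "Suc j"] by algebra
  also have "\<dots> = ?H [^] j \<otimes> (X \<otimes> h) \<oplus> \<ominus> (w \<otimes> h)"
   unfolding X(4)[symmetric] using cc c by (simp add: a_minus_def m_assoc)
  also have "\<dots> \<in> ?T" unfolding img_def proof (rule set_addI)
   show "?H [^] j \<otimes> (X \<otimes> h) \<in> scale (?H [^] j) (ipow J (D + n))"
    using ipow_mult_mem[OF J X(1,3)] by (intro scaleI)
   have "w \<otimes> h \<in> sip J (Suc j * D + n)" using sip_mult_mem'[OF X(2,3)] .
   then show "\<ominus> (w \<otimes> h) \<in> sip J (j * D + (D + n))" using smod_neg[OF sI(2) A] k by metis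
  qed
  finally show ?thesis .
 qed
 have PT: "?P <= ?T" proof -
  obtain w where w: "w \<in> sip J (Suc j * D)" "?H [^] j \<otimes> F = F [^] Suc j \<oplus> w"
   using pow_sum_mult[OF F G FG] by blast
  have "scale (F [^] Suc j) (ipow J n) <= ?T"
   using base[OF F w(1) _ w(2)] by (auto simp: mem_scale simp del: nat_pow_Suc)
  then show ?thesis unfolding img_def[of J F] using set_add_least[OF iT(1)] iT(2) k by metis
 qed
 \<comment> \<open>On \<open>?P\<close> the rank of \<open>F\<close> no longer drops, so
   \<open>F\<close> is injective there modulo \<open>s\<close>; but it kills
   \<open>G^(j+1) h\<close>. If \<open>?P\<close> were all of \<open>?T\<close>, then
   \<open>G^(j+1) h\<close> would vanish modulo \<open>s\<close>.\<close>
 have "?P \<noteq> ?T" proof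
  assume eq: "?P = ?T"
  obtain h where h: "h \<in> ipow J n" "G [^] Suc j \<otimes> h \<notin> sip J (Suc j * D + n)" using non by blast
  have GF: "G \<otimes> F \<in> sip J (D + D)" using FG m_comm[OF c(1,2)] by simp
  obtain w where w: "w \<in> sip J (Suc j * D)" "(G \<oplus> F) [^] j \<otimes> G = G [^] Suc j \<oplus> w"
   using pow_sum_mult[OF G F GF] by blast
  have "?H [^] j \<otimes> G = G [^] Suc j \<oplus> w" using w(2) a_comm[OF c(1,2)] by simp
  then have xT: "G [^] Suc j \<otimes> h \<in> ?P" using base[OF G w(1) h(1)] eq by blast
  have hc: "h \<in> carrier Q" using h clI by blast
  let ?k = "Suc (Suc j) * D + n"
  have kk: "(Suc j + 1) * D + n = ?k" "Suc j + 1 = Suc (Suc j)" by simp_all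
  have F1: "F [^] (1::nat) = F" using c by simp
  have "F \<otimes> (G [^] Suc j \<otimes> h) = (F \<otimes> G) \<otimes> (G [^] j \<otimes> h)"
   using c hc by (simp add: m_ac)
  also have "\<dots> \<in> sip J ((D + D) + (j * D + n))"
   using sip_mult_mem'[OF FG ipow_mult_mem[OF J elem_pow_ipow[OF J G] h(1)]] .
  also have "(D + D) + (j * D + n) = ?k" by simp
  finally have "F [^] (1::nat) \<otimes> (G [^] Suc j \<otimes> h) \<in> sip J ?k" using F1 by simp
  moreover have "scale (F [^] (1::nat)) (sip J k) <= sip J ?k" proof
   fix x assume "x \<in> scale (F [^] (1::nat)) (sip J k)"
   then obtain y where "y \<in> sip J k" "x = F \<otimes> y" unfolding F1 by (auto simp: mem_scale)
   then have "x \<in> sip J (D + k)" using sip_mult_mem[OF J F] by blast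
   moreover have "D + k = ?k" by (simp add: k_def)
   ultimately show "x \<in> sip J ?k" by simp
  qed
  moreover have "len A ?P (sip J k) <= len A (scale (F [^] (1::nat)) ?P \<boxplus> sip J ?k) (sip J ?k)"
   using img_mult[OF J F, of 1 "Suc j" n] iP(4) img_props(4)[OF J F, of "Suc (Suc j)" n]
    j1[of "Suc j"] j1[of "Suc (Suc j)"] unfolding kk j_def by simp
  ultimately have "G [^] Suc j \<otimes> h \<in> sip J k"
   using len_mult_eq_inj[OF A iP(1) sI(2) sI(2) _ iP(2), of "F [^] (1::nat)"] xT iP(4) F1 c by auto
  then show False using h(2) k(2) by metis
 qed
 then have "?P \<subset> ?T" using PT by blast
 then have "enat (rk J F D (Suc j) n) + 1 <= enat (rk J ?H D j (D + n))"
  using len_step[OF iP(1) iT(1) iP(2)] iP(4) iT(4) by simp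
 then show ?thesis using j1[of "Suc j"] j2[of j] by (simp add: j_def one_enat_def)
qed

text \<open>The ranks of the powers of \<open>f^a\<close> occur among the ranks of the powers of
  \<open>f\<close>.\<close>

lemma stable_rk_pow:
 assumes "f \<in> ipow J d" shows "stable_rk J f d n <= stable_rk J (f [^] (a::nat)) (a * d) n" proof -
 have fa: "f [^] a \<in> ipow J (a * d)" using elem_pow_ipow[OF J assms] .
 obtain j where j: "rk J (f [^] a) (a * d) j n = stable_rk J (f [^] a) (a * d) n"
  using stable_rk_attained[OF J fa] by blast
 have fc: "f \<in> carrier Q" using assms clI by blast
 have "rk J (f [^] a) (a * d) j n = rk J f d (a * j) n"
  unfolding rk_def img_def using fc by (simp add: nat_pow_pow mult.commute mult.left_commute)
 then show ?thesis using stable_rk_le[OF J, of f d n "a * j"] j by simp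
qed

definition max_rk :: "'a => nat => nat => bool" where
 "max_rk f d n \<longleftrightarrow> f \<in> ipow J d \<and> 0 < d \<and>
   (\<forall>f' d' n'. f' \<in> ipow J d' \<and> 0 < d' --> stable_rk J f' d' n' <= stable_rk J f d n)"

text \<open>All ranks are bounded by \<open>l(A/sA)\<close>, whatever the degrees.\<close>

lemma max_rk_exists: "\<exists>f d n. max_rk f d n" proof -
 let ?P = "\<lambda>(f, d, n::nat). f \<in> ipow J d \<and> 0 < d"
 let ?f = "\<lambda>(f, d, n). stable_rk J f d n"
 have "?P (\<zero>, 1, 0)" using smodD(2)[OF sI(1), of 1] by simp
 moreover have "\<forall>y. ?P y --> ?f y < Suc (the_enat (len A A (scale s A)))"
 proof (intro allI impI)
  fix y assume "?P y"
  then obtain f d n where y: "y = (f, d, n)" "f \<in> ipow J d" by (cases y) auto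
  have "enat (rk J f d 0 n) <= len A A (scale s A)" using img_props(5)[OF J y(2)] .
  then have "rk J f d 0 n <= the_enat (len A A (scale s A))" using fin by (cases "len A A (scale s A)") auto
  then show "?f y < Suc (the_enat (len A A (scale s A)))" using stable_rk_le[OF J, of f d n 0] y by simp
 qed
 ultimately obtain y where y: "?P y" "\<forall>z. ?P z --> ?f z <= ?f y"
  using ex_has_greatest_nat[of ?P _ ?f] by blast
 obtain f d n where fdn: "y = (f, d, n)" by (cases y) auto
 have "max_rk f d n" using y(1) y(2)[rule_format, of "(f', d', n')" for f' d' n'] unfolding fdn max_rk_def by auto
 then show ?thesis by blast
qed

text \<open>Suitable powers of \<open>f\<close> and \<open>g\<close> have the same degree and
  product zero; were \<open>g\<close> not nilpotent, their sum would have a larger stable rank than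
  \<open>f\<close>.\<close>

lemma annihilated_nil:
 assumes m: "max_rk f d n" and g: "g \<in> ipow J e" "0 < e" and fg: "f [^] (i::nat) \<otimes> g \<in> sip J (i * d + e)"
 shows "nil J g e" proof (rule ccontr)
 assume non: "\<not> nil J g e"
 have f: "f \<in> ipow J d" "0 < d" using m by (auto simp: max_rk_def)
 obtain d0 e0 where de: "d = Suc d0" "e = Suc e0" using f(2) g(2) gr0_implies_Suc by blast
 have c: "f \<in> carrier Q" "g \<in> carrier Q" using f g clI by auto
 let ?i = "Suc i"
 \<comment> \<open>The exponents \<open>(i+1)e\<close> and \<open>(i+1)d\<close> make the degrees
   equal, and both are large enough to split \<open>f^i g\<close> off the product.\<close>
 let ?F = "f [^] (?i * e)" and ?G = "g [^] (?i * d)" and ?D = "?i * e * d"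
 have F: "?F \<in> ipow J ?D" using elem_pow_ipow[OF J f(1)] .
 have "?G \<in> ipow J (?i * d * e)" using elem_pow_ipow[OF J g(1)] .
 moreover have "?i * d * e = ?D" by (simp add: algebra_simps)
 ultimately have G: "?G \<in> ipow J ?D" by metis
 have "?F \<otimes> ?G = (f [^] i \<otimes> g) \<otimes> (f [^] (1 + ?i * e0) \<otimes> g [^] (i + ?i * d0))"
 proof -
  have "?F = f [^] i \<otimes> f [^] (1 + ?i * e0)"
   unfolding de nat_pow_mult[OF c(1)] by (simp add: algebra_simps)
  moreover have "?G = g \<otimes> g [^] (i + ?i * d0)" proof -
   have "g \<otimes> g [^] (i + ?i * d0) = g [^] (1::nat) \<otimes> g [^] (i + ?i * d0)" using c by simp
   then show ?thesis unfolding de nat_pow_mult[OF c(2)] by (simp add: algebra_simps)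
  qed
  ultimately show ?thesis
   using c nat_pow_closed[OF c(1)] nat_pow_closed[OF c(2)] by (simp add: m_ac del: nat_pow_Suc)
 qed
 also have "\<dots> \<in> sip J ((i * d + e) + ((1 + ?i * e0) * d + (i + ?i * d0) * e))"
  by (intro sip_mult_mem' ipow_mult_mem[OF J] elem_pow_ipow[OF J] fg f g)
 also have "(i * d + e) + ((1 + ?i * e0) * d + (i + ?i * d0) * e) = ?D + ?D"
  unfolding de by (simp add: algebra_simps)
 finally have FG: "?F \<otimes> ?G \<in> sip J (?D + ?D)" .
 \<comment> \<open>If \<open>G^m\<close> killed all of \<open>J^n\<close> modulo \<open>s\<close>,
   it would also kill \<open>g^n\<close>, which lies in \<open>J^(ne) = J^n J^(n(e-1))\<close>; this
   makes \<open>g\<close> nilpotent.\<close>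
 have "\<exists>h\<in>ipow J n. ?G [^] (m::nat) \<otimes> h \<notin> sip J (m * ?D + n)" for m
 proof (rule ccontr)
  assume "\<not> ?thesis"
  then have *: "\<And>h. h \<in> ipow J n ==> ?G [^] m \<otimes> h \<in> sip J (m * ?D + n)" by blast
  have Gc: "?G [^] m \<in> carrier Q" using c by simp
  have "?G [^] m \<otimes> x \<in> sip J (m * ?D + n + n * e0)" if "x \<in> ipow J n \<cdot> ipow J (n * e0)" for x
   using that proof induction
   case (prod u v)
   then have "?G [^] m \<otimes> (u \<otimes> v) = (?G [^] m \<otimes> u) \<otimes> v" using Gc clI by (simp add: m_assoc)
   then show ?case using sip_mult_mem'[OF *[OF prod(1)] prod(2)] by simp
  next
   case (sum u v)
   have "u \<in> carrier Q" "v \<in> carrier Q" using sum(1,2) clI ipow_add[OF J] by metis+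
   then have "?G [^] m \<otimes> (u \<oplus> v) = ?G [^] m \<otimes> u \<oplus> ?G [^] m \<otimes> v" using Gc by (simp add: r_distr)
   then show ?case using sum smodD(3)[OF sI(2)] by metis
  qed
  moreover have "g [^] n \<in> ipow J n \<cdot> ipow J (n * e0)"
   using elem_pow_ipow[OF J g(1), of n] ipow_add[OF J] de by simp
  ultimately have "?G [^] m \<otimes> g [^] n \<in> sip J (m * ?D + n + n * e0)" by blast
  moreover have "?G [^] m \<otimes> g [^] n = g [^] (?i * d * m + n)"
   using c by (simp add: nat_pow_pow nat_pow_mult)
  moreover have "m * ?D + n + n * e0 = (?i * d * m + n) * e" unfolding de by (simp add: algebra_simps)
  ultimately have "nil J g e" unfolding nil_def by metis
  then show False using non by blast
 qed
 from stable_rk_increase_aux[OF F G FG this]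
 have "stable_rk J ?F ?D n < stable_rk J (?F \<oplus> ?G) ?D (?D + n)" .
 moreover have "stable_rk J f d n <= stable_rk J ?F ?D n" using stable_rk_pow[OF f(1)] .
 moreover have "stable_rk J (?F \<oplus> ?G) ?D (?D + n) <= stable_rk J f d n" proof -
  have "?F \<oplus> ?G \<in> ipow J ?D" "0 < ?D" using smodD(3)[OF sI(1) F G] de by simp_all
  then show ?thesis using m unfolding max_rk_def by blast
 qed
 ultimately show False by simp
qed

text \<open>By maximality the stable image of \<open>f\<close> on degree \<open>d + n\<close> is no
  larger than on degree \<open>n\<close>. So \<open>f^j x = f^(j+1) h\<close> modulo
  \<open>s\<close> for some \<open>h\<close>, and \<open>x - fh\<close> is killed by a power of
  \<open>f\<close>.\<close>

lemma decompose_nil: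
 assumes m: "max_rk f d n" and x: "x \<in> ipow J (d + n)"
 obtains h where "h \<in> ipow J n" "nil J (x \<ominus> f \<otimes> h) (d + n)" proof -
 have f: "f \<in> ipow J d" "0 < d" using m by (auto simp: max_rk_def)
 have fc: "f \<in> carrier Q" "x \<in> carrier Q" using f x clI by auto
 have eq: "stable_rk J f d (d + n) = stable_rk J f d n"
  using stable_rk_shift[OF J f(1), of n] m f unfolding max_rk_def by (metis le_antisym)
 obtain j1 where j1: "\<And>j. j1 <= j ==> rk J f d j n = stable_rk J f d n"
  using stable_rk_attained[OF J f(1)] by blast
 obtain j2 where j2: "\<And>j. j2 <= j ==> rk J f d j (d + n) = stable_rk J f d (d + n)"
  using stable_rk_attained[OF J f(1)] by blast
 define j where "j = max j1 j2"
 define k where "k = Suc j * d + n"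
 have k: "j * d + (d + n) = k" "Suc j * d + n = k" by (simp_all add: k_def)
 let ?T = "img J f d j (d + n)" and ?P = "img J f d (Suc j) n"
 note iT = img_props[OF J f(1), of j "d + n", unfolded k]
 note iP = img_props[OF J f(1), of "Suc j" n, unfolded k]
 have PT: "?P <= ?T" using img_shift[OF J f(1)] .
 have "len A ?T (sip J k) = len A ?T ?P + len A ?P (sip J k)" using len_add[OF A iT(1) iP(1) sI(2) iP(2) PT] .
 then have "len A ?T ?P = 0"
  using iT(4) iP(4) j1[of "Suc j"] j2[of j] eq by (cases "len A ?T ?P") (auto simp: j_def zero_enat_def)
 then have "?T = ?P" using len_eq_0[OF iT(1) iP(1) PT] by blast
 moreover have "f [^] j \<otimes> x \<in> ?T" proof -
  have "smod A (scale (f [^] j) (ipow J (d + n)))" using smod_scale[OF sI(1) _ AQ] fc by simp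
  then show ?thesis unfolding img_def using set_add_upper(1)[OF _ sI(2)] scaleI[OF x] by blast
 qed
 ultimately have "f [^] j \<otimes> x \<in> ?P" by simp
 then obtain h w where hw: "h \<in> ipow J n" "w \<in> sip J k" "f [^] j \<otimes> x = f [^] Suc j \<otimes> h \<oplus> w"
  unfolding img_def k by (auto simp: mem_set_add mem_scale)
 have hc: "h \<in> carrier Q" "w \<in> carrier Q" "f [^] j \<in> carrier Q" using hw clI sip_closed fc by auto
 have "f [^] j \<otimes> (x \<ominus> f \<otimes> h) = f [^] j \<otimes> x \<ominus> f [^] j \<otimes> f \<otimes> h" using hc fc by algebra
 also have "\<dots> = (f [^] j \<otimes> f \<otimes> h \<oplus> w) \<ominus> f [^] j \<otimes> f \<otimes> h" using hw(3) by simp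
 also have "\<dots> = w" using hc fc by algebra
 finally have "f [^] j \<otimes> (x \<ominus> f \<otimes> h) \<in> sip J (j * d + (d + n))" using hw k by simp
 moreover have "x \<ominus> f \<otimes> h \<in> ipow J (d + n)"
  using smod_minus[OF sI(1) A x ipow_mult_mem[OF J f(1) hw(1)]] .
 ultimately have "nil J (x \<ominus> f \<otimes> h) (d + n)" using annihilated_nil[OF m] f(2) by blast
 then show thesis using that hw by blast
qed

end

text \<open>
 A graded ideal \<open>W\<close> of the Rees ring of \<open>K\<close> contains a power of \<open>K\<close> as soon as \<open>K\<close> is generated
 by finitely many elements that are nilpotent modulo \<open>W\<close>.
\<close>

lemma nilpotent_generated:
 assumes K: "frac K" and "finite F" and "F <= K"
  and "\<And>q. smod A (W q)" "\<And>q. W q <= ipow K q" "\<And>q. K \<cdot> W q <= W (Suc q)"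
  and "\<And>x. x \<in> F ==> \<exists>i::nat. x [^] i \<in> W i"
  and "\<And>X. smod A X ==> F <= X ==> W 1 <= X ==> K <= X"
 shows "\<exists>q. ipow K (Suc q) <= W (Suc q)" using assms(2-) proof (induction F arbitrary: W)
 case empty
 then have "K <= W 1" by blast
 moreover have "ipow K 1 = K"
  using prod_one[OF frac_smod[OF K] one_A AQ] prod_comm[OF AQ frac_carrier[OF K]] by simp
 ultimately show ?case by (metis One_nat_def)
next
 case (insert x F)
 note W = insert.prems(2-4)
 have xK: "x \<in> K" using insert.prems by blast
 have xc: "x \<in> carrier Q" using xK frac_carrier[OF K] by blast
 have sK: "smod A (ipow K q)" "ipow K q <= carrier Q" for q
  using frac_smod frac_carrier frac_ipow[OF K] by auto
 have Wm: "y \<otimes> w \<in> W (m + q)" if "y \<in> ipow K m" "w \<in> W q" for m q y w proof -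
  have "ipow K m \<cdot> W q <= W (m + q)" proof (induction m)
   case 0
   then show ?case using prod_one[OF W(1) one_A AQ] by simp
  next
   case (Suc m)
   have "ipow K (Suc m) \<cdot> W q = K \<cdot> (ipow K m \<cdot> W q)"
    using prod_assoc[OF frac_carrier[OF K] sK(2) smodD(1)[OF W(1)]] by simp
   also have "\<dots> <= K \<cdot> W (m + q)" using Suc prod_mono by blast
   also have "\<dots> <= W (Suc m + q)" using W(3) by simp
   finally show ?case .
  qed
  then show ?thesis using prod_incl that by blast
 qed
 have xm: "x [^] (i::nat) \<otimes> y \<in> ipow K (i + m)" if "y \<in> ipow K m" for i m y proof -
  have x1: "x \<in> ipow K 1" using xK prod_one[OF frac_smod[OF K] one_A AQ] prod_comm[OF AQ frac_carrier[OF K]] by simp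
  have "x [^] i \<in> ipow K i" using elem_pow_ipow[OF K x1, of i] by simp
  then show ?thesis using ipow_mult_mem[OF K] that by blast
 qed
 \<comment> \<open>The generator \<open>x\<close> is adjoined to the graded ideal. The induction
   hypothesis applies to \<open>W'\<close>; afterwards the nilpotence of \<open>x\<close> modulo
   \<open>W\<close> removes it again.\<close>
 define W' where "W' q = (case q of 0 => W 0 | Suc p => scale x (ipow K p) \<boxplus> W (Suc p))" for q
 have W'S: "W' (Suc p) = scale x (ipow K p) \<boxplus> W (Suc p)" for p by (simp add: W'_def)
 have sx: "smod A (scale x (ipow K p))" for p using smod_scale[OF sK(1) xc AQ] .
 have sW': "smod A (W' q)" for q using W(1) smod_add[OF sx W(1) AQ] by (cases q) (auto simp: W'_def)
 have WW': "W q <= W' q" for q using set_add_upper(2)[OF sx W(1)] by (cases q) (auto simp: W'_def)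
 have "\<exists>q. ipow K (Suc q) <= W' (Suc q)" proof (rule insert.IH)
  show "F <= K" using insert.prems by blast
  show "smod A (W' q)" for q by (rule sW')
  show "W' q <= ipow K q" for q proof (cases q)
   case (Suc p)
   have "scale x (ipow K p) <= ipow K (Suc p)" using xm[of _ p 1] xc by (auto simp: scale_def)
   then show ?thesis using W(2)[of q] set_add_least[OF sK(1)] Suc by (simp add: W'S del: ipow_Suc)
  qed (use W(2)[of 0] in \<open>simp add: W'_def\<close>)
  show "K \<cdot> W' q <= W' (Suc q)" for q proof (cases q)
   case 0
   then show ?thesis using W(3)[of 0] WW'[of 1] by (auto simp: W'_def)
  next
   case (Suc p)
   show ?thesis proof (rule ideal_prod_minimal)
    fix y w assume y: "y \<in> K" "w \<in> W' q"
    then obtain u v where uv: "u \<in> ipow K p" "v \<in> W (Suc p)" "w = x \<otimes> u \<oplus> v"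
     unfolding Suc W'S by (auto simp: mem_set_add mem_scale)
    have cc: "y \<in> carrier Q" "u \<in> carrier Q" "v \<in> carrier Q"
     using y uv frac_carrier[OF K] sK smodD(1)[OF W(1)] by blast+
    have "y \<otimes> w = x \<otimes> (y \<otimes> u) \<oplus> y \<otimes> v" unfolding uv(3) using cc xc by algebra
    moreover have "y \<otimes> u \<in> ipow K (Suc p)" using prod_incl[OF y(1) uv(1)] by simp
    moreover have "y \<otimes> v \<in> W (Suc (Suc p))" using prod_incl[OF y(1) uv(2)] W(3) by blast
    ultimately show "y \<otimes> w \<in> W' (Suc q)" unfolding Suc W'S by (simp add: set_addI scaleI del: ipow_Suc)
   qed (use smodD(3)[OF sW'] in blast)
  qed
  show "\<exists>i::nat. z [^] i \<in> W' i" if "z \<in> F" for z using insert.prems(5)[of z] that WW' by blast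
  show "K <= X" if X: "smod A X" "F <= X" "W' 1 <= X" for X proof -
   have "x \<in> W' 1" proof -
    have "x \<in> scale x (ipow K 0)" using smod_cyclic(2)[OF A xc] by simp
    then show ?thesis using set_add_upper(1)[OF sx W(1), of 0 "Suc 0"] by (auto simp: W'S)
   qed
   then show ?thesis using insert.prems(6)[OF X(1)] X WW'[of 1] by blast
  qed
 qed
 then obtain q where q: "ipow K (Suc q) <= scale x (ipow K q) \<boxplus> W (Suc q)" unfolding W'S by blast
 \<comment> \<open>In the \<open>i\<close>-th power of the inclusion every term with a factor in
   \<open>W\<close> stays in \<open>W\<close>, and the other term carries \<open>x^i\<close>, which
   lies in \<open>W\<close> for a suitable \<open>i\<close>.\<close>
 have pw: "ipow K (i * Suc q) <= scale (x [^] i) (ipow K (i * q)) \<boxplus> W (i * Suc q)" for i :: nat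
 proof (induction i)
  case 0
  have "scale (x [^] (0::nat)) (ipow K 0) = A" using scale_one[OF AQ] by simp
  then show ?case using set_add_upper(1)[OF smod_A W(1)[of 0]] by simp
 next
  case (Suc i)
  have sR: "smod A (scale (x [^] Suc i) (ipow K (Suc i * q)) \<boxplus> W (Suc i * Suc q))"
   using smod_add[OF smod_scale[OF sK(1) _ AQ] W(1) AQ] xc by simp
  have "ipow K (Suc i * Suc q) = ipow K (Suc q) \<cdot> ipow K (i * Suc q)"
   using ipow_add[OF K, of "Suc q" "i * Suc q"] by (metis mult_Suc)
  also have "\<dots> <= scale (x [^] Suc i) (ipow K (Suc i * q)) \<boxplus> W (Suc i * Suc q)"
  proof (rule ideal_prod_minimal)
   fix y z assume y: "y \<in> ipow K (Suc q)" and z: "z \<in> ipow K (i * Suc q)"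
   obtain u v where uv: "u \<in> ipow K q" "v \<in> W (Suc q)" "y = x \<otimes> u \<oplus> v"
    using subsetD[OF q y] by (auto simp: mem_set_add mem_scale)
   obtain u' v' where uv': "u' \<in> ipow K (i * q)" "v' \<in> W (i * Suc q)" "z = x [^] i \<otimes> u' \<oplus> v'"
    using subsetD[OF Suc z] by (auto simp: mem_set_add mem_scale)
   have cc: "u \<in> carrier Q" "v \<in> carrier Q" "u' \<in> carrier Q" "v' \<in> carrier Q" "y \<in> carrier Q" "x [^] i \<in> carrier Q"
    using uv uv' y sK smodD(1)[OF W(1)] xc by blast+
   have "y \<otimes> z = y \<otimes> (x [^] i \<otimes> u') \<oplus> y \<otimes> v'" unfolding uv'(3) using cc by algebra
   also have "y \<otimes> (x [^] i \<otimes> u') = x [^] i \<otimes> x \<otimes> (u \<otimes> u') \<oplus> (x [^] i \<otimes> u') \<otimes> v"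
    unfolding uv(3) using cc xc by algebra
   finally have eq: "y \<otimes> z = x [^] Suc i \<otimes> (u \<otimes> u') \<oplus> ((x [^] i \<otimes> u') \<otimes> v \<oplus> y \<otimes> v')"
    using cc xc by (simp add: a_assoc)
   have d: "q + i * q = Suc i * q" "i + i * q + Suc q = Suc i * Suc q" "Suc q + i * Suc q = Suc i * Suc q" by simp_all
   have "u \<otimes> u' \<in> ipow K (Suc i * q)" using ipow_mult_mem[OF K uv(1) uv'(1)] d(1) by metis
   moreover have "(x [^] i \<otimes> u') \<otimes> v \<in> W (Suc i * Suc q)" using Wm[OF xm[OF uv'(1), of i] uv(2)] d(2) by metis
   moreover have "y \<otimes> v' \<in> W (Suc i * Suc q)" using Wm[OF y uv'(2)] d(3) by metis
   ultimately show "y \<otimes> z \<in> scale (x [^] Suc i) (ipow K (Suc i * q)) \<boxplus> W (Suc i * Suc q)"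
    unfolding eq using smodD(3)[OF W(1)] by (intro set_addI scaleI) auto
  qed (use smodD(3)[OF sR] in blast)
  finally show ?case .
 qed
 obtain i :: nat where i: "x [^] i \<in> W i" using insert.prems(5) by blast
 have "x [^] Suc i \<in> W (Suc i)" proof -
  have "x \<otimes> x [^] i \<in> W (Suc i)" using prod_incl[OF xK i] W(3) by blast
  then show ?thesis using xc by (simp add: m_comm)
 qed
 then have xW: "x [^] Suc i \<otimes> y \<in> W (Suc i * q + Suc i)" if "y \<in> ipow K (Suc i * q)" for y
 proof -
  have "x [^] Suc i \<otimes> y = y \<otimes> x [^] Suc i" using xc that sK(2) by (intro m_comm) auto
  then show ?thesis using Wm[OF that \<open>x [^] Suc i \<in> W (Suc i)\<close>] by simp
 qed
 then have "scale (x [^] Suc i) (ipow K (Suc i * q)) <= W (Suc i * q + Suc i)"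
  unfolding scale_def by blast
 then have "ipow K (Suc i * Suc q) <= W (Suc i * Suc q)"
  using pw[of "Suc i"] set_add_least[OF W(1)] by (simp add: algebra_simps del: nat_pow_Suc ipow_Suc) blast
 moreover have "Suc i * Suc q = Suc (q + i * Suc q)" by simp
 ultimately show ?case by metis
qed

text \<open>For \<open>f\<close> of maximal stable rank, \<open>J^N\<close> with
  \<open>N = d + n\<close> is generated by nilpotents modulo \<open>f\<close>. So a high power of
  \<open>J^N\<close> is contained in \<open>f\<close> times a power of \<open>J\<close> plus
  \<open>s\<close> times itself, and Nakayama's lemma removes the second summand. Over a finite
  residue field \<open>d = 1\<close> is impossible in general.\<close>

lemma reduction_exists:
 assumes J: "frac J"
 obtains f d n0 where "0 < d" "f \<in> ipow J d" "f \<in> Units Q" "\<And>n. n0 <= n ==> ipow J (d + n) = scale f (ipow J n)"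
proof -
 note sI = frac_smod[OF frac_ipow[OF J]] frac_smod[OF frac_sip[OF J]]
 note clI = ipow_closed[OF J] and clS = sip_closed[OF J]
 obtain f d n where m: "max_rk J f d n" using max_rk_exists[OF J] by blast
 have f: "f \<in> ipow J d" "0 < d" using m by (auto simp: max_rk_def[OF J])
 have fc: "f \<in> carrier Q" using f clI by blast
 define N where "N = d + n"
 let ?K = "ipow J N"
 have K: "frac ?K" using frac_ipow J by blast
 \<comment> \<open>The ideal generated by \<open>f\<close> and \<open>s\<close> in the Rees ring of
   \<open>J^N\<close>. Multiplication by \<open>f\<close> has degree \<open>d\<close> and takes
   degree \<open>pN + n\<close> to degree \<open>(p+1)N\<close>, since
   \<open>N = d + n\<close>.\<close>
 define W where "W q = (case q of 0 => sip J 0 | Suc p => scale f (ipow J (p * N + n)) \<boxplus> sip J (Suc p * N))" for q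
 have W0: "W 0 = sip J 0" and WS: "W (Suc p) = scale f (ipow J (p * N + n)) \<boxplus> sip J (Suc p * N)" for p
  by (simp_all add: W_def)
 have sf: "smod A (scale f (ipow J k))" for k using smod_scale[OF sI(1) fc AQ] .
 have sW: "smod A (W q)" for q using sI(2) smod_add[OF sf sI(2) AQ] by (cases q) (auto simp: W0 WS)
 have Wsip: "sip J (q * N) <= W q" for q
  using set_add_upper(2)[OF sf sI(2)] by (cases q) (auto simp: W0 WS)
 have fsub: "scale f (ipow J (p * N + n)) <= ipow J (Suc p * N)" for p proof -
  have "d + (p * N + n) = Suc p * N" by (simp add: N_def)
  then have "f \<otimes> y \<in> ipow J (Suc p * N)" if "y \<in> ipow J (p * N + n)" for y
   using ipow_mult_mem[OF J f(1) that] by metis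
  then show ?thesis by (auto simp: mem_scale simp del: mult_Suc)
 qed
 obtain F where F: "finite F" "F <= ?K" "\<And>X. smod A X ==> F <= X ==> ?K <= X"
  using finitely_gen[OF K frac_smod[OF K] order_refl] by blast
 have "\<exists>q. ipow ?K (Suc q) <= W (Suc q)" proof (rule nilpotent_generated[OF K F(1,2) sW])
  show "W q <= ipow ?K q" for q
   unfolding ipow_ipow[OF J] using fsub sip_subset[OF J] sip_subset[OF J, of 0] set_add_least[OF sI(1)]
   by (cases q) (auto simp: W0 WS simp del: ipow_Suc mult_Suc)
  show "?K \<cdot> W q <= W (Suc q)" for q proof (rule ideal_prod_minimal)
   fix y w assume y: "y \<in> ?K" and w: "w \<in> W q"
   show "y \<otimes> w \<in> W (Suc q)" proof (cases q)
    case 0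
    then have "y \<otimes> w \<in> sip J (N + 0)" using sip_mult_mem[OF J y, of w 0] w W0 by blast
    then show ?thesis using Wsip[of 1] 0 by auto
   next
    case (Suc p)
    then obtain u v where uv: "u \<in> ipow J (p * N + n)" "v \<in> sip J (Suc p * N)" "w = f \<otimes> u \<oplus> v"
     using w unfolding Suc WS by (auto simp: mem_set_add mem_scale simp del: mult_Suc)
    have cc: "y \<in> carrier Q" "u \<in> carrier Q" "v \<in> carrier Q" using y uv clI clS by auto
    have "y \<otimes> w = f \<otimes> (y \<otimes> u) \<oplus> y \<otimes> v" unfolding uv(3) using cc fc by algebra
    moreover have "y \<otimes> u \<in> ipow J (Suc p * N + n)"
     using ipow_mult_mem[OF J y uv(1)] by (simp add: add.assoc)
    moreover have "y \<otimes> v \<in> sip J (Suc (Suc p) * N)" using sip_mult_mem[OF J y uv(2)] by simp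
    ultimately show ?thesis unfolding Suc WS by (simp add: set_addI scaleI del: mult_Suc)
   qed
  qed (use smodD(3)[OF sW] in blast)
  show "\<exists>i::nat. x [^] i \<in> W i" if x: "x \<in> F" for x proof -
   have xK: "x \<in> ipow J (d + n)" using x F N_def by blast
   obtain h where h: "h \<in> ipow J n" "nil J (x \<ominus> f \<otimes> h) (d + n)" using decompose_nil[OF J m xK] by blast
   let ?k = "x \<ominus> f \<otimes> h"
   have cc: "x \<in> carrier Q" "h \<in> carrier Q" "?k \<in> carrier Q" using xK h clI fc by auto
   have kI: "?k \<in> ipow J N" using smod_minus[OF sI(1) A xK ipow_mult_mem[OF J f(1) h(1)]] N_def by simp
   obtain i :: nat where i: "?k [^] i \<in> sip J (i * N)" using h(2) unfolding nil_def N_def by blast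
   have ki: "?k [^] Suc i \<in> sip J (Suc i * N)" using sip_mult_mem'[OF J i kI] by (simp add: add.commute)
   \<comment> \<open>With \<open>x = fh + k\<close>, each power of \<open>x\<close> differs from the
     same power of the nilpotent \<open>k\<close> by a multiple of \<open>f\<close>.\<close>
   have "\<exists>y\<in>ipow J (j * N + n). x [^] Suc j = f \<otimes> y \<oplus> ?k [^] Suc j" for j :: nat
   proof (induction j)
    case 0
    have "x = f \<otimes> h \<oplus> ?k" using cc(1,2) fc by algebra
    then show ?case using h cc by auto
   next
    case (Suc j)
    then obtain y where y: "y \<in> ipow J (j * N + n)" "x [^] Suc j = f \<otimes> y \<oplus> ?k [^] Suc j" by blast
    have yc: "y \<in> carrier Q" "?k [^] Suc j \<in> carrier Q" using y clI cc by auto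
    have x': "x = f \<otimes> h \<oplus> ?k" using cc(1,2) fc by algebra
    have "x [^] Suc (Suc j) = (f \<otimes> y \<oplus> ?k [^] Suc j) \<otimes> x" using y(2) by simp
    also have "\<dots> = f \<otimes> y \<otimes> x \<oplus> ?k [^] Suc j \<otimes> (f \<otimes> h \<oplus> ?k)"
     using x' yc cc fc l_distr[of "f \<otimes> y" "?k [^] Suc j" x] by simp
    also have "\<dots> = f \<otimes> (y \<otimes> x \<oplus> ?k [^] Suc j \<otimes> h) \<oplus> ?k [^] Suc j \<otimes> ?k"
    proof -
     have "f \<otimes> y \<otimes> x \<oplus> b \<otimes> (f \<otimes> h \<oplus> c) = f \<otimes> (y \<otimes> x \<oplus> b \<otimes> h) \<oplus> b \<otimes> c"
      if "b \<in> carrier Q" "c \<in> carrier Q" for b c using that yc(1) cc(1,2) fc by algebra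
     then show ?thesis using yc(2) cc(3) by blast
    qed
    finally have "x [^] Suc (Suc j) = f \<otimes> (y \<otimes> x \<oplus> ?k [^] Suc j \<otimes> h) \<oplus> ?k [^] Suc (Suc j)" by simp
    moreover have "y \<otimes> x \<in> ipow J (Suc j * N + n)" proof -
     have "y \<otimes> x \<in> ipow J (j * N + n + (d + n))" using ipow_mult_mem[OF J y(1) xK] .
     moreover have "j * N + n + (d + n) = Suc j * N + n" by (simp add: N_def)
     ultimately show ?thesis by metis
    qed
    moreover have "?k [^] Suc j \<otimes> h \<in> ipow J (Suc j * N + n)"
     using ipow_mult_mem[OF J elem_pow_ipow[OF J kI] h(1)] .
    ultimately show ?case using smodD(3)[OF sI(1)] by blast
   qed
   then obtain y where y: "y \<in> ipow J (i * N + n)" "x [^] Suc i = f \<otimes> y \<oplus> ?k [^] Suc i" by blast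
   then have "x [^] Suc i \<in> W (Suc i)" unfolding y(2) WS using ki by (intro set_addI scaleI) auto
   then show ?thesis by blast
  qed
  show "?K <= X" if "smod A X" "F <= X" for X using F(3) that by blast
 qed
 then obtain q where q: "ipow J (Suc q * N) <= scale f (ipow J (q * N + n)) \<boxplus> sip J (Suc q * N)"
  unfolding WS ipow_ipow[OF J] by blast
 have eqN: "ipow J (Suc q * N) = scale f (ipow J (q * N + n))"
  by (rule nakayama[OF frac_ipow[OF J] sI(1) order_refl sf fsub]) (use q in \<open>simp add: sip_def\<close>)
 have fu: "f \<in> Units Q" proof -
  obtain k where "s [^] (k::nat) \<in> ipow J (Suc q * N)" using frac_ipow[OF J] unfolding frac_def by blast
  then obtain z where "z \<in> ipow J (q * N + n)" "s [^] k = f \<otimes> z" unfolding eqN by (auto simp: mem_scale)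
  then show ?thesis using unit_factor[of f z] spow_unit[of k] fc clI by auto
 qed
 have "ipow J (d + k) = scale f (ipow J k)" if k: "q * N + n <= k" for k proof -
  let ?l = "k - (q * N + n)"
  have "ipow J (d + k) = ipow J (Suc q * N) \<cdot> ipow J ?l" proof -
   have "Suc q * N + ?l = d + k" using k by (simp add: N_def)
   then show ?thesis using ipow_add[OF J] by metis
  qed
  also have "\<dots> = scale f (ipow J (q * N + n) \<cdot> ipow J ?l)"
   unfolding eqN using scale_prod[OF smodD(1)[OF sI(1)] smodD(1)[OF sI(1)] fc] .
  also have "\<dots> = scale f (ipow J k)" using ipow_add[OF J] k by simp
  finally show ?thesis .
 qed
 then show thesis using that[OF f(2,1) fu, of "q * N + n"] by blast
qed

end

section \<open>Multiplicity of a regular ideal\<close>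

lemma enat_add_left_le_cancel: "(c::enat) \<noteq> \<infinity> ==> c + a <= c + b ==> a <= b"
 by (cases c; cases a; cases b) auto

context curve begin

lemma acc_ex:
 assumes "frac Y" "\<F> \<noteq> {}" "\<And>T. T \<in> \<F> ==> smod A T \<and> T <= Y"
 shows "\<exists>M\<in>\<F>. \<forall>T\<in>\<F>. M <= T --> T = M"
proof (rule acc[OF assms])
 fix M assume "M \<in> \<F>" "\<And>T. T \<in> \<F> ==> M <= T ==> T = M"
 then show ?thesis by blast
qed

text \<open>
 For an overring \<open>B\<close> over which \<open>J\<close> becomes invertible, multiplication by \<open>J\<close> does not decrease
 lengths over a \<open>B\<close>-module: on each simple \<open>B\<close>-subquotient some element of \<open>J\<close> acts injectively.
\<close>

lemma len_growth:
 assumes J: "frac J" and B: "subring B Q" "A <= B"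
  and cancel: "\<forall>N N'. frac N \<and> frac N' \<and> smod B N \<and> smod B N' \<and> J \<cdot> N <= J \<cdot> N' --> N <= N'"
  and N: "frac N" "smod B N" "frac N0" "smod B N0" and M: "smod A M" "N0 <= M" "M <= N"
 shows "len A M N0 <= len A (J \<cdot> M) (J \<cdot> N0)" proof -
 obtain l where "len A N N0 = enat l" using len_finite[OF N(1,3)] by auto
 then show ?thesis using N(1,2) M proof (induction l arbitrary: N M rule: less_induct)
  case (less l)
  note N' = less.prems(2,3) and M = less.prems(4-6)
  have fM: "frac M" using frac_between[OF N(3) N'(1) M] .
  show ?case proof (cases "N = N0")
   case True
   then show ?thesis using M by (simp add: len_self)
  next
   case False
   \<comment> \<open>\<open>N1\<close> will be a maximal \<open>B\<close>-submodule of
     \<open>N\<close> above \<open>N0\<close>. By \<open>cancel\<close> some \<open>a\<close> in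
     \<open>J\<close> does not carry \<open>N\<close> into \<open>J N1\<close>; its kernel on
     \<open>N/N1\<close> is a proper \<open>B\<close>-submodule, hence zero. So \<open>a\<close>
     acts injectively on \<open>M/(M \<inter> N1)\<close>, while \<open>M \<inter> N1\<close> falls
     under the induction hypothesis for \<open>N1\<close>.\<close>
   let ?F = "{T. smod B T \<and> N0 <= T \<and> T \<subset> N}"
   have "?F \<noteq> {}" "\<And>T. T \<in> ?F ==> smod A T \<and> T <= N"
    using False N(4) M smod_subring[OF _ B(2)] by blast+
   from acc_ex[OF N'(1) this] obtain N1 where N1: "N1 \<in> ?F" and mx: "\<And>T. T \<in> ?F ==> N1 <= T ==> T = N1"
    by meson
   have sN1: "smod B N1" "smod A N1" "N0 <= N1" "N1 \<subset> N" using N1 smod_subring[OF _ B(2)] by auto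
   have fN1: "frac N1" using frac_between[OF N(3) N'(1) sN1(2,3)] sN1(4) by blast
   have "\<not> J \<cdot> N <= J \<cdot> N1" using cancel N'(1) fN1 N'(2) sN1(1) sN1(4) by blast
   moreover have sJN1: "smod B (J \<cdot> N1)" "smod A (J \<cdot> N1)" proof -
    have "smod B (N1 \<cdot> J)" using smod_prod2[OF sN1(1) frac_smod[OF J] subringE(1)[OF B(1)]] .
    then show "smod B (J \<cdot> N1)" using prod_comm frac_carrier J fN1 by metis
    then show "smod A (J \<cdot> N1)" using smod_subring B(2) by blast
   qed
   ultimately obtain a x where a: "a \<in> J" "x \<in> N" "a \<otimes> x \<notin> J \<cdot> N1"
    using ideal_prod_minimal[where X = J and Y = N and Z = "J \<cdot> N1"] smodD(3)[OF sJN1(1)] by blast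
   have ac: "a \<in> carrier Q" using a J frac_carrier by blast
   note ND = smodD[OF N'(2)] and JD = smodD[OF sJN1(1)]
   let ?K = "{y \<in> N. a \<otimes> y \<in> J \<cdot> N1}"
   have "smod B ?K" proof (rule smodI)
    show "\<zero> \<in> ?K" using ND JD ac by simp
    show "y \<oplus> z \<in> ?K" if "y \<in> ?K" "z \<in> ?K" for y z
     using that ND(3,5) JD(3) ac by (simp add: r_distr)
    show "b \<otimes> y \<in> ?K" if b: "b \<in> B" "y \<in> ?K" for b y proof -
     have "a \<otimes> (b \<otimes> y) = b \<otimes> (a \<otimes> y)"
      using b subringE(1)[OF B(1)] ND(5) ac by (auto intro: m_lcomm)
     then show ?thesis using b ND(4) JD(4) by simp
    qed
   qed (use ND in blast)
   moreover have "N1 <= ?K" using sN1(4) a(1) by (auto intro: prod_incl)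
   moreover have "?K \<subset> N" using a by blast
   ultimately have "?K = N1" using mx[of ?K] sN1(3) by blast
   then have inj: "y \<in> N1" if "y \<in> N" "a \<otimes> y \<in> J \<cdot> N1" for y using that by blast
   let ?M1 = "M \<inter> N1"
   have sM1: "smod A ?M1" using smod_inter M(1) sN1(2) by blast
   have fM1: "frac ?M1" using frac_inter fM fN1 by blast
   have NN1: "len A N N0 = len A N N1 + len A N1 N0" using frac_len_add[OF N'(1) fN1 N(3)] sN1 by blast
   have "1 <= len A N N1" using len_ge_1 frac_smod[OF N'(1)] sN1 by blast
   moreover obtain l1 where l1: "len A N1 N0 = enat l1" using len_finite[OF fN1 N(3)] by auto
   ultimately have "l1 < l" using NN1 less.prems(1) by (cases "len A N N1") (auto simp: one_enat_def)
   then have IH: "len A ?M1 N0 <= len A (J \<cdot> ?M1) (J \<cdot> N0)"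
    using less.IH[OF _ l1 fN1 sN1(1) sM1] M(2) sN1(3) by blast
   have fJ: "frac (J \<cdot> M)" "frac (J \<cdot> N1)" "frac (J \<cdot> N0)" "frac (J \<cdot> ?M1)"
    using frac_prod J fM fN1 N(3) fM1 by auto
   have fJi: "frac (J \<cdot> M \<inter> J \<cdot> N1)" using frac_inter fJ by blast
   have "len A M N0 = len A M ?M1 + len A ?M1 N0" using frac_len_add[OF fM fM1 N(3)] M(2) sN1(3) by blast
   also have "len A M ?M1 <= len A (scale a M \<boxplus> J \<cdot> N1) (J \<cdot> N1)"
   proof (rule len_mult_inj[OF A M(1) sM1 sJN1(2) ac])
    show "x \<in> ?M1" if "x \<in> M" "a \<otimes> x \<in> J \<cdot> N1" for x using inj that M(3) by blast
   qed blast
   also have "\<dots> <= len A (J \<cdot> M \<boxplus> J \<cdot> N1) (J \<cdot> N1)"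
   proof (rule len_mono[OF set_add_mono order_refl])
    show "scale a M <= J \<cdot> M" using a(1) by (auto simp: scale_def intro: prod_incl)
   qed blast
   also have "\<dots> = len A (J \<cdot> M) (J \<cdot> M \<inter> J \<cdot> N1)"
    using len_inter_add[OF A frac_smod[OF fJ(1)] sJN1(2)] .
   also have "len A ?M1 N0 <= len A (J \<cdot> M \<inter> J \<cdot> N1) (J \<cdot> N0)"
    using IH len_mono[of "J \<cdot> ?M1" "J \<cdot> M \<inter> J \<cdot> N1" "J \<cdot> N0" "J \<cdot> N0" A] prod_mono[of J J ?M1]
    by (meson Int_greatest Int_lower1 Int_lower2 order_refl order_trans)
   also have "len A (J \<cdot> M) (J \<cdot> M \<inter> J \<cdot> N1) + len A (J \<cdot> M \<inter> J \<cdot> N1) (J \<cdot> N0) = len A (J \<cdot> M) (J \<cdot> N0)"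
    using frac_len_add[OF fJ(1) fJi fJ(3)] prod_mono[of J J N0] M(2) sN1(3) by auto
   finally show ?thesis by (simp add: add_mono)
  qed
 qed
qed

text \<open>\<open>B = g^-1 J^D\<close> is the blow-up ring of \<open>J\<close>. On
  \<open>B\<close>-modules multiplication by \<open>J\<close> does not lower lengths, and
  \<open>D\<close> such multiplications amount to multiplying by the unit \<open>g\<close>; so
  lengths are preserved and \<open>l(N/JN)\<close> is the same number \<open>e\<close> for all
  \<open>N\<close>. The modules \<open>J^n M\<close> with \<open>n\<close> large are
  \<open>B\<close>-modules, and \<open>M\<close> itself is compared with \<open>BM\<close>.\<close>

theorem multiplicity_exists:
 assumes J: "frac J" and JA: "J <= A"
 obtains e where "e \<noteq> \<infinity>"
  "\<And>M. frac M ==> len A M (J \<cdot> M) <= e"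
  "\<And>M. frac M ==> \<exists>N. \<forall>n\<ge>N. len A (ipow J n \<cdot> M) (ipow J (Suc n) \<cdot> M) = e"
proof -
 from reduction_exists[OF J] have "\<exists>f d n0. 0 < d \<and> f \<in> ipow J d \<and> f \<in> Units Q \<and>
   (\<forall>n\<ge>n0. ipow J (d + n) = scale f (ipow J n))" by metis
 then obtain f d n0 where f: "0 < d" "f \<in> ipow J d" "f \<in> Units Q"
  and red: "\<And>n. n0 <= n ==> ipow J (d + n) = scale f (ipow J n)" by meson
 have fc: "f \<in> carrier Q" using f(3) by (rule Units_closed)
 note cI = frac_carrier[OF frac_ipow[OF J]] and sI = frac_smod[OF frac_ipow[OF J]]
 have red': "ipow J (i * d + n) = scale (f [^] i) (ipow J n)" if "n0 <= n" for i n proof (induction i)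
  case 0
  then show ?case using scale_one[OF cI] by simp
 next
  case (Suc i)
  have "ipow J (Suc i * d + n) = scale f (ipow J (i * d + n))"
   using red[of "i * d + n"] that by (simp add: add.assoc)
  also have "\<dots> = scale (f [^] Suc i) (ipow J n)"
   using Suc scale_scale[OF cI fc, of "f [^] i"] fc by (simp add: m_comm)
  finally show ?case .
 qed
 \<comment> \<open>\<open>D\<close> is a multiple of \<open>d\<close>, so that a power
   \<open>g\<close> of \<open>f\<close> has degree \<open>D\<close>, and at least \<open>n0\<close>,
   so that \<open>J^D\<close> lies in the range where multiplication by \<open>g\<close> is onto;
   this makes \<open>B\<close> a ring.\<close>
 define D where "D = Suc n0 * d"
 define g where "g = f [^] Suc n0"
 have D: "n0 <= D" "0 < D" using f(1) mult_le_mono2[of 1 d "Suc n0"] by (auto simp: D_def)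
 have g: "g \<in> ipow J D" "g \<in> Units Q" "g \<in> carrier Q" "inv g \<in> carrier Q" "inv g \<in> Units Q"
  using elem_pow_ipow[OF J f(2), of "Suc n0"] pow_unit[OF f(3), of "Suc n0"]
  unfolding g_def D_def by (auto simp del: nat_pow_Suc)
 have redg: "ipow J (D + n) = scale g (ipow J n)" if "n0 <= n" for n
  using red'[OF that, of "Suc n0"] unfolding g_def D_def .
 define B where "B = scale (inv g) (ipow J D)"
 have fB: "frac B" unfolding B_def using frac_scale[OF frac_ipow[OF J] g(5)] .
 have gB: "scale g B = ipow J D" unfolding B_def using scale_inv(1)[OF cI g(2)] .
 have act: "b \<otimes> z \<in> ipow J n" if b: "b \<in> B" and z: "z \<in> ipow J n" and n: "n0 <= n" for b z n
 proof -
  obtain x where x: "x \<in> ipow J D" "b = inv g \<otimes> x" using b unfolding B_def by (auto simp: mem_scale)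
  have "x \<otimes> z \<in> scale g (ipow J n)" using ipow_mult_mem[OF J x(1) z] redg[OF n] by simp
  then obtain w where w: "w \<in> ipow J n" "x \<otimes> z = g \<otimes> w" by (auto simp: mem_scale)
  have "b \<otimes> z = w" unfolding x(2) using x z w cI g by (simp add: m_assoc subset_iff)
  then show ?thesis using w by simp
 qed
 have one_B: "\<one> \<in> B" proof -
  have "inv g \<otimes> g \<in> B" unfolding B_def using g(1) by (rule scaleI)
  then show ?thesis using g by simp
 qed
 have sBI: "smod B (ipow J n)" if "n0 <= n" for n using smodD[OF sI] act that by (intro smodI) blast+
 have BQ: "B <= carrier Q" using frac_carrier[OF fB] .
 have sBB: "smod B B" using smod_scale[OF sBI[OF D(1)] g(4) BQ] unfolding B_def[symmetric] .
 have B: "subring B Q" proof (rule subringI)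
  show "\<ominus> h \<in> B" if "h \<in> B" for h using smod_neg[OF frac_smod[OF fB] A that] .
 qed (use BQ one_B smodD[OF sBB] in auto)
 have AB: "A <= B" proof
  fix a assume a: "a \<in> A"
  then have "a \<otimes> \<one> \<in> B" using smodD(4)[OF frac_smod[OF fB] a one_B] by blast
  then show "a \<in> B" using a AQ by auto
 qed
 have gN: "ipow J D \<cdot> N = scale g N" if N: "smod B N" for N proof -
  have "ipow J D \<cdot> N = scale g (B \<cdot> N)" using scale_prod[OF BQ smodD(1)[OF N] g(3)] gB by simp
  then show ?thesis using prod_one[OF N one_B BQ] by simp
 qed
 obtain D' where D': "D = Suc D'" using D gr0_implies_Suc by blast
 have cancel: "N <= N'" if NN: "frac N" "frac N'" "smod B N" "smod B N'" "J \<cdot> N <= J \<cdot> N'" for N N'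
 proof -
  have eq: "ipow J D' \<cdot> (J \<cdot> X) = ipow J D \<cdot> X" if "frac X" for X
   using prod_assoc[OF cI frac_carrier[OF J] frac_carrier[OF that]] prod_comm[OF cI frac_carrier[OF J]] D'
   by (simp add: ipow_def)
  have "ipow J D \<cdot> N <= ipow J D \<cdot> N'" using eq NN prod_mono by (metis order_refl)
  then show ?thesis using gN NN scale_subset_iff[OF frac_carrier frac_carrier g(2)] by simp
 qed
 have "\<forall>N N'. frac N \<and> frac N' \<and> smod B N \<and> smod B N' \<and> J \<cdot> N <= J \<cdot> N' --> N <= N'"
  using cancel by blast
 note growth = len_growth[OF J B AB this]
 have sBprod: "smod B (X \<cdot> N)" if "frac X" "frac N" "smod B N" for X N
  using smod_prod2[OF that(3) frac_smod[OF that(1)] BQ] prod_comm frac_carrier that by metis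
 have Jsub: "J \<cdot> X <= X" if X: "smod A X" for X
  by (rule ideal_prod_minimal) (use smodD[OF X] JA in auto)
 have EQ: "len A (J \<cdot> N) (J \<cdot> N0) = len A N N0"
  if N: "frac N" "smod B N" "frac N0" "smod B N0" "N0 <= N" for N N0 proof (rule antisym)
  have step: "len A X X0 <= len A (J \<cdot> X) (J \<cdot> X0)"
   if "frac X" "smod B X" "frac X0" "smod B X0" "X0 <= X" for X X0
   using growth[OF that(1-4) frac_smod[OF that(1)] that(5) order_refl] .
  have iprod: "J \<cdot> (ipow J k \<cdot> X) = ipow J (Suc k) \<cdot> X" if "frac X" for k X
   using prod_assoc[OF frac_carrier[OF J] cI frac_carrier[OF that]] by simp
  \<comment> \<open>The lengths increase with \<open>k\<close>; at \<open>k = D - 1\<close> they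
    have become \<open>l(gN/gN0) = l(N/N0)\<close>, which closes the circle.\<close>
  have mono: "len A (J \<cdot> N) (J \<cdot> N0) <= len A (ipow J (Suc k) \<cdot> N) (ipow J (Suc k) \<cdot> N0)" for k
  proof (induction k)
   case 0
   then show ?case using prod_comm[OF AQ frac_carrier[OF J]] prod_one[OF frac_smod[OF J] one_A AQ] by simp
  next
   case (Suc k)
   also have "len A (ipow J (Suc k) \<cdot> N) (ipow J (Suc k) \<cdot> N0)
     <= len A (J \<cdot> (ipow J (Suc k) \<cdot> N)) (J \<cdot> (ipow J (Suc k) \<cdot> N0))"
    using N by (intro step frac_prod frac_ipow[OF J] sBprod prod_mono order_refl)
   finally show ?case using iprod N by metis
  qed
  show "len A (J \<cdot> N) (J \<cdot> N0) <= len A N N0"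
   using mono[of D'] gN[OF N(2)] gN[OF N(4)] len_scale[OF frac_smod[OF N(1)] frac_smod[OF N(3)] g(2) AQ]
   unfolding D'[symmetric] by simp
  show "len A N N0 <= len A (J \<cdot> N) (J \<cdot> N0)" using step N by blast
 qed
 define e where "e = len A B (J \<cdot> B)"
 have const_aux: "len A N (J \<cdot> N) = len A N0 (J \<cdot> N0)"
  if N: "frac N" "smod B N" "frac N0" "smod B N0" "N0 <= N" for N N0 proof -
  have fJ: "frac (J \<cdot> N)" "frac (J \<cdot> N0)" using frac_prod J N by auto
  have "len A N N0 + len A N0 (J \<cdot> N0) = len A N (J \<cdot> N0)"
   using frac_len_add[OF N(1,3) fJ(2)] Jsub[OF frac_smod[OF N(3)]] N(5) by simp
  also have "\<dots> = len A N (J \<cdot> N) + len A (J \<cdot> N) (J \<cdot> N0)"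
   using frac_len_add[OF N(1) fJ] Jsub[OF frac_smod[OF N(1)]] prod_mono[of J J N0 N] N(5) by simp
  also have "\<dots> = len A N N0 + len A N (J \<cdot> N)" using EQ[OF N] by (simp add: add.commute)
  finally show ?thesis using len_finite[OF N(1,3)] by (simp add: enat_add_left_cancel)
 qed
 have const: "len A N (J \<cdot> N) = e" if N: "frac N" "smod B N" for N
  using const_aux[OF N frac_inter[OF N(1) fB] smod_inter[OF N(2) sBB]]
   const_aux[OF fB sBB frac_inter[OF N(1) fB] smod_inter[OF N(2) sBB]] unfolding e_def by simp
 show thesis proof (rule that[of e])
  show "e \<noteq> \<infinity>" unfolding e_def using len_finite[OF fB frac_prod[OF J fB]] .
  show "len A M (J \<cdot> M) <= e" if M: "frac M" for M proof -
   let ?N = "B \<cdot> M"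
   have fN: "frac ?N" using frac_prod[OF fB M] .
   have sN: "smod B ?N" using smod_prod2[OF sBB frac_smod[OF M] BQ] .
   have MN: "M <= ?N" proof
    fix x assume "x \<in> M"
    then have "\<one> \<otimes> x \<in> ?N" using one_B by (intro prod_incl)
    then show "x \<in> ?N" using \<open>x \<in> M\<close> frac_carrier[OF M] by auto
   qed
   \<comment> \<open>\<open>M\<close> is enclosed by two \<open>B\<close>-modules,
     \<open>s^k BM\<close> below and \<open>BM\<close> above. The growth of \<open>l(M/N0)\<close>
     under \<open>J\<close> is what bounds \<open>l(M/JM)\<close> by
     \<open>l(N0/J N0) = e\<close>.\<close>
   obtain k where k: "scale (s [^] (k::nat)) ?N <= M" using frac_comparable[OF fN M] .
   let ?N0 = "scale (s [^] k) ?N"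
   have fN0: "frac ?N0" using frac_scale[OF fN spow_unit] .
   have sN0: "smod B ?N0" using smod_scale[OF sN spow_closed BQ] .
   have fJ: "frac (J \<cdot> M)" "frac (J \<cdot> ?N0)" using frac_prod J M fN0 by auto
   have "len A (J \<cdot> M) (J \<cdot> ?N0) + len A M (J \<cdot> M) = len A M (J \<cdot> ?N0)"
    using frac_len_add[OF M fJ] Jsub[OF frac_smod[OF M]] prod_mono[of J J ?N0 M] k by (simp add: add.commute)
   also have "\<dots> = len A M ?N0 + len A ?N0 (J \<cdot> ?N0)"
    using frac_len_add[OF M fN0 fJ(2)] Jsub[OF frac_smod[OF fN0]] k by blast
   also have "\<dots> <= len A (J \<cdot> M) (J \<cdot> ?N0) + e"
    using growth[OF fN sN fN0 sN0 frac_smod[OF M] k MN] const[OF fN0 sN0] by (simp add: add_mono)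
   finally show ?thesis using enat_add_left_le_cancel len_finite[OF fJ] by blast
  qed
  show "\<exists>N. \<forall>n\<ge>N. len A (ipow J n \<cdot> M) (ipow J (Suc n) \<cdot> M) = e" if M: "frac M" for M
  proof (intro exI allI impI)
   fix n assume n: "n0 <= n"
   have "ipow J (Suc n) \<cdot> M = J \<cdot> (ipow J n \<cdot> M)"
    using prod_assoc[OF frac_carrier[OF J] cI frac_carrier[OF M]] by simp
   moreover have "smod B (ipow J n \<cdot> M)" using smod_prod2[OF sBI[OF n] frac_smod[OF M] BQ] .
   ultimately show "len A (ipow J n \<cdot> M) (ipow J (Suc n) \<cdot> M) = e"
    using const frac_prod frac_ipow J M by simp
  qed
 qed
qed

end

section \<open>A finite birational extension and its canonical module\<close>

locale overring = curve +
 fixes S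
 assumes S: "subring S Q" and AS: "A <= S" and frac_S: "frac S"
begin

lemma SQ: "S <= carrier Q" using subringE(1)[OF S] .
lemma one_S: "\<one> \<in> S" using subringE(3)[OF S] .
lemma smod_S: "smod S S" using smod_self[OF S] .

lemma smod_mult_right: "smod A X ==> x \<in> X ==> a \<in> A ==> x \<otimes> a \<in> X"
 using smodD(4,5)[of A X] A_closed m_comm by metis

lemma overring_curve: "curve Q S s" proof (intro curve.intro curve_axioms.intro)
 show "cring Q" by (rule is_cring)
 show "subring S Q" by (rule S)
 show "s \<in> S" using s_A AS by blast
 show "s \<in> Units Q" by (rule s_unit)
 show "\<exists>k::nat. s [^] k \<otimes> q \<in> S" if "q \<in> carrier Q" for q using denom[OF that] AS by blast
 show "\<exists>F. finite F \<and> F <= I \<and> (\<forall>X. smod S X \<and> F <= X --> I <= X)" if I: "smod S I" "I <= S" for I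
 proof -
  obtain F where F: "finite F" "F <= I" "\<And>X. smod A X ==> F <= X ==> I <= X"
   using finitely_gen[OF frac_S smod_subring[OF I(1) AS] I(2)] by blast
  have "I <= X" if "smod S X" "F <= X" for X using F(3)[OF smod_subring[OF that(1) AS] that(2)] .
  then show ?thesis using F(1,2) by blast
 qed
 \<comment> \<open>If \<open>s\<close> avoided \<open>n\<close>, it would be invertible modulo
   \<open>n\<close>; then \<open>S = n + sS\<close>, and Nakayama's lemma over \<open>A\<close>
   gives \<open>S = n\<close>.\<close>
 show "s \<in> n" if n: "maxl S n" for n proof (rule ccontr)
  assume "s \<notin> n"
  have sS: "s \<in> S" using s_A AS by blast
  obtain y c where y: "y \<in> n" "c \<in> S" "\<one> = y \<oplus> c \<otimes> s" using maxl_inverse[OF S n sS \<open>s \<notin> n\<close>] by blast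
  have sn: "smod S n" "n <= S" "n \<noteq> S" using n by (auto simp: maxl_def)
  have "S <= n \<boxplus> scale s S" proof
   fix x assume x: "x \<in> S"
   have cc: "x \<in> carrier Q" "y \<in> carrier Q" "c \<in> carrier Q" using x y sn SQ by auto
   have "x = (y \<oplus> c \<otimes> s) \<otimes> x" using y(3)[symmetric] cc by simp
   also have "\<dots> = x \<otimes> y \<oplus> s \<otimes> (c \<otimes> x)" using cc s_closed by algebra
   also have "\<dots> \<in> n \<boxplus> scale s S"
    using smodD(4)[OF sn(1) x y(1)] smodD(4)[OF smod_S y(2) x] by (intro set_addI scaleI)
   finally show "x \<in> n \<boxplus> scale s S" .
  qed
  then have "S = n"
   using nakayama[OF frac_S frac_smod[OF frac_S] order_refl smod_subring[OF sn(1) AS] sn(2)] by blast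
  then show False using sn by blast
 qed
 show "len S S (scale s S) \<noteq> \<infinity>"
  using len_subring[OF AS, of S "scale s S"] len_finite[OF frac_S frac_scale[OF frac_S s_unit]]
  by (metis enat_ord_simps(5))
qed

sublocale CS: curve Q S s by (rule overring_curve)

lemma CS_frac_iff: "CS.frac X \<longleftrightarrow> smod S X \<and> frac X" proof
 assume X: "CS.frac X"
 then have sX: "smod S X" by (rule CS.frac_smod)
 obtain k l where kl: "s [^] (k::nat) \<in> X" "scale (s [^] (l::nat)) X <= S" using X unfolding CS.frac_def by blast
 obtain j where "scale (s [^] (j::nat)) S <= A" using frac_S unfolding frac_def by blast
 then have "scale (s [^] j) (scale (s [^] l) X) <= A" using kl(2) scale_mono by blast
 then have "scale (s [^] (j + l)) X <= A"
  using smodD(1)[OF sX] s_closed by (simp add: scale_scale nat_pow_mult)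
 then show "smod S X \<and> frac X" using sX smod_subring[OF sX AS] kl unfolding frac_def by blast
next
 assume X: "smod S X \<and> frac X"
 then show "CS.frac X" using AS unfolding CS.frac_def frac_def by (meson order_trans)
qed

lemma prod_S: "smod S X ==> S \<cdot> X = X" using prod_one[OF _ one_S SQ] .

lemma smod_S_prod: "frac X ==> frac Y ==> smod S Y ==> smod S (X \<cdot> Y)"
 using smod_prod2[of S Y A X] frac_smod SQ prod_comm frac_carrier by metis

context
 fixes W assumes W: "dualizing W"
begin

lemma frac_W: "frac W" using W by (simp add: dualizing_def)

text \<open>\<open>W : A = W\<close>, and \<open>A\<close> is its own double dual.\<close>

lemma colon_W_W: "colon W W = A" proof -
 have "colon W A = W" proof
  show "colon W A <= W" using one_A by (auto simp: colon_def dest: bspec[of _ _ \<one>])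
  show "W <= colon W A"
   using smodD(5)[OF frac_smod[OF frac_W]] smod_mult_right[OF frac_smod[OF frac_W]] by (auto simp: colon_def)
 qed
 then show ?thesis using double_dual[OF W frac_A] by simp
qed

lemma smod_S_dual: "smod S X ==> smod S (colon W X)"
 using smod_colon'[OF _ frac_smod[OF frac_W] SQ] .

lemma frac_dual: "frac X ==> frac (colon W X)" using frac_colon frac_W by blast

text \<open>The map from \<open>T\<close> to \<open>W : uT\<close> reverses inclusions and takes the
  modules between \<open>S\<close> and \<open>S : n\<close> to ideals between \<open>n\<close> and
  \<open>S\<close>, where only the two ends exist.\<close>

lemma principal_gorenstein:
 assumes u: "u \<in> Units Q" and K: "colon W S = scale u S" shows "CS.dualizing S" unfolding CS.dualizing_def
proof (intro conjI allI impI, rule CS.frac_A)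
 fix n T assume n: "maxl S n" and T: "smod S T \<and> S <= T \<and> T <= colon S n"
 have fn: "frac n" "smod S n" using CS.maxl_frac[OF n] CS_frac_iff by auto
 have cn: "n <= carrier Q" using frac_carrier fn by blast
 have "scale u (colon S n) = colon (colon W S) n" using colon_scale_left[OF u SQ cn] K by simp
 also have "\<dots> = colon W n" using colon_prod[OF frac_smod[OF frac_W] SQ cn] prod_S[OF fn(2)] by simp
 finally have un: "scale u (colon S n) = colon W n" .
 have Tc: "T <= carrier Q" using T smodD(1) by blast
 let ?T = "scale u T"
 have sT: "smod S ?T" using smod_scale T u SQ by blast
 have KT: "colon W S <= ?T" "?T <= colon W n" using T scale_mono un K by metis+
 have fT: "frac ?T"
  using frac_between[OF frac_dual[OF frac_S] frac_dual[OF fn(1)] smod_subring[OF sT AS] KT] .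
 have "n <= colon W ?T" using colon_antimono[OF KT(2), of W] double_dual[OF W fn(1)] by simp
 moreover have "colon W ?T <= S" using colon_antimono[OF KT(1), of W] double_dual[OF W frac_S] by simp
 moreover have "smod S (colon W ?T)" using smod_S_dual[OF sT] .
 ultimately have "colon W ?T = n \<or> colon W ?T = S" using n unfolding maxl_def by blast
 then have "?T = colon W n \<or> ?T = colon W S" using double_dual[OF W fT] by metis
 then have "?T = scale u (colon S n) \<or> ?T = scale u S" using un K by simp
 moreover have "colon S n <= carrier Q" unfolding colon_def by blast
 ultimately show "T = S \<or> T = colon S n" using scale_inv(2)[OF _ u] Tc SQ by metis
qed

text \<open>With \<open>L = S : K\<close>, duality over \<open>S\<close> gives
  \<open>S : LK = (S : L) : K = K : K\<close>, which is \<open>W : K = S\<close> by duality over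
  \<open>A\<close>. Hence \<open>LK = S\<close>, and an invertible module over the semilocal ring
  \<open>S\<close> is principal.\<close>

lemma gorenstein_principal:
 assumes G: "CS.dualizing S"
 obtains u where "u \<in> Units Q" "colon W S = scale u S" proof -
 let ?K = "colon W S"
 have fK: "frac ?K" "smod S ?K" using frac_dual[OF frac_S] smod_S_dual[OF smod_S] by auto
 have cK: "?K <= carrier Q" using frac_carrier fK by blast
 let ?L = "colon S ?K"
 have CK: "CS.frac ?K" using CS_frac_iff fK by blast
 have CL: "CS.frac ?L" using CS.frac_colon[OF CS.frac_A CK] .
 have cL: "?L <= carrier Q" using CS.frac_carrier CL by blast
 have CP: "CS.frac (?L \<cdot> ?K)" using CS.frac_prod[OF CL CK] .
 have "colon S (?L \<cdot> ?K) = colon (colon S ?L) ?K" using colon_prod[OF smod_S cL cK] .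
 also have "colon S ?L = ?K" using CS.double_dual[OF G CK] .
 also have "colon ?K ?K = colon W (S \<cdot> ?K)" using colon_prod[OF frac_smod[OF frac_W] SQ cK] by simp
 also have "\<dots> = S" using prod_S[OF fK(2)] double_dual[OF W frac_S] by simp
 finally have "colon S (?L \<cdot> ?K) = S" .
 moreover have "colon S S = S"
  using smodD(4)[OF smod_S] SQ one_S by (auto simp: colon_def dest: bspec[of _ _ \<one>])
 ultimately have "?L \<cdot> ?K = S" using CS.double_dual[OF G CP] by simp
 then have "?K \<cdot> ?L = S" using prod_comm[OF cK cL] by simp
 then obtain u where "u \<in> Units Q" "?K = scale u S"
  using CS.invertible_principal[OF CK CS.frac_smod[OF CL]] by blast
 then show thesis using that by blast
qed

text \<open>The length condition \<open>e_J(M) = len (M / J M)\<close> defining Ulrich modules.\<close>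

definition ulr :: "'a set => 'a set => bool" where
 "ulr J M \<longleftrightarrow> (\<exists>N. \<forall>n\<ge>N. len A (ipow J n \<cdot> M) (ipow J (Suc n) \<cdot> M) = len A M (J \<cdot> M))"

text \<open>\<open>J^n M = q^n M\<close>, so all the quotients are copies of
  \<open>M/JM\<close>.\<close>

lemma ulr_if_scale:
 assumes J: "frac J" and M: "frac M" and q: "q \<in> Units Q" and JM: "J \<cdot> M = scale q M"
 shows "ulr J M" proof -
 have qc: "q \<in> carrier Q" using q by (rule Units_closed)
 have pw: "ipow J n \<cdot> M = scale (q [^] n) M" for n :: nat proof (induction n)
  case 0
  then show ?case using prod_one[OF frac_smod[OF M] one_A AQ] scale_one[OF frac_carrier[OF M]] by simp
 next
  case (Suc n)
  have "ipow J (Suc n) \<cdot> M = J \<cdot> scale (q [^] n) M"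
   using Suc prod_assoc[OF frac_carrier[OF J] frac_carrier[OF frac_ipow[OF J]] frac_carrier[OF M]] by simp
  also have "\<dots> = scale (q [^] n) (J \<cdot> M)" proof -
   have "smod A (scale (q [^] n) M)" using smod_scale[OF frac_smod[OF M] _ AQ] qc by simp
   then have "J \<cdot> scale (q [^] n) M = scale (q [^] n) M \<cdot> J"
    using prod_comm[OF frac_carrier[OF J]] smodD(1) by blast
   also have "\<dots> = scale (q [^] n) (M \<cdot> J)"
    using scale_prod[OF frac_carrier[OF M] frac_carrier[OF J]] qc by simp
   finally show ?thesis using prod_comm[OF frac_carrier[OF M] frac_carrier[OF J]] by simp
  qed
  also have "\<dots> = scale (q [^] Suc n) M" using JM scale_scale[OF frac_carrier[OF M]] qc by simp
  finally show ?case .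
 qed
 have "len A (ipow J n \<cdot> M) (ipow J (Suc n) \<cdot> M) = len A M (J \<cdot> M)" for n proof -
  have "scale (q [^] Suc n) M = scale (q [^] n) (scale q M)"
   using scale_scale[OF frac_carrier[OF M]] qc by simp
  then show ?thesis unfolding pw JM
   using len_scale[OF frac_smod[OF M] frac_smod[OF frac_scale[OF M q]] pow_unit[OF q] AQ] by simp
 qed
 then show ?thesis unfolding ulr_def by blast
qed

text \<open>The multiplicity is the same for all fractional ideals and bounds
  \<open>l(M'/JM')\<close>; the module \<open>M\<close> attains it.\<close>

lemma ulr_bound:
 assumes J: "frac J" "J <= A" and M: "frac M" "ulr J M" and M': "frac M'"
 shows "len A M' (J \<cdot> M') <= len A M (J \<cdot> M)" proof -
 obtain e where e: "\<And>M. frac M ==> len A M (J \<cdot> M) <= e"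
  "\<And>M. frac M ==> \<exists>N. \<forall>n\<ge>N. len A (ipow J n \<cdot> M) (ipow J (Suc n) \<cdot> M) = e"
  using multiplicity_exists[OF J] by metis
 obtain N1 where N1: "\<forall>n\<ge>N1. len A (ipow J n \<cdot> M) (ipow J (Suc n) \<cdot> M) = e" using e(2)[OF M(1)] by blast
 obtain N2 where N2: "\<forall>n\<ge>N2. len A (ipow J n \<cdot> M) (ipow J (Suc n) \<cdot> M) = len A M (J \<cdot> M)"
  using M(2) unfolding ulr_def by blast
 have "e = len A M (J \<cdot> M)" using N1[rule_format, of "max N1 N2"] N2[rule_format, of "max N1 N2"] by simp
 then show ?thesis using e(1)[OF M'] by simp
qed

context
 fixes I assumes I: "I = colon A S" and refl: "colon A I = S" and WA: "W <= A"
begin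

lemma frac_I: "frac I" "smod S I" "I <= A" proof -
 show "frac I" unfolding I using frac_colon[OF frac_A frac_S] .
 show "smod S I" unfolding I using smod_colon'[OF smod_S smod_A SQ] .
 show "I <= A" unfolding I colon_def using one_S by (auto dest: bspec[of _ _ \<one>])
qed

lemma W_prod_I: "W \<cdot> I = colon W S" proof -
 have "colon W (W \<cdot> I) = S"
  using colon_prod[OF frac_smod[OF frac_W] frac_carrier[OF frac_W] frac_carrier[OF frac_I(1)]]
   colon_W_W refl by simp
 then show ?thesis using double_dual[OF W frac_prod[OF frac_W frac_I(1)]] by metis
qed

text \<open>\<open>Y\<close> is only an \<open>A\<close>-module; \<open>SY\<close> has the same
  product with \<open>I\<close> and is an inverse of \<open>I\<close> over \<open>S\<close>.\<close>

lemma I_principal_if_invertible: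
 assumes "frac Y" "I \<cdot> Y = S"
 obtains v where "v \<in> Units Q" "I = scale v S" proof -
 have c: "I <= carrier Q" "Y <= carrier Q" using frac_carrier frac_I assms by auto
 have "I \<cdot> (S \<cdot> Y) = I \<cdot> Y"
  using prod_assoc[OF c(1) SQ c(2)] prod_comm[OF c(1) SQ] prod_S[OF frac_I(2)] by simp
 moreover have "smod S (S \<cdot> Y)" using smod_prod2[OF smod_S frac_smod[OF assms(1)] SQ] .
 ultimately show thesis
  using CS.invertible_principal[of I "S \<cdot> Y"] frac_I CS_frac_iff assms(2) that by metis
qed

text \<open>From \<open>WI = uS\<close> the module \<open>u^-1 W\<close> is an inverse of
  \<open>I\<close>. Then \<open>I = vS\<close>, so that \<open>I^2 = vI\<close> and
  \<open>WI = uS = u v^-1 I\<close>.\<close>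

lemma gorenstein_imp_scale:
 assumes G: "CS.dualizing S"
 shows "\<exists>q\<in>Units Q. I \<cdot> I = scale q I" "\<exists>q\<in>Units Q. W \<cdot> I = scale q I"
proof -
 obtain u where u: "u \<in> Units Q" "colon W S = scale u S" using gorenstein_principal[OF G] by blast
 have uc: "u \<in> carrier Q" "inv u \<in> carrier Q" "inv u \<in> Units Q" using u by auto
 have cI: "I <= carrier Q" "W <= carrier Q" using frac_carrier frac_I frac_W by auto
 have fY: "frac (scale (inv u) W)" using frac_scale[OF frac_W uc(3)] .
 have "I \<cdot> scale (inv u) W = scale (inv u) (W \<cdot> I)"
  using prod_comm[OF cI(1) frac_carrier[OF fY]] scale_prod[OF cI(2,1) uc(2)] by simp
 also have "\<dots> = S" using W_prod_I u scale_inv(2)[OF SQ u(1)] by simp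
 finally obtain v where v: "v \<in> Units Q" "I = scale v S" using I_principal_if_invertible[OF fY] by blast
 have vc: "v \<in> carrier Q" "inv v \<in> Units Q" "inv v \<in> carrier Q" using v by auto
 have "I \<cdot> I = scale v (S \<cdot> I)" using scale_prod[OF SQ cI(1) vc(1)] v(2) by simp
 then show "\<exists>q\<in>Units Q. I \<cdot> I = scale q I" using prod_S[OF frac_I(2)] v(1) by auto
 have "scale (u \<otimes> inv v) I = scale u (scale (inv v) I)" using scale_scale[OF cI(1) uc(1) vc(3)] by simp
 also have "scale (inv v) I = S" using v scale_inv(2)[OF SQ v(1)] by simp
 also have "scale u S = W \<cdot> I" using W_prod_I u by simp
 finally show "\<exists>q\<in>Units Q. W \<cdot> I = scale q I" using Units_m_closed[OF u(1) vc(2)] by metis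
qed

text \<open>Duality turns \<open>l(I/WI)\<close> into \<open>l(S/D)\<close> with
  \<open>D = W : I\<close>, and \<open>l(I/I^2)\<close> into \<open>l(T/D)\<close> with
  \<open>T = D : I\<close>. By \<open>ulr_bound\<close> these numbers also bound lengths attached to
  \<open>S\<close>, to maximal ideals of \<open>S\<close> and to \<open>T\<close>; each time the
  bound leaves no room in an inclusion.\<close>

lemma ulrich_imp_gorenstein:
 assumes UI: "ulr I I" and UW: "ulr W I" shows "CS.dualizing S" proof -
 note cW = frac_carrier[OF frac_W] and cI = frac_carrier[OF frac_I(1)]
 note sW = frac_smod[OF frac_W]
 let ?D = "colon W I"
 have fD: "frac ?D" "smod S ?D" using frac_dual frac_I smod_S_dual by auto
 note cD = frac_carrier[OF fD(1)]
 have fWS: "frac (W \<cdot> S)" "smod S (W \<cdot> S)" using frac_prod[OF frac_W frac_S] smod_S_prod[OF frac_W frac_S smod_S] by auto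
 have Wsub: "W \<cdot> X <= X" if X: "smod A X" for X
  by (rule ideal_prod_minimal) (use smodD[OF X] WA in auto)
 have Isub: "I \<cdot> X <= X" if X: "smod A X" for X
  by (rule ideal_prod_minimal) (use smodD[OF X] frac_I(3) in auto)
 have WSD: "W \<cdot> S <= ?D" proof -
  have "W \<cdot> S \<cdot> I = W \<cdot> I" using prod_assoc[OF cW SQ cI] prod_S[OF frac_I(2)] by simp
  also have "\<dots> <= W"
   by (rule ideal_prod_minimal) (use smodD(3)[OF sW] smod_mult_right[OF sW] frac_I(3) in auto)
  finally show ?thesis using prod_subset_iff_colon[OF sW cI frac_carrier[OF fWS(1)]] by blast
 qed
 have dWI: "colon W (W \<cdot> I) = S" using W_prod_I double_dual[OF W frac_S] by simp
 have DS: "?D <= S" using colon_antimono[OF Wsub[OF frac_smod[OF frac_I(1)]], of W] dWI by simp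
 have l1: "len A I (W \<cdot> I) = len A S ?D"
  using dual_len[OF W frac_I(1) frac_prod[OF frac_W frac_I(1)] Wsub[OF frac_smod[OF frac_I(1)]]] dWI by simp
 \<comment> \<open>\<open>WS <= D <= S\<close>, and the Ulrich condition for \<open>W\<close> bounds
   \<open>l(S/WS)\<close> by \<open>l(I/WI) = l(S/D)\<close>.\<close>
 have D: "?D = W \<cdot> S" proof -
  have "len A S (W \<cdot> S) <= len A S ?D" using ulr_bound[OF frac_W WA frac_I(1) UW frac_S] l1 by simp
  moreover have "len A S (W \<cdot> S) = len A S ?D + len A ?D (W \<cdot> S)"
   using frac_len_add[OF frac_S fD(1) fWS(1) WSD DS] .
  ultimately have "len A ?D (W \<cdot> S) = 0"
   using len_finite[OF frac_S fD(1)] by (cases "len A S ?D"; cases "len A ?D (W \<cdot> S)") (auto simp: zero_enat_def)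
  then show ?thesis using len_eq_0[OF frac_smod[OF fD(1)] frac_smod[OF fWS(1)] WSD] by blast
 qed
 have e_W: "len A M (W \<cdot> M) <= len A S (W \<cdot> S)" if "frac M" for M
  using ulr_bound[OF frac_W WA frac_I(1) UW that] l1 D by simp
 \<comment> \<open>\<open>D/nD\<close> is cyclic. Here \<open>nD = Wn\<close>, and for
   \<open>w\<close> in \<open>D\<close> outside it \<open>S/n\<close> embeds in
   \<open>(wS + Wn)/Wn\<close>. Computing \<open>l(S/Wn)\<close> once through \<open>n\<close> and
   once through \<open>D\<close>, with \<open>l(n/Wn) <= l(S/D)\<close>, leaves length zero for
   \<open>D/(wS + Wn)\<close>.\<close>
 have "\<exists>w\<in>?D. ?D <= scale w S \<boxplus> n \<cdot> ?D" if n: "maxl S n" for n proof -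
  have fn: "frac n" "smod S n" "n <= S" using CS.maxl_frac[OF n] CS_frac_iff n by (auto simp: maxl_def)
  note cn = frac_carrier[OF fn(1)]
  have nD: "n \<cdot> ?D = W \<cdot> n"
   using D prod_comm[OF cn frac_carrier[OF fWS(1)]] prod_assoc[OF cW SQ cn] prod_S[OF fn(2)] by simp
  have fWn: "frac (W \<cdot> n)" "smod S (W \<cdot> n)" using frac_prod[OF frac_W fn(1)] smod_S_prod[OF frac_W fn(1,2)] by auto
  have WnD: "W \<cdot> n <= ?D" using prod_mono[of W W n S] fn(3) D by simp
  show ?thesis proof (cases "?D = W \<cdot> n")
   case True
   have z: "\<zero> \<in> ?D" using smodD(2)[OF fD(2)] .
   have "?D <= scale \<zero> S \<boxplus> n \<cdot> ?D"
    using set_add_upper(2)[OF smod_cyclic(1)[OF S zero_closed] fWn(2)] True nD by simp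
   then show ?thesis using z by blast
  next
   case False
   then obtain w where w: "w \<in> ?D" "w \<notin> W \<cdot> n" using WnD by blast
   have wc: "w \<in> carrier Q" using w cD by blast
   have inj: "x \<in> n" if x: "x \<in> S" "w \<otimes> x \<in> W \<cdot> n" for x proof (rule ccontr)
    assume "x \<notin> n"
    then obtain y c where y: "y \<in> n" "c \<in> S" "\<one> = y \<oplus> c \<otimes> x" using maxl_inverse[OF S n x(1)] by blast
    have cc: "x \<in> carrier Q" "y \<in> carrier Q" "c \<in> carrier Q" using x y cn SQ by auto
    have "w = (y \<oplus> c \<otimes> x) \<otimes> w" using y(3)[symmetric] wc by simp
    also have "\<dots> = y \<otimes> w \<oplus> c \<otimes> (w \<otimes> x)" using cc wc by algebra
    also have "\<dots> \<in> W \<cdot> n" proof -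
     have "y \<otimes> w \<in> W \<cdot> n" using prod_incl[OF y(1) w(1)] nD by simp
     then show ?thesis using smodD(3,4)[OF fWn(2)] x(2) y(2) by blast
    qed
    finally show False using w by blast
   qed
   have sw: "smod A (scale w S)" using smod_scale[OF frac_smod[OF frac_S] wc AQ] .
   let ?T = "scale w S \<boxplus> W \<cdot> n"
   have sT: "smod A ?T" using smod_add[OF sw frac_smod[OF fWn(1)] AQ] .
   have TD: "?T <= ?D" using set_add_least[OF fD(2)] cyclic_least[OF S fD(2) w(1)] WnD by blast
   have WnT: "W \<cdot> n <= ?T" using set_add_upper(2)[OF sw frac_smod[OF fWn(1)]] .
   have fT: "frac ?T" using frac_between[OF fWn(1) fD(1) sT WnT TD] .
   have 1: "len A S n <= len A ?T (W \<cdot> n)"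
    using len_mult_inj[OF A frac_smod[OF frac_S] frac_smod[OF fn(1)] frac_smod[OF fWn(1)] wc fn(3)] inj by blast
   have "len A S n + len A n (W \<cdot> n) = len A S (W \<cdot> n)"
    using frac_len_add[OF frac_S fn(1) fWn(1)] Wsub[OF frac_smod[OF fn(1)]] fn(3) by simp
   also have "\<dots> = len A S ?D + len A ?D (W \<cdot> n)" using frac_len_add[OF frac_S fD(1) fWn(1) WnD DS] .
   also have "len A ?D (W \<cdot> n) = len A ?D ?T + len A ?T (W \<cdot> n)"
    using frac_len_add[OF fD(1) fT fWn(1) WnT TD] .
   finally have eq: "len A S n + len A n (W \<cdot> n) = len A S ?D + (len A ?D ?T + len A ?T (W \<cdot> n))" .
   have 2: "len A n (W \<cdot> n) <= len A S ?D" using e_W[OF fn(1)] D by simp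
   obtain l1 l2 l3 l4 l5 where
    "len A S n = enat l1" "len A n (W \<cdot> n) = enat l2" "len A S ?D = enat l3"
    "len A ?D ?T = enat l4" "len A ?T (W \<cdot> n) = enat l5"
    using len_finite frac_S fn(1) fWn(1) fD(1) fT by (metis not_enat_eq)
   then have "len A ?D ?T = 0" using eq 1 2 by (simp add: zero_enat_def)
   then have "?D = ?T" using len_eq_0[OF frac_smod[OF fD(1)] sT TD] by blast
   then show ?thesis using w nD by auto
  qed
 qed
 then obtain w where w: "w \<in> Units Q" "?D = scale w S"
  using CS.locally_cyclic_principal[of ?D] fD CS_frac_iff by metis
 have wc: "w \<in> carrier Q" "inv w \<in> Units Q" using w by auto
 \<comment> \<open>Dualizing \<open>D = wS\<close> gives \<open>I = w^-1 (W : S)\<close>; it remains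
   to see that \<open>I\<close> is principal over \<open>S\<close>.\<close>
 have K: "colon W S = scale w I" proof -
  have "I = colon W ?D" using double_dual[OF W frac_I(1)] by simp
  also have "\<dots> = scale (inv w) (colon W S)" using w colon_scale[OF w(1) cW SQ] by simp
  finally show ?thesis using scale_inv(1)[OF frac_carrier[OF frac_dual[OF frac_S]] w(1)] by simp
 qed
 let ?T = "colon ?D I"
 have fT: "frac ?T" "smod A ?T" using frac_colon[OF fD(1) frac_I(1)] frac_smod by auto
 have fII: "frac (I \<cdot> I)" using frac_prod frac_I by blast
 have ITD: "I \<cdot> ?T <= ?D"
  using prod_subset_iff_colon[OF fD(2) cI frac_carrier[OF fT(1)]] prod_comm[OF cI frac_carrier[OF fT(1)]] by simp
 have DT: "?D <= ?T"
  using prod_subset_iff_colon[OF fD(2) cI cD] prod_comm[OF cI cD] Isub[OF frac_smod[OF fD(1)]] by simp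
 have dII: "colon W (I \<cdot> I) = ?T" using colon_prod[OF sW cI cI] .
 have "len A I (I \<cdot> I) = len A ?T ?D"
  using dual_len[OF W frac_I(1) fII Isub[OF frac_smod[OF frac_I(1)]]] dII by simp
 \<comment> \<open>\<open>IT <= D <= T\<close>, and the Ulrich condition for \<open>I\<close> bounds
   \<open>l(T/IT)\<close> by \<open>l(I/I^2) = l(T/D)\<close>. So \<open>IT = D\<close>, which says
   \<open>I(S : I) = S\<close> because \<open>T = w(S : I)\<close>.\<close>
 then have le: "len A ?T (I \<cdot> ?T) <= len A ?T ?D" using ulr_bound[OF frac_I(1,3,1) UI fT(1)] by simp
 have fIT: "frac (I \<cdot> ?T)" using frac_prod frac_I fT by blast
 have "len A ?T (I \<cdot> ?T) = len A ?T ?D + len A ?D (I \<cdot> ?T)"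
  using frac_len_add[OF fT(1) fD(1) fIT ITD DT] .
 then have "len A ?D (I \<cdot> ?T) = 0"
  using le len_finite[OF fT(1) fD(1)] by (cases "len A ?T ?D"; cases "len A ?D (I \<cdot> ?T)") (auto simp: zero_enat_def)
 then have IT: "I \<cdot> ?T = ?D" using len_eq_0[OF frac_smod[OF fD(1)] frac_smod[OF fIT] ITD] by blast
 let ?L = "colon S I"
 have fL: "frac ?L" using frac_colon[OF frac_S frac_I(1)] .
 have "?T = scale w ?L" using w(2) colon_scale_left[OF w(1) SQ cI] by simp
 then have "I \<cdot> ?T = scale w (I \<cdot> ?L)"
  using prod_comm[OF cI] scale_prod[OF frac_carrier[OF fL] cI wc(1)] frac_carrier[OF fT(1)] frac_carrier[OF fL] by simp
 then have "scale w (I \<cdot> ?L) = scale w S" using IT w by simp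
 then have "I \<cdot> ?L = S"
  using scale_inv(2)[OF _ w(1)] SQ frac_carrier[OF frac_prod[OF frac_I(1) fL]] by metis
 then obtain v where v: "v \<in> Units Q" "I = scale v S" using I_principal_if_invertible[OF fL] by blast
 then have "colon W S = scale (w \<otimes> v) S" using K scale_scale[OF SQ wc(1)] Units_closed by simp
 then show ?thesis using principal_gorenstein[of "w \<otimes> v"] Units_m_closed[OF w(1) v(1)] by blast
qed

end
end
end

subsection \<open>Quotient modules\<close>

locale plain_module = module R M
 for R :: "('a, 'm) ring_scheme" (structure) and M :: "('a, 'b) module" (structure)
begin

lemma submodule_iff:
 "submodule H R M \<longleftrightarrow> H <= carrier M \<and> \<zero>\<^bsub>M\<^esub> \<in> H \<and> (\<forall>x\<in>H. \<forall>y\<in>H. x \<oplus>\<^bsub>M\<^esub> y \<in> H) \<and>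
   (\<forall>r\<in>carrier R. \<forall>x\<in>H. r \<odot>\<^bsub>M\<^esub> x \<in> H)" (is "?L = ?R") proof
 assume ?L
 then have "\<zero>\<^bsub>M\<^esub> \<in> H" using subgroup.one_closed[OF submodule.axioms(1)] by fastforce
 then show ?R using submoduleE[OF \<open>?L\<close>] by blast
next
 assume r: ?R
 show ?L proof (rule submoduleI)
  fix a assume a: "a \<in> H"
  have "\<ominus>\<^bsub>R\<^esub> \<one>\<^bsub>R\<^esub> \<odot>\<^bsub>M\<^esub> a \<in> H" using r a by blast
  moreover have "\<ominus>\<^bsub>R\<^esub> \<one>\<^bsub>R\<^esub> \<odot>\<^bsub>M\<^esub> a = \<ominus>\<^bsub>M\<^esub> a"
   using r a smult_l_minus[of "\<one>\<^bsub>R\<^esub>" a] by (auto simp: subset_iff)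
  ultimately show "\<ominus>\<^bsub>M\<^esub> a \<in> H" by simp
 qed (use r in blast)+
qed

lemma submodule_minus:
 assumes "submodule H R M" "x \<in> H" "y \<in> H" shows "x \<ominus>\<^bsub>M\<^esub> y \<in> H"
 using submoduleE(3,5)[OF assms(1)] assms by (simp add: a_minus_def)

lemma submodule_abelian_subgroup:
 assumes "submodule N R M" shows "abelian_subgroup N M"
 using abelian_subgroupI3[of N M] submodule.axioms(1)[OF assms] M.abelian_group_axioms
 by (simp add: additive_subgroup_def)

context
 fixes N assumes N: "submodule N R M"
begin

interpretation N: abelian_subgroup N M by (rule submodule_abelian_subgroup[OF N])

lemma coset_eq_iff:
 assumes "x \<in> carrier M" "y \<in> carrier M"
 shows "N +>\<^bsub>M\<^esub> x = N +>\<^bsub>M\<^esub> y \<longleftrightarrow> x \<ominus>\<^bsub>M\<^esub> y \<in> N"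
 using N.a_rcos_module[OF assms(2,1)] N.a_repr_independence'[OF _ assms(2)] N.a_rcos_self[OF assms(1)]
 unfolding a_minus_def by metis

lemma coset_eq_N_iff: "x \<in> carrier M ==> N +>\<^bsub>M\<^esub> x = N \<longleftrightarrow> x \<in> N"
proof -
 assume x: "x \<in> carrier M"
 have "\<ominus>\<^bsub>M\<^esub> \<zero>\<^bsub>M\<^esub> = \<zero>\<^bsub>M\<^esub>" by (rule M.minus_equality) auto
 then show ?thesis using coset_eq_iff[of x "\<zero>\<^bsub>M\<^esub>"] M.a_coset_add_zero[OF N.a_subset] x
  \<open>\<ominus>\<^bsub>M\<^esub> \<zero>\<^bsub>M\<^esub> = \<zero>\<^bsub>M\<^esub>\<close> by (simp add: a_minus_def)
qed

lemma quot_carrier: "carrier (quot_module R M N) = {N +>\<^bsub>M\<^esub> x | x. x \<in> carrier M}"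
 unfolding quot_module_def A_RCOSETS_def' by auto

lemma quot_add:
 assumes "x \<in> carrier M" "y \<in> carrier M"
 shows "(N +>\<^bsub>M\<^esub> x) \<oplus>\<^bsub>quot_module R M N\<^esub> (N +>\<^bsub>M\<^esub> y) = N +>\<^bsub>M\<^esub> (x \<oplus>\<^bsub>M\<^esub> y)"
 using N.a_rcos_sum[OF assms] by (simp add: quot_module_def)

lemma quot_smult:
 assumes "r \<in> carrier R" "x \<in> carrier M"
 shows "r \<odot>\<^bsub>quot_module R M N\<^esub> (N +>\<^bsub>M\<^esub> x) = N +>\<^bsub>M\<^esub> (r \<odot>\<^bsub>M\<^esub> x)"
proof -
 have "N +>\<^bsub>M\<^esub> (r \<odot>\<^bsub>M\<^esub> y) = N +>\<^bsub>M\<^esub> (r \<odot>\<^bsub>M\<^esub> x)" if y: "y \<in> N +>\<^bsub>M\<^esub> x" for y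
 proof -
  have yc: "y \<in> carrier M" using N.a_elemrcos_carrier[OF assms(2) y] .
  have "y \<ominus>\<^bsub>M\<^esub> x \<in> N" using N.a_rcos_module_imp[OF assms(2) y] by (simp add: a_minus_def)
  then have "r \<odot>\<^bsub>M\<^esub> (y \<ominus>\<^bsub>M\<^esub> x) \<in> N" using submodule.smult_closed[OF N assms(1)] by blast
  moreover have "r \<odot>\<^bsub>M\<^esub> (y \<ominus>\<^bsub>M\<^esub> x) = r \<odot>\<^bsub>M\<^esub> y \<ominus>\<^bsub>M\<^esub> r \<odot>\<^bsub>M\<^esub> x"
   using assms yc by (simp add: a_minus_def smult_r_distr smult_r_minus)
  ultimately show ?thesis using coset_eq_iff assms yc by simp
 qed
 then have "(\<Union>y\<in>N +>\<^bsub>M\<^esub> x. N +>\<^bsub>M\<^esub> (r \<odot>\<^bsub>M\<^esub> y)) = (\<Union>y\<in>N +>\<^bsub>M\<^esub> x. N +>\<^bsub>M\<^esub> (r \<odot>\<^bsub>M\<^esub> x))"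
  by (rule SUP_cong[OF refl])
 moreover have "x \<in> N +>\<^bsub>M\<^esub> x" using N.a_rcos_self[OF assms(2)] .
 ultimately show ?thesis unfolding quot_module_def by auto
qed

lemma quot_zero: "\<zero>\<^bsub>quot_module R M N\<^esub> = N" by (simp add: quot_module_def)

lemma module_quot: "module R (quot_module R M N)" proof (rule moduleI)
 show "cring R" by (rule R.is_cring)
 have z: "N = N +>\<^bsub>M\<^esub> \<zero>\<^bsub>M\<^esub>" using coset_eq_N_iff[of "\<zero>\<^bsub>M\<^esub>"] by simp
 show "abelian_group (quot_module R M N)" proof (rule abelian_groupI)
  show "\<zero>\<^bsub>quot_module R M N\<^esub> \<in> carrier (quot_module R M N)"
   unfolding quot_zero quot_carrier using z by blast
  show "\<zero>\<^bsub>quot_module R M N\<^esub> \<oplus>\<^bsub>quot_module R M N\<^esub> X = X" if X: "X \<in> carrier (quot_module R M N)" for X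
  proof -
   obtain x where x: "x \<in> carrier M" "X = N +>\<^bsub>M\<^esub> x" using X unfolding quot_carrier by blast
   then show ?thesis unfolding quot_zero using quot_add[of "\<zero>\<^bsub>M\<^esub>" x] z by simp
  qed
  show "\<exists>Y\<in>carrier (quot_module R M N). Y \<oplus>\<^bsub>quot_module R M N\<^esub> X = \<zero>\<^bsub>quot_module R M N\<^esub>"
   if X: "X \<in> carrier (quot_module R M N)" for X proof -
   obtain x where x: "x \<in> carrier M" "X = N +>\<^bsub>M\<^esub> x" using X unfolding quot_carrier by blast
   have "(N +>\<^bsub>M\<^esub> (\<ominus>\<^bsub>M\<^esub> x)) \<oplus>\<^bsub>quot_module R M N\<^esub> X = N"
    using x quot_add[of "\<ominus>\<^bsub>M\<^esub> x" x] z by (simp add: M.l_neg)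
   moreover have "N +>\<^bsub>M\<^esub> (\<ominus>\<^bsub>M\<^esub> x) \<in> carrier (quot_module R M N)" unfolding quot_carrier using x by blast
   ultimately show ?thesis unfolding quot_zero by blast
  qed
 qed (auto simp: quot_carrier quot_add M.a_ac)
qed (auto simp: quot_carrier quot_add quot_smult smult_l_distr smult_r_distr smult_assoc1)

text \<open>The correspondence theorem: image and preimage are strictly monotone. It connects
  \<open>module_length\<close> of a quotient with lengths of intervals of submodules.\<close>

lemma module_length_quot:
 "module_length R (quot_module R M N) = clen {T. submodule T R M \<and> N <= T}" proof -
 interpret quo: plain_module R "quot_module R M N" by (rule plain_module.intro[OF module_quot])
 let ?c = "\<lambda>x. N +>\<^bsub>M\<^esub> x"
 have eq: "module_length R (quot_module R M N) = clen {X. submodule X R (quot_module R M N)}"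
  unfolding module_length_def clen_def by simp
 show ?thesis unfolding eq proof (rule antisym)
  show "clen {X. submodule X R (quot_module R M N)} <= clen {T. submodule T R M \<and> N <= T}"
  proof (rule clen_map[where \<Phi> = "\<lambda>X. {x \<in> carrier M. ?c x \<in> X}"])
   fix X assume "X \<in> {X. submodule X R (quot_module R M N)}"
   then have X: "X <= carrier (quot_module R M N)" "N \<in> X"
    "\<And>x y. x \<in> X ==> y \<in> X ==> x \<oplus>\<^bsub>quot_module R M N\<^esub> y \<in> X"
    "\<And>r x. r \<in> carrier R ==> x \<in> X ==> r \<odot>\<^bsub>quot_module R M N\<^esub> x \<in> X"
    unfolding quo.submodule_iff quot_zero by auto
   have NX: "?c x \<in> X" if "x \<in> N" for x
    using X(2) N.a_subset coset_eq_N_iff[of x] that by (auto simp: subset_iff)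
   then have "submodule {x \<in> carrier M. ?c x \<in> X} R M"
    unfolding submodule_iff using X(2-4) by (auto simp flip: quot_add quot_smult)
   moreover have "N <= {x \<in> carrier M. ?c x \<in> X}" using NX N.a_subset by auto
   ultimately show "{x \<in> carrier M. ?c x \<in> X} \<in> {T. submodule T R M \<and> N <= T}" by blast
  next
   fix X X' assume "X \<in> {X. submodule X R (quot_module R M N)}" "X' \<in> {X. submodule X R (quot_module R M N)}"
    and *: "X \<subset> X'"
   then have "X' <= carrier (quot_module R M N)" unfolding quo.submodule_iff by blast
   then show "{x \<in> carrier M. ?c x \<in> X} \<subset> {x \<in> carrier M. ?c x \<in> X'}"
    using * unfolding quot_carrier by blast
  qed
  show "clen {T. submodule T R M \<and> N <= T} <= clen {X. submodule X R (quot_module R M N)}"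
  proof (rule clen_map[where \<Phi> = "\<lambda>T. ?c ` T"])
   fix T assume "T \<in> {T. submodule T R M \<and> N <= T}"
   then have T: "T <= carrier M" "\<zero>\<^bsub>M\<^esub> \<in> T" "\<And>x y. x \<in> T ==> y \<in> T ==> x \<oplus>\<^bsub>M\<^esub> y \<in> T"
    "\<And>r x. r \<in> carrier R ==> x \<in> T ==> r \<odot>\<^bsub>M\<^esub> x \<in> T" "N <= T" unfolding submodule_iff by auto
   have "N = ?c \<zero>\<^bsub>M\<^esub>" using coset_eq_N_iff[of "\<zero>\<^bsub>M\<^esub>"] by simp
   then have 0: "N \<in> ?c ` T" using T(2) by blast
   have add: "?c x \<oplus>\<^bsub>quot_module R M N\<^esub> ?c y \<in> ?c ` T" if "x \<in> T" "y \<in> T" for x y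
    using quot_add[of x y] T(1,3) that by (simp add: subset_iff)
   have sm: "r \<odot>\<^bsub>quot_module R M N\<^esub> ?c x \<in> ?c ` T" if "r \<in> carrier R" "x \<in> T" for r x
    using quot_smult[of r x] T(1,4) that by (simp add: subset_iff)
   have "submodule (?c ` T) R (quot_module R M N)"
    unfolding quo.submodule_iff quot_zero quot_carrier using T(1) 0 add sm by auto
   then show "?c ` T \<in> {X. submodule X R (quot_module R M N)}" by blast
  next
   fix T T' assume T: "T \<in> {T. submodule T R M \<and> N <= T}" "T' \<in> {T. submodule T R M \<and> N <= T}" "T \<subset> T'"
   then obtain x where x: "x \<in> T'" "x \<notin> T" by blast
   have Tc: "T <= carrier M" "T' <= carrier M" using T unfolding submodule_iff by auto
   have "?c x \<notin> ?c ` T" proof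
    assume "?c x \<in> ?c ` T"
    then obtain y where y: "y \<in> T" "?c x = ?c y" by blast
    have c: "x \<in> carrier M" "y \<in> carrier M" using x y Tc by auto
    have "x \<ominus>\<^bsub>M\<^esub> y \<in> N" using coset_eq_iff[OF c] y by simp
    then have "(x \<ominus>\<^bsub>M\<^esub> y) \<oplus>\<^bsub>M\<^esub> y \<in> T" using T(1) y unfolding submodule_iff by blast
    moreover have "(x \<ominus>\<^bsub>M\<^esub> y) \<oplus>\<^bsub>M\<^esub> y = x" using c by (simp add: a_minus_def M.a_assoc M.l_neg)
    ultimately show False using x by simp
   qed
   then show "?c ` T \<subset> ?c ` T'" using T(3) x(1) by blast
  qed
 qed
qed

end
end

subsection \<open>Submodules of an overring as modules\<close>

lemma as_module_simps [simp]:
 "carrier (as_module R X) = X" "add (as_module R X) = add R" "zero (as_module R X) = zero R"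
 "module.smult (as_module R X) = monoid.mult R" "as_module (R\<lparr>carrier := C\<rparr>) X = as_module R X"
 "(as_module R X)\<lparr>carrier := Y\<rparr> = as_module R Y" by (simp_all add: as_module_def)

lemma mod_homI:
 assumes "f \<in> carrier M \<rightarrow>\<^sub>E carrier N"
  "\<And>x y. x \<in> carrier M ==> y \<in> carrier M ==> f (x \<oplus>\<^bsub>M\<^esub> y) = f x \<oplus>\<^bsub>N\<^esub> f y"
  "\<And>r x. r \<in> carrier R ==> x \<in> carrier M ==> f (r \<odot>\<^bsub>M\<^esub> x) = r \<odot>\<^bsub>N\<^esub> f x"
 shows "f \<in> mod_hom R M N" using assms unfolding mod_hom_def by blast

lemma mod_homD:
 assumes "f \<in> mod_hom R M N" shows "x \<in> carrier M ==> f x \<in> carrier N"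
  "x \<in> carrier M ==> y \<in> carrier M ==> f (x \<oplus>\<^bsub>M\<^esub> y) = f x \<oplus>\<^bsub>N\<^esub> f y"
  "r \<in> carrier R ==> x \<in> carrier M ==> f (r \<odot>\<^bsub>M\<^esub> x) = r \<odot>\<^bsub>N\<^esub> f x"
  "f \<in> carrier M \<rightarrow>\<^sub>E carrier N" using assms unfolding mod_hom_def by auto

lemma module_Hom:
 assumes N: "module R N" and E: "module R E" shows "module R (Hom_module R N E)" proof -
 interpret N: module R N by (rule N)
 interpret E: module R E by (rule E)
 let ?H = "Hom_module R N E"
 have [simp]: "carrier ?H = mod_hom R N E" "\<zero>\<^bsub>?H\<^esub> = (\<lambda>x\<in>carrier N. \<zero>\<^bsub>E\<^esub>)"
  "f \<oplus>\<^bsub>?H\<^esub> g = (\<lambda>x\<in>carrier N. f x \<oplus>\<^bsub>E\<^esub> g x)" "r \<odot>\<^bsub>?H\<^esub> f = (\<lambda>x\<in>carrier N. r \<odot>\<^bsub>E\<^esub> f x)" for f g r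
  by (simp_all add: Hom_module_def)
 have cl [simp]: "f x \<in> carrier E" if "f \<in> mod_hom R N E" "x \<in> carrier N" for f x
  using mod_homD(1)[OF that] .
 have add: "(\<lambda>x\<in>carrier N. f x \<oplus>\<^bsub>E\<^esub> g x) \<in> mod_hom R N E"
  if "f \<in> mod_hom R N E" "g \<in> mod_hom R N E" for f g
  using that mod_homD(2,3)[OF that(1)] mod_homD(2,3)[OF that(2)]
  by (intro mod_homI) (auto simp: E.a_ac E.smult_r_distr)
 have smult: "(\<lambda>x\<in>carrier N. r \<odot>\<^bsub>E\<^esub> f x) \<in> mod_hom R N E" if "f \<in> mod_hom R N E" "r \<in> carrier R" for f r
 proof (rule mod_homI)
  fix t x assume t: "t \<in> carrier R" "x \<in> carrier N"
  then have "r \<odot>\<^bsub>E\<^esub> (t \<odot>\<^bsub>E\<^esub> f x) = t \<odot>\<^bsub>E\<^esub> (r \<odot>\<^bsub>E\<^esub> f x)"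
   using that E.smult_assoc1[of r t "f x"] E.smult_assoc1[of t r "f x"] N.R.m_comm[of r t] by simp
  then show "(\<lambda>x\<in>carrier N. r \<odot>\<^bsub>E\<^esub> f x) (t \<odot>\<^bsub>N\<^esub> x) = t \<odot>\<^bsub>E\<^esub> (\<lambda>x\<in>carrier N. r \<odot>\<^bsub>E\<^esub> f x) x"
   using that t mod_homD(3)[OF that(1) t] by simp
 qed (use that mod_homD(2)[OF that(1)] in \<open>auto simp: E.smult_r_distr\<close>)
 have zero: "(\<lambda>x\<in>carrier N. \<zero>\<^bsub>E\<^esub>) \<in> mod_hom R N E"
  by (rule mod_homI) (auto simp: E.smult_r_null)
 have ext: "f \<in> extensional (carrier N)" if "f \<in> mod_hom R N E" for f
  using mod_homD(4)[OF that] by (simp add: PiE_iff)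
 show ?thesis proof (rule moduleI)
  show "cring R" by (rule N.R.is_cring)
  show "abelian_group ?H" proof (rule abelian_groupI)
   fix f assume f: "f \<in> carrier ?H"
   have "(\<lambda>x\<in>carrier N. (\<ominus>\<^bsub>R\<^esub> \<one>\<^bsub>R\<^esub>) \<odot>\<^bsub>E\<^esub> f x) \<in> mod_hom R N E" using smult f by simp
   moreover have "(\<ominus>\<^bsub>R\<^esub> \<one>\<^bsub>R\<^esub>) \<odot>\<^bsub>E\<^esub> f x \<oplus>\<^bsub>E\<^esub> f x = \<zero>\<^bsub>E\<^esub>" if "x \<in> carrier N" for x
    using E.smult_l_minus[of "\<one>\<^bsub>R\<^esub>" "f x"] f that by (simp add: E.l_neg)
   ultimately show "\<exists>g\<in>carrier ?H. g \<oplus>\<^bsub>?H\<^esub> f = \<zero>\<^bsub>?H\<^esub>"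
    by (intro bexI[of _ "\<lambda>x\<in>carrier N. (\<ominus>\<^bsub>R\<^esub> \<one>\<^bsub>R\<^esub>) \<odot>\<^bsub>E\<^esub> f x"]) auto
   show "\<zero>\<^bsub>?H\<^esub> \<oplus>\<^bsub>?H\<^esub> f = f"
    using f ext[of f] by (intro extensionalityI[of _ "carrier N"]) auto
  qed (auto simp: add zero E.a_ac intro!: restrict_ext)
  show "\<one>\<^bsub>R\<^esub> \<odot>\<^bsub>?H\<^esub> f = f" if "f \<in> carrier ?H" for f
   using that ext[of f] by (intro extensionalityI[of _ "carrier N"]) auto
 qed (auto simp: smult E.smult_l_distr E.smult_r_distr E.smult_assoc1 intro!: restrict_ext)
qed

context cring begin

abbreviation subr :: "'a set => ('a, 'b) ring_scheme" where
 "subr A \<equiv> R\<lparr>carrier := A\<rparr>"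

lemma cring_subr: "subring A R ==> cring (subr A)"
 using subcring_iff[of A] subcringI'[of A] subringE(1)[of A R] by blast

lemma module_as_module:
 assumes A: "subring A R" and X: "smod A X" shows "module (subr A) (as_module R X)" proof (rule moduleI)
 note XD = smodD[OF X]
 have AR: "A <= carrier R" using subringE(1)[OF A] .
 show "cring (subr A)" using cring_subr[OF A] .
 show "abelian_group (as_module R X)" proof (rule abelian_groupI)
  fix x assume x: "x \<in> carrier (as_module R X)"
  then have "\<ominus> x \<in> X" "\<ominus> x \<oplus> x = \<zero>" using smod_neg[OF X A] XD(5) by (auto simp: l_neg)
  then show "\<exists>y\<in>carrier (as_module R X). y \<oplus>\<^bsub>as_module R X\<^esub> x = \<zero>\<^bsub>as_module R X\<^esub>" by auto
 qed (use XD in \<open>auto simp: a_ac\<close>)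
qed (use smodD[OF X] subringE(1)[OF A] in \<open>auto simp: l_distr r_distr m_assoc subset_iff\<close>)

lemma submodule_as_module:
 assumes A: "subring A R" and X: "smod A X"
 shows "submodule T (subr A) (as_module R X) \<longleftrightarrow> smod A T \<and> T <= X" proof -
 interpret mm: plain_module "subr A" "as_module R X" by (rule plain_module.intro[OF module_as_module[OF A X]])
 show ?thesis unfolding mm.submodule_iff smod_def using smodD(1)[OF X] by auto
qed

lemma module_length_quot_as_module:
 assumes A: "subring A R" and X: "smod A X" and Y: "smod A Y" "Y <= X"
 shows "module_length (subr A) (quot_module (subr A) (as_module R X) Y) = len A X Y" proof -
 interpret mm: plain_module "subr A" "as_module R X" by (rule plain_module.intro[OF module_as_module[OF A X]])
 have "submodule Y (subr A) (as_module R X)" using submodule_as_module[OF A X] Y by blast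
 from mm.module_length_quot[OF this] show ?thesis
  unfolding len_def submodule_as_module[OF A X] by (simp add: conj_ac)
qed

lemma ideal_iff_smod:
 assumes A: "subring A R" shows "ideal J (subr A) \<longleftrightarrow> smod A J \<and> J <= A" proof
 interpret B: cring "subr A" by (rule cring_subr[OF A])
 assume J: "ideal J (subr A)"
 interpret J: ideal J "subr A" by (rule J)
 have JA: "J <= A" using J.a_subset by simp
 have "smod A J" using JA subringE(1)[OF A] J.zero_closed J.a_closed J.I_l_closed by (intro smodI) auto
 then show "smod A J \<and> J <= A" using JA by blast
next
 interpret B: cring "subr A" by (rule cring_subr[OF A])
 assume J: "smod A J \<and> J <= A"
 note JD = smodD[OF conjunct1[OF J]]
 have AR: "A <= carrier R" using subringE(1)[OF A] .
 show "ideal J (subr A)" proof (rule idealI[OF B.ring_axioms])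
  show "subgroup J (add_monoid (subr A))" proof (rule B.add.subgroupI)
   show "\<ominus>\<^bsub>subr A\<^esub> x \<in> J" if x: "x \<in> J" for x proof -
    have nx: "\<ominus> x \<in> J" using smod_neg[OF conjunct1[OF J] A x] .
    then have "\<ominus> x \<in> A" "x \<in> A" using J x by blast+
    then have "\<ominus>\<^bsub>subr A\<^esub> x = \<ominus> x"
     using B.minus_equality[of "\<ominus> x" x] AR by (simp add: l_neg subset_iff)
    then show ?thesis using nx by simp
   qed
  qed (use J JD in auto)
  fix a x assume "a \<in> J" "x \<in> carrier (subr A)"
  then show "x \<otimes>\<^bsub>subr A\<^esub> a \<in> J" "a \<otimes>\<^bsub>subr A\<^esub> x \<in> J"
   using JD AR m_comm[of a x] by auto
 qed
qed

lemma maximalideal_iff_maxl: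
 assumes A: "subring A R" shows "maximalideal n (subr A) \<longleftrightarrow> maxl A n" proof
 assume "maximalideal n (subr A)"
 then interpret n: maximalideal n "subr A" .
 have sn: "smod A n" "n <= A" using ideal_iff_smod[OF A, of n] n.is_ideal by auto
 moreover have "X = n" if "smod A X" "n <= X" "X \<subset> A" for X
  using n.I_maximal[of X] ideal_iff_smod[OF A, of X] that by auto
 moreover have "n \<noteq> A" using n.I_notcarr by auto
 ultimately show "maxl A n" unfolding maxl_def by blast
next
 assume n: "maxl A n"
 show "maximalideal n (subr A)" proof (rule maximalidealI)
  show "ideal n (subr A)" using n ideal_iff_smod[OF A] by (auto simp: maxl_def)
  show "carrier (subr A) \<noteq> n" using n by (auto simp: maxl_def)
  fix J assume "ideal J (subr A)" "n <= J" "J <= carrier (subr A)"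
  then show "J = n \<or> J = carrier (subr A)"
   using n ideal_iff_smod[OF A, of J] unfolding maxl_def by (metis partial_object.select_convs(1) partial_object.surjective partial_object.update_convs(1) psubsetI)
 qed
qed

lemma ideal_smult_as_module:
 assumes A: "subring A R" and X: "smod A X" and J: "smod A J" "J <= A" and Y: "smod A Y" "Y <= X"
 shows "ideal_smult (subr A) (as_module R X) J Y = J \<cdot> Y" proof -
 have AR: "A <= carrier R" using subringE(1)[OF A] .
 have s: "smod A (J \<cdot> Y)" using smod_prod2[OF J(1) Y(1) AR] .
 have "J \<cdot> Y <= Y" by (rule ideal_prod_minimal) (use smodD[OF Y(1)] J in auto)
 then have JYX: "J \<cdot> Y <= X" using Y by blast
 show ?thesis unfolding ideal_smult_def module_span_def submodule_as_module[OF A X] proof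
  show "\<Inter> {N. (smod A N \<and> N <= X) \<and> {j \<odot>\<^bsub>as_module R X\<^esub> x |j x. j \<in> J \<and> x \<in> Y} <= N} <= J \<cdot> Y"
   using s JYX by (intro Inter_lower) (auto intro: prod_incl)
  show "J \<cdot> Y <= \<Inter> {N. (smod A N \<and> N <= X) \<and> {j \<odot>\<^bsub>as_module R X\<^esub> x |j x. j \<in> J \<and> x \<in> Y} <= N}"
  proof (rule Inter_greatest)
   fix N assume "N \<in> {N. (smod A N \<and> N <= X) \<and> {j \<odot>\<^bsub>as_module R X\<^esub> x |j x. j \<in> J \<and> x \<in> Y} <= N}"
   then have N: "smod A N" "\<And>j x. j \<in> J ==> x \<in> Y ==> j \<otimes> x \<in> N" by auto
   show "J \<cdot> Y <= N" by (rule ideal_prod_minimal) (use N(2) smodD(3)[OF N(1)] in auto)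
  qed
 qed
qed

end

context curve begin

abbreviation R0 :: "('a, 'b) ring_scheme" where "R0 \<equiv> Q\<lparr>carrier := A\<rparr>"

lemma ideal_power_smult_as_module:
 assumes J: "frac J" "J <= A" and M: "frac M"
 shows "ideal_power_smult R0 J n (as_module Q M) = ipow J n \<cdot> M" proof (induction n)
 case 0
 then show ?case using prod_one[OF frac_smod[OF M] one_A AQ] by (simp add: ideal_power_smult_def)
next
 case (Suc n)
 have f: "frac (ipow J n \<cdot> M)" using frac_prod frac_ipow J M by blast
 have "ipow J n \<cdot> M <= M" by (rule ideal_prod_minimal)
   (use smodD[OF frac_smod[OF M]] subsetD[OF ipow_subset[OF J]] in auto)
 then have "ideal_smult R0 (as_module Q M) J (ipow J n \<cdot> M) = J \<cdot> (ipow J n \<cdot> M)"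
  using ideal_smult_as_module[OF A frac_smod[OF M] frac_smod[OF J(1)] J(2) frac_smod[OF f]] by blast
 then show ?case
  using Suc prod_assoc[OF frac_carrier[OF J(1)] frac_carrier[OF frac_ipow[OF J(1)]] frac_carrier[OF M]]
  by (simp add: ideal_power_smult_def)
qed

text \<open>By \<open>multiplicity_exists\<close> the lengths become constant, so the definite
  description in \<open>multiplicity_dim1\<close> denotes their eventual value.\<close>

lemma multiplicity_iff_ulr:
 assumes J: "frac J" "J <= A" and M: "frac M" shows "multiplicity_dim1 R0 J (as_module Q M) =
   module_length R0 (quot_module R0 (as_module Q M) (ideal_smult R0 (as_module Q M) J (carrier (as_module Q M))))
  \<longleftrightarrow> (\<exists>N. \<forall>n\<ge>N. len A (ipow J n \<cdot> M) (ipow J (Suc n) \<cdot> M) = len A M (J \<cdot> M))"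
proof -
 have f: "frac (ipow J n \<cdot> M)" for n using frac_prod frac_ipow J M by blast
 have dec: "J \<cdot> X <= X" if X: "smod A X" for X
  by (rule ideal_prod_minimal) (use smodD[OF X] J in auto)
 have eqS: "ipow J (Suc n) \<cdot> M = J \<cdot> (ipow J n \<cdot> M)" for n
  using prod_assoc[OF frac_carrier[OF J(1)] frac_carrier[OF frac_ipow[OF J(1)]] frac_carrier[OF M]] by simp
 have 1: "ideal_smult R0 (as_module Q M) J (carrier (as_module Q M)) = J \<cdot> M"
  using ideal_smult_as_module[OF A frac_smod[OF M] frac_smod[OF J(1)] J(2) frac_smod[OF M]] by simp
 have 2: "module_length R0 (quot_module R0 (as_module Q M) (J \<cdot> M)) = len A M (J \<cdot> M)"
  using module_length_quot_as_module[OF A frac_smod[OF M] frac_smod[OF frac_prod[OF J(1) M]] dec[OF frac_smod[OF M]]] .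
 have 3: "module_length R0 (quot_module R0 ((as_module Q M)\<lparr>carrier := ideal_power_smult R0 J n (as_module Q M)\<rparr>)
   (ideal_power_smult R0 J (Suc n) (as_module Q M))) = len A (ipow J n \<cdot> M) (ipow J (Suc n) \<cdot> M)" for n
  unfolding ideal_power_smult_as_module[OF J M] as_module_simps
  using module_length_quot_as_module[OF A frac_smod[OF f[of n]] frac_smod[OF f[of "Suc n"]]]
   dec[OF frac_smod[OF f[of n]]] eqS by simp
 let ?P = "\<lambda>e. \<exists>N. \<forall>n\<ge>N. len A (ipow J n \<cdot> M) (ipow J (Suc n) \<cdot> M) = e"
 obtain e where e: "?P e" using multiplicity_exists[OF J] M by metis
 have uniq: "e' = e''" if "?P e'" "?P e''" for e' e'' proof -
  obtain N1 N2 where "\<forall>n\<ge>N1. len A (ipow J n \<cdot> M) (ipow J (Suc n) \<cdot> M) = e'"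
   "\<forall>n\<ge>N2. len A (ipow J n \<cdot> M) (ipow J (Suc n) \<cdot> M) = e''" using \<open>?P e'\<close> \<open>?P e''\<close> by blast
  then show ?thesis by (metis linear)
 qed
 have "multiplicity_dim1 R0 J (as_module Q M) = (THE e. ?P e)" unfolding multiplicity_dim1_def 3 ..
 also have "\<dots> = e" by (rule the_equality) (use e uniq in blast)+
 finally show ?thesis unfolding 1 2 using e uniq by metis
qed

text \<open>Homomorphisms between submodules of \<open>Q\<close> are multiplications.\<close>

lemma mod_hom_mult:
 assumes X: "smod A X" "s [^] (k::nat) \<in> X" and Y: "Y <= carrier Q"
  and f: "f \<in> mod_hom R0 (as_module Q X) (as_module Q Y)"
 shows "\<And>x. x \<in> X ==> f x = inv (s [^] k) \<otimes> f (s [^] k) \<otimes> x" proof -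
 fix x assume x: "x \<in> X"
 let ?a = "s [^] k"
 have xc: "x \<in> carrier Q" using smodD(5)[OF X(1) x] .
 obtain j where j: "s [^] (j::nat) \<otimes> x \<in> A" using denom[OF xc] by blast
 let ?b = "s [^] j"
 have fc: "f x \<in> carrier Q" "f ?a \<in> carrier Q" using mod_homD(1)[OF f] x X(2) Y by auto
 have lin: "f (r \<otimes> y) = r \<otimes> f y" if "r \<in> A" "y \<in> X" for r y
  using mod_homD(3)[OF f, of r y] that by simp
 have c: "?a \<in> carrier Q" "?b \<in> carrier Q" "inv ?a \<in> carrier Q" using spow_closed spow_unit by auto
 have "(?b \<otimes> x) \<otimes> f ?a = f ((?b \<otimes> x) \<otimes> ?a)" using lin[OF j X(2)] by simp
 also have "(?b \<otimes> x) \<otimes> ?a = ?b \<otimes> (?a \<otimes> x)" using c xc by algebra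
 also have "f \<dots> = ?b \<otimes> (?a \<otimes> f x)"
  using lin[OF spow_A, of "?a \<otimes> x" j] lin[OF spow_A x, of k] smodD(4)[OF X(1) spow_A x] by simp
 finally have "?b \<otimes> (x \<otimes> f ?a) = ?b \<otimes> (?a \<otimes> f x)" using c xc fc by (simp add: m_assoc)
 then have "x \<otimes> f ?a = ?a \<otimes> f x" using Units_l_cancel[OF spow_unit] c xc fc by simp
 then have "inv ?a \<otimes> (?a \<otimes> f x) = inv ?a \<otimes> (x \<otimes> f ?a)" by simp
 moreover have "inv ?a \<otimes> (?a \<otimes> f x) = f x" using spow_unit fc(1) by simp
 moreover have "inv ?a \<otimes> (x \<otimes> f ?a) = inv ?a \<otimes> f ?a \<otimes> x" using c xc fc by algebra
 ultimately show "f x = inv ?a \<otimes> f ?a \<otimes> x" by simp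
qed

lemma mult_mod_hom:
 assumes "smod A X" "q \<in> carrier Q" "\<And>x. x \<in> X ==> q \<otimes> x \<in> Y"
 shows "(\<lambda>x\<in>X. q \<otimes> x) \<in> mod_hom R0 (as_module Q X) (as_module Q Y)"
proof (rule mod_homI)
 note X = smodD[OF assms(1)]
 show "(\<lambda>x\<in>X. q \<otimes> x) (r \<odot>\<^bsub>as_module Q X\<^esub> x) = r \<odot>\<^bsub>as_module Q Y\<^esub> (\<lambda>x\<in>X. q \<otimes> x) x"
  if rx: "r \<in> carrier R0" "x \<in> carrier (as_module Q X)" for r x proof -
  have "r \<in> carrier Q" "x \<in> carrier Q" using rx AQ X(5) by auto
  then show ?thesis using rx X(4) m_lcomm[OF assms(2), of r x] by simp
 qed
qed (use assms(2,3) smodD[OF assms(1)] in \<open>auto simp: r_distr\<close>)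

text \<open>An isomorphism is multiplication by some \<open>q\<close>; a power of \<open>s\<close>
  lies in its image, which makes \<open>q\<close> a unit.\<close>

lemma module_isomorphic_iff:
 assumes X: "frac X" and Y: "frac Y"
 shows "module_isomorphic R0 (as_module Q X) (as_module Q Y) \<longleftrightarrow> (\<exists>q\<in>Units Q. Y = scale q X)"
proof
 assume "module_isomorphic R0 (as_module Q X) (as_module Q Y)"
 then obtain f where f: "f \<in> mod_hom R0 (as_module Q X) (as_module Q Y)" "bij_betw f X Y"
  unfolding module_isomorphic_def by auto
 obtain k l where kl: "s [^] (k::nat) \<in> X" "s [^] (l::nat) \<in> Y" using X Y unfolding frac_def by blast
 define q where "q = inv (s [^] k) \<otimes> f (s [^] k)"
 have fx: "f x = q \<otimes> x" if "x \<in> X" for x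
  using mod_hom_mult[OF frac_smod[OF X] kl(1) frac_carrier[OF Y] f(1) that] unfolding q_def .
 have "f (s [^] k) \<in> Y" using f(2) kl(1) by (auto simp: bij_betw_def)
 then have qc: "q \<in> carrier Q" unfolding q_def using frac_carrier[OF Y] spow_unit by auto
 have Yq: "Y = scale q X" using f(2) fx unfolding bij_betw_def scale_def by auto
 then obtain x where "x \<in> X" "s [^] l = q \<otimes> x" using kl(2) by (auto simp: mem_scale)
 then have "q \<in> Units Q" using unit_factor[of q x] spow_unit[of l] qc frac_carrier[OF X] by auto
 then show "\<exists>q\<in>Units Q. Y = scale q X" using Yq by blast
next
 assume "\<exists>q\<in>Units Q. Y = scale q X"
 then obtain q where q: "q \<in> Units Q" "Y = scale q X" by blast
 have "(\<lambda>x\<in>X. q \<otimes> x) \<in> mod_hom R0 (as_module Q X) (as_module Q Y)"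
  by (rule mult_mod_hom[OF frac_smod[OF X]]) (use q in \<open>auto intro: scaleI\<close>)
 moreover have "bij_betw (\<lambda>x\<in>X. q \<otimes> x) X Y" proof -
  have "inj_on (\<lambda>x. q \<otimes> x) X"
   using frac_carrier[OF X] q(1) by (auto intro!: inj_onI simp: subset_iff)
  then show ?thesis unfolding q(2) scale_def by (auto simp: bij_betw_def inj_on_def)
 qed
 ultimately show "module_isomorphic R0 (as_module Q X) (as_module Q Y)"
  unfolding module_isomorphic_def as_module_simps by blast
qed

text \<open>An element \<open>q\<close> of \<open>A : (A : X)\<close> defines a functional on the
  dual of \<open>X\<close>, sending \<open>\<phi>\<close> to \<open>q \<phi>(1)\<close>, because
  \<open>\<phi>(1)\<close> lies in \<open>A : X\<close>. Reflexivity makes it evaluation at some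
  \<open>x\<close> in \<open>X\<close>; on multiplication by \<open>s^k\<close> this reads
  \<open>s^k q = s^k x\<close>.\<close>

lemma reflexive_double_colon:
 assumes X: "frac X" "\<one> \<in> X" and refl: "reflexive_module R0 (as_module Q X)"
 shows "colon A (colon A X) = X" proof
 show "X <= colon A (colon A X)" using colon_galois[OF smod_A frac_carrier[OF X(1)]] .
 show "colon A (colon A X) <= X" proof
  fix q assume q: "q \<in> colon A (colon A X)"
  have qc: "q \<in> carrier Q" using q by (simp add: colon_def)
  let ?D = "dual_module R0 (as_module Q X)"
  have D: "carrier ?D = mod_hom R0 (as_module Q X) (as_module Q A)"
   by (simp add: dual_module_def Hom_module_def)
  interpret DM: module R0 ?D unfolding dual_module_def as_module_simps partial_object.simps
   by (intro module_Hom module_as_module[OF A] frac_smod[OF X(1)]) (simp add: smod_A)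
  have X1: "s [^] (0::nat) \<in> X" using X by simp
  have \<phi>: "\<phi> \<one> \<in> colon A X" if "\<phi> \<in> carrier ?D" for \<phi> proof -
   have \<phi>h: "\<phi> \<in> mod_hom R0 (as_module Q X) (as_module Q A)" using that D by simp
   have "\<phi> \<one> \<in> A" using mod_homD(1)[OF \<phi>h] X(2) by simp
   then have c: "\<phi> \<one> \<in> carrier Q" using AQ by blast
   have "\<phi> \<one> \<otimes> x \<in> A" if "x \<in> X" for x proof -
    have "\<phi> x = \<phi> \<one> \<otimes> x" using mod_hom_mult[OF frac_smod[OF X(1)] X1 AQ \<phi>h that] c by simp
    moreover have "\<phi> x \<in> A" using mod_homD(1)[OF \<phi>h] that by simp
    ultimately show ?thesis by metis
   qed
   then show ?thesis using c by (simp add: colon_def)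
  qed
  have \<phi>c: "\<phi> \<one> \<in> carrier Q" if "\<phi> \<in> carrier ?D" for \<phi> using \<phi>[OF that] by (simp add: colon_def)
  let ?F = "\<lambda>\<phi>\<in>carrier ?D. q \<otimes> \<phi> \<one>"
  have "?F \<in> mod_hom R0 ?D (as_module Q A)" proof (rule mod_homI)
   have "q \<otimes> \<phi> \<one> \<in> A" if "\<phi> \<in> carrier ?D" for \<phi> using \<phi>[OF that] q by (simp add: colon_def)
   then show "?F \<in> carrier ?D \<rightarrow>\<^sub>E carrier (as_module Q A)" by auto
   fix \<phi> \<psi> assume h: "\<phi> \<in> carrier ?D" "\<psi> \<in> carrier ?D"
   have val: "(\<phi> \<oplus>\<^bsub>?D\<^esub> \<psi>) \<one> = \<phi> \<one> \<oplus> \<psi> \<one>"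
    using X(2) by (simp add: dual_module_def Hom_module_def)
   have "\<phi> \<oplus>\<^bsub>?D\<^esub> \<psi> \<in> carrier ?D" using DM.M.a_closed h by blast
   then show "?F (\<phi> \<oplus>\<^bsub>?D\<^esub> \<psi>) = ?F \<phi> \<oplus>\<^bsub>as_module Q A\<^esub> ?F \<psi>"
    using h val qc \<phi>c by (simp add: r_distr)
  next
   fix r \<phi> assume h: "r \<in> carrier R0" "\<phi> \<in> carrier ?D"
   have rc: "r \<in> carrier Q" "r \<in> A" using h AQ by auto
   have val: "(r \<odot>\<^bsub>?D\<^esub> \<phi>) \<one> = r \<otimes> \<phi> \<one>"
    using X(2) by (simp add: dual_module_def Hom_module_def)
   have "r \<odot>\<^bsub>?D\<^esub> \<phi> \<in> carrier ?D" using DM.smult_closed h by blast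
   then show "?F (r \<odot>\<^bsub>?D\<^esub> \<phi>) = r \<odot>\<^bsub>as_module Q A\<^esub> ?F \<phi>"
    using h val qc \<phi>c[OF h(2)] rc by (simp add: m_lcomm)
  qed
  then have "?F \<in> carrier (dual_module R0 ?D)" by (simp add: dual_module_def Hom_module_def)
  then obtain x where x: "x \<in> X" "?F = (\<lambda>f\<in>carrier ?D. f x)"
   using refl unfolding reflexive_module_def bij_betw_def by fastforce
  obtain k where k: "scale (s [^] (k::nat)) X <= A" using X(1) unfolding frac_def by blast
  let ?m = "\<lambda>x\<in>X. s [^] k \<otimes> x"
  have "?m \<in> carrier ?D" unfolding D
   using mult_mod_hom[OF frac_smod[OF X(1)] spow_closed] k scaleI by blast
  then have "q \<otimes> ?m \<one> = ?m x" using fun_cong[OF x(2), of ?m] by simp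
  then have "s [^] k \<otimes> q = s [^] k \<otimes> x" using x X(2) qc spow_closed[of k] by (simp add: m_comm)
  then have "q = x" using Units_l_cancel[OF spow_unit] qc smodD(5)[OF frac_smod[OF X(1)] x(1)] by simp
  then show "q \<in> X" using x by simp
 qed
qed

end

subsection \<open>Injective resolutions\<close>

text \<open>Noetherian induction, from larger ideals to smaller ones.\<close>

lemma (in noetherian_ring) ideal_induct:
 assumes step: "\<And>J. ideal J R ==> (\<And>J'. ideal J' R ==> J \<subset> J' ==> P J') ==> P J" and J: "ideal J R"
 shows "P J" proof (rule ccontr)
 assume nP: "\<not> P J"
 let ?F = "{J. ideal J R \<and> \<not> P J}"
 have "\<Union>C \<in> ?F" if C: "C \<noteq> {}" "subset.chain ?F C" for C proof -
  have CF: "C <= ?F" and lin: "\<forall>x\<in>C. \<forall>y\<in>C. x \<subset> y \<or> x = y \<or> y \<subset> x"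
   using C(2) unfolding pred_on.chain_def by auto
  have "subset.chain {I. ideal I R} C" unfolding pred_on.chain_def using CF lin by auto
  then have "\<Union>C \<in> C" using ideal_chain_is_trivial[OF C(1)] by simp
  then show ?thesis using CF by blast
 qed
 moreover have "?F \<noteq> {}" using J nP by blast
 ultimately have "\<exists>M\<in>?F. \<forall>X\<in>?F. M <= X --> X = M"
  by (intro subset_Zorn_nonempty) auto
 then obtain M where M: "M \<in> ?F" "\<forall>X\<in>?F. M <= X --> X = M" by blast
 have "P J'" if "ideal J' R" "M \<subset> J'" for J' using M(2) that by blast
 then have "P M" using step[of M] M(1) by simp
 then show False using M(1) by simp
qed

lemma (in cring) add_cgenideal:
 assumes J: "ideal J R" and z: "z \<in> carrier R"
 shows "ideal (J <+> PIdl z) R" "w \<in> J <+> PIdl z \<longleftrightarrow> (\<exists>j\<in>J. \<exists>a\<in>carrier R. w = j \<oplus> a \<otimes> z)"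
  "r \<in> J ==> r \<in> J <+> PIdl z" "z \<in> J <+> PIdl z" proof -
 interpret J: ideal J R by (rule J)
 show "ideal (J <+> PIdl z) R" using add_ideals[OF J cgenideal_ideal[OF z]] .
 show mem: "w \<in> J <+> PIdl z \<longleftrightarrow> (\<exists>j\<in>J. \<exists>a\<in>carrier R. w = j \<oplus> a \<otimes> z)" for w
  unfolding set_add_def' cgenideal_def by blast
 show "r \<in> J ==> r \<in> J <+> PIdl z" unfolding mem using z J.Icarr by (intro bexI[of _ r] bexI[of _ \<zero>]) auto
 show "z \<in> J <+> PIdl z" unfolding mem using z J.zero_closed by (intro bexI[of _ \<zero>] bexI[of _ \<one>]) auto
qed

locale injective_res = cring R for R :: "('a, 'm) ring_scheme" (structure) +
 fixes M :: "('a, 'b) module" and \<epsilon> :: "'b => 'c" and E :: "nat => ('a, 'c) module" and d :: "nat => 'c => 'c"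
 assumes res: "injective_resolution R M \<epsilon> E d" and mod_M: "module R M"
begin

lemma mod_E: "module R (E i)" using res unfolding injective_resolution_def injective_module_def by blast

sublocale E: plain_module R "E i" for i by (rule plain_module.intro[OF mod_E])

sublocale M: plain_module R M by (rule plain_module.intro[OF mod_M])

lemma d_hom: "d i \<in> mod_hom R (E i) (E (Suc i))" using res unfolding injective_resolution_def by blast

lemmas d_closed = mod_homD(1)[OF d_hom] and d_add = mod_homD(2)[OF d_hom] and d_smult = mod_homD(3)[OF d_hom]

lemma eps_hom: "\<epsilon> \<in> mod_hom R M (E 0)" using res unfolding injective_resolution_def by blast

lemmas eps_closed = mod_homD(1)[OF eps_hom] and eps_add = mod_homD(2)[OF eps_hom] and eps_smult = mod_homD(3)[OF eps_hom]

lemma hom_minus: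
 assumes f: "f \<in> mod_hom R N N'" and N: "module R N" and N': "module R N'" and xy: "x \<in> carrier N" "y \<in> carrier N"
 shows "f (x \<ominus>\<^bsub>N\<^esub> y) = f x \<ominus>\<^bsub>N'\<^esub> f y" proof -
 interpret N: module R N by (rule N)
 interpret N': module R N' by (rule N')
 have "f ((\<ominus> \<one>) \<odot>\<^bsub>N\<^esub> y) = (\<ominus> \<one>) \<odot>\<^bsub>N'\<^esub> f y" using mod_homD(3)[OF f] xy by simp
 then have "f (\<ominus>\<^bsub>N\<^esub> y) = \<ominus>\<^bsub>N'\<^esub> f y"
  using N.smult_l_minus[of \<one> y] N'.smult_l_minus[of \<one> "f y"] xy mod_homD(1)[OF f] by simp
 then show ?thesis using mod_homD(2)[OF f xy(1), of "\<ominus>\<^bsub>N\<^esub> y"] xy by (simp add: a_minus_def)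
qed

lemma hom_zero:
 assumes f: "f \<in> mod_hom R N N'" and N: "module R N" and N': "module R N'"
 shows "f \<zero>\<^bsub>N\<^esub> = \<zero>\<^bsub>N'\<^esub>" proof -
 interpret N: module R N by (rule N)
 interpret N': module R N' by (rule N')
 have "f (\<zero> \<odot>\<^bsub>N\<^esub> \<zero>\<^bsub>N\<^esub>) = \<zero> \<odot>\<^bsub>N'\<^esub> f \<zero>\<^bsub>N\<^esub>" using mod_homD(3)[OF f, of \<zero> "\<zero>\<^bsub>N\<^esub>"] by simp
 then show ?thesis using mod_homD(1)[OF f, of "\<zero>\<^bsub>N\<^esub>"] by simp
qed

lemmas d_minus = hom_minus[OF d_hom mod_E mod_E] and d_zero = hom_zero[OF d_hom mod_E mod_E]
lemmas eps_zero = hom_zero[OF eps_hom mod_M mod_E]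

lemma eps_inj: "x \<in> carrier M ==> y \<in> carrier M ==> \<epsilon> x = \<epsilon> y ==> x = y"
 using res unfolding injective_resolution_def inj_on_def by blast

lemma eps_exact: "x \<in> carrier (E 0) ==> d 0 x = \<zero>\<^bsub>E (Suc 0)\<^esub> ==> \<exists>a\<in>carrier M. x = \<epsilon> a"
proof -
 assume x: "x \<in> carrier (E 0)" "d 0 x = \<zero>\<^bsub>E (Suc 0)\<^esub>"
 have "\<epsilon> ` carrier M = {x \<in> carrier (E 0). d 0 x = \<zero>\<^bsub>E 1\<^esub>}"
  using res unfolding injective_resolution_def by blast
 then show ?thesis using x by auto
qed

lemma d_eps: "a \<in> carrier M ==> d 0 (\<epsilon> a) = \<zero>\<^bsub>E (Suc 0)\<^esub>"
proof -
 assume a: "a \<in> carrier M"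
 have "\<epsilon> ` carrier M = {x \<in> carrier (E 0). d 0 x = \<zero>\<^bsub>E 1\<^esub>}"
  using res unfolding injective_resolution_def by blast
 then show ?thesis using a by auto
qed

lemma exact: "d i ` carrier (E i) = {x \<in> carrier (E (Suc i)). d (Suc i) x = \<zero>\<^bsub>E (Suc (Suc i))\<^esub>}"
 using res unfolding injective_resolution_def by blast

lemma d_d: "x \<in> carrier (E i) ==> d (Suc i) (d i x) = \<zero>\<^bsub>E (Suc (Suc i))\<^esub>"
 using exact[of i] by blast

lemma d_exact: "x \<in> carrier (E (Suc i)) ==> d (Suc i) x = \<zero>\<^bsub>E (Suc (Suc i))\<^esub> ==> \<exists>y\<in>carrier (E i). d i y = x"
proof -
 assume "x \<in> carrier (E (Suc i))" "d (Suc i) x = \<zero>\<^bsub>E (Suc (Suc i))\<^esub>"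
 then have "x \<in> d i ` carrier (E i)" using exact[of i] by simp
 then show ?thesis by auto
qed

text \<open>Baer's criterion: a homomorphism from \<open>J\<close> extends to \<open>R\<close>,
  where it is determined by its value \<open>e\<close> at one.\<close>

lemma extend:
 assumes J: "ideal J R" and h: "\<And>r. r \<in> J ==> h r \<in> carrier (E i)"
  "\<And>r r'. r \<in> J ==> r' \<in> J ==> h (r \<oplus> r') = h r \<oplus>\<^bsub>E i\<^esub> h r'"
  "\<And>a r. a \<in> carrier R ==> r \<in> J ==> h (a \<otimes> r) = a \<odot>\<^bsub>E i\<^esub> h r"
 shows "\<exists>e\<in>carrier (E i). \<forall>r\<in>J. h r = r \<odot>\<^bsub>E i\<^esub> e" proof -
 interpret J: ideal J R by (rule J)
 have "restrict h J \<in> mod_hom R (as_module R J) (E i)"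
  by (rule mod_homI) (use h J.a_closed J.I_l_closed in auto)
 then obtain g where g: "g \<in> mod_hom R (self_module R) (E i)" "\<forall>x\<in>J. g x = restrict h J x"
  using res J unfolding injective_resolution_def injective_module_def by blast
 have "h r = r \<odot>\<^bsub>E i\<^esub> g \<one>" if "r \<in> J" for r
  using mod_homD(3)[OF g(1), of r \<one>] g(2) that J.Icarr by fastforce
 moreover have "g \<one> \<in> carrier (E i)" using mod_homD(1)[OF g(1)] by simp
 ultimately show ?thesis by blast
qed

text \<open>The map that sends \<open>j + az\<close> to \<open>ae\<close> on \<open>J + Rz\<close>
  is well defined by \<open>ann\<close>, and \<open>x\<close> comes from extending it to
  \<open>R\<close>.\<close>

lemma extend_cyclic:
 assumes J: "ideal J R" and z: "z \<in> carrier R" and e: "e \<in> carrier (E i)"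
  and ann: "\<And>a. a \<in> carrier R ==> a \<otimes> z \<in> J ==> a \<odot>\<^bsub>E i\<^esub> e = \<zero>\<^bsub>E i\<^esub>"
 obtains x where "x \<in> carrier (E i)" "\<And>r. r \<in> J ==> r \<odot>\<^bsub>E i\<^esub> x = \<zero>\<^bsub>E i\<^esub>" "z \<odot>\<^bsub>E i\<^esub> x = e"
proof -
 interpret J: ideal J R by (rule J)
 let ?J = "J <+>\<^bsub>R\<^esub> PIdl z"
 note J' = add_cgenideal(1)[OF J z] and mem = add_cgenideal(2)[OF J z]
 define h where "h w = (SOME y. \<exists>j\<in>J. \<exists>a\<in>carrier R. w = j \<oplus> a \<otimes> z \<and> y = a \<odot>\<^bsub>E i\<^esub> e)" for w
 have hval: "h (j \<oplus> a \<otimes> z) = a \<odot>\<^bsub>E i\<^esub> e" if ja: "j \<in> J" "a \<in> carrier R" for j a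
 proof -
  have "y = a \<odot>\<^bsub>E i\<^esub> e" if y: "\<exists>j'\<in>J. \<exists>a'\<in>carrier R. j \<oplus> a \<otimes> z = j' \<oplus> a' \<otimes> z \<and> y = a' \<odot>\<^bsub>E i\<^esub> e" for y
  proof -
   obtain j' a' where *: "j' \<in> J" "a' \<in> carrier R" "j \<oplus> a \<otimes> z = j' \<oplus> a' \<otimes> z" "y = a' \<odot>\<^bsub>E i\<^esub> e" using y by blast
   have c: "j \<in> carrier R" "j' \<in> carrier R" using ja * J.Icarr by auto
   have "(a \<ominus> a') \<otimes> z = (j \<oplus> a \<otimes> z) \<ominus> (j \<oplus> a' \<otimes> z)" using c ja(2) *(2) z by algebra
   also have "\<dots> = (j' \<oplus> a' \<otimes> z) \<ominus> (j \<oplus> a' \<otimes> z)" unfolding *(3) ..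
   also have "\<dots> = j' \<ominus> j" using c ja(2) *(2) z by algebra
   finally have "(a \<ominus> a') \<otimes> z \<in> J" using ja(1) *(1) J.a_closed J.a_inv_closed by (simp add: a_minus_def)
   then have "(a \<ominus> a') \<odot>\<^bsub>E i\<^esub> e = \<zero>\<^bsub>E i\<^esub>" using ann ja * by simp
   moreover have "a \<odot>\<^bsub>E i\<^esub> e = ((a \<ominus> a') \<oplus> a') \<odot>\<^bsub>E i\<^esub> e"
   proof -
    have "(a \<ominus> a') \<oplus> a' = a" using ja * by algebra
    then show ?thesis by simp
   qed
   ultimately show ?thesis using ja * e E.smult_l_distr[of "a \<ominus> a'" a' e i] by simp
  qed
  moreover have "\<exists>j'\<in>J. \<exists>a'\<in>carrier R. j \<oplus> a \<otimes> z = j' \<oplus> a' \<otimes> z \<and> a \<odot>\<^bsub>E i\<^esub> e = a' \<odot>\<^bsub>E i\<^esub> e" using ja by blast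
  ultimately show ?thesis unfolding h_def by (intro some_equality) blast+
 qed
 have "\<exists>x\<in>carrier (E i). \<forall>r\<in>?J. h r = r \<odot>\<^bsub>E i\<^esub> x"
 proof (rule extend[OF J', of h])
  show "h r \<in> carrier (E i)" if "r \<in> ?J" for r using that hval e unfolding mem by auto
  show "h (r \<oplus> r') = h r \<oplus>\<^bsub>E i\<^esub> h r'" if rr: "r \<in> ?J" "r' \<in> ?J" for r r'
  proof -
   obtain j a j' a' where *: "j \<in> J" "a \<in> carrier R" "r = j \<oplus> a \<otimes> z" "j' \<in> J" "a' \<in> carrier R" "r' = j' \<oplus> a' \<otimes> z"
    using rr unfolding mem by blast
   have c: "j \<in> carrier R" "j' \<in> carrier R" using * J.Icarr by auto
   have "r \<oplus> r' = (j \<oplus> j') \<oplus> (a \<oplus> a') \<otimes> z" unfolding * using c *(2,5) z by algebra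
   then show ?thesis using hval[of "j \<oplus> j'" "a \<oplus> a'"] hval[of j a] hval[of j' a'] * J.a_closed e
    by (simp add: E.smult_l_distr)
  qed
  show "h (b \<otimes> r) = b \<odot>\<^bsub>E i\<^esub> h r" if br: "b \<in> carrier R" "r \<in> ?J" for b r
  proof -
   obtain j a where *: "j \<in> J" "a \<in> carrier R" "r = j \<oplus> a \<otimes> z" using br unfolding mem by blast
   have c: "j \<in> carrier R" using * J.Icarr by auto
   have "b \<otimes> r = (b \<otimes> j) \<oplus> (b \<otimes> a) \<otimes> z" unfolding * using c *(2) br z by algebra
   then show ?thesis using hval[of "b \<otimes> j" "b \<otimes> a"] hval[of j a] * J.I_l_closed e br
    by (simp add: E.smult_assoc1)
  qed
 qed
 then obtain x where x: "x \<in> carrier (E i)" "\<And>r. r \<in> ?J ==> h r = r \<odot>\<^bsub>E i\<^esub> x" by blast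
 show thesis proof (rule that[OF x(1)])
  fix r assume r: "r \<in> J"
  have "r = r \<oplus> \<zero> \<otimes> z" using r z J.Icarr by simp
  then have "r \<in> ?J" "h r = \<zero> \<odot>\<^bsub>E i\<^esub> e" using hval[OF r zero_closed] r mem by auto
  then show "r \<odot>\<^bsub>E i\<^esub> x = \<zero>\<^bsub>E i\<^esub>" using x(2)[of r] e by simp
 next
  have "z = \<zero> \<oplus> \<one> \<otimes> z" using z by simp
  then have "z \<in> ?J" "h z = \<one> \<odot>\<^bsub>E i\<^esub> e"
   using hval[OF J.zero_closed one_closed] J.zero_closed one_closed unfolding mem by metis+
  then show "z \<odot>\<^bsub>E i\<^esub> x = e" using x(2)[of z] e by simp
 qed
qed

end

text \<open>
 A local ring of finite injective dimension in which \<open>s\<close> is a nonzerodivisor and \<open>R / sR\<close> has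
 finite length: the socle of \<open>R / sR\<close> is simple.
\<close>

locale local_injective_res = injective_res R "self_module R" \<epsilon> E d + noetherian_ring R
 for R :: "('a, 'm) ring_scheme" (structure) and \<epsilon> :: "'a => 'c" and E :: "nat => ('a, 'c) module" and d +
 fixes m s n
 assumes m: "ideal m R" and unit: "a \<in> carrier R ==> a \<notin> m ==> a \<in> Units R"
  and s: "s \<in> m" and nzd: "x \<in> carrier R ==> s \<otimes> x = \<zero> ==> x = \<zero>"
  and artin: "ideal J R ==> s \<in> J ==> J \<noteq> carrier R ==> \<exists>z\<in>carrier R. z \<notin> J \<and> (\<forall>r\<in>m. r \<otimes> z \<in> J)"
  and proper: "m \<noteq> carrier R"
  and bounded: "n < i ==> carrier (E i) = {\<zero>\<^bsub>E i\<^esub>}"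
begin

lemma s_closed: "s \<in> carrier R" using s ideal.Icarr[OF m] by blast

lemma sR: "ideal (PIdl s) R" "s \<in> PIdl s" "x \<in> PIdl s \<longleftrightarrow> (\<exists>a\<in>carrier R. x = s \<otimes> a)"
 using cgenideal_ideal[OF s_closed] cgenideal_self[OF s_closed] by (auto simp: cgenideal_def m_comm s_closed)

lemma divisible:
 assumes "e \<in> carrier (E i)"
 obtains x where "x \<in> carrier (E i)" "s \<odot>\<^bsub>E i\<^esub> x = e"
proof (rule extend_cyclic[OF zeroideal s_closed assms])
 fix a assume "a \<in> carrier R" "a \<otimes> s \<in> {\<zero>}"
 then have "a = \<zero>" using nzd[of a] s_closed by (simp add: m_comm)
 then show "a \<odot>\<^bsub>E i\<^esub> e = \<zero>\<^bsub>E i\<^esub>" using assms by simp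
qed (use that in blast)

lemma nonunit: "a \<in> carrier R ==> z \<in> carrier R ==> ideal J R ==> a \<otimes> z \<in> J ==> z \<notin> J ==> a \<in> m"
proof (rule ccontr)
 assume *: "a \<in> carrier R" "z \<in> carrier R" "ideal J R" "a \<otimes> z \<in> J" "z \<notin> J" "a \<notin> m"
 have "a \<in> Units R" using unit * by blast
 then have "z = inv a \<otimes> (a \<otimes> z)" using * by simp
 moreover have "inv a \<otimes> (a \<otimes> z) \<in> J" using ideal.I_l_closed[OF *(3,4)] \<open>a \<in> Units R\<close> by simp
 ultimately show False using * by simp
qed

text \<open>
 \<open>lift i\<close> says that \<open>Hom(R/J, E_i) \<rightarrow> Hom(R/J, Z_{i+1})\<close> is surjective for all \<open>J\<close> containing \<open>s\<close>,
 where \<open>Z_{i+1}\<close> is the kernel of \<open>d_{i+1}\<close>; equivalently \<open>Ext^{i+1}(R/J, R) = 0\<close>.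
\<close>

definition lift :: "nat => 'a set => bool" where
 "lift i J \<longleftrightarrow> (\<forall>y\<in>carrier (E (Suc i)). d (Suc i) y = \<zero>\<^bsub>E (Suc (Suc i))\<^esub> \<and>
   (\<forall>r\<in>J. r \<odot>\<^bsub>E (Suc i)\<^esub> y = \<zero>\<^bsub>E (Suc i)\<^esub>) -->
   (\<exists>e\<in>carrier (E i). d i e = y \<and> (\<forall>r\<in>J. r \<odot>\<^bsub>E i\<^esub> e = \<zero>\<^bsub>E i\<^esub>)))"

lemma liftD:
 assumes "lift i J" "y \<in> carrier (E (Suc i))" "d (Suc i) y = \<zero>\<^bsub>E (Suc (Suc i))\<^esub>"
  "\<And>r. r \<in> J ==> r \<odot>\<^bsub>E (Suc i)\<^esub> y = \<zero>\<^bsub>E (Suc i)\<^esub>"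
 obtains e where "e \<in> carrier (E i)" "d i e = y" "\<And>r. r \<in> J ==> r \<odot>\<^bsub>E i\<^esub> e = \<zero>\<^bsub>E i\<^esub>"
 using assms unfolding lift_def by blast

text \<open>Injectivity provides a \<open>c\<close> with \<open>zc = y\<close> that is killed by
  \<open>J\<close>, but it may fail to be a cocycle. Its coboundary is killed by
  \<open>J + Rz\<close>, so by \<open>L\<close> it is also the coboundary of some \<open>e\<close>
  killed by \<open>J + Rz\<close>; the difference \<open>c - e\<close> has all four
  properties.\<close>

lemma cocycle_extend:
 assumes L: "\<And>J. ideal J R ==> s \<in> J ==> lift (Suc i) J" and J: "ideal J R" "s \<in> J"
  and z: "z \<in> carrier R" "z \<notin> J"
  and y: "y \<in> carrier (E (Suc i))" "d (Suc i) y = \<zero>\<^bsub>E (Suc (Suc i))\<^esub>" "\<And>r. r \<in> m ==> r \<odot>\<^bsub>E (Suc i)\<^esub> y = \<zero>\<^bsub>E (Suc i)\<^esub>"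
 obtains c where "c \<in> carrier (E (Suc i))" "d (Suc i) c = \<zero>\<^bsub>E (Suc (Suc i))\<^esub>" "z \<odot>\<^bsub>E (Suc i)\<^esub> c = y"
  "\<And>r. r \<in> J ==> r \<odot>\<^bsub>E (Suc i)\<^esub> c = \<zero>\<^bsub>E (Suc i)\<^esub>"
proof -
 interpret J: ideal J R by (rule J)
 let ?E = "E (Suc i)" and ?E' = "E (Suc (Suc i))"
 obtain c where c: "c \<in> carrier ?E" "\<And>r. r \<in> J ==> r \<odot>\<^bsub>?E\<^esub> c = \<zero>\<^bsub>?E\<^esub>" "z \<odot>\<^bsub>?E\<^esub> c = y"
  using extend_cyclic[OF J(1) z(1) y(1)] y(3) nonunit z J by metis
 let ?J = "J <+>\<^bsub>R\<^esub> PIdl z"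
 note J' = add_cgenideal(1)[OF J(1) z(1)] and mem = add_cgenideal(2)[OF J(1) z(1)]
  and JJ = add_cgenideal(3)[OF J(1) z(1)] and zJ = add_cgenideal(4)[OF J(1) z(1)]
 let ?w = "d (Suc i) c"
 have wc: "?w \<in> carrier ?E'" using d_closed c by blast
 have "r \<odot>\<^bsub>?E'\<^esub> ?w = \<zero>\<^bsub>?E'\<^esub>" if r: "r \<in> ?J" for r proof -
  obtain j a where ja: "j \<in> J" "a \<in> carrier R" "r = j \<oplus> a \<otimes> z" using r unfolding mem by blast
  have jc: "j \<in> carrier R" using ja J.Icarr by blast
  have "r \<odot>\<^bsub>?E'\<^esub> ?w = d (Suc i) (r \<odot>\<^bsub>?E\<^esub> c)" using d_smult c ja jc z by simp
  also have "r \<odot>\<^bsub>?E\<^esub> c = a \<odot>\<^bsub>?E\<^esub> y"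
   using c ja jc z y by (simp add: E.smult_l_distr E.smult_assoc1)
  also have "d (Suc i) \<dots> = \<zero>\<^bsub>?E'\<^esub>" using d_smult[of a y "Suc i"] ja y by simp
  finally show ?thesis .
 qed
 from liftD[OF L[OF J' JJ[OF J(2)]] wc d_d[OF c(1)] this]
 obtain e where e: "e \<in> carrier ?E" "d (Suc i) e = ?w" "\<And>r. r \<in> ?J ==> r \<odot>\<^bsub>?E\<^esub> e = \<zero>\<^bsub>?E\<^esub>"
  by auto
 have sub: "r \<odot>\<^bsub>?E\<^esub> (c \<ominus>\<^bsub>?E\<^esub> e) = r \<odot>\<^bsub>?E\<^esub> c" if "r \<in> ?J" for r
 proof -
  have rc: "r \<in> carrier R" using that ideal.Icarr[OF J'] by blast
  have "r \<odot>\<^bsub>?E\<^esub> (c \<ominus>\<^bsub>?E\<^esub> e) = r \<odot>\<^bsub>?E\<^esub> c \<ominus>\<^bsub>?E\<^esub> r \<odot>\<^bsub>?E\<^esub> e"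
   using rc c e by (simp add: a_minus_def E.smult_r_distr E.smult_r_minus)
  moreover have "\<ominus>\<^bsub>?E\<^esub> \<zero>\<^bsub>?E\<^esub> = \<zero>\<^bsub>?E\<^esub>" by (rule E.M.minus_equality) auto
  ultimately show ?thesis using e(3)[OF that] rc c by (simp add: a_minus_def)
 qed
 show thesis proof (rule that[of "c \<ominus>\<^bsub>?E\<^esub> e"])
  show "c \<ominus>\<^bsub>?E\<^esub> e \<in> carrier ?E" using c e by simp
  show "d (Suc i) (c \<ominus>\<^bsub>?E\<^esub> e) = \<zero>\<^bsub>?E'\<^esub>"
   using d_minus[OF c(1) e(1)] e(2) wc by (simp add: a_minus_def E.M.r_neg)
  show "z \<odot>\<^bsub>?E\<^esub> (c \<ominus>\<^bsub>?E\<^esub> e) = y" using sub[OF zJ] c by simp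
  show "r \<odot>\<^bsub>?E\<^esub> (c \<ominus>\<^bsub>?E\<^esub> e) = \<zero>\<^bsub>?E\<^esub>" if "r \<in> J" for r using sub[OF JJ[OF that]] c that by simp
 qed
qed

text \<open>For a socle element \<open>v\<close> modulo \<open>s\<close> one can write
  \<open>y = vc\<close> with a cocycle \<open>c\<close> killed by \<open>s\<close>. Since
  \<open>E_i\<close> is divisible by \<open>s\<close>, a preimage of \<open>c\<close> can be
  corrected until \<open>s\<close> kills it, and then \<open>m\<close> kills \<open>v\<close> times
  this preimage.\<close>

lemma lift_residue:
 assumes L: "\<And>J. ideal J R ==> s \<in> J ==> lift (Suc (Suc i)) J"
 shows "lift (Suc i) m" unfolding lift_def proof (intro ballI impI)
 let ?E = "E (Suc i)" and ?E' = "E (Suc (Suc i))"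
 fix y assume y: "y \<in> carrier ?E'"
  and "d (Suc (Suc i)) y = \<zero>\<^bsub>E (Suc (Suc (Suc i)))\<^esub> \<and> (\<forall>r\<in>m. r \<odot>\<^bsub>?E'\<^esub> y = \<zero>\<^bsub>?E'\<^esub>)"
 then have y': "d (Suc (Suc i)) y = \<zero>\<^bsub>E (Suc (Suc (Suc i)))\<^esub>" "\<And>r. r \<in> m ==> r \<odot>\<^bsub>?E'\<^esub> y = \<zero>\<^bsub>?E'\<^esub>" by auto
 have "PIdl s \<noteq> carrier R" using proper s cgenideal_minimal[OF m s] ideal.Icarr[OF m] by blast
 then obtain v where v: "v \<in> carrier R" "v \<notin> PIdl s" "\<And>r. r \<in> m ==> r \<otimes> v \<in> PIdl s"
  using artin[OF sR(1,2)] by blast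
 obtain c where c: "c \<in> carrier ?E'" "d (Suc (Suc i)) c = \<zero>\<^bsub>E (Suc (Suc (Suc i)))\<^esub>" "v \<odot>\<^bsub>?E'\<^esub> c = y"
  "\<And>r. r \<in> PIdl s ==> r \<odot>\<^bsub>?E'\<^esub> c = \<zero>\<^bsub>?E'\<^esub>"
  using cocycle_extend[OF L sR(1,2) v(1,2) y y'] by blast
 obtain e1 where e1: "e1 \<in> carrier ?E" "d (Suc i) e1 = c" using d_exact c by blast
 have "d (Suc i) (s \<odot>\<^bsub>?E\<^esub> e1) = \<zero>\<^bsub>?E'\<^esub>" using d_smult[OF s_closed e1(1)] e1(2) c(4)[OF sR(2)] by simp
 then obtain e2 where e2: "e2 \<in> carrier (E i)" "d i e2 = s \<odot>\<^bsub>?E\<^esub> e1" using d_exact e1 s_closed by blast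
 obtain e3 where e3: "e3 \<in> carrier (E i)" "s \<odot>\<^bsub>E i\<^esub> e3 = e2" using divisible[OF e2(1)] by blast
 let ?f = "e1 \<ominus>\<^bsub>?E\<^esub> d i e3"
 have d3: "d i e3 \<in> carrier ?E" using d_closed e3 by blast
 have fc: "?f \<in> carrier ?E" using e1 d3 by simp
 have sf: "s \<odot>\<^bsub>?E\<^esub> ?f = \<zero>\<^bsub>?E\<^esub>" proof -
  have "s \<odot>\<^bsub>?E\<^esub> ?f = s \<odot>\<^bsub>?E\<^esub> e1 \<ominus>\<^bsub>?E\<^esub> s \<odot>\<^bsub>?E\<^esub> d i e3"
   using e1 d3 s_closed by (simp add: a_minus_def E.smult_r_distr E.smult_r_minus)
  also have "s \<odot>\<^bsub>?E\<^esub> d i e3 = s \<odot>\<^bsub>?E\<^esub> e1" using d_smult[OF s_closed e3(1)] e3(2) e2(2) by simp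
  finally show ?thesis using e1 s_closed by (simp add: a_minus_def E.M.r_neg)
 qed
 have df: "d (Suc i) ?f = c" proof -
  have "\<ominus>\<^bsub>?E'\<^esub> \<zero>\<^bsub>?E'\<^esub> = \<zero>\<^bsub>?E'\<^esub>" by (rule E.M.minus_equality) auto
  then show ?thesis using d_minus[OF e1(1) d3] d_d[OF e3(1)] e1(2) c(1) by (simp add: a_minus_def)
 qed
 show "\<exists>e\<in>carrier ?E. d (Suc i) e = y \<and> (\<forall>r\<in>m. r \<odot>\<^bsub>?E\<^esub> e = \<zero>\<^bsub>?E\<^esub>)"
 proof (intro bexI[of _ "v \<odot>\<^bsub>?E\<^esub> ?f"] conjI ballI)
  show "d (Suc i) (v \<odot>\<^bsub>?E\<^esub> ?f) = y" using d_smult[OF v(1) fc] df c(3) by simp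
  show "v \<odot>\<^bsub>?E\<^esub> ?f \<in> carrier ?E" using v fc by simp
  fix r assume r: "r \<in> m"
  then have rc: "r \<in> carrier R" using ideal.Icarr[OF m] by blast
  obtain a where a: "a \<in> carrier R" "r \<otimes> v = s \<otimes> a" using v(3)[OF r] sR(3) by blast
  have "r \<odot>\<^bsub>?E\<^esub> (v \<odot>\<^bsub>?E\<^esub> ?f) = (a \<otimes> s) \<odot>\<^bsub>?E\<^esub> ?f"
   using rc v(1) fc a s_closed by (simp add: m_comm flip: E.smult_assoc1)
  also have "\<dots> = a \<odot>\<^bsub>?E\<^esub> (s \<odot>\<^bsub>?E\<^esub> ?f)" using a(1) s_closed fc by (rule E.smult_assoc1)
  finally show "r \<odot>\<^bsub>?E\<^esub> (v \<odot>\<^bsub>?E\<^esub> ?f) = \<zero>\<^bsub>?E\<^esub>" using sf a by simp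
 qed
qed

text \<open>Noetherian induction along \<open>J\<close> and \<open>J + Rz\<close>, whose quotient is
  a copy of \<open>R/m\<close>; this is the long exact sequence on elements. First \<open>zy\<close>
  is lifted, the lift is extended so that \<open>J\<close> kills it, and the remaining cocycle is
  killed by \<open>J + Rz\<close>.\<close>

lemma lift_all:
 assumes k: "lift i m" and J: "ideal J R" "s \<in> J" shows "lift i J" using J(2)
proof (induction rule: ideal_induct[OF _ J(1)])
 case (1 J)
 note J = 1(1,3) and IH = 1(2)
 interpret J: ideal J R by (rule J)
 show ?case proof (cases "J = carrier R")
  case True
  show ?thesis unfolding lift_def proof (intro ballI impI)
   fix y assume "y \<in> carrier (E (Suc i))"
    "d (Suc i) y = \<zero>\<^bsub>E (Suc (Suc i))\<^esub> \<and> (\<forall>r\<in>J. r \<odot>\<^bsub>E (Suc i)\<^esub> y = \<zero>\<^bsub>E (Suc i)\<^esub>)"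
   then have "\<one> \<odot>\<^bsub>E (Suc i)\<^esub> y = \<zero>\<^bsub>E (Suc i)\<^esub>" "y \<in> carrier (E (Suc i))" using True one_closed by blast+
   then have "y = \<zero>\<^bsub>E (Suc i)\<^esub>" by simp
   then show "\<exists>e\<in>carrier (E i). d i e = y \<and> (\<forall>r\<in>J. r \<odot>\<^bsub>E i\<^esub> e = \<zero>\<^bsub>E i\<^esub>)"
    using d_zero J.Icarr by (intro bexI[of _ "\<zero>\<^bsub>E i\<^esub>"]) (auto simp: E.smult_r_null)
  qed
 next
  case False
  then obtain z where z: "z \<in> carrier R" "z \<notin> J" "\<And>r. r \<in> m ==> r \<otimes> z \<in> J" using artin[OF J] by blast
  let ?J = "J <+>\<^bsub>R\<^esub> PIdl z"
  note J' = add_cgenideal(1)[OF J(1) z(1)] and mem = add_cgenideal(2)[OF J(1) z(1)]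
   and JJ = add_cgenideal(3)[OF J(1) z(1)] and zJ = add_cgenideal(4)[OF J(1) z(1)]
  have L': "lift i ?J" using IH[OF J' _ JJ[OF J(2)]] JJ zJ z(2) by blast
  show ?thesis unfolding lift_def proof (intro ballI impI)
   let ?E' = "E (Suc i)"
   fix y assume y: "y \<in> carrier ?E'"
    and "d (Suc i) y = \<zero>\<^bsub>E (Suc (Suc i))\<^esub> \<and> (\<forall>r\<in>J. r \<odot>\<^bsub>?E'\<^esub> y = \<zero>\<^bsub>?E'\<^esub>)"
   then have y': "d (Suc i) y = \<zero>\<^bsub>E (Suc (Suc i))\<^esub>" "\<And>r. r \<in> J ==> r \<odot>\<^bsub>?E'\<^esub> y = \<zero>\<^bsub>?E'\<^esub>" by auto
   have "r \<odot>\<^bsub>?E'\<^esub> (z \<odot>\<^bsub>?E'\<^esub> y) = \<zero>\<^bsub>?E'\<^esub>" if "r \<in> m" for r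
    using y'(2)[OF z(3)[OF that]] E.smult_assoc1[of r z y "Suc i"] z(1) y ideal.Icarr[OF m that] by simp
   moreover have "d (Suc i) (z \<odot>\<^bsub>?E'\<^esub> y) = \<zero>\<^bsub>E (Suc (Suc i))\<^esub>"
    using d_smult[OF z(1) y] y'(1) z(1) by simp
   ultimately obtain e1 where e1: "e1 \<in> carrier (E i)" "d i e1 = z \<odot>\<^bsub>?E'\<^esub> y" "\<And>r. r \<in> m ==> r \<odot>\<^bsub>E i\<^esub> e1 = \<zero>\<^bsub>E i\<^esub>"
    using k z(1) y unfolding lift_def by (metis E.smult_closed)
   obtain e2 where e2: "e2 \<in> carrier (E i)" "\<And>r. r \<in> J ==> r \<odot>\<^bsub>E i\<^esub> e2 = \<zero>\<^bsub>E i\<^esub>" "z \<odot>\<^bsub>E i\<^esub> e2 = e1"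
    using extend_cyclic[OF J(1) z(1) e1(1)] e1(3) nonunit z J(1) by metis
   let ?y = "y \<ominus>\<^bsub>?E'\<^esub> d i e2"
   have d2: "d i e2 \<in> carrier ?E'" using d_closed e2 by blast
   have neg0: "\<ominus>\<^bsub>E j\<^esub> \<zero>\<^bsub>E j\<^esub> = \<zero>\<^bsub>E j\<^esub>" for j by (rule E.M.minus_equality) auto
   have act: "r \<odot>\<^bsub>?E'\<^esub> ?y = r \<odot>\<^bsub>?E'\<^esub> y \<ominus>\<^bsub>?E'\<^esub> d i (r \<odot>\<^bsub>E i\<^esub> e2)" if "r \<in> carrier R" for r
    using that y d2 d_smult[OF that e2(1)] by (simp add: a_minus_def E.smult_r_distr E.smult_r_minus)
   have zy: "z \<odot>\<^bsub>?E'\<^esub> ?y = \<zero>\<^bsub>?E'\<^esub>"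
    using act[OF z(1)] e2(3) e1(2) z(1) y by (simp add: a_minus_def E.M.r_neg)
   have jy: "j \<odot>\<^bsub>?E'\<^esub> ?y = \<zero>\<^bsub>?E'\<^esub>" if "j \<in> J" for j
    using act[OF J.Icarr[OF that]] e2(2)[OF that] y'(2)[OF that] d_zero[of i] by (simp add: a_minus_def neg0)
   have yc: "?y \<in> carrier ?E'" using y d2 by simp
   have "r \<odot>\<^bsub>?E'\<^esub> ?y = \<zero>\<^bsub>?E'\<^esub>" if r: "r \<in> ?J" for r proof -
    obtain j a where ja: "j \<in> J" "a \<in> carrier R" "r = j \<oplus> a \<otimes> z" using r unfolding mem by blast
    then have "r \<odot>\<^bsub>?E'\<^esub> ?y = j \<odot>\<^bsub>?E'\<^esub> ?y \<oplus>\<^bsub>?E'\<^esub> a \<odot>\<^bsub>?E'\<^esub> (z \<odot>\<^bsub>?E'\<^esub> ?y)"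
     using yc z(1) J.Icarr by (simp add: E.smult_l_distr E.smult_assoc1)
    then show ?thesis using jy[OF ja(1)] zy ja by simp
   qed
   note Jy = this
   have "d (Suc i) ?y = \<zero>\<^bsub>E (Suc (Suc i))\<^esub>"
    using d_minus[OF y d2] d_d[OF e2(1)] y'(1) by (simp add: a_minus_def neg0)
   from liftD[OF L' yc this Jy]
   obtain e3 where e3: "e3 \<in> carrier (E i)" "d i e3 = ?y" "\<And>r. r \<in> ?J ==> r \<odot>\<^bsub>E i\<^esub> e3 = \<zero>\<^bsub>E i\<^esub>"
    by auto
   show "\<exists>e\<in>carrier (E i). d i e = y \<and> (\<forall>r\<in>J. r \<odot>\<^bsub>E i\<^esub> e = \<zero>\<^bsub>E i\<^esub>)"
   proof (intro bexI[of _ "e2 \<oplus>\<^bsub>E i\<^esub> e3"] conjI ballI)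
    show "d i (e2 \<oplus>\<^bsub>E i\<^esub> e3) = y" using d_add[OF e2(1) e3(1)] e3(2) y d2
     by (simp add: a_minus_def E.M.a_comm[of y] E.M.r_neg2)
    show "e2 \<oplus>\<^bsub>E i\<^esub> e3 \<in> carrier (E i)" using e2 e3 by simp
    fix r assume "r \<in> J"
    then show "r \<odot>\<^bsub>E i\<^esub> (e2 \<oplus>\<^bsub>E i\<^esub> e3) = \<zero>\<^bsub>E i\<^esub>"
     using e2 e3(1) e3(3)[OF JJ] J.Icarr by (simp add: E.smult_r_distr)
   qed
  qed
 qed
qed

text \<open>Descending induction on the degree, starting above \<open>n\<close> where the resolution
  vanishes. It ends at the vanishing of \<open>Ext^2(R/J, R)\<close>, because
  \<open>lift_residue\<close> divides by \<open>s\<close> in the preceding term of the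
  resolution.\<close>

lemma lift_1: "ideal J R ==> s \<in> J ==> lift 1 J" proof -
 have "lift (Suc i) J" if "ideal J R" "s \<in> J" "Suc n = i + k" for i k J using that
 proof (induction k arbitrary: i J)
  case 0
  show ?case unfolding lift_def proof (intro ballI impI)
   fix y assume y: "y \<in> carrier (E (Suc (Suc i)))"
   then have "y = \<zero>\<^bsub>E (Suc (Suc i))\<^esub>" using bounded[of "Suc (Suc i)"] 0 by auto
   then show "\<exists>e\<in>carrier (E (Suc i)). d (Suc i) e = y \<and> (\<forall>r\<in>J. r \<odot>\<^bsub>E (Suc i)\<^esub> e = \<zero>\<^bsub>E (Suc i)\<^esub>)"
    using d_zero ideal.Icarr[OF 0(1)] by (intro bexI[of _ "\<zero>\<^bsub>E (Suc i)\<^esub>"]) (auto simp: E.smult_r_null)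
  qed
 next
  case (Suc k)
  have "lift (Suc (Suc i)) J" if "ideal J R" "s \<in> J" for J using Suc.IH[of J "Suc i"] that Suc.prems by simp
  then have "lift (Suc i) m" using lift_residue by blast
  then show ?case using lift_all Suc.prems by blast
 qed
 from this[of J 0 "Suc n"] show "ideal J R ==> s \<in> J ==> lift 1 J" by simp
qed

text \<open>
 If \<open>X, Y\<close> were independent in the socle of \<open>R / sR\<close>, then by injectivity some \<open>b\<close> would satisfy
 \<open>b Y = Y\<close> and \<open>b X = 0\<close> modulo \<open>s\<close>, which is impossible in a local ring.
\<close>

theorem socle_simple:
 assumes X: "X \<in> carrier R" "X \<notin> PIdl s" "\<And>r. r \<in> m ==> r \<otimes> X \<in> PIdl s"
  and Y: "Y \<in> carrier R" "\<And>r. r \<in> m ==> r \<otimes> Y \<in> PIdl s"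
 shows "Y \<in> PIdl s <+>\<^bsub>R\<^esub> PIdl X" proof (rule ccontr)
 let ?J = "PIdl s <+>\<^bsub>R\<^esub> PIdl X"
 assume nY: "Y \<notin> ?J"
 note J = add_cgenideal(1)[OF sR(1) X(1)] and sJ = add_cgenideal(3)[OF sR(1) X(1)] and XJ = add_cgenideal(4)[OF sR(1) X(1)]
 have mc: "r \<in> carrier R" if "r \<in> m" for r using ideal.Icarr[OF m that] .
 have canc: "a = b" if "a \<in> carrier R" "b \<in> carrier R" "s \<otimes> a = s \<otimes> b" for a b proof -
  have "s \<otimes> (a \<ominus> b) = s \<otimes> a \<ominus> s \<otimes> b" using that(1,2) s_closed by algebra
  then have "s \<otimes> (a \<ominus> b) = \<zero>" using that s_closed by (simp add: a_minus_def r_neg)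
  then have "a \<ominus> b = \<zero>" using nzd that by simp
  then show ?thesis using that by (simp add: r_right_minus_eq)
 qed
 \<comment> \<open>Multiplication by the fraction \<open>Y/s\<close>, which carries \<open>m\<close>
   into \<open>R\<close>.\<close>
 define h where "h r = (THE t. t \<in> carrier R \<and> r \<otimes> Y = s \<otimes> t)" for r
 have h: "h r \<in> carrier R" "r \<otimes> Y = s \<otimes> h r" if r: "r \<in> m" for r proof -
  obtain t where "t \<in> carrier R" "r \<otimes> Y = s \<otimes> t" using Y(2)[OF r] sR(3) by blast
  then have "\<exists>!t. t \<in> carrier R \<and> r \<otimes> Y = s \<otimes> t" using canc by metis
  from theI'[OF this] show "h r \<in> carrier R" "r \<otimes> Y = s \<otimes> h r" unfolding h_def by auto
 qed
 have heq: "h r = t" if "r \<in> m" "t \<in> carrier R" "r \<otimes> Y = s \<otimes> t" for r t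
  using canc[OF h(1)[OF that(1)] that(2)] h(2)[OF that(1)] that(3) by simp
 have m_add: "r \<oplus> r' \<in> m" if "r \<in> m" "r' \<in> m" for r r'
  using additive_subgroup.a_closed[OF ideal.axioms(1)[OF m]] that by blast
 have m_mult: "a \<otimes> r \<in> m" if "a \<in> carrier R" "r \<in> m" for a r using ideal.I_l_closed[OF m that(2,1)] .
 \<comment> \<open>The element \<open>a\<close> represents \<open>Y/s\<close> in \<open>E_0\<close>,
   and its coboundary represents the corresponding class in \<open>Ext^1(R/m, R)\<close>.\<close>
 have "\<exists>a\<in>carrier (E 0). \<forall>r\<in>m. \<epsilon> (h r) = r \<odot>\<^bsub>E 0\<^esub> a"
 proof (rule extend[OF m, of "\<lambda>r. \<epsilon> (h r)" 0])
  show "\<epsilon> (h r) \<in> carrier (E 0)" if "r \<in> m" for r using eps_closed h that by simp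
  show "\<epsilon> (h (r \<oplus> r')) = \<epsilon> (h r) \<oplus>\<^bsub>E 0\<^esub> \<epsilon> (h r')" if "r \<in> m" "r' \<in> m" for r r'
  proof -
   have "h (r \<oplus> r') = h r \<oplus> h r'"
    by (rule heq) (use that h[OF that(1)] h[OF that(2)] m_add Y(1) mc s_closed in \<open>auto simp: l_distr r_distr\<close>)
   then show ?thesis using eps_add[of "h r" "h r'"] h that by simp
  qed
  show "\<epsilon> (h (b \<otimes> r)) = b \<odot>\<^bsub>E 0\<^esub> \<epsilon> (h r)" if "b \<in> carrier R" "r \<in> m" for b r
  proof -
   have "h (b \<otimes> r) = b \<otimes> h r"
    by (rule heq) (use that h[OF that(2)] m_mult Y(1) mc s_closed in \<open>auto simp: m_assoc m_lcomm[of s b]\<close>)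
   then show ?thesis using eps_smult[of b "h r"] h that by simp
  qed
 qed
 then obtain a where a: "a \<in> carrier (E 0)" "\<And>r. r \<in> m ==> \<epsilon> (h r) = r \<odot>\<^bsub>E 0\<^esub> a" by blast
 have sa: "s \<odot>\<^bsub>E 0\<^esub> a = \<epsilon> Y" using a(2)[OF s] heq[OF s Y(1) refl] by simp
 let ?z = "d 0 a"
 have zc: "?z \<in> carrier (E (Suc 0))" using d_closed a by blast
 have mz: "r \<odot>\<^bsub>E (Suc 0)\<^esub> ?z = \<zero>\<^bsub>E (Suc 0)\<^esub>" if "r \<in> m" for r
  using d_smult[OF mc[OF that] a(1)] a(2)[OF that] d_eps[of "h r"] h(1)[OF that] by simp
 have L: "lift (Suc 0) J" if "ideal J R" "s \<in> J" for J using lift_1 that by simp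
 \<comment> \<open>Here \<open>Ext^2 = 0\<close> enters: the class becomes \<open>Yc\<close> for a
   cocycle \<open>c\<close> killed by \<open>s\<close> and \<open>X\<close>. For \<open>e\<close>
   with coboundary \<open>c\<close>, the elements \<open>se\<close>, \<open>Xe\<close> and
   \<open>Ye - a\<close> all come from \<open>R\<close>; comparing them gives \<open>Xb\<close> in
   \<open>sR\<close> and \<open>Yb - Y\<close> in \<open>sR\<close>.\<close>
 obtain c where c: "c \<in> carrier (E (Suc 0))" "d (Suc 0) c = \<zero>\<^bsub>E (Suc (Suc 0))\<^esub>" "Y \<odot>\<^bsub>E (Suc 0)\<^esub> c = ?z"
  "\<And>r. r \<in> ?J ==> r \<odot>\<^bsub>E (Suc 0)\<^esub> c = \<zero>\<^bsub>E (Suc 0)\<^esub>"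
  using cocycle_extend[OF L J sJ[OF sR(2)] Y(1) nY zc d_d[OF a(1)] mz] by blast
 obtain e where e: "e \<in> carrier (E 0)" "d 0 e = c" using d_exact c by blast
 have "d 0 (s \<odot>\<^bsub>E 0\<^esub> e) = \<zero>\<^bsub>E (Suc 0)\<^esub>" using d_smult[OF s_closed e(1)] e(2) c(4)[OF sJ[OF sR(2)]] by simp
 then obtain b where b: "b \<in> carrier R" "s \<odot>\<^bsub>E 0\<^esub> e = \<epsilon> b" using eps_exact[of "s \<odot>\<^bsub>E 0\<^esub> e"] e s_closed by auto
 have eS: "\<epsilon> (r \<otimes> x) = r \<odot>\<^bsub>E 0\<^esub> \<epsilon> x" if "r \<in> carrier R" "x \<in> carrier R" for r x using eps_smult[of r x] that by simp
 have eps_c: "\<epsilon> x \<in> carrier (E 0)" if "x \<in> carrier R" for x using eps_closed[of x] that by simp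
 have einj: "x = y" if "x \<in> carrier R" "y \<in> carrier R" "\<epsilon> x = \<epsilon> y" for x y using eps_inj[of x y] that by simp
 have "d 0 (X \<odot>\<^bsub>E 0\<^esub> e) = \<zero>\<^bsub>E (Suc 0)\<^esub>" using d_smult[OF X(1) e(1)] e(2) c(4)[OF XJ] by simp
 then obtain a2 where a2: "a2 \<in> carrier R" "X \<odot>\<^bsub>E 0\<^esub> e = \<epsilon> a2" using eps_exact[of "X \<odot>\<^bsub>E 0\<^esub> e"] e X by auto
 have sm2: "r \<odot>\<^bsub>E 0\<^esub> (r' \<odot>\<^bsub>E 0\<^esub> e) = r' \<odot>\<^bsub>E 0\<^esub> (r \<odot>\<^bsub>E 0\<^esub> e)" if "r \<in> carrier R" "r' \<in> carrier R" for r r'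
  using that e(1) by (simp add: m_comm flip: E.smult_assoc1)
 have "\<epsilon> (X \<otimes> b) = \<epsilon> (s \<otimes> a2)"
  using eS[OF X(1) b(1)] eS[OF s_closed a2(1)] a2(2) b(2) sm2[OF X(1) s_closed] by simp
 then have Xb: "X \<otimes> b = s \<otimes> a2" using einj X b a2 s_closed by simp
 have Yea: "Y \<odot>\<^bsub>E 0\<^esub> e \<ominus>\<^bsub>E 0\<^esub> a \<in> carrier (E 0)" using Y e a by simp
 have "d 0 (Y \<odot>\<^bsub>E 0\<^esub> e \<ominus>\<^bsub>E 0\<^esub> a) = \<zero>\<^bsub>E (Suc 0)\<^esub>"
  using d_minus[of "Y \<odot>\<^bsub>E 0\<^esub> e" 0 a] d_smult[OF Y(1) e(1)] Y(1) e a(1) c(3) zc by (simp add: a_minus_def E.M.r_neg)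
 then obtain a3 where a3: "a3 \<in> carrier R" "Y \<odot>\<^bsub>E 0\<^esub> e \<ominus>\<^bsub>E 0\<^esub> a = \<epsilon> a3" using eps_exact[OF Yea] by auto
 have Ye: "Y \<odot>\<^bsub>E 0\<^esub> e = \<epsilon> a3 \<oplus>\<^bsub>E 0\<^esub> a"
  using a3(2)[symmetric] Y e a by (simp add: a_minus_def E.M.a_assoc E.M.l_neg)
 have "\<epsilon> (Y \<otimes> b) = Y \<odot>\<^bsub>E 0\<^esub> (s \<odot>\<^bsub>E 0\<^esub> e)" using eS[OF Y(1) b(1)] b(2) by simp
 also have "\<dots> = s \<odot>\<^bsub>E 0\<^esub> (\<epsilon> a3 \<oplus>\<^bsub>E 0\<^esub> a)" using sm2[OF Y(1) s_closed] Ye by simp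
 also have "\<dots> = \<epsilon> (s \<otimes> a3) \<oplus>\<^bsub>E 0\<^esub> \<epsilon> Y"
  using E.smult_r_distr[OF s_closed eps_c[OF a3(1)] a(1)] eS[OF s_closed a3(1)] sa by simp
 also have "\<dots> = \<epsilon> (s \<otimes> a3 \<oplus> Y)" using eps_add[of "s \<otimes> a3" Y] a3 s_closed Y by simp
 finally have Yb: "Y \<otimes> b = s \<otimes> a3 \<oplus> Y" using einj Y b a3 s_closed by simp
 have bm: "b \<in> m" using nonunit[OF b(1) X(1) sR(1) _ X(2)] Xb a2 sR(3) b X by (metis m_comm)
 have "(b \<ominus> \<one>) \<otimes> Y = Y \<otimes> b \<ominus> Y" using b Y(1) by algebra
 also have "\<dots> = s \<otimes> a3" unfolding Yb using a3 Y(1) s_closed by algebra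
 finally have "(b \<ominus> \<one>) \<otimes> Y \<in> PIdl s" using sR(3) a3 by blast
 then have "b \<ominus> \<one> \<in> m" using nonunit[OF _ Y(1) sR(1)] b nY sJ by blast
 then have "\<ominus> (b \<ominus> \<one>) \<oplus> b \<in> m" using m_add bm additive_subgroup.a_inv_closed[OF ideal.axioms(1)[OF m]] by blast
 moreover have "\<ominus> (b \<ominus> \<one>) \<oplus> b = \<one>" using b by algebra
 ultimately show False using proper ideal.one_imp_carrier[OF m] by simp
qed

end

section \<open>Canonical modules are dualizing\<close>

lemma (in plain_module) minus_add_cancel:
 "x \<in> carrier M ==> y \<in> carrier M ==> (x \<ominus>\<^bsub>M\<^esub> y) \<oplus>\<^bsub>M\<^esub> y = x"
 by (simp add: a_minus_def M.a_assoc M.l_neg)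

lemma mod_hom_compose:
 assumes f: "f \<in> mod_hom R M N" and g: "g \<in> mod_hom R N K" and M: "module R M"
 shows "compose (carrier M) g f \<in> mod_hom R M K" proof -
 interpret M: module R M by (rule M)
 show ?thesis by (rule mod_homI) (use mod_homD[OF f] mod_homD[OF g] in \<open>auto simp: compose_def\<close>)
qed

context curve begin

text \<open>
 For \<open>u\<close> in \<open>W : m\<close> choose \<open>e\<close> in \<open>E_0\<close> with \<open>r e = r u\<close> for all \<open>r\<close> in \<open>m\<close>. The class of \<open>d e\<close>
 embeds \<open>(W : m)/W\<close> into \<open>Ext^1(A/m, W)\<close>.
\<close>

lemma len_le_Ext:
 assumes n: "maxl A n" and W: "frac W" and res: "injective_resolution R0 (as_module Q W) \<epsilon> E d"
 defines "k \<equiv> quot_module R0 (as_module Q A) n" shows "len A (colon W n) W <= module_length R0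
  (quot_module R0 ((Hom_module R0 k (E (Suc 0)))\<lparr>carrier := Hom_cocycles R0 k E d (Suc 0)\<rparr>) (Hom_coboundaries R0 k E d (Suc 0)))"
proof -
 interpret I: injective_res R0 "as_module Q W" \<epsilon> E d
  by (intro injective_res.intro injective_res_axioms.intro cring_subr[OF A] res
    module_as_module[OF A frac_smod[OF W]])
 interpret S: plain_module R0 "as_module Q A" by (rule plain_module.intro[OF module_as_module[OF A smod_A]])
 have sn: "submodule n R0 (as_module Q A)" using submodule_as_module[OF A smod_A] n by (auto simp: maxl_def)
 interpret k: plain_module R0 k unfolding k_def by (rule plain_module.intro[OF S.module_quot[OF sn]])
 let ?c = "\<lambda>x. n +>\<^bsub>as_module Q A\<^esub> x"
 have kc: "carrier k = {?c x | x. x \<in> A}" unfolding k_def using S.quot_carrier[OF sn] by simp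
 have kadd: "?c x \<oplus>\<^bsub>k\<^esub> ?c y = ?c (x \<oplus> y)" if "x \<in> A" "y \<in> A" for x y
  unfolding k_def using S.quot_add[OF sn] that by simp
 have ksm: "r \<odot>\<^bsub>k\<^esub> ?c x = ?c (r \<otimes> x)" if "r \<in> A" "x \<in> A" for r x
  unfolding k_def using S.quot_smult[OF sn] that by simp
 have nA: "n <= A" using n by (auto simp: maxl_def)
 have c1: "?c \<one> \<in> carrier k" unfolding kc using one_A by blast
 have ck: "r \<odot>\<^bsub>k\<^esub> ?c \<one> = \<zero>\<^bsub>k\<^esub>" if "r \<in> n" for r proof -
  have "r \<in> A" using that nA by blast
  then show ?thesis using ksm[of r \<one>] one_A S.coset_eq_N_iff[OF sn, of r] that AQ
   unfolding k_def by (auto simp: S.quot_zero[OF sn])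
 qed
 \<comment> \<open>An element killed by \<open>n\<close> gives a homomorphism on \<open>k\<close>;
   its value at a coset is computed from a chosen representative, and \<open>z(2)\<close> makes the
   choice irrelevant.\<close>
 have hom: "\<exists>\<phi>\<in>mod_hom R0 k (E i). \<phi> (?c \<one>) = z"
  if z: "z \<in> carrier (E i)" "\<And>r. r \<in> n ==> r \<odot>\<^bsub>E i\<^esub> z = \<zero>\<^bsub>E i\<^esub>" for i z
 proof
  define \<phi> where "\<phi> = (\<lambda>X\<in>carrier k. (SOME x. x \<in> A \<and> X = ?c x) \<odot>\<^bsub>E i\<^esub> z)"
  have \<phi>v: "\<phi> (?c x) = x \<odot>\<^bsub>E i\<^esub> z" if x: "x \<in> A" for x proof -
   let ?y = "SOME y. y \<in> A \<and> ?c x = ?c y"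
   have y': "?y \<in> A \<and> ?c x = ?c ?y" by (rule someI[of _ x]) (use x in simp)
   then have y: "?y \<in> A" by blast
   let ?D = "x \<ominus>\<^bsub>as_module Q A\<^esub> ?y"
   have "?D \<in> n"
    by (rule S.coset_eq_iff[OF sn, THEN iffD1]) (use x y y' in \<open>auto simp only: as_module_simps\<close>)
   then have xy: "?D \<odot>\<^bsub>E i\<^esub> z = \<zero>\<^bsub>E i\<^esub>" by (rule z(2))
   have "x = ?D \<oplus> ?y" using S.minus_add_cancel[of x ?y] x y by (simp only: as_module_simps)
   moreover have "?D \<in> A" using S.M.minus_closed[of x ?y] x y by simp
   ultimately have "x \<odot>\<^bsub>E i\<^esub> z = ?D \<odot>\<^bsub>E i\<^esub> z \<oplus>\<^bsub>E i\<^esub> ?y \<odot>\<^bsub>E i\<^esub> z"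
    using I.E.smult_l_distr[of ?D ?y z i] y z(1) by simp
   also have "\<dots> = ?y \<odot>\<^bsub>E i\<^esub> z" using xy y z(1) by simp
   finally show ?thesis unfolding \<phi>_def using kc x by auto
  qed
  show "\<phi> (?c \<one>) = z" using \<phi>v[OF one_A] I.E.smult_one[OF z(1)] by simp
  show "\<phi> \<in> mod_hom R0 k (E i)" proof (rule mod_homI)
   show "\<phi> \<in> carrier k \<rightarrow>\<^sub>E carrier (E i)" proof (rule PiE_I)
    fix X assume "X \<in> carrier k"
    then show "\<phi> X \<in> carrier (E i)" using \<phi>v z(1) unfolding kc by auto
   qed (simp add: \<phi>_def)
   show "\<phi> (X \<oplus>\<^bsub>k\<^esub> Y) = \<phi> X \<oplus>\<^bsub>E i\<^esub> \<phi> Y" if "X \<in> carrier k" "Y \<in> carrier k" for X Y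
    using that kadd \<phi>v A_add z(1) I.E.smult_l_distr[of _ _ z i] unfolding kc by auto
   show "\<phi> (r \<odot>\<^bsub>k\<^esub> X) = r \<odot>\<^bsub>E i\<^esub> \<phi> X" if "r \<in> carrier R0" "X \<in> carrier k" for r X
    using that ksm \<phi>v A_mult z(1) I.E.smult_assoc1[of _ _ z i] unfolding kc by auto
  qed
 qed
 have at: "\<phi> (?c x) = x \<odot>\<^bsub>E i\<^esub> \<phi> (?c \<one>)" if "\<phi> \<in> mod_hom R0 k (E i)" "x \<in> A" for \<phi> i x
  using mod_homD(3)[OF that(1), of x "?c \<one>"] that(2) c1 ksm[OF that(2) one_A] A_closed by simp
 have ext: "\<phi> = \<phi>'" if h: "\<phi> \<in> mod_hom R0 k (E i)" "\<phi>' \<in> mod_hom R0 k (E i)" "\<phi> (?c \<one>) = \<phi>' (?c \<one>)" for \<phi> \<phi>' i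
 proof (rule extensionalityI[of _ "carrier k"])
  show "\<phi> \<in> extensional (carrier k)" "\<phi>' \<in> extensional (carrier k)" using mod_homD(4)[OF h(1)] mod_homD(4)[OF h(2)] by (simp_all add: PiE_iff)
  show "\<phi> X = \<phi>' X" if "X \<in> carrier k" for X using that at[OF h(1)] at[OF h(2)] h(3) unfolding kc by auto
 qed
 let ?E1 = "E (Suc 0)"
 interpret H: plain_module R0 "Hom_module R0 k ?E1"
  by (rule plain_module.intro[OF module_Hom[OF k.module_axioms I.mod_E]])
 have Hs [simp]: "carrier (Hom_module R0 k ?E1) = mod_hom R0 k ?E1"
  "\<zero>\<^bsub>Hom_module R0 k ?E1\<^esub> = (\<lambda>x\<in>carrier k. \<zero>\<^bsub>?E1\<^esub>)"
  "f \<oplus>\<^bsub>Hom_module R0 k ?E1\<^esub> g = (\<lambda>x\<in>carrier k. f x \<oplus>\<^bsub>?E1\<^esub> g x)"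
  "r \<odot>\<^bsub>Hom_module R0 k ?E1\<^esub> f = (\<lambda>x\<in>carrier k. r \<odot>\<^bsub>?E1\<^esub> f x)" for f g r
  by (simp_all add: Hom_module_def)
 let ?Z = "Hom_cocycles R0 k E d (Suc 0)"
 have Z: "\<phi> \<in> ?Z \<longleftrightarrow> \<phi> \<in> mod_hom R0 k ?E1 \<and> (\<forall>x\<in>carrier k. d (Suc 0) (\<phi> x) = \<zero>\<^bsub>E (Suc (Suc 0))\<^esub>)" for \<phi>
  unfolding Hom_cocycles_def by blast
 have sZ: "submodule ?Z R0 (Hom_module R0 k ?E1)" unfolding H.submodule_iff proof (intro conjI ballI)
  show "?Z <= carrier (Hom_module R0 k ?E1)" using Z by auto
  show "\<zero>\<^bsub>Hom_module R0 k ?E1\<^esub> \<in> ?Z"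
   using H.M.zero_closed I.d_zero[of "Suc 0"] by (simp add: Z)
 next
  fix f g assume fg: "f \<in> ?Z" "g \<in> ?Z"
  then have "f \<oplus>\<^bsub>Hom_module R0 k ?E1\<^esub> g \<in> mod_hom R0 k ?E1" using H.M.a_closed[of f g] Z by simp
  moreover have "d (Suc 0) (f x \<oplus>\<^bsub>?E1\<^esub> g x) = \<zero>\<^bsub>E (Suc (Suc 0))\<^esub>" if "x \<in> carrier k" for x
   using I.d_add[of "f x" "Suc 0" "g x"] fg that mod_homD(1)[of f R0 k ?E1 x] mod_homD(1)[of g R0 k ?E1 x]
   unfolding Z by auto
  ultimately show "f \<oplus>\<^bsub>Hom_module R0 k ?E1\<^esub> g \<in> ?Z" unfolding Z by simp
 next
  fix r f assume rf: "r \<in> carrier R0" "f \<in> ?Z"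
  then have "r \<odot>\<^bsub>Hom_module R0 k ?E1\<^esub> f \<in> mod_hom R0 k ?E1" using H.smult_closed[of r f] Z by simp
  moreover have "d (Suc 0) (r \<odot>\<^bsub>?E1\<^esub> f x) = \<zero>\<^bsub>E (Suc (Suc 0))\<^esub>" if "x \<in> carrier k" for x
   using I.d_smult[of r "f x" "Suc 0"] rf that mod_homD(1)[of f] unfolding Z by auto
  ultimately show "r \<odot>\<^bsub>Hom_module R0 k ?E1\<^esub> f \<in> ?Z" unfolding Z by simp
 qed
 let ?C = "(Hom_module R0 k ?E1)\<lparr>carrier := ?Z\<rparr>"
 interpret C: plain_module R0 ?C
  by (rule plain_module.intro[OF submodule.submodule_is_module[OF sZ H.module_axioms]])
 let ?B = "Hom_coboundaries R0 k E d (Suc 0)"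
 have B: "\<phi> \<in> ?B \<longleftrightarrow> (\<exists>g\<in>mod_hom R0 k (E 0). \<phi> = compose (carrier k) (d 0) g)" for \<phi>
  by (auto simp: One_nat_def)
 have dg: "compose (carrier k) (d 0) g \<in> ?Z" if g: "g \<in> mod_hom R0 k (E 0)" for g unfolding Z
 proof (intro conjI ballI)
  show "compose (carrier k) (d 0) g \<in> mod_hom R0 k ?E1" using mod_hom_compose[OF g I.d_hom k.module_axioms] .
  show "d (Suc 0) (compose (carrier k) (d 0) g x) = \<zero>\<^bsub>E (Suc (Suc 0))\<^esub>" if "x \<in> carrier k" for x
   using that I.d_d[OF mod_homD(1)[OF g that]] by (simp add: compose_eq)
 qed
 have BZ: "?B <= ?Z" proof
  fix \<phi> assume "\<phi> \<in> ?B"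
  then obtain g where g: "g \<in> mod_hom R0 k (E 0)" "\<phi> = compose (carrier k) (d 0) g" unfolding B by blast
  show "\<phi> \<in> ?Z" using dg[OF g(1)] unfolding g(2) .
 qed
 \<comment> \<open>The element \<open>e\<close> stands for \<open>u\<close> in \<open>E_0\<close>:
   the two act alike on \<open>n\<close>. A submodule \<open>T\<close> is sent to the cocycles that
   arise from its elements.\<close>
 define \<Phi> where "\<Phi> T = {\<phi> \<in> ?Z. \<exists>u\<in>T. \<exists>e\<in>carrier (E 0).
  (\<forall>r\<in>n. \<epsilon> (r \<otimes> u) = r \<odot>\<^bsub>E 0\<^esub> e) \<and> \<phi> (?c \<one>) = d 0 e}" for T
 have mem: "r \<otimes> u \<in> W" if "u \<in> colon W n" "r \<in> n" for u r
  using that nA AQ m_comm[of u r] by (auto simp: colon_def subset_iff)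
 have cc: "u \<in> carrier Q" if "u \<in> colon W n" for u using that by (simp add: colon_def)
 have nQ: "r \<in> carrier Q" "r \<in> A" if "r \<in> n" for r using that nA AQ by auto
 have ecl: "\<epsilon> x \<in> carrier (E 0)" if "x \<in> W" for x using I.eps_closed that by simp
 have eadd: "\<epsilon> (x \<oplus> y) = \<epsilon> x \<oplus>\<^bsub>E 0\<^esub> \<epsilon> y" if "x \<in> W" "y \<in> W" for x y using I.eps_add[of x y] that by simp
 have esm: "\<epsilon> (a \<otimes> x) = a \<odot>\<^bsub>E 0\<^esub> \<epsilon> x" if "a \<in> A" "x \<in> W" for a x using I.eps_smult[of a x] that by simp
 have e0: "\<epsilon> \<zero> = \<zero>\<^bsub>E 0\<^esub>" using I.eps_zero by simp
 have \<Phi>_sub: "submodule (\<Phi> T) R0 ?C" if T: "smod A T" "T <= colon W n" for T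
  unfolding C.submodule_iff proof (intro conjI ballI)
  show "\<Phi> T <= carrier ?C" unfolding \<Phi>_def by auto
  show "\<zero>\<^bsub>?C\<^esub> \<in> \<Phi> T" unfolding \<Phi>_def
  proof (intro CollectI conjI bexI[of _ \<zero>] bexI[of _ "\<zero>\<^bsub>E 0\<^esub>"] ballI)
   show "\<zero>\<^bsub>?C\<^esub> \<in> ?Z" using C.M.zero_closed by simp
   show "\<zero>\<^bsub>?C\<^esub> (?c \<one>) = d 0 \<zero>\<^bsub>E 0\<^esub>" using c1 I.d_zero[of 0] by simp
   show "\<epsilon> (r \<otimes> \<zero>) = r \<odot>\<^bsub>E 0\<^esub> \<zero>\<^bsub>E 0\<^esub>" if "r \<in> n" for r
    using nQ[OF that] e0 I.E.smult_r_null[of r 0] by simp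
  qed (use smodD(2)[OF T(1)] in auto)
 next
  fix f g assume "f \<in> \<Phi> T" "g \<in> \<Phi> T"
  then obtain u e u' e' where f: "f \<in> ?Z" "u \<in> T" "e \<in> carrier (E 0)" "\<forall>r\<in>n. \<epsilon> (r \<otimes> u) = r \<odot>\<^bsub>E 0\<^esub> e" "f (?c \<one>) = d 0 e"
   and g: "g \<in> ?Z" "u' \<in> T" "e' \<in> carrier (E 0)" "\<forall>r\<in>n. \<epsilon> (r \<otimes> u') = r \<odot>\<^bsub>E 0\<^esub> e'" "g (?c \<one>) = d 0 e'"
   unfolding \<Phi>_def by blast
  show "f \<oplus>\<^bsub>?C\<^esub> g \<in> \<Phi> T" unfolding \<Phi>_def
  proof (intro CollectI conjI bexI[of _ "u \<oplus> u'"] bexI[of _ "e \<oplus>\<^bsub>E 0\<^esub> e'"] ballI)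
   show "f \<oplus>\<^bsub>?C\<^esub> g \<in> ?Z" using C.M.a_closed[of f g] f g by simp
   show "(f \<oplus>\<^bsub>?C\<^esub> g) (?c \<one>) = d 0 (e \<oplus>\<^bsub>E 0\<^esub> e')" using c1 I.d_add[OF f(3) g(3)] f(5) g(5) by simp
   fix r assume r: "r \<in> n"
   have uu: "r \<otimes> u \<in> W" "r \<otimes> u' \<in> W" "u \<in> carrier Q" "u' \<in> carrier Q"
    using mem cc f(2) g(2) T(2) r by blast+
   then show "\<epsilon> (r \<otimes> (u \<oplus> u')) = r \<odot>\<^bsub>E 0\<^esub> (e \<oplus>\<^bsub>E 0\<^esub> e')"
    using eadd f(3,4) g(3,4) r nQ[OF r] by (simp add: r_distr I.E.smult_r_distr)
  qed (use f g smodD(3)[OF T(1)] in auto)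
 next
  fix a f assume a: "a \<in> carrier R0" and "f \<in> \<Phi> T"
  then obtain u e where f: "f \<in> ?Z" "u \<in> T" "e \<in> carrier (E 0)" "\<forall>r\<in>n. \<epsilon> (r \<otimes> u) = r \<odot>\<^bsub>E 0\<^esub> e" "f (?c \<one>) = d 0 e"
   unfolding \<Phi>_def by blast
  show "a \<odot>\<^bsub>?C\<^esub> f \<in> \<Phi> T" unfolding \<Phi>_def
  proof (intro CollectI conjI bexI[of _ "a \<otimes> u"] bexI[of _ "a \<odot>\<^bsub>E 0\<^esub> e"] ballI)
   show "a \<odot>\<^bsub>?C\<^esub> f \<in> ?Z" using C.smult_closed[of a f] f a by simp
   show "(a \<odot>\<^bsub>?C\<^esub> f) (?c \<one>) = d 0 (a \<odot>\<^bsub>E 0\<^esub> e)" using c1 I.d_smult[OF a f(3)] f(5) by simp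
   fix r assume r: "r \<in> n"
   have uu: "r \<otimes> u \<in> W" "u \<in> carrier Q" using mem cc f(2) T(2) r by blast+
   have aA: "a \<in> A" "a \<in> carrier Q" using a AQ by auto
   have "\<epsilon> (r \<otimes> (a \<otimes> u)) = \<epsilon> (a \<otimes> (r \<otimes> u))" using m_lcomm[OF nQ(1)[OF r] aA(2) uu(2)] by simp
   also have "\<dots> = a \<odot>\<^bsub>E 0\<^esub> (r \<odot>\<^bsub>E 0\<^esub> e)" using esm[OF aA(1) uu(1)] f(4) r by simp
   also have "\<dots> = r \<odot>\<^bsub>E 0\<^esub> (a \<odot>\<^bsub>E 0\<^esub> e)"
    using I.E.smult_assoc1[of a r e 0] I.E.smult_assoc1[of r a e 0] aA nQ[OF r] f(3) m_comm[of a r] by simp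
   finally show "\<epsilon> (r \<otimes> (a \<otimes> u)) = r \<odot>\<^bsub>E 0\<^esub> (a \<odot>\<^bsub>E 0\<^esub> e)" .
  qed (use f a smodD(4)[OF T(1)] in auto)
 qed
 have s0: "smod A {\<zero>}" using A_closed by (intro smodI) auto
 have c0: "{\<zero>} <= colon W n" using smodD(2)[OF frac_smod[OF W]] nQ by (auto simp: colon_def)
 \<comment> \<open>The coboundaries are the cocycles attached to \<open>u = 0\<close>, so they lie
   in the image of every \<open>T\<close>.\<close>
 have B0: "?B = \<Phi> {\<zero>}" proof
  show "?B <= \<Phi> {\<zero>}" proof
   fix \<phi> assume "\<phi> \<in> ?B"
   then obtain g where g: "g \<in> mod_hom R0 k (E 0)" "\<phi> = compose (carrier k) (d 0) g" unfolding B by blast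
   have "\<epsilon> (r \<otimes> \<zero>) = r \<odot>\<^bsub>E 0\<^esub> g (?c \<one>)" if r: "r \<in> n" for r
   proof -
    have "r \<odot>\<^bsub>E 0\<^esub> g (?c \<one>) = g (r \<odot>\<^bsub>k\<^esub> ?c \<one>)" using mod_homD(3)[OF g(1), of r] nQ[OF r] c1 by simp
    also have "\<dots> = \<zero>\<^bsub>E 0\<^esub>" using ck[OF r] I.hom_zero[OF g(1) k.module_axioms I.mod_E] by simp
    finally show ?thesis using nQ[OF r] e0 by simp
   qed
   then show "\<phi> \<in> \<Phi> {\<zero>}"
    unfolding \<Phi>_def g(2) using dg[OF g(1)] mod_homD(1)[OF g(1) c1] c1
    by (auto simp: compose_eq intro!: bexI[of _ "g (?c \<one>)"])
  qed
  show "\<Phi> {\<zero>} <= ?B" proof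
   fix \<phi> assume "\<phi> \<in> \<Phi> {\<zero>}"
   then obtain e where e: "\<phi> \<in> ?Z" "e \<in> carrier (E 0)" "\<forall>r\<in>n. \<epsilon> (r \<otimes> \<zero>) = r \<odot>\<^bsub>E 0\<^esub> e" "\<phi> (?c \<one>) = d 0 e"
    unfolding \<Phi>_def by blast
   have "r \<odot>\<^bsub>E 0\<^esub> e = \<zero>\<^bsub>E 0\<^esub>" if "r \<in> n" for r proof -
    have "\<epsilon> (r \<otimes> \<zero>) = r \<odot>\<^bsub>E 0\<^esub> e" using e(3) that by blast
    then show ?thesis using e0 nQ[OF that] by simp
   qed
   then obtain g where g: "g \<in> mod_hom R0 k (E 0)" "g (?c \<one>) = e" using hom[OF e(2)] by blast
   have "\<phi> = compose (carrier k) (d 0) g"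
    using ext[of \<phi> "Suc 0" "compose (carrier k) (d 0) g"] e(1,4) dg[OF g(1)] g(2) c1 by (simp add: Z compose_eq)
   then show "\<phi> \<in> ?B" using g B by blast
  qed
 qed
 have B\<Phi>: "?B <= \<Phi> T" if "smod A T" for T
  unfolding B0 using smodD(2)[OF that] by (auto simp: \<Phi>_def)
 have sB: "submodule ?B R0 ?C" unfolding B0 by (rule \<Phi>_sub[OF s0 c0])
 show ?thesis unfolding C.module_length_quot[OF sB] len_def proof (rule clen_map[where \<Phi> = \<Phi>])
  fix T assume "T \<in> {T. smod A T \<and> W <= T \<and> T <= colon W n}"
  then show "\<Phi> T \<in> {T. submodule T R0 ?C \<and> ?B <= T}" using \<Phi>_sub B\<Phi> by blast
 next
  fix T T' assume T: "T \<in> {T. smod A T \<and> W <= T \<and> T <= colon W n}"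
   "T' \<in> {T. smod A T \<and> W <= T \<and> T <= colon W n}" "T \<subset> T'"
  then obtain u where u: "u \<in> T'" "u \<notin> T" by blast
  have uc: "u \<in> colon W n" "u \<in> carrier Q" using u T cc by blast+
  have idn: "ideal n R0" using ideal_iff_smod[OF A] n by (auto simp: maxl_def)
  have "\<exists>e\<in>carrier (E 0). \<forall>r\<in>n. \<epsilon> (r \<otimes> u) = r \<odot>\<^bsub>E 0\<^esub> e"
  proof (rule I.extend[OF idn])
   show "\<epsilon> (r \<otimes> u) \<in> carrier (E 0)" if "r \<in> n" for r using mem[OF uc(1) that] ecl by blast
   show "\<epsilon> ((r \<oplus>\<^bsub>R0\<^esub> r') \<otimes> u) = \<epsilon> (r \<otimes> u) \<oplus>\<^bsub>E 0\<^esub> \<epsilon> (r' \<otimes> u)" if "r \<in> n" "r' \<in> n" for r r'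
    using that mem[OF uc(1)] nQ uc(2) eadd by (simp add: l_distr)
   show "\<epsilon> ((a \<otimes>\<^bsub>R0\<^esub> r) \<otimes> u) = a \<odot>\<^bsub>E 0\<^esub> \<epsilon> (r \<otimes> u)" if "a \<in> carrier R0" "r \<in> n" for a r
    using that mem[OF uc(1)] nQ uc(2) esm A_closed by (simp add: m_assoc)
  qed
  then obtain e where e: "e \<in> carrier (E 0)" "\<And>r. r \<in> n ==> \<epsilon> (r \<otimes> u) = r \<odot>\<^bsub>E 0\<^esub> e" by blast
  let ?z = "d 0 e"
  have zc: "?z \<in> carrier ?E1" using I.d_closed[OF e(1)] by simp
  have nz: "r \<odot>\<^bsub>?E1\<^esub> ?z = \<zero>\<^bsub>?E1\<^esub>" if "r \<in> n" for r
   using I.d_smult[of r e 0] e nQ[OF that] that I.d_eps[of "r \<otimes> u"] mem[OF uc(1) that] by simp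
  obtain \<phi> where \<phi>: "\<phi> \<in> mod_hom R0 k ?E1" and z1: "\<phi> (?c \<one>) = ?z" using hom[OF zc nz] by blast
  have "d (Suc 0) (\<phi> X) = \<zero>\<^bsub>E (Suc (Suc 0))\<^esub>" if X: "X \<in> carrier k" for X proof -
   obtain x where x: "x \<in> A" "X = ?c x" using X unfolding kc by blast
   then show ?thesis
    using at[OF \<phi> x(1)] z1 I.d_d[OF e(1)] I.d_smult[of x ?z "Suc 0"] zc I.E.smult_r_null[of x "Suc (Suc 0)"] by simp
  qed
  then have \<phi>Z: "\<phi> \<in> ?Z" using \<phi> Z by blast
  have "\<phi> \<in> \<Phi> T'" unfolding \<Phi>_def using \<phi>Z u(1) e z1 by blast
  moreover have "\<phi> \<notin> \<Phi> T" proof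
   assume "\<phi> \<in> \<Phi> T"
   then obtain u' e' where u': "u' \<in> T" "e' \<in> carrier (E 0)" "\<And>r. r \<in> n ==> \<epsilon> (r \<otimes> u') = r \<odot>\<^bsub>E 0\<^esub> e'" "d 0 e' = ?z"
    unfolding \<Phi>_def using z1 by auto
   have uc': "u' \<in> colon W n" "u' \<in> carrier Q" using u' T cc by blast+
   \<comment> \<open>Two representatives with the same coboundary differ by
     \<open>\<epsilon> a\<close> with \<open>a\<close> in \<open>W\<close>. Acting with
     \<open>s\<close>, which lies in \<open>n\<close>, turns this into \<open>su = sa + su'\<close>
     in \<open>W\<close>, and \<open>s\<close> can be cancelled in \<open>Q\<close>.\<close>
   have "d 0 (e \<ominus>\<^bsub>E 0\<^esub> e') = \<zero>\<^bsub>E (Suc 0)\<^esub>"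
    using I.d_minus[OF e(1) u'(2)] u'(4) zc I.E.M.r_neg by (simp add: a_minus_def)
   then obtain a where a: "a \<in> W" "e \<ominus>\<^bsub>E 0\<^esub> e' = \<epsilon> a"
    using I.eps_exact[of "e \<ominus>\<^bsub>E 0\<^esub> e'"] e(1) u'(2) by auto
   have ac: "a \<in> carrier Q" using a frac_carrier[OF W] by blast
   have ee: "e = \<epsilon> a \<oplus>\<^bsub>E 0\<^esub> e'"
    using a(2)[symmetric] e(1) u'(2) I.E.M.l_neg by (simp add: a_minus_def I.E.M.a_assoc)
   have sn': "s \<in> n" using jac[OF n] .
   have "\<epsilon> (s \<otimes> u) = s \<odot>\<^bsub>E 0\<^esub> (\<epsilon> a \<oplus>\<^bsub>E 0\<^esub> e')" using e(2)[OF sn'] ee by simp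
   also have "\<dots> = \<epsilon> (s \<otimes> a) \<oplus>\<^bsub>E 0\<^esub> \<epsilon> (s \<otimes> u')"
    using I.E.smult_r_distr[where a = s and x = "\<epsilon> a" and y = e'] ecl[OF a(1)] u'(2) s_A esm[OF s_A a(1)] u'(3)[OF sn'] by simp
   also have "\<dots> = \<epsilon> (s \<otimes> a \<oplus> s \<otimes> u')"
    using eadd[OF smodD(4)[OF frac_smod[OF W] s_A a(1)] mem[OF uc'(1) sn']] by simp
   finally have "\<epsilon> (s \<otimes> u) = \<epsilon> (s \<otimes> a \<oplus> s \<otimes> u')" .
   then have "s \<otimes> u = s \<otimes> a \<oplus> s \<otimes> u'"
    using I.eps_inj[of "s \<otimes> u" "s \<otimes> a \<oplus> s \<otimes> u'"] mem[OF uc(1) sn'] mem[OF uc'(1) sn']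
     smodD(3)[OF frac_smod[OF W] smodD(4)[OF frac_smod[OF W] s_A a(1)] mem[OF uc'(1) sn']] by simp
   then have "s \<otimes> u = s \<otimes> (a \<oplus> u')" using ac uc' s_closed by (simp add: r_distr)
   then have "u = a \<oplus> u'" using Units_l_cancel[OF s_unit] uc ac uc' by simp
   moreover have "a \<in> T" using a T by blast
   ultimately have "u \<in> T" using smodD(3)[of A T a u'] T u' by blast
   then show False using u by blast
  qed
  moreover have "\<Phi> T <= \<Phi> T'" unfolding \<Phi>_def using T(3) by blast
  ultimately show "\<Phi> T \<subset> \<Phi> T'" by blast
 qed
qed

lemma dualizing_if_len_le_1:
 assumes W: "frac W" and l: "\<And>n. maxl A n ==> len A (colon W n) W <= 1"
 shows "dualizing W" unfolding dualizing_def proof (intro conjI allI impI, rule W, rule ccontr)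
 fix n T assume n: "maxl A n" and T: "smod A T \<and> W <= T \<and> T <= colon W n"
  and "\<not> (T = W \<or> T = colon W n)"
 then have "W \<subset> T" "T \<subset> colon W n" by auto
 moreover have "smod A (colon W n)" using smod_colon[OF frac_smod[OF W] AQ] n smodD(1) by (auto simp: maxl_def)
 ultimately have "len A T W + 1 <= len A (colon W n) W" "1 <= len A T W"
  using len_step[of A T "colon W n" W] len_ge_1[of T W] T frac_smod[OF W] by auto
 then have "len A T W + 1 <= 1" using l[OF n] by (meson order_trans)
 then show False using \<open>1 <= len A T W\<close> by (cases "len A T W") (auto simp: one_enat_def)
qed

text \<open>Finite injective dimension ensures that the choice in \<open>Ext_module\<close> is a
  resolution. As the depth is one, the type is the length of an \<open>Ext^1\<close>, and
  \<open>len_le_Ext\<close> holds for whichever resolution was chosen.\<close>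

lemma canonical_dualizing:
 assumes loc: "\<And>n. maxl A n \<longleftrightarrow> n = max_ideal R0" and W: "frac W"
  and C: "canonical_module R0 (as_module Q W)" and dim: "krull_dim R0 = 1" shows "dualizing W"
proof (rule dualizing_if_len_le_1[OF W])
 fix n assume n: "maxl A n"
 then have nm: "n = max_ideal R0" using loc by blast
 let ?M = "as_module Q W"
 let ?P = "\<lambda>(\<epsilon> :: 'a => ('a, 'a) res, E, d). injective_resolution R0 ?M \<epsilon> E d"
 have dep: "the_enat (depth R0 ?M) = 1"
  using C dim by (simp add: canonical_module_def maximal_cohen_macaulay_def one_enat_def)
 obtain \<epsilon>0 :: "'a => ('a, 'a) res" and E0 d0 where "injective_resolution R0 ?M \<epsilon>0 E0 d0"
  using C unfolding canonical_module_def finite_injective_dimension_def by blast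
 then have "?P (\<epsilon>0, E0, d0)" by simp
 then have P: "?P (SOME x. ?P x)" by (rule someI)
 obtain \<epsilon> E d where x: "(SOME x. ?P x) = (\<epsilon>, E, d)" by (cases "SOME x. ?P x")
 have res: "injective_resolution R0 ?M \<epsilon> E d" using P unfolding x by simp
 have "module_length R0 (Ext_module R0 1 (residue_field_module R0) ?M) = 1"
  using C dep unfolding canonical_module_def cm_type_def by simp
 moreover have "residue_field_module R0 = quot_module R0 (as_module Q A) n"
  by (simp add: residue_field_module_def nm)
 ultimately show "len A (colon W n) W <= 1" using len_le_Ext[OF n W res] unfolding Ext_module_def x by simp
qed

end

subsection \<open>Self-dual rings have finite injective dimension\<close>

context cring begin

lemma mem_scale_add:
 "z \<in> X \<boxplus> scale a Y \<longleftrightarrow> (\<exists>x\<in>X. \<exists>y\<in>Y. z = x \<oplus> a \<otimes> y)"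
 "z \<in> scale a X \<boxplus> Y \<longleftrightarrow> (\<exists>x\<in>X. \<exists>y\<in>Y. z = a \<otimes> x \<oplus> y)"
 unfolding mem_set_add bex_simps(6,7) scale_def by auto

lemma smod_mult_preimage:
 assumes A: "A <= carrier R" and U: "smod A U" and D: "smod A D" and c: "c \<in> carrier R"
 shows "smod A {x \<in> U. c \<otimes> x \<in> D}" proof (rule smodI)
 show "x \<oplus> y \<in> {x \<in> U. c \<otimes> x \<in> D}" if "x \<in> {x \<in> U. c \<otimes> x \<in> D}" "y \<in> {x \<in> U. c \<otimes> x \<in> D}" for x y
  using that smodD(3,5)[OF U] smodD(3)[OF D] c by (simp add: r_distr)
 show "a \<otimes> x \<in> {x \<in> U. c \<otimes> x \<in> D}" if "a \<in> A" "x \<in> {x \<in> U. c \<otimes> x \<in> D}" for a x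
  using that smodD(4,5)[OF U] smodD(4)[OF D] A c by (auto simp: m_lcomm)
qed (use smodD(1,2)[OF U] smodD(2)[OF D] c in auto)

text \<open>Homomorphisms from \<open>J\<close> to \<open>R/D\<close> are represented by maps that are linear modulo \<open>D\<close>.\<close>

definition lin_mod :: "'a set => 'a set => 'a set => ('a => 'a) => bool" where
 "lin_mod A D J \<psi> \<longleftrightarrow> (\<forall>x\<in>J. \<psi> x \<in> carrier R) \<and>
   (\<forall>x\<in>J. \<forall>y\<in>J. \<psi> (x \<oplus> y) \<ominus> (\<psi> x \<oplus> \<psi> y) \<in> D) \<and> (\<forall>a\<in>A. \<forall>x\<in>J. \<psi> (a \<otimes> x) \<ominus> a \<otimes> \<psi> x \<in> D)"

lemma lin_modD:
 assumes "lin_mod A D J \<psi>"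
 shows "x \<in> J ==> \<psi> x \<in> carrier R" "x \<in> J ==> y \<in> J ==> \<psi> (x \<oplus> y) \<ominus> (\<psi> x \<oplus> \<psi> y) \<in> D"
  "a \<in> A ==> x \<in> J ==> \<psi> (a \<otimes> x) \<ominus> a \<otimes> \<psi> x \<in> D"
 using assms unfolding lin_mod_def by blast+

text \<open>The part of \<open>J\<close> on which \<open>\<psi>\<close> is multiplication by
  \<open>q\<close> modulo \<open>D\<close> is a submodule, so agreement can be checked on
  generators.\<close>

lemma lin_mod_kernel:
 assumes A: "subring A R" and D: "smod A D" and J: "smod A J" and lin: "lin_mod A D J \<psi>" and q: "q \<in> carrier R"
 shows "smod A {x \<in> J. \<psi> x \<ominus> q \<otimes> x \<in> D}" proof (rule smodI)
 note L = lin_modD[OF lin] and JD = smodD[OF J]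
 have AR: "A <= carrier R" using subringE(1)[OF A] .
 show sm: "a \<otimes> x \<in> {x \<in> J. \<psi> x \<ominus> q \<otimes> x \<in> D}" if ax: "a \<in> A" "x \<in> {x \<in> J. \<psi> x \<ominus> q \<otimes> x \<in> D}" for a x
 proof -
  have c: "\<psi> x \<in> carrier R" "\<psi> (a \<otimes> x) \<in> carrier R" "x \<in> carrier R" "a \<in> carrier R" using ax L(1) JD AR by auto
  have "P \<ominus> q \<otimes> (a \<otimes> x) = (P \<ominus> a \<otimes> Y) \<oplus> a \<otimes> (Y \<ominus> q \<otimes> x)" if "P \<in> carrier R" "Y \<in> carrier R" for P Y
   using that c(3,4) q by algebra
  then have "\<psi> (a \<otimes> x) \<ominus> q \<otimes> (a \<otimes> x) = (\<psi> (a \<otimes> x) \<ominus> a \<otimes> \<psi> x) \<oplus> a \<otimes> (\<psi> x \<ominus> q \<otimes> x)" using c by blast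
  then show ?thesis using L(3)[of a x] ax JD(4) smodD(3,4)[OF D] by simp
 qed
 show "x \<oplus> y \<in> {x \<in> J. \<psi> x \<ominus> q \<otimes> x \<in> D}"
  if xy: "x \<in> {x \<in> J. \<psi> x \<ominus> q \<otimes> x \<in> D}" "y \<in> {x \<in> J. \<psi> x \<ominus> q \<otimes> x \<in> D}" for x y
 proof -
  have c: "\<psi> x \<in> carrier R" "\<psi> y \<in> carrier R" "\<psi> (x \<oplus> y) \<in> carrier R" "x \<in> carrier R" "y \<in> carrier R"
   using xy L(1) JD by auto
  have "P \<ominus> q \<otimes> (x \<oplus> y) = (P \<ominus> (X \<oplus> Y)) \<oplus> (X \<ominus> q \<otimes> x) \<oplus> (Y \<ominus> q \<otimes> y)"
   if "P \<in> carrier R" "X \<in> carrier R" "Y \<in> carrier R" for P X Y using that c(4,5) q by algebra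
  then have "\<psi> (x \<oplus> y) \<ominus> q \<otimes> (x \<oplus> y) = (\<psi> (x \<oplus> y) \<ominus> (\<psi> x \<oplus> \<psi> y)) \<oplus> (\<psi> x \<ominus> q \<otimes> x) \<oplus> (\<psi> y \<ominus> q \<otimes> y)"
   using c by blast
  then show ?thesis using L(2)[of x y] xy JD(3) smodD(3)[OF D] by simp
 qed
 have c: "\<psi> \<zero> \<in> carrier R" "\<zero> \<in> A" using L(1) JD(2) subringE(2)[OF A] by auto
 then have "\<psi> \<zero> \<ominus> \<zero> \<otimes> \<psi> \<zero> \<in> D" using L(3)[of \<zero> \<zero>] JD(2) by simp
 then show "\<zero> \<in> {x \<in> J. \<psi> x \<ominus> q \<otimes> x \<in> D}" using JD(2) c q by (simp add: a_minus_def)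
qed (use smodD(1)[OF J] in auto)

end

context curve begin

lemma A_neg: "a \<in> A ==> \<ominus> a \<in> A" using subringE(5)[OF A] .
lemma A_minus: "a \<in> A ==> b \<in> A ==> a \<ominus> b \<in> A" using smod_minus[OF smod_A A] .
lemma zero_A: "\<zero> \<in> A" using smodD(2)[OF smod_A] .

lemma colon_A_self: "maxl A n ==> A <= colon A n"
 using A_mult AQ by (auto simp: colon_def maxl_def)

lemma spow_le:
 assumes "smod A X" "s [^] (i::nat) \<otimes> x \<in> X" "i <= j" "x \<in> carrier Q"
 shows "s [^] j \<otimes> x \<in> X" proof -
 have "s [^] j \<otimes> x = s [^] (j - i) \<otimes> (s [^] i \<otimes> x)" using assms s_closed by (simp add: nat_pow_mult flip: m_assoc)
 then show ?thesis using smodD(4)[OF assms(1) spow_A assms(2)] by simp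
qed

lemma spow_add: "x \<in> carrier Q ==> s [^] (i + j :: nat) \<otimes> x = s [^] i \<otimes> (s [^] j \<otimes> x)"
 using s_closed by (simp add: nat_pow_mult flip: m_assoc)

lemma spow_cancel: "smod (carrier Q) V ==> s [^] (k::nat) \<otimes> x \<in> V ==> x \<in> carrier Q ==> x \<in> V"
 using smodD(4)[of "carrier Q" V "inv (s [^] k)" "s [^] k \<otimes> x"] spow_unit by simp

lemma spow_eq_zero: "s [^] (k::nat) \<otimes> x = \<zero> ==> x \<in> carrier Q ==> x = \<zero>"
 using Units_l_cancel[OF spow_unit, of x \<zero> k] spow_closed by simp

lemma common_denominator:
 assumes "finite F" "F <= carrier Q"
 shows "\<exists>k::nat. \<forall>x\<in>F. s [^] k \<otimes> x \<in> A" using assms proof induction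
 case (insert x F)
 then obtain k :: nat where k: "\<forall>x\<in>F. s [^] k \<otimes> x \<in> A" by blast
 obtain j :: nat where "s [^] j \<otimes> x \<in> A" using denom insert.prems by blast
 then have "\<forall>y\<in>insert x F. s [^] (max j k) \<otimes> y \<in> A"
  using spow_le[OF smod_A, of j x "max j k"] spow_le[OF smod_A, of k _ "max j k"] k insert.prems by auto
 then show ?case by blast
qed simp

text \<open>The \<open>s\<close>-power torsion of \<open>A/J\<close> is the union of an ascending
  chain, which becomes stationary; one power of \<open>s\<close> kills all of it.\<close>

lemma torsion_bound:
 assumes J: "smod A J" "J <= A"
 shows "\<exists>i. \<forall>j. \<forall>b\<in>A. s [^] (j::nat) \<otimes> b \<in> J --> s [^] (i::nat) \<otimes> b \<in> J"
proof -
 define C where "C i = {a \<in> A. s [^] (i::nat) \<otimes> a \<in> J}" for i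
 have sC: "smod A (C i)" for i unfolding C_def using smod_mult_preimage[OF AQ smod_A J(1) spow_closed] .
 have mono: "C i <= C j" if "i <= j" for i j using spow_le[OF J(1) _ that] A_closed by (auto simp: C_def)
 have "\<exists>M\<in>range C. \<forall>T\<in>range C. M <= T --> T = M"
  by (rule acc_ex[OF frac_A]) (auto simp: sC, auto simp: C_def)
 then obtain i where i: "\<And>j. C i <= C j ==> C j = C i" by auto
 have "C j <= C i" for j using mono[of j "max i j"] i[OF mono[of i "max i j"]] by auto
 then show ?thesis by (auto simp: C_def subset_iff)
qed

lemma frac_add_spow:
 assumes J: "smod A J" "J <= A"
 shows "frac (J \<boxplus> scale (s [^] (k::nat)) A)" "J \<boxplus> scale (s [^] k) A <= A"
  "J <= J \<boxplus> scale (s [^] k) A" "smod A (J \<boxplus> scale (s [^] k) A)" proof -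
 note c = frac_scale[OF frac_A spow_unit, of k]
 show s: "smod A (J \<boxplus> scale (s [^] k) A)" using smod_add[OF J(1) frac_smod[OF c] AQ] .
 show sub: "J \<boxplus> scale (s [^] k) A <= A" using set_add_least[OF smod_A J(2) scale_spow_frac_subset[OF smod_A]] .
 show "frac (J \<boxplus> scale (s [^] k) A)"
  using frac_between[OF c frac_A s set_add_upper(2)[OF J(1) frac_smod[OF c]] sub] .
 show "J <= J \<boxplus> scale (s [^] k) A" using set_add_upper(1)[OF J(1) frac_smod[OF c]] .
qed

text \<open>
 Krull's intersection theorem: first for the saturation \<open>H\<close> of \<open>J\<close>, modulo which \<open>s\<close> is a
 nonzerodivisor, so that Nakayama's lemma applies.
\<close>

lemma krull_intersection:
 assumes J: "smod A J" "J <= A" and y: "\<And>k::nat. y \<in> J \<boxplus> scale (s [^] k) A"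
 shows "y \<in> J" proof -
 obtain i where i: "\<And>j b. b \<in> A ==> s [^] (j::nat) \<otimes> b \<in> J ==> s [^] (i::nat) \<otimes> b \<in> J"
  using torsion_bound[OF J] by blast
 define H where "H = {a \<in> A. s [^] i \<otimes> a \<in> J}"
 have JH: "J <= H" using J smodD(4)[OF J(1) spow_A] by (auto simp: H_def)
 have sH: "smod A H" unfolding H_def using smod_mult_preimage[OF AQ smod_A J(1) spow_closed] .
 have sat: "b \<in> H" if "b \<in> A" "s [^] (j::nat) \<otimes> b \<in> H" for b j proof -
  have "s [^] (i + j) \<otimes> b \<in> J" using that spow_add A_closed by (simp add: H_def)
  then show ?thesis using i that(1) by (auto simp: H_def)
 qed
 have HA: "H <= A" by (auto simp: H_def)
 define Z where "Z = {z \<in> A. \<forall>k. z \<in> H \<boxplus> scale (s [^] (k::nat)) A}"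
 have sZ: "smod A Z"
  using smodD[OF smod_A] smodD[OF frac_add_spow(4)[OF sH HA]] by (intro smodI) (auto simp: Z_def)
 have HZ: "H <= Z" using frac_add_spow(3)[OF sH HA] HA by (auto simp: Z_def)
 have "Z = H" proof (rule nakayama[OF frac_A sZ _ sH HZ])
  show "Z <= A" by (auto simp: Z_def)
  show "Z <= H \<boxplus> scale s Z" proof
   fix z assume z: "z \<in> Z"
   obtain h a where h: "h \<in> H" "a \<in> A" "z = h \<oplus> s [^] (1::nat) \<otimes> a" using z unfolding Z_def mem_scale_add by blast
   have "a \<in> H \<boxplus> scale (s [^] k) A" for k :: nat proof -
    obtain g b where g: "g \<in> H" "b \<in> A" "z = g \<oplus> s [^] Suc k \<otimes> b" using z unfolding Z_def mem_scale_add by blast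
    have c: "a \<in> carrier Q" "b \<in> carrier Q" "h \<in> carrier Q" "g \<in> carrier Q" "s [^] k \<in> carrier Q"
     using h g HA AQ spow_closed by auto
    have "s \<otimes> (a \<ominus> s [^] k \<otimes> b) = (h \<oplus> s \<otimes> a) \<ominus> (g \<oplus> s [^] k \<otimes> s \<otimes> b) \<oplus> (g \<ominus> h)" using c s_closed by algebra
    moreover have "h \<oplus> s \<otimes> a = g \<oplus> s [^] k \<otimes> s \<otimes> b" using h(3) g(3) s_closed by simp
    ultimately have "s \<otimes> (a \<ominus> s [^] k \<otimes> b) = g \<ominus> h" using c s_closed by (simp add: r_neg a_minus_def)
    then have "s [^] (1::nat) \<otimes> (a \<ominus> s [^] k \<otimes> b) \<in> H" using smod_minus[OF sH A g(1) h(1)] s_closed by simp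
    then have "a \<ominus> s [^] k \<otimes> b \<in> H" using sat[of "a \<ominus> s [^] k \<otimes> b" 1] A_minus A_mult[OF spow_A g(2)] h(2) by simp
    moreover have "a = (a \<ominus> s [^] k \<otimes> b) \<oplus> s [^] k \<otimes> b" using c by algebra
    ultimately show ?thesis using set_addI scaleI[OF g(2)] by metis
   qed
   then have "a \<in> Z" using h(2) by (simp add: Z_def)
   then show "z \<in> H \<boxplus> scale s Z" using set_addI[OF h(1) scaleI, of a Z s] h(3) s_closed by simp
  qed
 qed
 have yA: "y \<in> A" using y[of 0] frac_add_spow(2)[OF J] by blast
 have "y \<in> H \<boxplus> scale (s [^] k) A" for k :: nat using y set_add_mono[OF JH order_refl] by blast
 then have yH: "y \<in> H" using yA \<open>Z = H\<close> by (auto simp: Z_def)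
 obtain h a where h: "h \<in> J" "a \<in> A" "y = h \<oplus> s [^] i \<otimes> a" using y[of i] unfolding mem_scale_add by blast
 have c: "h \<in> carrier Q" "a \<in> carrier Q" using h J AQ by auto
 have "y \<ominus> h \<in> H" using smod_minus[OF sH A yH] h JH by blast
 moreover have "y \<ominus> h = s [^] i \<otimes> a" unfolding h(3) using c spow_closed[of i] by algebra
 ultimately have "s [^] i \<otimes> a \<in> J" using sat[OF h(2), of i] by (simp add: H_def)
 then show ?thesis using h smodD(3)[OF J(1)] by blast
qed

text \<open>\<open>J\<close> need not contain a power of \<open>s\<close>. So
  \<open>double_dual\<close> is applied to \<open>J + s^k A\<close> for every \<open>k\<close>, and
  Krull's theorem leads back to \<open>J\<close>.\<close>

lemma double_dual_ideal:
 assumes G: "dualizing A" and J: "smod A J" "J <= A" and y: "\<And>p. p \<in> colon A J ==> p \<otimes> y \<in> A" "y \<in> carrier Q"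
 shows "y \<in> J" proof (rule krull_intersection[OF J])
 fix k :: nat
 let ?X = "J \<boxplus> scale (s [^] k) A"
 have "y \<in> colon A (colon A ?X)" proof -
  have "y \<otimes> p \<in> A" if p: "p \<in> colon A ?X" for p
   using y(1)[of p] p colon_antimono[OF frac_add_spow(3)[OF J]] m_comm[OF y(2), of p] by (auto simp: colon_def)
  then show ?thesis using y(2) by (simp add: colon_def)
 qed
 then show "y \<in> ?X" using double_dual[OF G frac_add_spow(1)[OF J]] by simp
qed

text \<open>The condition on \<open>w\<close> makes the map from \<open>(J + xA)/J\<close> to
  \<open>Q/A\<close> with \<open>x\<close> going to \<open>w\<close> well defined; it is then
  multiplication by some \<open>p\<close>. The claim is that \<open>w\<close> lies in
  \<open>D = x(A : X) + A\<close> for an approximation \<open>X\<close> of \<open>J\<close>, and by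
  duality this is checked on the elements of \<open>A : D\<close>.\<close>

lemma dual_quotient:
 assumes G: "dualizing A" and J: "smod A J" "J <= A" and x: "x \<in> A"
  and w: "w \<in> carrier Q" "\<And>a. a \<in> A ==> a \<otimes> x \<in> J ==> a \<otimes> w \<in> A"
 shows "\<exists>p\<in>colon A J. w \<ominus> p \<otimes> x \<in> A" proof -
 have xc: "x \<in> carrier Q" using x AQ by blast
 let ?Y = "J \<boxplus> scale x A"
 have Y: "smod A ?Y" "?Y <= A"
  using smod_add[OF J(1) smod_cyclic(1)[OF A xc] AQ] set_add_least[OF smod_A J(2) cyclic_least[OF A smod_A x]] by auto
 obtain i where i: "\<And>j b. b \<in> A ==> s [^] (j::nat) \<otimes> b \<in> ?Y ==> s [^] (i::nat) \<otimes> b \<in> ?Y"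
  using torsion_bound[OF Y] by blast
 obtain k :: nat where k: "s [^] k \<otimes> w \<in> A" using denom w(1) by blast
 \<comment> \<open>\<open>J\<close> is enlarged to a fractional ideal. In the exponent
   \<open>k + i\<close>, the power \<open>s^i\<close> absorbs the torsion modulo
   \<open>J + xA\<close> and \<open>s^k\<close> the denominator of \<open>w\<close>.\<close>
 let ?X = "J \<boxplus> scale (s [^] (k + i)) A"
 note fX = frac_add_spow(1)[OF J, of "k + i"]
 let ?L = "colon A ?X"
 have fL: "frac ?L" using frac_colon[OF frac_A fX] .
 have Lx: "smod A (scale x ?L)" using smod_scale[OF frac_smod[OF fL] xc AQ] .
 let ?D = "scale x ?L \<boxplus> A"
 note up = set_add_upper[OF Lx smod_A]
 have fD: "frac ?D" proof -
  obtain l :: nat where l: "scale (s [^] l) ?L <= A" using fL unfolding frac_def by blast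
  have "s [^] l \<otimes> y \<in> A" if y: "y \<in> ?D" for y proof -
   obtain p a where p: "p \<in> ?L" "a \<in> A" "y = x \<otimes> p \<oplus> a" using y unfolding mem_scale_add by blast
   have c: "p \<in> carrier Q" "a \<in> carrier Q" "s [^] l \<in> carrier Q" using p AQ spow_closed by (auto simp: colon_def)
   have "s [^] l \<otimes> y = x \<otimes> (s [^] l \<otimes> p) \<oplus> s [^] l \<otimes> a" unfolding p(3) using c xc by algebra
   moreover have "s [^] l \<otimes> p \<in> A" using l scaleI[OF p(1)] by blast
   ultimately show ?thesis using A_add A_mult x spow_A p(2) by simp
  qed
  then have "scale (s [^] l) ?D <= A" by (auto simp: mem_scale)
  moreover have "s [^] (0::nat) \<in> ?D" using up(2) one_A by auto
  ultimately show ?thesis unfolding frac_def using smod_add[OF Lx smod_A AQ] by blast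
 qed
 have "a \<otimes> w \<in> A" if a: "a \<in> colon A ?D" for a proof -
  have aD: "a \<otimes> y \<in> A" if "y \<in> ?D" for y using a that by (simp add: colon_def)
  have aA: "a \<in> A" using aD[of \<one>] up(2) one_A a by (auto simp: colon_def)
  have ac: "a \<in> carrier Q" using aA AQ by blast
  have "(a \<otimes> x) \<otimes> p \<in> A" if "p \<in> ?L" for p proof -
   have "p \<in> carrier Q" using that by (simp add: colon_def)
   then show ?thesis using aD[of "x \<otimes> p"] up(1) scaleI[OF that] ac xc by (auto simp: m_assoc)
  qed
  then have "a \<otimes> x \<in> colon A ?L" using ac xc by (simp add: colon_def)
  then have "a \<otimes> x \<in> ?X" using double_dual[OF G fX] by simp
  then obtain j b where b: "j \<in> J" "b \<in> A" "a \<otimes> x = j \<oplus> s [^] (k + i) \<otimes> b" unfolding mem_scale_add by blast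
  have bc: "j \<in> carrier Q" "b \<in> carrier Q" "s [^] (k + i) \<in> carrier Q" using b J AQ spow_closed by auto
  have "s [^] (k + i) \<otimes> b = (j \<oplus> s [^] (k + i) \<otimes> b) \<ominus> j" using bc by algebra
  also have "\<dots> = \<ominus> j \<oplus> a \<otimes> x" unfolding b(3)[symmetric] using bc ac xc by algebra
  also have "\<dots> \<in> ?Y" using set_addI[of "\<ominus> j" J "a \<otimes> x"] smod_neg[OF J(1) A b(1)] mem_cyclic[OF A xc] aA by blast
  finally obtain j' c where c: "j' \<in> J" "c \<in> A" "s [^] i \<otimes> b = j' \<oplus> c \<otimes> x"
   using i[OF b(2)] mem_cyclic[OF A xc] unfolding mem_set_add by metis
  have cc: "j' \<in> carrier Q" "c \<in> carrier Q" "s [^] k \<in> carrier Q" using c J AQ spow_closed by auto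
  have e: "a \<otimes> x = j \<oplus> s [^] k \<otimes> (j' \<oplus> c \<otimes> x)" unfolding b(3) spow_add[OF bc(2)] c(3) ..
  have "(a \<ominus> s [^] k \<otimes> c) \<otimes> x = a \<otimes> x \<ominus> s [^] k \<otimes> (c \<otimes> x)" using ac cc xc by algebra
  also have "\<dots> = j \<oplus> s [^] k \<otimes> j'" unfolding e using bc(1) cc xc by algebra
  also have "\<dots> \<in> J" using smodD(3,4)[OF J(1)] b(1) c(1) spow_A by blast
  finally have "(a \<ominus> s [^] k \<otimes> c) \<otimes> w \<in> A" using w(2) A_minus aA A_mult[OF spow_A c(2)] by blast
  moreover have "a \<otimes> w = (a \<ominus> s [^] k \<otimes> c) \<otimes> w \<oplus> c \<otimes> (s [^] k \<otimes> w)" using ac cc w(1) by algebra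
  ultimately show ?thesis using A_add A_mult c(2) k by simp
 qed
 then have "w \<in> colon A (colon A ?D)" using w(1) m_comm by (auto simp: colon_def)
 then have "w \<in> ?D" using double_dual[OF G fD] by simp
 then obtain p a where p: "p \<in> ?L" "a \<in> A" "w = x \<otimes> p \<oplus> a" unfolding mem_scale_add by blast
 have c: "p \<in> carrier Q" "a \<in> carrier Q" using p AQ by (auto simp: colon_def)
 have "w \<ominus> p \<otimes> x = a" unfolding p(3) using c xc by algebra
 then show ?thesis using p colon_antimono[OF frac_add_spow(3)[OF J]] by blast
qed

text \<open>The injectivity of \<open>Q/A\<close>. Generators are treated one at a time: if
  \<open>q\<close> is right on the ideal \<open>K\<close>, the error at the next generator is
  corrected by some \<open>p\<close> in \<open>A : K\<close>, which changes nothing on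
  \<open>K\<close> modulo \<open>A\<close>.\<close>

lemma quotient_hom_mult:
 assumes G: "dualizing A" and J: "smod A J" "J <= A" and lin: "lin_mod A A J \<psi>"
 shows "\<exists>q\<in>carrier Q. \<forall>x\<in>J. \<psi> x \<ominus> q \<otimes> x \<in> A" proof -
 note L = lin_modD[OF lin] and ker = lin_mod_kernel[OF A smod_A J(1) lin]
 obtain F where F: "finite F" "F <= J" "\<And>X. smod A X ==> F <= X ==> J <= X"
  using finitely_gen[OF frac_A J] by blast
 have "\<exists>q\<in>carrier Q. \<forall>x\<in>F'. \<psi> x \<ominus> q \<otimes> x \<in> A" if "finite F'" "F' <= J" for F'
  using that proof induction
  case (insert x F')
  then obtain q where q: "q \<in> carrier Q" "\<And>x. x \<in> F' ==> \<psi> x \<ominus> q \<otimes> x \<in> A" by blast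
  let ?K = "{x \<in> J. \<psi> x \<ominus> q \<otimes> x \<in> A}"
  have x: "x \<in> J" "x \<in> A" "x \<in> carrier Q" "\<psi> x \<in> carrier Q" using insert.prems J AQ L(1) by auto
  have "a \<otimes> (\<psi> x \<ominus> q \<otimes> x) \<in> A" if a: "a \<in> A" "a \<otimes> x \<in> ?K" for a
  proof -
   have c: "a \<in> carrier Q" "\<psi> (a \<otimes> x) \<in> carrier Q" using a AQ L(1) by auto
   have "a \<otimes> (X \<ominus> q \<otimes> x) = (P \<ominus> q \<otimes> (a \<otimes> x)) \<ominus> (P \<ominus> a \<otimes> X)" if "P \<in> carrier Q" "X \<in> carrier Q" for P X
    using that c(1) q(1) x(3) by algebra
   then have "a \<otimes> (\<psi> x \<ominus> q \<otimes> x) = (\<psi> (a \<otimes> x) \<ominus> q \<otimes> (a \<otimes> x)) \<ominus> (\<psi> (a \<otimes> x) \<ominus> a \<otimes> \<psi> x)" using c x by blast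
   then show ?thesis using A_minus a L(3)[OF a(1) x(1)] by simp
  qed
  then obtain p where p: "p \<in> colon A ?K" "\<psi> x \<ominus> q \<otimes> x \<ominus> p \<otimes> x \<in> A"
   using dual_quotient[OF G ker[OF q(1)] _ x(2), of "\<psi> x \<ominus> q \<otimes> x"] J(2) x q(1) by blast
  have pc: "p \<in> carrier Q" using p by (simp add: colon_def)
  have eq: "\<psi> y \<ominus> (q \<oplus> p) \<otimes> y = \<psi> y \<ominus> q \<otimes> y \<ominus> p \<otimes> y" if "y \<in> J" for y
  proof -
   have "\<psi> y \<in> carrier Q" "y \<in> carrier Q" using that L(1) smodD(5)[OF J(1)] by auto
   then show ?thesis using q(1) pc by algebra
  qed
  have "\<psi> y \<ominus> q \<otimes> y \<ominus> p \<otimes> y \<in> A" if "y \<in> F'" for y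
   using A_minus[OF q(2)[OF that]] p(1) that q insert.prems by (auto simp: colon_def)
  then have "\<forall>y\<in>insert x F'. \<psi> y \<ominus> (q \<oplus> p) \<otimes> y \<in> A" using eq p(2) insert.prems by auto
  then show ?case using q(1) pc by blast
 qed auto
 from this[OF F(1,2)] obtain q where q: "q \<in> carrier Q" "\<And>x. x \<in> F ==> \<psi> x \<ominus> q \<otimes> x \<in> A" by blast
 then have "J <= {x \<in> J. \<psi> x \<ominus> q \<otimes> x \<in> A}" using F(2) F(3)[OF ker[OF q(1)]] by blast
 then show ?thesis using q(1) by blast
qed

definition anni :: "'a set => 'a set" where
 "anni F = {t \<in> carrier Q. \<forall>x\<in>F. t \<otimes> x = \<zero>}"

lemma smod_anni: "F <= carrier Q ==> smod (carrier Q) (anni F)"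
 by (rule smodI) (auto simp: anni_def l_distr m_assoc subset_iff)

lemma smod_scale_anni: "F <= carrier Q ==> x \<in> carrier Q ==> smod (carrier Q) (scale x (anni F))"
 using smod_scale[OF smod_anni] by simp

text \<open>If \<open>F\<close> generated a fractional ideal, its dual would have a common
  denominator. In general the dual contains the whole annihilator of \<open>F\<close> in
  \<open>Q\<close>, and it has a common denominator modulo this annihilator.\<close>

lemma dual_bounded_mod_anni:
 assumes "finite F" "F <= A"
 shows "\<exists>k::nat. \<forall>p\<in>carrier Q. (\<forall>x\<in>F. p \<otimes> x \<in> A) --> (\<exists>t\<in>anni F. s [^] k \<otimes> p \<ominus> t \<in> A)"
 using assms proof induction
 case empty
 have "\<exists>t\<in>anni {}. s [^] (0::nat) \<otimes> p \<ominus> t \<in> A" if "p \<in> carrier Q" for p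
  using that zero_A by (intro bexI[of _ p]) (auto simp: anni_def a_minus_def r_neg)
 then show ?case by blast
next
 case (insert x F)
 let ?T = "anni F"
 have FQ: "F <= carrier Q" and x: "x \<in> A" "x \<in> carrier Q" using insert.prems AQ by auto
 note sT = smod_anni[OF FQ]
 have Tc: "t \<in> carrier Q" if "t \<in> ?T" for t using that by (simp add: anni_def)
 \<comment> \<open>For the new element \<open>x\<close>, a \<open>t\<close> that kills
   \<open>F\<close> and has \<open>xt\<close> in \<open>A\<close> can be replaced by one with a
   bounded denominator and the same \<open>xt\<close>, because the ideal of all such
   \<open>xt\<close> is finitely generated.\<close>
 let ?Y = "scale x ?T \<inter> A"
 have sY: "smod A ?Y" using smod_inter[OF smod_subring[OF smod_scale_anni[OF FQ x(2)] AQ] smod_A] .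
 obtain G where G: "finite G" "G <= ?Y" "\<And>X. smod A X ==> G <= X ==> ?Y <= X"
  using finitely_gen[OF frac_A sY] by blast
 have "\<exists>t. t \<in> ?T \<and> y = x \<otimes> t" if "y \<in> G" for y proof -
  have "y \<in> scale x ?T" using that G(2) by blast
  then show ?thesis unfolding mem_scale by blast
 qed
 then obtain \<tau> where \<tau>: "\<And>y. y \<in> G ==> \<tau> y \<in> ?T \<and> y = x \<otimes> \<tau> y" by metis
 obtain l :: nat where l: "\<forall>t\<in>\<tau> ` G. s [^] l \<otimes> t \<in> A"
  using common_denominator[of "\<tau> ` G"] G(1) \<tau> Tc by auto
 let ?X = "{x \<otimes> t | t. t \<in> ?T \<and> s [^] l \<otimes> t \<in> A}"
 have "smod A ?X" proof (rule smodI)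
  show "\<zero> \<in> ?X" using smodD(2)[OF sT] x spow_closed zero_A by (auto intro!: exI[of _ \<zero>])
  show "y \<oplus> z \<in> ?X" if "y \<in> ?X" "z \<in> ?X" for y z proof -
   obtain t t' where t: "t \<in> ?T" "y = x \<otimes> t" "s [^] l \<otimes> t \<in> A" "t' \<in> ?T" "z = x \<otimes> t'" "s [^] l \<otimes> t' \<in> A"
    using \<open>y \<in> ?X\<close> \<open>z \<in> ?X\<close> by blast
   then show ?thesis using smodD(3)[OF sT, of t t'] Tc x spow_closed A_add by (auto intro!: exI[of _ "t \<oplus> t'"] simp: r_distr)
  qed
  show "a \<otimes> y \<in> ?X" if "a \<in> A" "y \<in> ?X" for a y proof -
   obtain t where t: "t \<in> ?T" "y = x \<otimes> t" "s [^] l \<otimes> t \<in> A" using \<open>y \<in> ?X\<close> by blast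
   then show ?thesis using that(1) smodD(4)[OF sT, of a t] Tc x A_closed spow_closed A_mult
    by (auto intro!: exI[of _ "a \<otimes> t"] simp: m_lcomm)
  qed
 qed (use x Tc in auto)
 moreover have "G <= ?X" using \<tau> l by blast
 ultimately have YX: "?Y <= ?X" using G(3) by blast
 obtain k :: nat where k: "\<And>p. p \<in> carrier Q ==> \<forall>x\<in>F. p \<otimes> x \<in> A ==> \<exists>t\<in>?T. s [^] k \<otimes> p \<ominus> t \<in> A"
  using insert by blast
 have "\<exists>t\<in>anni (insert x F). s [^] (l + k) \<otimes> p \<ominus> t \<in> A" if p: "p \<in> carrier Q" "\<forall>y\<in>insert x F. p \<otimes> y \<in> A" for p
 proof -
  obtain t where t: "t \<in> ?T" "s [^] k \<otimes> p \<ominus> t \<in> A" using k[OF p(1)] p(2) by blast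
  have c: "t \<in> carrier Q" "s [^] k \<in> carrier Q" "s [^] l \<in> carrier Q" using Tc t spow_closed by auto
  have "x \<otimes> t = s [^] k \<otimes> (p \<otimes> x) \<ominus> x \<otimes> (s [^] k \<otimes> p \<ominus> t)" using c p(1) x(2) by algebra
  then have "x \<otimes> t \<in> ?Y" using A_minus A_mult spow_A p(2) x(1) t scaleI[OF t(1), of x] by simp
  then obtain t' where t': "x \<otimes> t = x \<otimes> t'" "t' \<in> ?T" "s [^] l \<otimes> t' \<in> A" using YX by blast
  have c': "t' \<in> carrier Q" using Tc t' by blast
  let ?u = "s [^] l \<otimes> (t \<ominus> t')"
  have "(t \<ominus> t') \<otimes> x = x \<otimes> t \<ominus> x \<otimes> t'" using c c' x by algebra
  then have "(t \<ominus> t') \<otimes> x = \<zero>" using t'(1) c' x by (simp add: r_neg a_minus_def)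
  moreover have "t \<ominus> t' \<in> ?T" using smod_minus[OF sT carrier_is_subring t(1) t'(2)] .
  ultimately have "t \<ominus> t' \<in> anni (insert x F)" by (simp add: anni_def)
  then have u: "?u \<in> anni (insert x F)" using smodD(4)[OF smod_anni c(3)] FQ x(2) by simp
  have "s [^] l \<otimes> (s [^] k \<otimes> p) \<ominus> ?u = s [^] l \<otimes> (s [^] k \<otimes> p \<ominus> t) \<oplus> s [^] l \<otimes> t'" using c c' p(1) by algebra
  then have "s [^] (l + k) \<otimes> p \<ominus> ?u \<in> A" unfolding spow_add[OF p(1)] using A_add A_mult[OF spow_A t(2)] t'(3) by simp
  then show ?thesis using u by blast
 qed
 then show ?case by blast
qed

text \<open>Up to a power of \<open>s\<close>, an element of \<open>A : J\<close> is the sum of an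
  annihilator of \<open>J\<close> and an element of \<open>A\<close>. The first summand kills
  \<open>y\<close>, so a multiple of \<open>y\<close> passes the test of
  \<open>double_dual_ideal\<close>.\<close>

lemma double_annihilator:
 assumes G: "dualizing A" and J: "smod A J" "J <= A" and y: "y \<in> carrier Q" "\<And>t. t \<in> anni J ==> t \<otimes> y = \<zero>"
 shows "\<exists>k::nat. s [^] k \<otimes> y \<in> J" proof -
 obtain F where F: "finite F" "F <= J" "\<And>X. smod A X ==> F <= X ==> J <= X"
  using finitely_gen[OF frac_A J] by blast
 have FA: "F <= A" using F J by blast
 have anni: "anni F <= anni J" proof
  fix t assume t: "t \<in> anni F"
  then have "smod A {x \<in> carrier Q. t \<otimes> x \<in> {\<zero>}}"
   by (intro smod_mult_preimage AQ smodI) (auto simp: anni_def A_closed)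
  then have "J <= {x \<in> carrier Q. t \<otimes> x \<in> {\<zero>}}" using F(3) t FA AQ by (auto simp: anni_def)
  then show "t \<in> anni J" using t by (auto simp: anni_def)
 qed
 obtain k :: nat where k: "\<And>p. p \<in> carrier Q ==> \<forall>x\<in>F. p \<otimes> x \<in> A ==> \<exists>t\<in>anni F. s [^] k \<otimes> p \<ominus> t \<in> A"
  using dual_bounded_mod_anni[OF F(1) FA] by blast
 obtain l :: nat where l: "s [^] l \<otimes> y \<in> A" using denom y by blast
 have "s [^] (l + k) \<otimes> y \<in> J" proof (rule double_dual_ideal[OF G J])
  fix p assume p: "p \<in> colon A J"
  then have pc: "p \<in> carrier Q" and "\<forall>x\<in>F. p \<otimes> x \<in> A" using F(2) by (auto simp: colon_def)
  then obtain t where t: "t \<in> anni F" "s [^] k \<otimes> p \<ominus> t \<in> A" using k by blast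
  have ty: "t \<otimes> y = \<zero>" and tc: "t \<in> carrier Q" using t anni y(2) by (auto simp: anni_def)
  have c: "s [^] k \<in> carrier Q" "s [^] l \<in> carrier Q" using spow_closed by auto
  have "p \<otimes> (s [^] l \<otimes> (s [^] k \<otimes> y)) = (s [^] k \<otimes> p \<ominus> t) \<otimes> (s [^] l \<otimes> y) \<oplus> s [^] l \<otimes> (t \<otimes> y)"
   using c pc tc y(1) by algebra
  then show "p \<otimes> (s [^] (l + k) \<otimes> y) \<in> A" unfolding spow_add[OF y(1)] ty using A_mult[OF t(2) l] A_closed c by simp
 qed (use y(1) spow_closed in simp)
 then show ?thesis ..
qed

text \<open>The injectivity of \<open>Q\<close>, again one generator at a time, with annihilators in
  the place of duals. The error \<open>w\<close> at the new generator \<open>x\<close> has to lie in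
  \<open>x\<close> times the annihilator of \<open>K\<close>; two applications of
  \<open>double_annihilator\<close> show this.\<close>

lemma fraction_hom_mult:
 assumes G: "dualizing A" and J: "smod A J" "J <= A" and lin: "lin_mod A {\<zero>} J f"
 shows "\<exists>q\<in>carrier Q. \<forall>x\<in>J. f x \<ominus> q \<otimes> x \<in> {\<zero>}" proof -
 have s0: "smod A {\<zero>}" using AQ by (intro smodI) auto
 note L = lin_modD[OF lin] and ker = lin_mod_kernel[OF A s0 J(1) lin]
 obtain F where F: "finite F" "F <= J" "\<And>X. smod A X ==> F <= X ==> J <= X"
  using finitely_gen[OF frac_A J] by blast
 have "\<exists>q\<in>carrier Q. \<forall>x\<in>F'. f x \<ominus> q \<otimes> x \<in> {\<zero>}" if "finite F'" "F' <= J" for F'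
  using that proof induction
  case (insert x F')
  then obtain q where q: "q \<in> carrier Q" "\<And>x. x \<in> F' ==> f x \<ominus> q \<otimes> x \<in> {\<zero>}" by blast
  let ?K = "{x \<in> J. f x \<ominus> q \<otimes> x \<in> {\<zero>}}"
  have KA: "?K <= A" and KQ: "?K <= carrier Q" using J AQ by auto
  have x: "x \<in> J" "x \<in> A" "x \<in> carrier Q" "f x \<in> carrier Q" using insert.prems J AQ L(1) by auto
  let ?w = "f x \<ominus> q \<otimes> x"
  have wc: "?w \<in> carrier Q" using x q by simp
  have kill: "a \<otimes> ?w = \<zero>" if a: "a \<in> A" "a \<otimes> x \<in> ?K" for a proof -
   have c: "a \<in> carrier Q" "f (a \<otimes> x) \<in> carrier Q" using a AQ L(1) by auto
   have "a \<otimes> (X \<ominus> q \<otimes> x) = (P \<ominus> q \<otimes> (a \<otimes> x)) \<ominus> (P \<ominus> a \<otimes> X)" if "P \<in> carrier Q" "X \<in> carrier Q" for P X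
    using that c(1) q(1) x(3) by algebra
   then have "a \<otimes> ?w = (f (a \<otimes> x) \<ominus> q \<otimes> (a \<otimes> x)) \<ominus> (f (a \<otimes> x) \<ominus> a \<otimes> f x)" using c x by blast
   then show ?thesis using a L(3)[OF a(1) x(1)] by (simp add: a_minus_def)
  qed
  let ?V = "scale x (anni ?K)"
  have sV: "smod (carrier Q) ?V" using smod_scale_anni[OF KQ x(3)] .
  have "\<exists>k::nat. s [^] k \<otimes> ?w \<in> ?V \<inter> A"
  proof (rule double_annihilator[OF G smod_inter[OF smod_subring[OF sV AQ] smod_A] _ wc])
   \<comment> \<open>Since \<open>u\<close> kills \<open>x\<close> times the annihilator of
     \<open>K\<close>, that annihilator kills \<open>ux\<close>; so some \<open>s^k ux\<close> lies
     in \<open>K\<close>. Then \<open>kill\<close> applies to a multiple of \<open>u\<close>, and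
     \<open>u\<close> itself kills \<open>w\<close>.\<close>
   fix u assume u: "u \<in> anni (?V \<inter> A)"
   have uc: "u \<in> carrier Q" using u by (simp add: anni_def)
   have "t \<otimes> (u \<otimes> x) = \<zero>" if t: "t \<in> anni ?K" for t proof -
    have tc: "t \<in> carrier Q" using t by (simp add: anni_def)
    obtain k :: nat where "s [^] k \<otimes> (x \<otimes> t) \<in> A" using denom tc x by blast
    moreover have "s [^] k \<otimes> (x \<otimes> t) \<in> ?V" using smodD(4)[OF sV spow_closed scaleI[OF t]] .
    ultimately have "u \<otimes> (s [^] k \<otimes> (x \<otimes> t)) = \<zero>" using u by (simp add: anni_def)
    then have "s [^] k \<otimes> (t \<otimes> (u \<otimes> x)) = \<zero>" using uc tc x spow_closed by (simp add: m_ac)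
    then show ?thesis using spow_eq_zero uc tc x by simp
   qed
   then obtain k :: nat where k: "s [^] k \<otimes> (u \<otimes> x) \<in> ?K"
    using double_annihilator[OF G ker[OF q(1)] KA, of "u \<otimes> x"] uc x by blast
   obtain l :: nat where l: "s [^] l \<otimes> u \<in> A" using denom uc by blast
   let ?a = "s [^] (k + l) \<otimes> u"
   have "?a \<in> A" using spow_le[OF smod_A l _ uc] by simp
   moreover have "s [^] (k + l) \<otimes> (u \<otimes> x) \<in> ?K" using spow_le[OF ker[OF q(1)] k] uc x by simp
   then have "?a \<otimes> x \<in> ?K" using uc x spow_closed by (simp only: m_assoc)
   ultimately have "?a \<otimes> ?w = \<zero>" by (rule kill)
   then have "s [^] (k + l) \<otimes> (u \<otimes> ?w) = \<zero>" using uc wc spow_closed by (simp only: m_assoc)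
   then show "u \<otimes> ?w = \<zero>" using spow_eq_zero uc wc by simp
  qed simp
  then have "?w \<in> ?V" using spow_cancel[OF sV _ wc] by blast
  then obtain p where p: "p \<in> anni ?K" "?w = x \<otimes> p" unfolding mem_scale by blast
  have pc: "p \<in> carrier Q" using p by (simp add: anni_def)
  have "f y \<ominus> (q \<oplus> p) \<otimes> y = \<zero>" if y: "y \<in> insert x F'" for y proof -
   have c: "f y \<in> carrier Q" "y \<in> carrier Q" using y insert.prems L(1) smodD(5)[OF J(1)] by auto
   have "f y \<ominus> q \<otimes> y = p \<otimes> y"
    using y p q(2) pc x insert.prems by (auto simp: anni_def m_comm)
   moreover have "f y \<ominus> (q \<oplus> p) \<otimes> y = (f y \<ominus> q \<otimes> y) \<ominus> p \<otimes> y" using c q(1) pc by algebra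
   ultimately show ?thesis using pc c by (simp add: r_neg a_minus_def)
  qed
  then show ?case using q(1) pc by (intro bexI[of _ "q \<oplus> p"]) auto
 qed auto
 from this[OF F(1,2)] obtain q where q: "q \<in> carrier Q" "\<And>x. x \<in> F ==> f x \<ominus> q \<otimes> x \<in> {\<zero>}" by blast
 then have "J <= {x \<in> J. f x \<ominus> q \<otimes> x \<in> {\<zero>}}" using F(2) F(3)[OF ker[OF q(1)]] by blast
 then show ?thesis using q(1) by blast
qed

end

section \<open>The resolution by Q and Q/A\<close>

context curve begin

text \<open>
 \<open>quot_res D\<close> is \<open>Q/D\<close> with cosets encoded by representatives, so that it fits the type of
 resolutions.
\<close>

definition rep :: "'a set => 'a => ('a, 'a) res" where
 "rep D x = [Inl (SOME y. y \<in> carrier Q \<and> x \<ominus> y \<in> D)]"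

definition unrep :: "('a, 'a) res => 'a" where
 "unrep X = projl (hd X)"

definition quot_res :: "'a set => ('a, ('a, 'a) res) module" where
 "quot_res D = \<lparr>carrier = rep D ` carrier Q, monoid.mult = undefined, one = undefined,
   zero = rep D \<zero>, add = (\<lambda>X Y. rep D (unrep X \<oplus> unrep Y)), module.smult = (\<lambda>r X. rep D (r \<otimes> unrep X))\<rparr>"

lemma unrep_rep:
 assumes D: "smod A D" and x: "x \<in> carrier Q"
 shows "unrep (rep D x) \<in> carrier Q" "x \<ominus> unrep (rep D x) \<in> D" proof -
 have "x \<in> carrier Q \<and> x \<ominus> x \<in> D" using x smodD(2)[OF D] by (simp add: a_minus_def r_neg)
 from someI[of "\<lambda>y. y \<in> carrier Q \<and> x \<ominus> y \<in> D", OF this]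
 show "unrep (rep D x) \<in> carrier Q" "x \<ominus> unrep (rep D x) \<in> D" by (auto simp: rep_def unrep_def)
qed

lemma rep_eq_iff:
 assumes D: "smod A D" and xy: "x \<in> carrier Q" "y \<in> carrier Q"
 shows "rep D x = rep D y \<longleftrightarrow> x \<ominus> y \<in> D" proof
 assume eq: "rep D x = rep D y"
 let ?z = "unrep (rep D y)"
 have z: "?z \<in> carrier Q" "x \<ominus> ?z \<in> D" "y \<ominus> ?z \<in> D" using unrep_rep[OF D] xy eq by metis+
 have "x \<ominus> y = (x \<ominus> ?z) \<ominus> (y \<ominus> ?z)" using xy z(1) by algebra
 then show "x \<ominus> y \<in> D" using smod_minus[OF D A z(2,3)] by simp
next
 assume d: "x \<ominus> y \<in> D"
 have "x \<ominus> z \<in> D \<longleftrightarrow> y \<ominus> z \<in> D" if z: "z \<in> carrier Q" for z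
 proof -
  have "x \<ominus> z = (x \<ominus> y) \<oplus> (y \<ominus> z)" "y \<ominus> z = (x \<ominus> z) \<ominus> (x \<ominus> y)" using xy z by algebra+
  then show ?thesis using smodD(3)[OF D d] smod_minus[OF D A _ d] by metis
 qed
 then show "rep D x = rep D y" by (auto simp: rep_def intro!: arg_cong[where f = Eps])
qed

lemma quot_res_simps:
 "carrier (quot_res D) = rep D ` carrier Q" "\<zero>\<^bsub>quot_res D\<^esub> = rep D \<zero>"
 by (simp_all add: quot_res_def)

lemma rep_hom:
 assumes D: "smod A D" "smod A D'" "D <= D'" and x: "x \<in> carrier Q"
 shows "rep D' (unrep (rep D x)) = rep D' x" proof -
 note u = unrep_rep[OF D(1) x]
 have "unrep (rep D x) \<ominus> x = \<ominus> (x \<ominus> unrep (rep D x))" using u x by algebra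
 then show ?thesis using rep_eq_iff[OF D(2) u(1) x] smod_neg[OF D(2) A] u(2) D(3) by auto
qed

lemma quot_res_ops:
 assumes D: "smod A D" and x: "x \<in> carrier Q"
 shows "y \<in> carrier Q ==> rep D x \<oplus>\<^bsub>quot_res D\<^esub> rep D y = rep D (x \<oplus> y)"
  "a \<in> A ==> a \<odot>\<^bsub>quot_res D\<^esub> rep D x = rep D (a \<otimes> x)" proof -
 note ux = unrep_rep[OF D x]
 show "rep D x \<oplus>\<^bsub>quot_res D\<^esub> rep D y = rep D (x \<oplus> y)" if y: "y \<in> carrier Q"
 proof -
  note uy = unrep_rep[OF D y]
  have "(x \<oplus> y) \<ominus> (unrep (rep D x) \<oplus> unrep (rep D y)) = (x \<ominus> unrep (rep D x)) \<oplus> (y \<ominus> unrep (rep D y))"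
   using x y ux uy by algebra
  then have "rep D (x \<oplus> y) = rep D (unrep (rep D x) \<oplus> unrep (rep D y))"
   using rep_eq_iff[OF D, of "x \<oplus> y"] smodD(3)[OF D ux(2) uy(2)] x y ux uy by simp
  then show ?thesis by (simp add: quot_res_def)
 qed
 show "a \<odot>\<^bsub>quot_res D\<^esub> rep D x = rep D (a \<otimes> x)" if a: "a \<in> A" proof -
  have ac: "a \<in> carrier Q" using a AQ by blast
  have "a \<otimes> x \<ominus> a \<otimes> unrep (rep D x) = a \<otimes> (x \<ominus> unrep (rep D x))" using x ac ux by algebra
  then have "rep D (a \<otimes> x) = rep D (a \<otimes> unrep (rep D x))"
   using rep_eq_iff[OF D, of "a \<otimes> x"] smodD(4)[OF D a ux(2)] x ac ux by simp
  then show ?thesis by (simp add: quot_res_def)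
 qed
qed

lemma module_quot_res:
 assumes D: "smod A D" shows "module R0 (quot_res D)" proof (rule moduleI)
 note [simp] = quot_res_simps quot_res_ops[OF D]
 show "cring R0" by (rule cring_subr[OF A])
 show "abelian_group (quot_res D)" proof (rule abelian_groupI)
  fix X assume "X \<in> carrier (quot_res D)"
  then obtain x where x: "x \<in> carrier Q" "X = rep D x" by auto
  then have "rep D (\<ominus> x) \<oplus>\<^bsub>quot_res D\<^esub> X = \<zero>\<^bsub>quot_res D\<^esub>" by (simp add: l_neg)
  then show "\<exists>Y\<in>carrier (quot_res D). Y \<oplus>\<^bsub>quot_res D\<^esub> X = \<zero>\<^bsub>quot_res D\<^esub>" using x by auto
 qed (auto simp: a_ac)
qed (use AQ A_closed A_mult A_add in \<open>auto simp: quot_res_simps quot_res_ops[OF D] l_distr r_distr m_assoc one_A\<close>)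

lemma injective_quot_res:
 assumes D: "smod A D"
  and mult: "\<And>J f. smod A J ==> J <= A ==> lin_mod A D J f ==> \<exists>q\<in>carrier Q. \<forall>x\<in>J. f x \<ominus> q \<otimes> x \<in> D"
 shows "injective_module R0 (quot_res D)" unfolding injective_module_def
proof (intro conjI allI impI module_quot_res[OF D])
 fix J f assume "ideal J R0 \<and> f \<in> mod_hom R0 (as_module R0 J) (quot_res D)"
 then have J: "smod A J" "J <= A" and f: "f \<in> mod_hom R0 (as_module Q J) (quot_res D)"
  using ideal_iff_smod[OF A] by auto
 note JD = smodD[OF J(1)]
 define \<psi> where "\<psi> x = unrep (f x)" for x
 have \<psi>: "\<psi> x \<in> carrier Q" "f x = rep D (\<psi> x)" if x: "x \<in> J" for x proof -
  obtain y where y: "y \<in> carrier Q" "f x = rep D y" using mod_homD(1)[OF f, of x] x by (auto simp: quot_res_simps)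
  then show "\<psi> x \<in> carrier Q" "f x = rep D (\<psi> x)"
   unfolding \<psi>_def using unrep_rep(1)[OF D y(1)] rep_hom[OF D D order_refl y(1)] by simp_all
 qed
 have "lin_mod A D J \<psi>" unfolding lin_mod_def proof (intro conjI ballI)
  show "\<psi> x \<in> carrier Q" if "x \<in> J" for x using \<psi> that by blast
  show "\<psi> (x \<oplus> y) \<ominus> (\<psi> x \<oplus> \<psi> y) \<in> D" if xy: "x \<in> J" "y \<in> J" for x y
   using mod_homD(2)[OF f, of x y] xy \<psi> JD(3)[OF xy] quot_res_ops(1)[OF D, of "\<psi> x" "\<psi> y"]
    rep_eq_iff[OF D, of "\<psi> (x \<oplus> y)" "\<psi> x \<oplus> \<psi> y"] by simp
  show "\<psi> (a \<otimes> x) \<ominus> a \<otimes> \<psi> x \<in> D" if ax: "a \<in> A" "x \<in> J" for a x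
   using mod_homD(3)[OF f, of a x] ax \<psi> JD(4)[OF ax] quot_res_ops(2)[OF D, of "\<psi> x" a] A_closed
    rep_eq_iff[OF D, of "\<psi> (a \<otimes> x)" "a \<otimes> \<psi> x"] by simp
 qed
 from mult[OF J this] obtain q where q: "q \<in> carrier Q" "\<And>x. x \<in> J ==> \<psi> x \<ominus> q \<otimes> x \<in> D" by blast
 let ?g = "\<lambda>x\<in>A. rep D (q \<otimes> x)"
 have "?g \<in> mod_hom R0 (self_module R0) (quot_res D)" proof (rule mod_homI)
  show "?g (a \<odot>\<^bsub>self_module R0\<^esub> x) = a \<odot>\<^bsub>quot_res D\<^esub> ?g x" if "a \<in> carrier R0" "x \<in> carrier (self_module R0)" for a x
   using that q(1) A_closed A_mult quot_res_ops(2)[OF D, of "q \<otimes> x" a] by (simp add: m_lcomm)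
 qed (use q(1) A_closed A_add in \<open>auto simp: quot_res_simps quot_res_ops[OF D] r_distr\<close>)
 moreover have "\<forall>x\<in>J. ?g x = f x" proof
  fix x assume x: "x \<in> J"
  have "f x = rep D (q \<otimes> x)" using rep_eq_iff[OF D, of "\<psi> x" "q \<otimes> x"] \<psi>[OF x] q x JD(5) by simp
  then show "?g x = f x" using x J(2) by auto
 qed
 ultimately show "\<exists>g\<in>mod_hom R0 (self_module R0) (quot_res D). \<forall>x\<in>J. g x = f x" by blast
qed

theorem dualizing_finite_injective_dimension:
 assumes G: "dualizing A" shows "finite_injective_dimension R0 (self_module R0)" proof -
 \<comment> \<open>The terms are \<open>Q/0\<close>, \<open>Q/A\<close> and then \<open>Q/Q\<close>:
   a uniform format for the resolution by \<open>Q\<close>, \<open>Q/A\<close> and zero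
   modules.\<close>
 define D where "D i = (if i = 0 then {\<zero>} else if i = 1 then A else carrier Q)" for i :: nat
 define E where "E i = quot_res (D i)" for i
 define d where "d i = (\<lambda>X\<in>carrier (E i). rep (D (Suc i)) (unrep X))" for i
 have sD: "smod A (D i)" for i
  unfolding D_def using smod_A smod_subring[OF smod_self[OF carrier_is_subring] AQ] AQ by (auto intro!: smodI)
 have Dm: "D i <= D (Suc i)" for i using AQ smodD(2)[OF smod_A] by (auto simp: D_def)
 have dr: "d i (rep (D i) x) = rep (D (Suc i)) x" if "x \<in> carrier Q" for i x
  using that rep_hom[OF sD sD Dm that] by (simp add: d_def E_def quot_res_simps)
 note Es = E_def quot_res_simps
 have c: "carrier (E j) = rep (D j) ` carrier Q" for j by (simp add: Es)
 have rep_top: "rep (D (Suc (Suc i))) x = rep (D (Suc (Suc i))) \<zero>" if "x \<in> carrier Q" for i x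
  using rep_eq_iff[OF sD that, of \<zero> "Suc (Suc i)"] that by (simp add: D_def)
 have inj: "injective_module R0 (E i)" for i unfolding E_def proof (rule injective_quot_res[OF sD])
  fix J f assume J: "smod A J" "J <= A" "lin_mod A (D i) J f"
  consider "i = 0" | "i = 1" | "i > 1" by linarith
  then show "\<exists>q\<in>carrier Q. \<forall>x\<in>J. f x \<ominus> q \<otimes> x \<in> D i" proof cases
   case 1
   then show ?thesis using fraction_hom_mult[OF G J(1,2)] J(3) by (simp add: D_def)
  next
   case 2
   then show ?thesis using quotient_hom_mult[OF G J(1,2)] J(3) by (simp add: D_def)
  next
   case 3
   then show ?thesis using lin_modD(1)[OF J(3)] smodD(5)[OF J(1)] by (intro bexI[of _ \<zero>]) (auto simp: D_def)
  qed
 qed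
 let ?e = "\<lambda>x\<in>A. rep (D 0) x"
 have hom: "d i \<in> mod_hom R0 (E i) (E (Suc i))" for i proof (rule mod_homI)
  show "d i \<in> carrier (E i) \<rightarrow>\<^sub>E carrier (E (Suc i))"
   by (rule PiE_I) (auto simp: Es dr, simp add: d_def Es)
 qed (use A_closed in \<open>auto simp: Es dr quot_res_ops[OF sD]\<close>)
 have "injective_resolution R0 (self_module R0) ?e E d" unfolding injective_resolution_def
 proof (intro conjI allI inj hom)
  show "?e \<in> mod_hom R0 (self_module R0) (E 0)"
   by (rule mod_homI) (use A_closed A_mult A_add in \<open>auto simp: Es quot_res_ops[OF sD]\<close>)
  show "inj_on ?e (carrier (self_module R0))"
   using rep_eq_iff[OF sD, of _ _ 0] A_closed by (simp add: inj_on_def) (simp add: D_def)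
  show "?e ` carrier (self_module R0) = {x \<in> carrier (E 0). d 0 x = \<zero>\<^bsub>E 1\<^esub>}" proof -
   have "rep (D (Suc 0)) x = rep (D (Suc 0)) \<zero> \<longleftrightarrow> x \<in> A" if "x \<in> carrier Q" for x
    using rep_eq_iff[OF sD that, of \<zero> "Suc 0"] that by (simp add: D_def a_minus_def)
   then have "d 0 (rep (D 0) x) = \<zero>\<^bsub>E 1\<^esub> \<longleftrightarrow> x \<in> A" if "x \<in> carrier Q" for x using that by (simp add: dr Es)
   moreover have "carrier (E 0) = rep (D 0) ` carrier Q" by (simp add: Es)
   ultimately show ?thesis using A_closed by (auto 0 3 simp del: One_nat_def)
  qed
  fix i
  have "d (Suc i) (rep (D (Suc i)) x) = \<zero>\<^bsub>E (Suc (Suc i))\<^esub>" if "x \<in> carrier Q" for x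
   using dr[OF that, of "Suc i"] rep_top[OF that, of i] by (simp add: Es)
  moreover have "d i ` carrier (E i) = carrier (E (Suc i))"
   unfolding c image_image by (rule image_cong[OF refl dr])
  moreover have "carrier (E (Suc i)) = rep (D (Suc i)) ` carrier Q" using c .
  ultimately show "d i ` carrier (E i) = {x \<in> carrier (E (Suc i)). d (Suc i) x = \<zero>\<^bsub>E (Suc (Suc i))\<^esub>}"
   by auto
 qed
 moreover have "\<forall>i>1. carrier (E i) = {\<zero>\<^bsub>E i\<^esub>}" proof (intro allI impI)
  fix i :: nat assume "1 < i"
  then have i: "i = Suc (Suc (i - 2))" by simp
  have "carrier (E i) = (\<lambda>_. rep (D i) \<zero>) ` carrier Q"
   unfolding c by (rule image_cong[OF refl]) (metis i rep_top)
  then show "carrier (E i) = {\<zero>\<^bsub>E i\<^esub>}" using zero_closed by (auto simp: E_def quot_res_simps(2))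
 qed
 ultimately show ?thesis unfolding finite_injective_dimension_def by blast
qed

text \<open>Multiplication by \<open>s\<close> identifies \<open>(A : m)/A\<close> with the socle of
  \<open>A/sA\<close>, which \<open>socle_simple\<close> shows to be simple.\<close>

theorem finite_injective_dimension_dualizing:
 assumes m: "maxl A m" "\<And>n. maxl A n ==> n = m" and noe: "noetherian_ring R0"
  and fid: "finite_injective_dimension R0 (self_module R0)" shows "dualizing A" proof -
 obtain \<epsilon> E d n where res: "injective_resolution R0 (self_module R0) (\<epsilon> :: 'a => ('a, 'a) res) E d"
  and bd: "\<forall>i>n. carrier (E i) = {\<zero>\<^bsub>E i\<^esub>}" using fid unfolding finite_injective_dimension_def by blast
 have mA: "m <= A" "m \<noteq> A" "smod A m" using m(1) by (auto simp: maxl_def)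
 interpret L: local_injective_res R0 \<epsilon> E d m s n
 proof (intro local_injective_res.intro injective_res.intro injective_res_axioms.intro
   local_injective_res_axioms.intro noe res cring_subr[OF A])
  show "module R0 (self_module R0)" using module_as_module[OF A smod_A] by simp
  show "ideal m R0" using ideal_iff_smod[OF A] mA by blast
  show "s \<in> m" using jac m by blast
  show "m \<noteq> carrier R0" using mA by simp
  show "x = \<zero>\<^bsub>R0\<^esub>" if "x \<in> carrier R0" "s \<otimes>\<^bsub>R0\<^esub> x = \<zero>\<^bsub>R0\<^esub>" for x
   using that Units_l_cancel[OF s_unit, of x \<zero>] A_closed s_closed by simp
  show "carrier (E i) = {\<zero>\<^bsub>E i\<^esub>}" if "n < i" for i using bd that by blast
 next
  fix a assume "a \<in> carrier R0" and am: "a \<notin> m"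
  then have a: "a \<in> A" "a \<in> carrier Q" using AQ by auto
  have "scale a A = A" proof (rule ccontr)
   assume "scale a A \<noteq> A"
   then have lt: "scale a A \<subset> A" using scale_A_subset[OF smod_A a(1)] by blast
   obtain M where M: "smod A M" "scale a A <= M" "M \<subset> A" "\<And>Z. smod A Z ==> M <= Z ==> Z <= A ==> Z = M \<or> Z = A"
    using maximal_submodule[OF frac_A smod_A order_refl smod_cyclic(1)[OF A a(2)] lt] by blast
   then have "maxl A M" unfolding maxl_def by blast
   then show False using m(2) M(2) smod_cyclic(2)[OF A a(2)] am by blast
  qed
  then obtain b where "b \<in> A" "\<one> = a \<otimes> b" using one_A by (auto simp: mem_scale set_eq_iff)
  then show "a \<in> Units R0" using a A_closed by (auto simp: Units_def m_comm intro!: bexI[of _ b])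
 next
  fix J assume "ideal J R0" and sJ: "s \<in> J" and ne: "J \<noteq> carrier R0"
  then have J: "smod A J" "J \<subset> A" using ideal_iff_smod[OF A] by auto
  have "scale (s [^] (1::nat)) A <= J" using scale_A_subset[OF J(1) sJ] s_closed by simp
  then have fJ: "frac J" using J s_closed sJ scale_one[of J] AQ unfolding frac_def
   by (metis nat_pow_0 nat_pow_eone psubset_imp_subset subset_trans)
  let ?P = "\<lambda>T. smod A T \<and> J \<subset> T \<and> T <= A"
  \<comment> \<open>A module of least length above \<open>J\<close> covers \<open>J\<close>, so
    \<open>T/J\<close> is a copy of \<open>A/m\<close> and contains the required socle
    element.\<close>
  obtain T where T: "?P T" and min: "\<And>T'. ?P T' ==> the_enat (len A T J) <= the_enat (len A T' J)"
   using ex_has_least_nat[of ?P A "\<lambda>T. the_enat (len A T J)"] smod_A J by blast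
  have fT: "frac T'" if "?P T'" for T' using frac_between[OF fJ frac_A] that by blast
  have cover: "T' = J \<or> T' = T" if T': "smod A T'" "J <= T'" "T' <= T" for T'
  proof (rule ccontr)
   assume "\<not> ?thesis"
   then have P: "?P T'" "T' \<subset> T" using T T' by auto
   have "len A T' J + 1 <= len A T J" using len_step[OF T'(1) _ T'(2) P(2)] T by blast
   moreover obtain i j where "len A T' J = enat i" "len A T J = enat j"
    using len_finite[OF fT[OF P(1)] fJ] len_finite[OF fT[OF T] fJ] by auto
   ultimately show False using min[OF P(1)] by (simp add: one_enat_def)
  qed
  obtain z where z: "z \<in> T" "z \<notin> J" using T by blast
  have "maxl A {a \<in> A. a \<otimes> z \<in> J}" by (rule cover_maxl(2)[OF A _ J(1) _ cover z]) (use T in auto)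
  then have "{a \<in> A. a \<otimes> z \<in> J} = m" by (rule m(2))
  then show "\<exists>z\<in>carrier R0. z \<notin> J \<and> (\<forall>r\<in>m. r \<otimes>\<^bsub>R0\<^esub> z \<in> J)" using z T by auto
 qed
 show ?thesis unfolding dualizing_def proof (intro conjI frac_A allI impI)
  fix n T assume "maxl A n" and T: "smod A T \<and> A <= T \<and> T <= colon A n"
  then have n: "n = m" using m(2) by blast
  have sx: "s \<otimes> x \<in> A" if "x \<in> colon A m" for x
   using that jac[OF m(1)] m_comm s_closed by (auto simp: colon_def)
  have kill: "r \<otimes>\<^bsub>R0\<^esub> (s \<otimes> x) \<in> PIdl\<^bsub>R0\<^esub> s" if "x \<in> colon A m" "r \<in> m" for r x
  proof -
   have c: "r \<in> carrier Q" "x \<in> carrier Q" "x \<otimes> r \<in> A" using that mA AQ by (auto simp: colon_def)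
   have "r \<otimes> (s \<otimes> x) = s \<otimes> (x \<otimes> r)" using c s_closed by algebra
   then show ?thesis using L.sR(3) c(3) by auto
  qed
  have "y \<in> T" if x: "x \<in> T" "x \<notin> A" and y: "y \<in> colon A m" for x y proof -
   have xm: "x \<in> colon A m" "x \<in> carrier Q" using x T n by (auto simp: colon_def)
   have yc: "y \<in> carrier Q" using y by (simp add: colon_def)
   have "s \<otimes> x \<notin> PIdl\<^bsub>R0\<^esub> s" using L.sR(3) Units_l_cancel[OF s_unit xm(2)] A_closed x(2) by auto
   then have "s \<otimes> y \<in> PIdl\<^bsub>R0\<^esub> s <+>\<^bsub>R0\<^esub> PIdl\<^bsub>R0\<^esub> (s \<otimes> x)"
    using L.socle_simple[of "s \<otimes> x" "s \<otimes> y"] kill xm y sx by simp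
   then obtain a b where ab: "a \<in> A" "b \<in> A" "s \<otimes> y = s \<otimes> a \<oplus> b \<otimes> (s \<otimes> x)"
    unfolding set_add_def' cgenideal_def by (auto simp: m_comm A_closed s_closed)
   have "s \<otimes> y = s \<otimes> (a \<oplus> b \<otimes> x)" unfolding ab(3) using A_closed[OF ab(1)] A_closed[OF ab(2)] xm(2) s_closed by algebra
   then have "y = a \<oplus> b \<otimes> x" using Units_l_cancel[OF s_unit yc, of "a \<oplus> b \<otimes> x"] A_closed ab(1,2) xm(2) by simp
   then show ?thesis using T ab x smodD(3,4)[of A T] by blast
  qed
  then show "T = A \<or> T = colon A n" using T n by blast
 qed
qed

end

subsection \<open>Localization at a maximal ideal\<close>

text \<open>\<open>L\<close> is the localization of \<open>Q\<close>, not of \<open>A\<close>, at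
  the complement of \<open>n\<close>: in this way the localized ring \<open>loc A\<close> sits
  inside its ring of fractions and is again a \<open>curve\<close>. The map \<open>\<iota>\<close>
  is described by the properties of a localization map.\<close>

locale loc_curve = curve Q A s + L: cring L for Q (structure) and A s and L (structure) +
 fixes n \<iota>
 assumes n: "maxl A n" and \<iota>: "\<iota> \<in> ring_hom Q L"
  and \<iota>_unit: "t \<in> A - n ==> \<iota> t \<in> Units L"
  and \<iota>_surj: "x \<in> carrier L ==> \<exists>t\<in>A - n. \<exists>q\<in>carrier Q. \<iota> t \<otimes>\<^bsub>L\<^esub> x = \<iota> q"
  and \<iota>_eqD: "p \<in> carrier Q ==> q \<in> carrier Q ==> \<iota> p = \<iota> q ==> \<exists>t\<in>A - n. t \<otimes> p = t \<otimes> q"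
begin

abbreviation mult_L (infixl "\<star>" 70) where "x \<star> y \<equiv> x \<otimes>\<^bsub>L\<^esub> y"

lemmas \<iota>_simps = ring_hom_closed[OF \<iota>] ring_hom_mult[OF \<iota>] ring_hom_add[OF \<iota>] ring_hom_one[OF \<iota>]

lemma nA: "n <= A" "smod A n" "n \<noteq> A" using n by (auto simp: maxl_def)

lemma one_n: "\<one> \<in> A - n" using nA smodD(4)[OF nA(2), of _ \<one>] one_A A_closed by fastforce

lemma T_mult: "t \<in> A - n ==> u \<in> A - n ==> t \<otimes> u \<in> A - n"
 using maxl_prime[OF A n, of t u] A_mult by auto

lemma T_closed: "t \<in> A - n ==> t \<in> carrier Q" using AQ by blast

definition loc :: "'a set => 'c set" where
 "loc X = {x \<in> carrier L. \<exists>t\<in>A - n. \<exists>a\<in>X. \<iota> t \<star> x = \<iota> a}"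

lemma locE:
 assumes "x \<in> loc X"
 obtains t a where "t \<in> A - n" "a \<in> X" "x \<in> carrier L" "\<iota> t \<star> x = \<iota> a"
 using assms unfolding loc_def by blast

lemma locI: "x \<in> carrier L ==> t \<in> A - n ==> a \<in> X ==> \<iota> t \<star> x = \<iota> a ==> x \<in> loc X"
 unfolding loc_def by blast

lemma \<iota>_loc: "X <= carrier Q ==> a \<in> X ==> \<iota> a \<in> loc X"
 by (rule locI[OF _ one_n]) (auto simp: \<iota>_simps)

lemma loc_carrier: "loc X <= carrier L" by (auto simp: loc_def)

lemma loc_mono: "X <= Y ==> loc X <= loc Y" by (auto simp: loc_def)

lemma \<iota>_cancel: "t \<in> A - n ==> x \<in> carrier L ==> inv\<^bsub>L\<^esub> \<iota> t \<star> (\<iota> t \<star> x) = x"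
 using \<iota>_unit by simp

lemma loc_add:
 assumes X: "smod A X" and xy: "x \<in> loc X" "y \<in> loc X"
 shows "x \<oplus>\<^bsub>L\<^esub> y \<in> loc X" proof -
 obtain t a where t: "t \<in> A - n" "a \<in> X" "x \<in> carrier L" "\<iota> t \<star> x = \<iota> a" using xy(1) by (rule locE)
 obtain u b where u: "u \<in> A - n" "b \<in> X" "y \<in> carrier L" "\<iota> u \<star> y = \<iota> b" using xy(2) by (rule locE)
 have c: "t \<in> carrier Q" "u \<in> carrier Q" "a \<in> carrier Q" "b \<in> carrier Q" using t u T_closed smodD(5)[OF X] by auto
 have "(\<iota> t \<star> \<iota> u) \<star> (x \<oplus>\<^bsub>L\<^esub> y) = \<iota> u \<star> (\<iota> t \<star> x) \<oplus>\<^bsub>L\<^esub> \<iota> t \<star> (\<iota> u \<star> y)"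
  using t(3) u(3) \<iota>_simps(1)[OF c(1)] \<iota>_simps(1)[OF c(2)] by algebra
 then have "\<iota> (t \<otimes> u) \<star> (x \<oplus>\<^bsub>L\<^esub> y) = \<iota> (u \<otimes> a \<oplus> t \<otimes> b)" unfolding t(4) u(4) using c by (simp add: \<iota>_simps)
 then show ?thesis using locI[OF _ T_mult[OF t(1) u(1)]] smodD(3,4)[OF X] t u by (metis DiffE L.a_closed)
qed

lemma loc_mult:
 assumes X: "X <= carrier Q" and Y: "Y <= carrier Q" and xy: "x \<in> loc X" "y \<in> loc Y"
  and Z: "\<And>a b. a \<in> X ==> b \<in> Y ==> a \<otimes> b \<in> Z"
 shows "x \<star> y \<in> loc Z" proof -
 obtain t a where t: "t \<in> A - n" "a \<in> X" "x \<in> carrier L" "\<iota> t \<star> x = \<iota> a" using xy(1) by (rule locE)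
 obtain u b where u: "u \<in> A - n" "b \<in> Y" "y \<in> carrier L" "\<iota> u \<star> y = \<iota> b" using xy(2) by (rule locE)
 have c: "t \<in> carrier Q" "u \<in> carrier Q" "a \<in> carrier Q" "b \<in> carrier Q" using t u T_closed X Y by auto
 have "(\<iota> t \<star> \<iota> u) \<star> (x \<star> y) = (\<iota> t \<star> x) \<star> (\<iota> u \<star> y)"
  using t(3) u(3) \<iota>_simps(1)[OF c(1)] \<iota>_simps(1)[OF c(2)] by algebra
 then have "\<iota> (t \<otimes> u) \<star> (x \<star> y) = \<iota> (a \<otimes> b)" unfolding t(4) u(4) using c by (simp add: \<iota>_simps)
 then show ?thesis using locI[OF _ T_mult[OF t(1) u(1)] Z[OF t(2) u(2)]] t u by simp
qed

lemma loc_A_subring: "subring (loc A) L" proof (rule L.subringI[OF loc_carrier])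
 show "\<one>\<^bsub>L\<^esub> \<in> loc A" using \<iota>_loc[OF AQ one_A] by (simp add: \<iota>_simps)
 show "x \<oplus>\<^bsub>L\<^esub> y \<in> loc A" if "x \<in> loc A" "y \<in> loc A" for x y using loc_add[OF smod_A that] .
 show xy: "x \<star> y \<in> loc A" if "x \<in> loc A" "y \<in> loc A" for x y using loc_mult[OF AQ AQ that A_mult] .
 show "\<ominus>\<^bsub>L\<^esub> x \<in> loc A" if x: "x \<in> loc A" for x proof -
  have "\<iota> (\<ominus> \<one>) \<oplus>\<^bsub>L\<^esub> \<one>\<^bsub>L\<^esub> = \<iota> (\<ominus> \<one> \<oplus> \<one>)" using \<iota>_simps by simp
  also have "\<iota> (\<ominus> \<one> \<oplus> \<one>) \<oplus>\<^bsub>L\<^esub> \<one>\<^bsub>L\<^esub> = \<iota> (\<ominus> \<one> \<oplus> \<one> \<oplus> \<one>)" by (simp only: \<iota>_simps a_closed a_inv_closed one_closed)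
  then have "\<iota> (\<ominus> \<one> \<oplus> \<one>) = \<zero>\<^bsub>L\<^esub>" by (simp add: l_neg \<iota>_simps L.l_neg)
  finally have "\<iota> (\<ominus> \<one>) = \<ominus>\<^bsub>L\<^esub> \<one>\<^bsub>L\<^esub>" by (intro L.minus_equality[symmetric]) (auto simp: \<iota>_simps)
  then have "\<ominus>\<^bsub>L\<^esub> \<one>\<^bsub>L\<^esub> \<in> loc A" using \<iota>_loc[OF AQ A_neg[OF one_A]] by simp
  moreover have "x \<in> carrier L" using x loc_carrier by blast
  ultimately show ?thesis using xy[OF _ x] by (metis L.l_minus L.l_one L.one_closed)
 qed
qed

lemma smod_loc:
 assumes X: "smod A X" shows "L.smod (loc A) (loc X)" proof (rule L.smodI[OF loc_carrier _ loc_add[OF X]])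
 have "\<iota> \<zero> = \<zero>\<^bsub>L\<^esub>" using ring_hom_zero[OF \<iota> ring_axioms L.ring_axioms] .
 then show "\<zero>\<^bsub>L\<^esub> \<in> loc X" using \<iota>_loc[OF smodD(1,2)[OF X]] by simp
 show "a \<star> x \<in> loc X" if "a \<in> loc A" "x \<in> loc X" for a x
  using loc_mult[OF AQ smodD(1)[OF X] that smodD(4)[OF X]] .
qed

definition contr :: "'a set => 'c set => 'a set" where
 "contr U X = {a \<in> U. \<iota> a \<in> X}"

lemma smod_contr:
 assumes U: "smod A U" and X: "L.smod (loc A) X" shows "smod A (contr U X)" proof (rule smodI)
 have "\<iota> \<zero> = \<zero>\<^bsub>L\<^esub>" using ring_hom_zero[OF \<iota> ring_axioms L.ring_axioms] .
 then show "\<zero> \<in> contr U X" using smodD(2)[OF U] L.smodD(2)[OF X] by (simp add: contr_def)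
 show "x \<oplus> y \<in> contr U X" if "x \<in> contr U X" "y \<in> contr U X" for x y
  using that smodD(3,5)[OF U] L.smodD(3)[OF X] by (auto simp: contr_def \<iota>_simps)
 show "a \<otimes> x \<in> contr U X" if "a \<in> A" "x \<in> contr U X" for a x
  using that smodD(4,5)[OF U] L.smodD(4)[OF X \<iota>_loc[OF AQ]] A_closed by (auto simp: contr_def \<iota>_simps)
qed (use smodD(1)[OF U] in \<open>auto simp: contr_def\<close>)

text \<open>Both \<open>\<iota> t\<close> and its inverse lie in \<open>loc A\<close>, so a
  submodule contains \<open>x\<close> as soon as it contains the numerator, and conversely.\<close>

lemma mem_if_contr:
 assumes X: "L.smod (loc A) X" and x: "x \<in> carrier L" "t \<in> A - n" "\<iota> t \<star> x = \<iota> a"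
 shows "x \<in> X \<longleftrightarrow> \<iota> a \<in> X" proof -
 have tl: "\<iota> t \<in> loc A" using \<iota>_loc[OF AQ] x(2) by blast
 have "inv\<^bsub>L\<^esub> \<iota> t \<in> loc A" proof (rule locI[OF _ x(2) one_A])
  show "inv\<^bsub>L\<^esub> \<iota> t \<in> carrier L" "\<iota> t \<star> inv\<^bsub>L\<^esub> \<iota> t = \<iota> \<one>" using \<iota>_unit[OF x(2)] by (auto simp: \<iota>_simps)
 qed
 then show ?thesis using L.smodD(4)[OF X tl, of x] L.smodD(4)[OF X, of "inv\<^bsub>L\<^esub> \<iota> t" "\<iota> a"] \<iota>_cancel[OF x(2,1)] x(3) by auto
qed

lemma subset_if_contr:
 assumes X: "L.smod (loc A) X" and Y: "L.smod (loc A) Y" and U: "smod A U" "X <= loc U" and sub: "contr U X <= contr U Y"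
 shows "X <= Y" proof
 fix x assume x: "x \<in> X"
 then obtain t a where t: "t \<in> A - n" "a \<in> U" "x \<in> carrier L" "\<iota> t \<star> x = \<iota> a" using U(2) locE by blast
 then show "x \<in> Y" using mem_if_contr[OF X t(3,1,4)] mem_if_contr[OF Y t(3,1,4)] x sub by (auto simp: contr_def)
qed

lemma loc_proper: "\<one>\<^bsub>L\<^esub> \<notin> loc n" proof
 assume "\<one>\<^bsub>L\<^esub> \<in> loc n"
 then obtain t a where t: "t \<in> A - n" "a \<in> n" "\<iota> t \<star> \<one>\<^bsub>L\<^esub> = \<iota> a" by (auto elim: locE)
 have c: "t \<in> carrier Q" "a \<in> carrier Q" using t nA AQ by auto
 then obtain u where u: "u \<in> A - n" "u \<otimes> t = u \<otimes> a" using \<iota>_eqD[OF c] t \<iota>_simps by auto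
 have "u \<otimes> a \<in> n" using smodD(4)[OF nA(2)] u t by blast
 then show False using T_mult[OF u(1) t(1)] u(2) by simp
qed

text \<open>An element of a proper ideal has its numerator in \<open>n\<close>, since numerators
  outside \<open>n\<close> are units of \<open>loc A\<close>. Hence \<open>loc A\<close> is
  local.\<close>

lemma subset_loc_n:
 assumes X: "L.smod (loc A) X" "X \<subset> loc A" shows "X <= loc n" proof
 fix x assume x: "x \<in> X"
 then obtain t a where t: "t \<in> A - n" "a \<in> A" "x \<in> carrier L" "\<iota> t \<star> x = \<iota> a" using X(2) locE by blast
 have aX: "\<iota> a \<in> X" using mem_if_contr[OF X(1) t(3,1,4)] x by blast
 show "x \<in> loc n" proof (cases "a \<in> n")
  case True
  then show ?thesis using locI[OF t(3,1) _ t(4)] by blast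
 next
  case False
  then have "\<one>\<^bsub>L\<^esub> \<in> X"
   using mem_if_contr[OF X(1), of "\<one>\<^bsub>L\<^esub>" a a] t(2) aX A_closed by (simp add: \<iota>_simps)
  then have "loc A <= X" using L.smodD(4)[OF X(1), of _ "\<one>\<^bsub>L\<^esub>"] loc_carrier by (auto simp: subset_iff)
  then show ?thesis using X(2) by blast
 qed
qed

lemma maxl_loc: "L.maxl (loc A) N \<longleftrightarrow> N = loc n" proof -
 have s: "L.smod (loc A) (loc n)" using smod_loc nA by blast
 have "loc n \<subset> loc A" using loc_mono[OF nA(1)] loc_proper \<iota>_loc[OF AQ one_A] by (auto simp: \<iota>_simps)
 then show ?thesis unfolding L.maxl_def using s subset_loc_n by (metis dual_order.antisym)
qed

lemma len_loc_finite: "L.len (loc A) (loc A) (L.scale (\<iota> s) (loc A)) \<noteq> \<infinity>" proof -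
 have "L.len (loc A) (loc A) (L.scale (\<iota> s) (loc A)) <= len A A (scale s A)"
  unfolding len_def L.len_def proof (rule clen_map[where \<Phi> = "contr A"])
  fix X assume "X \<in> {V. L.smod (loc A) V \<and> L.scale (\<iota> s) (loc A) <= V \<and> V <= loc A}"
  then have X: "L.smod (loc A) X" "L.scale (\<iota> s) (loc A) <= X" by auto
  have "scale s A <= contr A X" proof
   fix y assume "y \<in> scale s A"
   then obtain a where a: "a \<in> A" "y = s \<otimes> a" by (auto simp: mem_scale)
   have "\<iota> s \<star> \<iota> a \<in> X" using X(2) L.scaleI[OF \<iota>_loc[OF AQ a(1)]] by blast
   then show "y \<in> contr A X" using a s_A A_mult A_closed by (simp add: contr_def \<iota>_simps)
  qed
  then show "contr A X \<in> {V. smod A V \<and> scale s A <= V \<and> V <= A}"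
   using smod_contr[OF smod_A X(1)] by (auto simp: contr_def)
 next
  fix X X' assume "X \<in> {V. L.smod (loc A) V \<and> L.scale (\<iota> s) (loc A) <= V \<and> V <= loc A}"
   "X' \<in> {V. L.smod (loc A) V \<and> L.scale (\<iota> s) (loc A) <= V \<and> V <= loc A}" "X \<subset> X'"
  then have "\<not> contr A X' <= contr A X" using subset_if_contr[OF _ _ smod_A, of X' X] by blast
  then show "contr A X \<subset> contr A X'" using \<open>X \<subset> X'\<close> by (auto simp: contr_def)
 qed
 then show ?thesis using fin by (cases "L.len (loc A) (loc A) (L.scale (\<iota> s) (loc A))") auto
qed

lemma \<iota>_pow: "q \<in> carrier Q ==> \<iota> (q [^] (k::nat)) = \<iota> q [^]\<^bsub>L\<^esub> k"
 by (induction k) (simp_all add: \<iota>_simps)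

lemma loc_noeth:
 assumes X: "L.smod (loc A) X" "X <= loc A"
 shows "\<exists>F. finite F \<and> F <= X \<and> (\<forall>Y. L.smod (loc A) Y \<and> F <= Y --> X <= Y)"
proof -
 have sc: "smod A (contr A X)" "contr A X <= A" using smod_contr[OF smod_A X(1)] by (auto simp: contr_def)
 obtain F where F: "finite F" "F <= contr A X" "\<And>Y. smod A Y \<and> F <= Y --> contr A X <= Y"
  using noeth[OF sc] by blast
 have "X <= Y" if Y: "L.smod (loc A) Y" "\<iota> ` F <= Y" for Y
 proof (rule subset_if_contr[OF X(1) Y(1) smod_A X(2)])
  have "F <= contr A Y" using F(2) Y(2) by (auto simp: contr_def)
  then show "contr A X <= contr A Y" using F(3) smod_contr[OF smod_A Y(1)] by blast
 qed
 moreover have "finite (\<iota> ` F)" "\<iota> ` F <= X" using F by (auto simp: contr_def)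
 ultimately show ?thesis by blast
qed

lemma \<iota>_s: "\<iota> s \<in> Units L" proof -
 have i: "inv s \<in> carrier Q" using s_unit by simp
 have "\<iota> (s \<otimes> inv s) = \<one>\<^bsub>L\<^esub>" using s_unit \<iota>_simps(4) by simp
 then have "\<iota> s \<star> \<iota> (inv s) = \<one>\<^bsub>L\<^esub>" using \<iota>_simps(2)[OF s_closed i] by simp
 then show ?thesis using \<iota>_simps(1)[OF s_closed] \<iota>_simps(1)[OF i] L.m_comm
  unfolding Units_def by (intro CollectI conjI bexI[of _ "\<iota> (inv s)"]) auto
qed

sublocale CL: curve L "loc A" "\<iota> s"
proof (intro curve.intro curve_axioms.intro L.cring_axioms loc_A_subring \<iota>_s len_loc_finite loc_noeth)
 show "\<iota> s \<in> loc A" using \<iota>_loc[OF AQ s_A] .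
 show "\<iota> s \<in> N" if "L.maxl (loc A) N" for N
  using that maxl_loc \<iota>_loc[of n s] jac[OF n] nA AQ by auto
 fix x assume x: "x \<in> carrier L"
 then obtain t q where t: "t \<in> A - n" "q \<in> carrier Q" "\<iota> t \<star> x = \<iota> q" using \<iota>_surj by blast
 obtain k :: nat where k: "s [^] k \<otimes> q \<in> A" using denom[OF t(2)] by blast
 have c: "\<iota> t \<in> carrier L" "\<iota> (s [^] k) \<in> carrier L" using \<iota>_simps(1) t T_closed spow_closed by auto
 have "\<iota> t \<star> (\<iota> (s [^] k) \<star> x) = \<iota> (s [^] k) \<star> (\<iota> t \<star> x)" using c x by algebra
 then have "\<iota> t \<star> (\<iota> (s [^] k) \<star> x) = \<iota> (s [^] k \<otimes> q)" unfolding t(3) using \<iota>_simps t spow_closed by simp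
 then have "\<iota> (s [^] k) \<star> x \<in> loc A" using locI[OF _ t(1) k] c x by simp
 then show "\<exists>k::nat. \<iota> s [^]\<^bsub>L\<^esub> k \<star> x \<in> loc A" using \<iota>_pow[OF s_closed] by auto
qed

text \<open>\<open>(A : n)/A\<close> is killed by \<open>n\<close>, so \<open>t\<close> outside
  \<open>n\<close> acts on it invertibly: \<open>1 = a + bt\<close> gives
  \<open>y = ya + b(ty)\<close>.\<close>

lemma colon_nD:
 assumes "y \<in> carrier Q" "t \<in> A - n" "t \<otimes> y \<in> T" "smod A T" "A <= T" "y \<in> colon A n"
 shows "y \<in> T" proof -
 obtain b a where b: "b \<in> A" "a \<in> n" "\<one> = a \<oplus> b \<otimes> t" using maxl_inverse[OF A n, of t] assms(2) by blast
 have c: "b \<in> carrier Q" "a \<in> carrier Q" "t \<in> carrier Q" using b nA AQ assms(2) by auto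
 have "(a \<oplus> b \<otimes> t) \<otimes> y = y \<otimes> a \<oplus> b \<otimes> (t \<otimes> y)" using c assms(1) by algebra
 then have y: "y = y \<otimes> a \<oplus> b \<otimes> (t \<otimes> y)" unfolding b(3)[symmetric] using assms(1) by simp
 have "y \<otimes> a \<in> T" using assms(5,6) b(2) by (auto simp: colon_def)
 then have "y \<otimes> a \<oplus> b \<otimes> (t \<otimes> y) \<in> T" using smodD(3,4)[OF assms(4)] assms(3) b(1) by blast
 then show ?thesis using y by simp
qed

text \<open>Localization commutes with the colon by \<open>n\<close> because \<open>n\<close> is
  finitely generated: one denominator serves all generators.\<close>

lemma colon_loc:
 assumes x: "x \<in> L.colon (loc A) (loc n)"
 shows "\<exists>t\<in>A - n. \<exists>y\<in>colon A n. \<iota> t \<star> x = \<iota> y" proof -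
 have xc: "x \<in> carrier L" using x by (simp add: L.colon_def)
 obtain t0 q where t0: "t0 \<in> A - n" "q \<in> carrier Q" "\<iota> t0 \<star> x = \<iota> q" using \<iota>_surj[OF xc] by blast
 have nQ: "n <= carrier Q" using nA AQ by blast
 have one: "\<exists>w\<in>A - n. w \<otimes> (q \<otimes> a) \<in> A" if a: "a \<in> n" for a proof -
  have ac: "a \<in> carrier Q" using a nQ by blast
  have "x \<star> \<iota> a \<in> loc A" using x \<iota>_loc[OF nQ a] by (simp add: L.colon_def)
  then obtain u b where u: "u \<in> A - n" "b \<in> A" "\<iota> u \<star> (x \<star> \<iota> a) = \<iota> b" by (rule locE)
  have c: "u \<in> carrier Q" "b \<in> carrier Q" "t0 \<in> carrier Q" using u t0 AQ by auto
  have "\<iota> t0 \<star> (\<iota> u \<star> (x \<star> \<iota> a)) = \<iota> u \<star> ((\<iota> t0 \<star> x) \<star> \<iota> a)"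
   using \<iota>_simps(1)[OF c(1)] \<iota>_simps(1)[OF c(3)] \<iota>_simps(1)[OF ac] xc by algebra
  then have "\<iota> (t0 \<otimes> b) = \<iota> (u \<otimes> (q \<otimes> a))" unfolding t0(3) u(3) using c ac t0(2) by (simp add: \<iota>_simps)
  then obtain v where v: "v \<in> A - n" "v \<otimes> (t0 \<otimes> b) = v \<otimes> (u \<otimes> (q \<otimes> a))"
   using \<iota>_eqD[of "t0 \<otimes> b" "u \<otimes> (q \<otimes> a)"] c ac t0(2) by auto
  have "(v \<otimes> u) \<otimes> (q \<otimes> a) = v \<otimes> (t0 \<otimes> b)" unfolding v(2) using T_closed[OF v(1)] c ac t0(2) by (simp add: m_assoc)
  then show ?thesis using T_mult[OF v(1) u(1)] A_mult v(1) t0(1) u(2) by (metis DiffD1)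
 qed
 obtain F where F: "finite F" "F <= n" "\<And>X. smod A X ==> F <= X ==> n <= X"
  using finitely_gen[OF frac_A nA(2,1)] by blast
 have "\<exists>w\<in>A - n. \<forall>a\<in>F'. w \<otimes> (q \<otimes> a) \<in> A" if "finite F'" "F' <= n" for F'
  using that proof induction
  case empty
  then show ?case using one_n by blast
 next
  case (insert a F')
  then obtain w where w: "w \<in> A - n" "\<forall>a\<in>F'. w \<otimes> (q \<otimes> a) \<in> A" by blast
  obtain v where v: "v \<in> A - n" "v \<otimes> (q \<otimes> a) \<in> A" using one insert.prems by blast
  have c: "w \<in> carrier Q" "v \<in> carrier Q" using w v AQ by auto
  have "(v \<otimes> w) \<otimes> (q \<otimes> b) \<in> A" if b: "b \<in> insert a F'" for b proof -
   have "b \<in> carrier Q" using b insert.prems nQ by blast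
   then have "(v \<otimes> w) \<otimes> (q \<otimes> b) = v \<otimes> (w \<otimes> (q \<otimes> b))" "(v \<otimes> w) \<otimes> (q \<otimes> b) = w \<otimes> (v \<otimes> (q \<otimes> b))"
    using c(1,2) t0(2) by algebra+
   then show ?thesis using b w v A_mult by (metis DiffD1 insertE)
  qed
  then show ?case using T_mult[OF v(1) w(1)] by blast
 qed
 from this[OF F(1,2)] obtain w where w: "w \<in> A - n" "\<And>a. a \<in> F ==> w \<otimes> (q \<otimes> a) \<in> A" by blast
 have wc: "w \<in> carrier Q" "w \<otimes> q \<in> carrier Q" using w AQ t0 by auto
 have "smod A {a \<in> A. (w \<otimes> q) \<otimes> a \<in> A}"
  using smod_mult_preimage[OF AQ smod_A smod_A wc(2)] .
 moreover have "F <= {a \<in> A. (w \<otimes> q) \<otimes> a \<in> A}"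
  using F(2) w(2) nA(1) nQ wc t0(2) by (auto simp: m_assoc subset_iff)
 ultimately have "n <= {a \<in> A. (w \<otimes> q) \<otimes> a \<in> A}" using F(3) by blast
 then have "w \<otimes> q \<in> colon A n" using wc by (auto simp: colon_def)
 moreover have "\<iota> (w \<otimes> t0) \<star> x = \<iota> (w \<otimes> q)"
  using \<iota>_simps wc t0 T_closed xc by (simp add: L.m_assoc)
 ultimately show ?thesis using T_mult[OF w(1) t0(1)] by blast
qed

text \<open>The elements of \<open>A - n\<close> act bijectively on \<open>(A : n)/A\<close>, so its
  submodules are the same before and after localization.\<close>

lemma dualizing_loc_iff:
 "CL.dualizing (loc A) \<longleftrightarrow> (\<forall>T. smod A T \<and> A <= T \<and> T <= colon A n --> T = A \<or> T = colon A n)"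
proof
 have nQ: "n <= carrier Q" using nA AQ by blast
 have cQ: "colon A n <= carrier Q" by (auto simp: colon_def)
 have sC: "smod A (colon A n)" using smod_colon[OF smod_A AQ nQ] .
 have loc_colon: "loc (colon A n) <= L.colon (loc A) (loc n)" proof
  fix x assume x: "x \<in> loc (colon A n)"
  have "x \<star> y \<in> loc A" if "y \<in> loc n" for y
   by (rule loc_mult[OF cQ nQ x that]) (auto simp: colon_def)
  then show "x \<in> L.colon (loc A) (loc n)" using x loc_carrier by (auto simp: L.colon_def)
 qed
 assume D: "CL.dualizing (loc A)"
 show "\<forall>T. smod A T \<and> A <= T \<and> T <= colon A n --> T = A \<or> T = colon A n"
 proof (intro allI impI)
  fix T assume T: "smod A T \<and> A <= T \<and> T <= colon A n"
  have pull: "y \<in> Z" if "y \<in> colon A n" "\<iota> y \<in> loc Z" "smod A Z" "A <= Z" for y Z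
  proof -
   have yc: "y \<in> carrier Q" using that(1) cQ by blast
   obtain t z where t: "t \<in> A - n" "z \<in> Z" "\<iota> t \<star> \<iota> y = \<iota> z" using \<open>\<iota> y \<in> loc Z\<close> by (rule locE)
   have c: "t \<in> carrier Q" "z \<in> carrier Q" using t AQ smodD(5)[OF that(3)] by auto
   obtain v where v: "v \<in> A - n" "v \<otimes> (t \<otimes> y) = v \<otimes> z"
    using \<iota>_eqD[of "t \<otimes> y" z] t c yc \<iota>_simps by auto
   have "(v \<otimes> t) \<otimes> y = v \<otimes> z" using v T_closed c yc by (simp add: m_assoc)
   then show ?thesis
    using colon_nD[OF yc T_mult[OF v(1) t(1)] _ that(3,4,1)] smodD(4)[OF that(3) _ t(2)] v(1) by simp
  qed
  have "L.smod (loc A) (loc T)" "loc A <= loc T" "loc T <= L.colon (loc A) (loc n)"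
   using smod_loc loc_mono T loc_colon by blast+
  then consider "loc T = loc A" | "loc T = L.colon (loc A) (loc n)" using D maxl_loc unfolding CL.dualizing_def by metis
  then show "T = A \<or> T = colon A n" proof cases
   case 1
   then have "T <= A" using pull[OF _ _ smod_A order_refl] \<iota>_loc[of T] T cQ by blast
   then show ?thesis using T by blast
  next
   case 2
   then have "colon A n <= T" using pull[of _ T] \<iota>_loc[OF cQ] loc_colon T by blast
   then show ?thesis using T by blast
  qed
 qed
next
 assume H: "\<forall>T. smod A T \<and> A <= T \<and> T <= colon A n --> T = A \<or> T = colon A n"
 show "CL.dualizing (loc A)" unfolding CL.dualizing_def proof (intro conjI allI impI CL.frac_A)
  fix N T assume "L.maxl (loc A) N" and "L.smod (loc A) T \<and> loc A <= T \<and> T <= L.colon (loc A) N"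
  then have N: "N = loc n" and T: "L.smod (loc A) T" "loc A <= T" "T <= L.colon (loc A) (loc n)" using maxl_loc by auto
  have sC: "smod A (colon A n)" using smod_colon[OF smod_A AQ] nA AQ by auto
  let ?Z = "contr (colon A n) T"
  have "A <= ?Z" using colon_A_self[OF n] \<iota>_loc[OF AQ] T(2) by (auto simp: contr_def)
  then consider "?Z = A" | "?Z = colon A n" using H smod_contr[OF sC T(1)] unfolding contr_def by blast
  then show "T = loc A \<or> T = L.colon (loc A) N" proof cases
   case 1
   have "T <= loc A" proof
    fix x assume x: "x \<in> T"
    then obtain t y where t: "t \<in> A - n" "y \<in> colon A n" "\<iota> t \<star> x = \<iota> y" using colon_loc T(3) by blast
    have xc: "x \<in> carrier L" using x T(1) L.smodD(5) by blast
    have "y \<in> ?Z" using mem_if_contr[OF T(1) xc t(1,3)] x t(2) by (simp add: contr_def)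
    then show "x \<in> loc A" using locI[OF xc t(1) _ t(3)] 1 by blast
   qed
   then show ?thesis using T by blast
  next
   case 2
   have "L.colon (loc A) (loc n) <= T" proof
    fix x assume x: "x \<in> L.colon (loc A) (loc n)"
    then obtain t y where t: "t \<in> A - n" "y \<in> colon A n" "\<iota> t \<star> x = \<iota> y" using colon_loc by blast
    have xc: "x \<in> carrier L" using x by (simp add: L.colon_def)
    have "\<iota> y \<in> T" using t(2) 2 by (auto simp: contr_def)
    then show "x \<in> T" using mem_if_contr[OF T(1) xc t(1,3)] by blast
   qed
   then show ?thesis using T N by blast
  qed
 qed
qed

end

section \<open>Rings of fractions as classes of pairs\<close>

text \<open>Only the complement of \<open>P\<close> has to be multiplicative. Besides a maximal
  ideal of \<open>A\<close>, the locale is used for a subset of \<open>Q\<close> whose complement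
  consists of elements of \<open>A\<close>.\<close>

locale mult_loc = cring R for R (structure) +
 fixes P assumes one_T: "\<one> \<notin> P" and mult_T: "s \<in> carrier R - P ==> t \<in> carrier R - P ==> s \<otimes> t \<notin> P"
begin

abbreviation "T \<equiv> carrier R - P"
abbreviation "fr \<equiv> loc_frac R P"
abbreviation "L \<equiv> localization R P"

lemma T1: "\<one> \<in> T" and T2: "s \<in> T ==> t \<in> T ==> s \<otimes> t \<in> T" and T3: "t \<in> T ==> t \<in> carrier R"
 using one_T mult_T by auto

lemma rel_iff:
 "((a, s), (b, t)) \<in> loc_rel R P \<longleftrightarrow> a \<in> carrier R \<and> b \<in> carrier R \<and> s \<in> T \<and> t \<in> T \<and>
   (\<exists>u\<in>T. u \<otimes> (a \<otimes> t) = u \<otimes> (b \<otimes> s))" proof -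
 have "u \<otimes> (a \<otimes> t \<ominus> b \<otimes> s) = \<zero> \<longleftrightarrow> u \<otimes> (a \<otimes> t) = u \<otimes> (b \<otimes> s)"
  if c: "u \<in> carrier R" "a \<in> carrier R" "b \<in> carrier R" "s \<in> carrier R" "t \<in> carrier R" for u
 proof -
  have "u \<otimes> (a \<otimes> t \<ominus> b \<otimes> s) = u \<otimes> (a \<otimes> t) \<ominus> u \<otimes> (b \<otimes> s)" using c by algebra
  then show ?thesis using c by simp
 qed
 then show ?thesis unfolding loc_rel_def by auto
qed

lemma equiv_rel: "equiv (carrier R \<times> T) (loc_rel R P)" proof (rule equivI)
 show "loc_rel R P <= (carrier R \<times> T) \<times> (carrier R \<times> T)" unfolding loc_rel_def by auto
 show "refl_on (carrier R \<times> T) (loc_rel R P)" using T1 by (auto simp: refl_on_def rel_iff)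
 show "sym (loc_rel R P)" proof (rule symI)
  fix x y assume "(x, y) \<in> loc_rel R P"
  then show "(y, x) \<in> loc_rel R P" by (cases x, cases y) (simp only: rel_iff, metis)
 qed
 show "trans (loc_rel R P)" proof (rule transI)
  fix x y z assume xy: "(x, y) \<in> loc_rel R P" "(y, z) \<in> loc_rel R P"
  obtain a s b t c v where e: "x = (a, s)" "y = (b, t)" "z = (c, v)" by (cases x, cases y, cases z)
  obtain u where u: "u \<in> T" "u \<otimes> (a \<otimes> t) = u \<otimes> (b \<otimes> s)" using xy(1) unfolding e rel_iff by blast
  obtain w where w: "w \<in> T" "w \<otimes> (b \<otimes> v) = w \<otimes> (c \<otimes> t)" using xy(2) unfolding e rel_iff by blast
  have c: "a \<in> carrier R" "b \<in> carrier R" "c \<in> carrier R" "s \<in> T" "t \<in> T" "v \<in> T" using xy unfolding e rel_iff by auto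
  have cc: "s \<in> carrier R" "t \<in> carrier R" "v \<in> carrier R" "u \<in> carrier R" "w \<in> carrier R" using c u w by auto
  have "(u \<otimes> w \<otimes> t) \<otimes> (a \<otimes> v) = (u \<otimes> (a \<otimes> t)) \<otimes> (w \<otimes> v)" using c(1-3) cc by algebra
  also have "\<dots> = u \<otimes> s \<otimes> (w \<otimes> (b \<otimes> v))" unfolding u(2) using c(1-3) cc by algebra
  also have "\<dots> = (u \<otimes> w \<otimes> t) \<otimes> (c \<otimes> s)" unfolding w(2) using c(1-3) cc by algebra
  finally show "(x, z) \<in> loc_rel R P" unfolding e rel_iff using c T2[OF T2[OF u(1) w(1)] c(5)] by blast
 qed
qed

lemma fr_eq_iff:
 assumes "a \<in> carrier R" "b \<in> carrier R" "s \<in> T" "t \<in> T"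
 shows "fr a s = fr b t \<longleftrightarrow> (\<exists>u\<in>T. u \<otimes> (a \<otimes> t) = u \<otimes> (b \<otimes> s))"
 unfolding loc_frac_def using eq_equiv_class_iff[OF equiv_rel, of "(a, s)" "(b, t)"] assms by (simp add: rel_iff)

lemma fr_eqI:
 assumes "a \<in> carrier R" "b \<in> carrier R" "s \<in> T" "t \<in> T" "a \<otimes> t = b \<otimes> s"
 shows "fr a s = fr b t" using fr_eq_iff[OF assms(1-4)] T1 assms by auto

lemma mem_fr: "(b, t) \<in> fr a s \<longleftrightarrow> a \<in> carrier R \<and> s \<in> T \<and> b \<in> carrier R \<and> t \<in> T \<and> fr b t = fr a s"
 using fr_eq_iff[of a b s t] unfolding loc_frac_def Image_singleton_iff rel_iff by metis

lemma frD:
 assumes "(b, t) \<in> fr a s"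
 shows "b \<in> carrier R" "t \<in> T" "\<exists>u\<in>T. u \<otimes> (b \<otimes> s) = u \<otimes> (a \<otimes> t)"
 using assms fr_eq_iff[of b a t s] unfolding mem_fr by auto

lemma L_carrier: "X \<in> carrier L \<longleftrightarrow> (\<exists>a\<in>carrier R. \<exists>s\<in>T. X = fr a s)"
 unfolding localization_def loc_frac_def quotient_def by auto

lemma fr_closed: "a \<in> carrier R ==> s \<in> T ==> fr a s \<in> carrier L"
 using L_carrier by blast

text \<open>Operations on classes are defined as unions over representatives; when all of them give
  the same class, the union is that class.\<close>

lemma UN_fr:
 assumes "a \<in> carrier R" "s \<in> T" "\<And>a' s'. (a', s') \<in> fr a s ==> F a' s' = (C :: 'z set)"
 shows "(\<Union>(a', s')\<in>fr a s. F a' s') = C" proof -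
 have "(a, s) \<in> fr a s" using assms mem_fr by blast
 then have "(\<Union>x\<in>fr a s. case x of (a', s') => F a' s') = (\<Union>x\<in>fr a s. C)"
  by (intro SUP_cong[OF refl]) (use assms(3) in \<open>auto split: prod.splits\<close>)
 then show ?thesis using \<open>(a, s) \<in> fr a s\<close> by auto
qed

lemma fr_mult:
 assumes "a \<in> carrier R" "b \<in> carrier R" "s \<in> T" "t \<in> T"
 shows "fr a s \<otimes>\<^bsub>L\<^esub> fr b t = fr (a \<otimes> b) (s \<otimes> t)" proof -
 have "fr (a' \<otimes> b') (s' \<otimes> t') = fr (a \<otimes> b) (s \<otimes> t)" if ab: "(a', s') \<in> fr a s" "(b', t') \<in> fr b t" for a' b' s' t'
 proof -
  note 1 = frD[OF ab(1)] and 2 = frD[OF ab(2)]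
  note c = 1(1) 2(1) 1(2) 2(2)
  obtain u where u: "u \<in> T" "u \<otimes> (a' \<otimes> s) = u \<otimes> (a \<otimes> s')" using 1(3) by blast
  obtain v where v: "v \<in> T" "v \<otimes> (b' \<otimes> t) = v \<otimes> (b \<otimes> t')" using 2(3) by blast
  have cc: "s \<in> carrier R" "t \<in> carrier R" "s' \<in> carrier R" "t' \<in> carrier R" "u \<in> carrier R" "v \<in> carrier R" using c u v assms by auto
  have "(u \<otimes> v) \<otimes> ((a' \<otimes> b') \<otimes> (s \<otimes> t)) = (u \<otimes> (a' \<otimes> s)) \<otimes> (v \<otimes> (b' \<otimes> t))" using cc c(1,2) by algebra
  also have "\<dots> = (u \<otimes> v) \<otimes> ((a \<otimes> b) \<otimes> (s' \<otimes> t'))" unfolding u(2) v(2) using cc assms(1,2) by algebra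
  finally show ?thesis
   using fr_eq_iff[of "a' \<otimes> b'" "a \<otimes> b" "s' \<otimes> t'" "s \<otimes> t"] T2 assms c u(1) v(1) by (meson m_closed)
 qed
 then show ?thesis unfolding localization_def monoid.simps using assms by (intro UN_fr) auto
qed

lemma fr_add:
 assumes "a \<in> carrier R" "b \<in> carrier R" "s \<in> T" "t \<in> T"
 shows "fr a s \<oplus>\<^bsub>L\<^esub> fr b t = fr (a \<otimes> t \<oplus> b \<otimes> s) (s \<otimes> t)"
proof -
 have "fr (a' \<otimes> t' \<oplus> b' \<otimes> s') (s' \<otimes> t') = fr (a \<otimes> t \<oplus> b \<otimes> s) (s \<otimes> t)"
  if ab: "(a', s') \<in> fr a s" "(b', t') \<in> fr b t" for a' b' s' t' proof -
  note 1 = frD[OF ab(1)] and 2 = frD[OF ab(2)]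
  note c = 1(1) 2(1) 1(2) 2(2)
  obtain u where u: "u \<in> T" "u \<otimes> (a' \<otimes> s) = u \<otimes> (a \<otimes> s')" using 1(3) by blast
  obtain v where v: "v \<in> T" "v \<otimes> (b' \<otimes> t) = v \<otimes> (b \<otimes> t')" using 2(3) by blast
  have cc: "s \<in> carrier R" "t \<in> carrier R" "s' \<in> carrier R" "t' \<in> carrier R" "u \<in> carrier R" "v \<in> carrier R" using c u v assms by auto
  have "(u \<otimes> v) \<otimes> ((a' \<otimes> t' \<oplus> b' \<otimes> s') \<otimes> (s \<otimes> t)) =
    (u \<otimes> (a' \<otimes> s)) \<otimes> (v \<otimes> t \<otimes> t') \<oplus> (v \<otimes> (b' \<otimes> t)) \<otimes> (u \<otimes> s \<otimes> s')" using cc c(1,2) by algebra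
  also have "\<dots> = (u \<otimes> v) \<otimes> ((a \<otimes> t \<oplus> b \<otimes> s) \<otimes> (s' \<otimes> t'))" unfolding u(2) v(2) using cc assms(1,2) by algebra
  finally show ?thesis
   using fr_eq_iff[of "a' \<otimes> t' \<oplus> b' \<otimes> s'" "a \<otimes> t \<oplus> b \<otimes> s" "s' \<otimes> t'" "s \<otimes> t"] T2 cc assms c u(1) v(1)
   by (meson m_closed a_closed)
 qed
 then show ?thesis unfolding localization_def ring.simps using assms by (intro UN_fr) auto
qed

lemma L_const: "\<one>\<^bsub>L\<^esub> = fr \<one> \<one>" "\<zero>\<^bsub>L\<^esub> = fr \<zero> \<one>"
 by (simp_all add: localization_def)

lemma cring_L: "cring L" proof (rule cringI)
 have rep: "\<exists>a s. a \<in> carrier R \<and> s \<in> T \<and> s \<in> carrier R \<and> X = fr a s" if "X \<in> carrier L" for X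
  using that unfolding L_carrier by auto
 note ops = fr_mult fr_add L_const T1 T2
 show "abelian_group L" proof (rule abelian_groupI)
  fix X Y Z assume X: "X \<in> carrier L" "Y \<in> carrier L" "Z \<in> carrier L"
  obtain a s where 1: "a \<in> carrier R" "s \<in> carrier R" "s \<in> T" "X = fr a s" using rep[OF X(1)] by blast
  obtain b t where 2: "b \<in> carrier R" "t \<in> carrier R" "t \<in> T" "Y = fr b t" using rep[OF X(2)] by blast
  obtain c u where 3: "c \<in> carrier R" "u \<in> carrier R" "u \<in> T" "Z = fr c u" using rep[OF X(3)] by blast
  note x = 1(1) 2(1) 3(1) 1(2) 2(2) 3(2) and y = 1(3) 2(3) 3(3) and z = 1(4) 2(4) 3(4)
  show "X \<oplus>\<^bsub>L\<^esub> Y \<in> carrier L" unfolding z using x y ops by (simp add: fr_closed)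
  have "fr ((a \<otimes> t \<oplus> b \<otimes> s) \<otimes> u \<oplus> c \<otimes> (s \<otimes> t)) (s \<otimes> t \<otimes> u) = fr (a \<otimes> (t \<otimes> u) \<oplus> (b \<otimes> u \<oplus> c \<otimes> t) \<otimes> s) (s \<otimes> (t \<otimes> u))"
   by (rule fr_eqI) (use x y T2 in \<open>simp_all\<close>, use x in algebra)
  then show "X \<oplus>\<^bsub>L\<^esub> Y \<oplus>\<^bsub>L\<^esub> Z = X \<oplus>\<^bsub>L\<^esub> (Y \<oplus>\<^bsub>L\<^esub> Z)" unfolding z using x y T2 by (simp add: fr_add)
  show "X \<oplus>\<^bsub>L\<^esub> Y = Y \<oplus>\<^bsub>L\<^esub> X" unfolding z using x y by (simp add: fr_add a_comm m_comm)
  show "\<zero>\<^bsub>L\<^esub> \<oplus>\<^bsub>L\<^esub> X = X" unfolding z L_const using x y T1 by (simp add: fr_add)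
  have "fr (\<ominus> a) s \<oplus>\<^bsub>L\<^esub> fr a s = fr \<zero> \<one>"
   unfolding fr_add[OF a_inv_closed[OF x(1)] x(1) y(1) y(1)]
   by (rule fr_eqI) (use x y T1 T2 in \<open>simp_all add: l_minus l_neg\<close>)
  then show "\<exists>Y\<in>carrier L. Y \<oplus>\<^bsub>L\<^esub> X = \<zero>\<^bsub>L\<^esub>"
   unfolding z L_const by (rule bexI[OF _ fr_closed[OF a_inv_closed[OF x(1)] y(1)]])
 qed (use L_const fr_closed T1 in auto)
 show "comm_monoid L" proof (rule comm_monoidI)
  fix X Y Z assume X: "X \<in> carrier L" "Y \<in> carrier L" "Z \<in> carrier L"
  obtain a s where 1: "a \<in> carrier R" "s \<in> carrier R" "s \<in> T" "X = fr a s" using rep[OF X(1)] by blast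
  obtain b t where 2: "b \<in> carrier R" "t \<in> carrier R" "t \<in> T" "Y = fr b t" using rep[OF X(2)] by blast
  obtain c u where 3: "c \<in> carrier R" "u \<in> carrier R" "u \<in> T" "Z = fr c u" using rep[OF X(3)] by blast
  note x = 1(1) 2(1) 3(1) 1(2) 2(2) 3(2) and y = 1(3) 2(3) 3(3) and z = 1(4) 2(4) 3(4)
  show "X \<otimes>\<^bsub>L\<^esub> Y \<in> carrier L" unfolding z using x y ops by (simp add: fr_closed)
  show "X \<otimes>\<^bsub>L\<^esub> Y \<otimes>\<^bsub>L\<^esub> Z = X \<otimes>\<^bsub>L\<^esub> (Y \<otimes>\<^bsub>L\<^esub> Z)" unfolding z using x y T2 by (simp add: fr_mult m_assoc)
  show "X \<otimes>\<^bsub>L\<^esub> Y = Y \<otimes>\<^bsub>L\<^esub> X" unfolding z using x y by (simp add: fr_mult m_comm)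
  show "\<one>\<^bsub>L\<^esub> \<otimes>\<^bsub>L\<^esub> X = X" unfolding z L_const using x y T1 by (simp add: fr_mult)
 qed (use L_const fr_closed T1 in auto)
 fix X Y Z assume X: "X \<in> carrier L" "Y \<in> carrier L" "Z \<in> carrier L"
  obtain a s where 1: "a \<in> carrier R" "s \<in> carrier R" "s \<in> T" "X = fr a s" using rep[OF X(1)] by blast
  obtain b t where 2: "b \<in> carrier R" "t \<in> carrier R" "t \<in> T" "Y = fr b t" using rep[OF X(2)] by blast
  obtain c u where 3: "c \<in> carrier R" "u \<in> carrier R" "u \<in> T" "Z = fr c u" using rep[OF X(3)] by blast
  note x = 1(1) 2(1) 3(1) 1(2) 2(2) 3(2) and y = 1(3) 2(3) 3(3) and z = 1(4) 2(4) 3(4)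
 have "fr ((a \<otimes> t \<oplus> b \<otimes> s) \<otimes> c) (s \<otimes> t \<otimes> u) = fr (a \<otimes> c \<otimes> (t \<otimes> u) \<oplus> b \<otimes> c \<otimes> (s \<otimes> u)) (s \<otimes> u \<otimes> (t \<otimes> u))"
  by (rule fr_eqI) (use x y T2 in \<open>simp_all\<close>, use x in algebra)
 then show "(X \<oplus>\<^bsub>L\<^esub> Y) \<otimes>\<^bsub>L\<^esub> Z = X \<otimes>\<^bsub>L\<^esub> Z \<oplus>\<^bsub>L\<^esub> Y \<otimes>\<^bsub>L\<^esub> Z" unfolding z using x y T2 by (simp add: fr_mult fr_add)
qed

lemma canonical_hom: "(\<lambda>a. fr a \<one>) \<in> ring_hom R L"
 by (rule ring_hom_memI) (use T1 in \<open>auto simp: fr_closed fr_mult fr_add L_const\<close>)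

lemma canonical_unit:
 assumes "t \<in> T" shows "fr t \<one> \<in> Units L" proof -
 have t: "t \<in> carrier R" using assms by blast
 have "fr t t = fr \<one> \<one>" by (rule fr_eqI) (use assms T1 t in auto)
 then have "fr \<one> t \<otimes>\<^bsub>L\<^esub> fr t \<one> = \<one>\<^bsub>L\<^esub>" "fr t \<one> \<otimes>\<^bsub>L\<^esub> fr \<one> t = \<one>\<^bsub>L\<^esub>"
  unfolding L_const using assms T1 t by (simp_all add: fr_mult)
 then show ?thesis unfolding Units_def using fr_closed[OF t T1] fr_closed[OF one_closed assms] by blast
qed

lemma canonical_fr: "a \<in> carrier R ==> t \<in> T ==> fr t \<one> \<otimes>\<^bsub>L\<^esub> fr a t = fr a \<one>"
 using fr_eqI[of "t \<otimes> a" a t \<one>] T1 by (simp add: fr_mult m_comm)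

end

subsection \<open>Invariance under ring isomorphisms\<close>

text \<open>The two rings have elements of the same type; the type \<open>res\<close> of their
  resolutions is then the same as well.\<close>

locale iso_rings = R: cring R + R': cring R' for R :: "('a, 'm) ring_scheme" and R' :: "('a, 'k) ring_scheme" +
 fixes h assumes h: "h \<in> ring_iso R R'"
begin

abbreviation "g \<equiv> inv_into (carrier R) h"

lemmas hE = ring_iso_memE[OF h] and gE = ring_iso_memE[OF ring_iso_set_sym[OF R.ring_axioms h]]

lemma gh: "x \<in> carrier R ==> g (h x) = x" and hg: "y \<in> carrier R' ==> h (g y) = y"
 using hE(5) bij_betw_inv_into_left bij_betw_inv_into_right by metis+

abbreviation "pull J \<equiv> {x \<in> carrier R. h x \<in> J}"
abbreviation "push J \<equiv> {y \<in> carrier R'. g y \<in> J}"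

lemma ideal_pull: "ideal J R' ==> ideal (pull J) R"
 using ring_hom_ring.ideal_vimage[of R R' h J] R.ring_axioms R'.ring_axioms h
 by (simp add: ring_hom_ring_def ring_hom_ring_axioms_def ring_iso_def)

lemma ideal_push: "ideal J R ==> ideal (push J) R'"
 using ring_hom_ring.ideal_vimage[of R' R g J] R.ring_axioms R'.ring_axioms ring_iso_set_sym[OF R.ring_axioms h]
 by (simp add: ring_hom_ring_def ring_hom_ring_axioms_def ring_iso_def)

lemma pull_push: "J <= carrier R ==> pull (push J) = J" using gh hE(1) by auto

lemma push_pull: "J <= carrier R' ==> push (pull J) = J" using hg gE(1) by auto

lemma noetherian_pull:
 assumes "noetherian_ring R'" shows "noetherian_ring R"
proof (intro noetherian_ring.intro noetherian_ring_axioms.intro R.ring_axioms)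
 fix J assume J: "ideal J R"
 have JR: "J <= carrier R" using ideal.Icarr[OF J] by blast
 obtain F where F: "F <= carrier R'" "finite F" "push J = Idl\<^bsub>R'\<^esub> F"
  using noetherian_ring.finetely_gen[OF assms ideal_push[OF J]] by blast
 have gF: "g ` F <= carrier R" using F(1) gE(1) by blast
 have "J = Idl\<^bsub>R\<^esub> (g ` F)" proof
  have "F <= push J" using R'.genideal_self[OF F(1)] F(3) by simp
  then show "Idl\<^bsub>R\<^esub> (g ` F) <= J" using R.genideal_minimal[OF J] by blast
  let ?K = "Idl\<^bsub>R\<^esub> (g ` F)"
  have K: "ideal ?K R" "g ` F <= ?K" using R.genideal_ideal[OF gF] R.genideal_self[OF gF] by auto
  then have "F <= push ?K" using F(1) by auto
  then have "push J <= push ?K" unfolding F(3) using R'.genideal_minimal[OF ideal_push[OF K(1)]] by blast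
  moreover have "?K <= carrier R" using ideal.Icarr[OF K(1)] by blast
  ultimately show "J <= ?K" using pull_push[OF JR] pull_push[of ?K] by blast
 qed
 then show "\<exists>A\<le>carrier R. finite A \<and> J = Idl\<^bsub>R\<^esub> A" using gF F(2) by blast
qed

lemma maximalideal_pull:
 assumes "maximalideal m R'" shows "maximalideal (pull m) R" proof -
 interpret m: maximalideal m R' by fact
 have mR: "m <= carrier R'" using m.Icarr by blast
 show ?thesis proof (intro maximalideal.intro maximalideal_axioms.intro ideal_pull[OF m.is_ideal])
  show "carrier R \<noteq> pull m" proof
   assume "carrier R = pull m"
   then have "push (carrier R) = m" using push_pull[OF mR] by simp
   then show False using m.I_notcarr gE(1) by auto
  qed
  fix J assume J: "ideal J R" "pull m <= J" "J <= carrier R"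
  have "m <= push J" using J(2) mR hg gE(1) by auto
  then have "push J = m \<or> push J = carrier R'" using m.I_maximal[OF ideal_push[OF J(1)]] by blast
  then show "J = pull m \<or> J = carrier R" using pull_push[OF J(3)] hE(1) by auto
 qed
qed

lemma noetherian_local_pull:
 assumes "noetherian_local_ring R'" shows "noetherian_local_ring R" proof -
 obtain m where m: "maximalideal m R'" "\<And>m'. maximalideal m' R' ==> m' = m"
  using assms unfolding noetherian_local_ring_def by blast
 interpret I: iso_rings R' R g
  by (intro iso_rings.intro iso_rings_axioms.intro R.cring_axioms R'.cring_axioms ring_iso_set_sym[OF R.ring_axioms h])
 have "m' = pull m" if m': "maximalideal m' R" for m' proof -
  have "push m' = m" using m(2)[OF I.maximalideal_pull[OF m']] .
  moreover have "m' <= carrier R" using ideal.Icarr[OF maximalideal.axioms(1)[OF m']] by blast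
  ultimately show ?thesis using pull_push[of m'] by simp
 qed
 then have "\<exists>!m. maximalideal m R" by (rule ex1I[of "\<lambda>m. maximalideal m R", OF maximalideal_pull[OF m(1)]])
 then show ?thesis using noetherian_pull assms R.cring_axioms by (simp add: noetherian_local_ring_def)
qed

text \<open>The modules and maps of the resolution are kept; only the scalar action is transported
  along \<open>h\<close>.\<close>

lemma finite_injective_dimension_pull:
 assumes "finite_injective_dimension R' (self_module R')" shows "finite_injective_dimension R (self_module R)"
proof -
 obtain \<epsilon> :: "'a => ('a, 'a) res" and E d n where res: "injective_resolution R' (self_module R') \<epsilon> E d"
  and bd: "\<forall>i>n. carrier (E i) = {\<zero>\<^bsub>E i\<^esub>}" using assms unfolding finite_injective_dimension_def by blast
 have inj: "injective_module R' (E i)" for i using res unfolding injective_resolution_def by blast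
 have eps: "\<epsilon> \<in> mod_hom R' (self_module R') (E 0)" using res unfolding injective_resolution_def by blast
 have dh: "d i \<in> mod_hom R' (E i) (E (Suc i))" for i using res unfolding injective_resolution_def by blast
 define G where "G i = (E i)\<lparr>module.smult := (\<lambda>r. module.smult (E i) (h r))\<rparr>" for i
 have G [simp]: "carrier (G i) = carrier (E i)" "add (G i) = add (E i)" "zero (G i) = zero (E i)"
  "module.smult (G i) r x = h r \<odot>\<^bsub>E i\<^esub> x" for i r x by (simp_all add: G_def)
 have injG: "injective_module R (G i)" for i unfolding injective_module_def proof (intro conjI allI impI)
  interpret E: module R' "E i" using inj unfolding injective_module_def by blast
  have "abelian_group (G i)" by (rule abelian_groupI) (auto simp: E.M.a_ac intro: E.M.l_neg)
  then show "module R (G i)"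
   by (intro moduleI R.cring_axioms) (auto simp: hE E.smult_l_distr E.smult_r_distr E.smult_assoc1)
  fix J f assume Jf: "ideal J R \<and> f \<in> mod_hom R (as_module R J) (G i)"
  then have f: "f \<in> mod_hom R (as_module R J) (G i)" and J: "ideal J R" "J <= carrier R"
   using ideal.Icarr[of J R] by auto
  have "(\<lambda>y\<in>push J. f (g y)) \<in> mod_hom R' (as_module R' (push J)) (E i)" proof (rule mod_homI)
   show "(\<lambda>y\<in>push J. f (g y)) \<in> carrier (as_module R' (push J)) \<rightarrow>\<^sub>E carrier (E i)" using mod_homD(1)[OF f] by auto
   note P = ideal_push[OF J(1)]
   note Pa = additive_subgroup.a_closed[OF ideal.axioms(1)[OF P]]
   show "(\<lambda>y\<in>push J. f (g y)) (x \<oplus>\<^bsub>as_module R' (push J)\<^esub> y) = (\<lambda>y\<in>push J. f (g y)) x \<oplus>\<^bsub>E i\<^esub> (\<lambda>y\<in>push J. f (g y)) y"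
    if "x \<in> carrier (as_module R' (push J))" "y \<in> carrier (as_module R' (push J))" for x y proof -
    have c: "x \<in> push J" "y \<in> push J" "x \<oplus>\<^bsub>R'\<^esub> y \<in> push J" using that Pa by (simp_all only: as_module_simps)
    then have "f (g x \<oplus>\<^bsub>R\<^esub> g y) = f (g x) \<oplus>\<^bsub>E i\<^esub> f (g y)" using mod_homD(2)[OF f] by simp
    moreover have "g (x \<oplus>\<^bsub>R'\<^esub> y) = g x \<oplus>\<^bsub>R\<^esub> g y" using c by (intro gE(3)) auto
    ultimately show ?thesis using c by (simp only: as_module_simps restrict_apply if_True)
   qed
   show "(\<lambda>y\<in>push J. f (g y)) (r \<odot>\<^bsub>as_module R' (push J)\<^esub> x) = r \<odot>\<^bsub>E i\<^esub> (\<lambda>y\<in>push J. f (g y)) x"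
    if "r \<in> carrier R'" "x \<in> carrier (as_module R' (push J))" for r x proof -
    have c: "x \<in> push J" "r \<otimes>\<^bsub>R'\<^esub> x \<in> push J" using that ideal.I_l_closed[OF P] by (simp_all only: as_module_simps)
    have r: "g r \<in> carrier R" "h (g r) = r" using gE(1) hg that(1) by blast+
    then have "f (g r \<otimes>\<^bsub>R\<^esub> g x) = r \<odot>\<^bsub>E i\<^esub> f (g x)" using mod_homD(3)[OF f r(1), of "g x"] c by simp
    moreover have "g (r \<otimes>\<^bsub>R'\<^esub> x) = g r \<otimes>\<^bsub>R\<^esub> g x" using c that(1) by (intro gE(2)) auto
    ultimately show ?thesis using c by (simp only: as_module_simps restrict_apply if_True)
   qed
  qed
  then obtain k where k: "k \<in> mod_hom R' (self_module R') (E i)" "\<forall>y\<in>push J. k y = (\<lambda>y\<in>push J. f (g y)) y"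
   using inj[of i] ideal_push[OF J(1)] unfolding injective_module_def by blast
  have "(\<lambda>x\<in>carrier R. k (h x)) \<in> mod_hom R (self_module R) (G i)"
   by (rule mod_homI) (use mod_homD[OF k(1)] hE in auto)
  moreover have "\<forall>x\<in>J. (\<lambda>x\<in>carrier R. k (h x)) x = f x" using k(2) J(2) gh hE(1) by auto
  ultimately show "\<exists>g\<in>mod_hom R (self_module R) (G i). \<forall>x\<in>J. g x = f x" by blast
 qed
 have "injective_resolution R (self_module R) (\<lambda>x\<in>carrier R. \<epsilon> (h x)) G d"
  unfolding injective_resolution_def proof (intro conjI allI injG)
  show "(\<lambda>x\<in>carrier R. \<epsilon> (h x)) \<in> mod_hom R (self_module R) (G 0)"
   by (rule mod_homI) (use mod_homD[OF eps] hE in auto)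
  have "inj_on \<epsilon> (carrier R')" using res unfolding injective_resolution_def by simp
  then show "inj_on (\<lambda>x\<in>carrier R. \<epsilon> (h x)) (carrier (self_module R))"
   using hE(1,5) by (auto simp: inj_on_def bij_betw_def)
  show "d i \<in> mod_hom R (G i) (G (Suc i))" for i by (rule mod_homI) (use mod_homD[OF dh[of i]] hE in auto)
  have "(\<lambda>x\<in>carrier R. \<epsilon> (h x)) ` carrier R = \<epsilon> ` h ` carrier R" by (auto simp: image_image)
  also have "h ` carrier R = carrier R'" using hE(5) by (simp add: bij_betw_def)
  finally show "(\<lambda>x\<in>carrier R. \<epsilon> (h x)) ` carrier (self_module R) = {x \<in> carrier (G 0). d 0 x = \<zero>\<^bsub>G 1\<^esub>}"
   using res unfolding injective_resolution_def by simp
  show "d i ` carrier (G i) = {x \<in> carrier (G (Suc i)). d (Suc i) x = \<zero>\<^bsub>G (Suc (Suc i))\<^esub>}" for i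
   using res unfolding injective_resolution_def by simp
 qed
 moreover have "\<forall>i>n. carrier (G i) = {\<zero>\<^bsub>G i\<^esub>}" using bd by simp
 ultimately show ?thesis unfolding finite_injective_dimension_def by blast
qed

end

context curve begin

lemma noetherian_R0: "noetherian_ring R0" proof -
 interpret R: cring R0 by (rule cring_subr[OF A])
 show ?thesis proof (intro noetherian_ring.intro noetherian_ring_axioms.intro R.ring_axioms)
  fix J assume "ideal J R0"
  then have J: "smod A J" "J <= A" using ideal_iff_smod[OF A] by auto
  obtain F where F: "finite F" "F <= J" "\<And>X. smod A X \<and> F <= X --> J <= X" using noeth[OF J] by blast
  have FA: "F <= carrier R0" using F J by auto
  have "J = Idl\<^bsub>R0\<^esub> F" proof
   show "Idl\<^bsub>R0\<^esub> F <= J" using R.genideal_minimal[OF \<open>ideal J R0\<close> F(2)] .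
   show "J <= Idl\<^bsub>R0\<^esub> F" using F(3) R.genideal_ideal[OF FA] R.genideal_self[OF FA] ideal_iff_smod[OF A] by blast
  qed
  then show "\<exists>B\<le>carrier R0. finite B \<and> J = Idl\<^bsub>R0\<^esub> B" using F(1) FA by blast
 qed
qed

text \<open>Two localizations meet: that of \<open>A\<close> at \<open>n\<close>, by which
  Gorenstein rings are defined, and that of \<open>Q\<close> with the same denominators, where
  \<open>loc_curve\<close> works. Fractions \<open>a/t\<close> identify the first with the subring
  \<open>loc A\<close> of the second.\<close>

lemma gorenstein_localization_iff:
 assumes n: "maxl A n" shows "gorenstein_local_ring (localization R0 n) \<longleftrightarrow>
  (\<forall>T. smod A T \<and> A <= T \<and> T <= colon A n --> T = A \<or> T = colon A n)"
proof -
 have nA: "n <= A" "smod A n" "n \<noteq> A" using n by (auto simp: maxl_def)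
 have n1: "\<one> \<notin> n" using nA smodD(4)[OF nA(2), of _ \<one>] A_closed by fastforce
 have nT: "s \<otimes> t \<notin> n" if "s \<in> A - n" "t \<in> A - n" for s t using maxl_prime[OF A n, of s t] that by auto
 \<comment> \<open>Chosen so that its complement in \<open>Q\<close> is the set \<open>A - n\<close>
   of denominators.\<close>
 define P where "P = carrier Q - (A - n)"
 have T: "carrier Q - P = A - n" using AQ by (auto simp: P_def)
 interpret M: mult_loc Q P
  by unfold_locales (use n1 nT one_A A_mult in \<open>auto simp: T, auto simp: P_def\<close>)
 interpret R0: cring R0 by (rule cring_subr[OF A])
 interpret N: mult_loc R0 n by unfold_locales (use n1 nT in auto)
 interpret LC: loc_curve Q A s M.L n "\<lambda>a. M.fr a \<one>"
 proof (intro loc_curve.intro loc_curve_axioms.intro curve_axioms M.cring_L n M.canonical_hom)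
  show "M.fr t \<one> \<in> Units M.L" if "t \<in> A - n" for t using M.canonical_unit that T by blast
  show "\<exists>t\<in>A - n. \<exists>q\<in>carrier Q. M.fr t \<one> \<otimes>\<^bsub>M.L\<^esub> x = M.fr q \<one>" if "x \<in> carrier M.L" for x
   using that M.canonical_fr unfolding M.L_carrier T by blast
  show "\<exists>t\<in>A - n. t \<otimes> p = t \<otimes> q" if "p \<in> carrier Q" "q \<in> carrier Q" "M.fr p \<one> = M.fr q \<one>" for p q
   using M.fr_eq_iff[of p q \<one> \<one>] that M.T1 unfolding T by auto
 qed
 have eq: "N.fr a s = N.fr b t \<longleftrightarrow> M.fr a s = M.fr b t" if "a \<in> A" "b \<in> A" "s \<in> A - n" "t \<in> A - n" for a b s t
  using N.fr_eq_iff[of a b s t] M.fr_eq_iff[of a b s t] that A_closed unfolding T by simp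
 define h where "h X = (\<Union>(a, t)\<in>X. M.fr a t)" for X
 have h: "h (N.fr a t) = M.fr a t" if "a \<in> A" "t \<in> A - n" for a t
  unfolding h_def by (rule N.UN_fr) (use that eq in \<open>auto simp: N.mem_fr\<close>)
 have mem_loc: "M.fr a t \<in> LC.loc A" if "a \<in> A" "t \<in> A - n" for a t
  using M.canonical_fr[of a t] M.fr_closed[of a t] that A_closed T LC.locI[of "M.fr a t" t a] by simp
 have loc_ex: "\<exists>a\<in>A. \<exists>t\<in>A - n. x = M.fr a t" if x: "x \<in> LC.loc A" for x proof -
  obtain t a where t: "t \<in> A - n" "a \<in> A" "x \<in> carrier M.L" "M.fr t \<one> \<otimes>\<^bsub>M.L\<^esub> x = M.fr a \<one>" using x by (rule LC.locE)
  have "M.fr t \<one> \<otimes>\<^bsub>M.L\<^esub> M.fr a t = M.fr a \<one>" using M.canonical_fr[of a t] t A_closed T by simp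
  then have "x = M.fr a t" using LC.\<iota>_cancel[OF t(1,3)] LC.\<iota>_cancel[OF t(1), of "M.fr a t"] t M.fr_closed[of a t] A_closed T by simp
  then show ?thesis using t by blast
 qed
 let ?B = "M.L\<lparr>carrier := LC.loc A\<rparr>"
 have Nc: "X \<in> carrier N.L \<longleftrightarrow> (\<exists>a\<in>A. \<exists>t\<in>A - n. X = N.fr a t)" for X using N.L_carrier by simp
 have hiso: "h \<in> ring_iso N.L ?B" proof (rule ring_iso_memI)
  have "h X \<in> LC.loc A" if "X \<in> carrier N.L" for X using that h mem_loc unfolding Nc by auto
  moreover have "x \<in> h ` carrier N.L" if x: "x \<in> LC.loc A" for x proof -
   obtain a t where a: "a \<in> A" "t \<in> A - n" "x = M.fr a t" using loc_ex[OF x] by blast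
   then show ?thesis using image_eqI[of x h "N.fr a t"] h[of a t] Nc by metis
  qed
  ultimately have "h ` carrier N.L = LC.loc A" by blast
  moreover have "inj_on h (carrier N.L)" proof (rule inj_onI)
   fix X Y assume "X \<in> carrier N.L" "Y \<in> carrier N.L" and hXY: "h X = h Y"
   then obtain a t b u where "a \<in> A" "t \<in> A - n" "X = N.fr a t" "b \<in> A" "u \<in> A - n" "Y = N.fr b u"
    unfolding Nc by meson
   then show "X = Y" using hXY h[of a t] h[of b u] eq[of a b t u] by simp
  qed
  ultimately show "bij_betw h (carrier N.L) (carrier ?B)" by (simp add: bij_betw_def)
  show "h x \<in> carrier ?B" if "x \<in> carrier N.L" for x using that h mem_loc unfolding Nc by auto
  show "h \<one>\<^bsub>N.L\<^esub> = \<one>\<^bsub>?B\<^esub>" using h[of \<one> \<one>] one_A n1 N.L_const M.L_const by simp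
  fix x y assume "x \<in> carrier N.L" "y \<in> carrier N.L"
  then obtain a t b u where x: "a \<in> A" "t \<in> A - n" "x = N.fr a t" and y: "b \<in> A" "u \<in> A - n" "y = N.fr b u"
   unfolding Nc by blast
  have tu: "t \<otimes> u \<in> A - n" using nT x y A_mult by auto
  show "h (x \<otimes>\<^bsub>N.L\<^esub> y) = h x \<otimes>\<^bsub>?B\<^esub> h y"
   using x y h[OF A_mult[OF x(1) y(1)] tu] N.fr_mult[of a b t u] M.fr_mult[of a b t u] h T A_closed by simp
  show "h (x \<oplus>\<^bsub>N.L\<^esub> y) = h x \<oplus>\<^bsub>?B\<^esub> h y"
   using x y h[of "a \<otimes> u \<oplus> b \<otimes> t", OF _ tu] N.fr_add[of a b t u] M.fr_add[of a b t u] h T A_closed A_mult A_add by simp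
 qed
 have cB: "cring ?B" using LC.L.cring_subr[OF LC.loc_A_subring] .
 interpret I: iso_rings N.L ?B h by (intro iso_rings.intro iso_rings_axioms.intro N.cring_L cB hiso)
 interpret I': iso_rings ?B N.L I.g
  by (intro iso_rings.intro iso_rings_axioms.intro N.cring_L cB ring_iso_set_sym[OF I.R.ring_axioms hiso])
 have "noetherian_local_ring ?B"
  unfolding noetherian_local_ring_def LC.L.maximalideal_iff_maxl[OF LC.loc_A_subring]
  using cB LC.CL.noetherian_R0 LC.maxl_loc by blast
 then have "noetherian_local_ring N.L" by (rule I.noetherian_local_pull)
 then have "gorenstein_local_ring N.L \<longleftrightarrow> finite_injective_dimension ?B (self_module ?B)"
  unfolding gorenstein_local_ring_def using I.finite_injective_dimension_pull I'.finite_injective_dimension_pull by blast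
 also have "\<dots> \<longleftrightarrow> LC.CL.dualizing (LC.loc A)"
  using LC.CL.dualizing_finite_injective_dimension LC.maxl_loc
   LC.CL.finite_injective_dimension_dualizing[of "LC.loc n"] LC.CL.noetherian_R0 by blast
 finally show ?thesis unfolding LC.dualizing_loc_iff .
qed

theorem gorenstein_ring_iff: "gorenstein_ring R0 \<longleftrightarrow> dualizing A"
 unfolding gorenstein_ring_def dualizing_def maximalideal_iff_maxl[OF A]
 using cring_subr[OF A] noetherian_R0 gorenstein_localization_iff frac_A by simp

end

subsection \<open>One-dimensional Cohen-Macaulay local rings\<close>

context cring begin

definition prm :: "'a set => 'a set => bool" where
 "prm A P \<longleftrightarrow> smod A P \<and> P <= A \<and> \<one> \<notin> P \<and> (\<forall>a\<in>A. \<forall>b\<in>A. a \<otimes> b \<in> P --> a \<in> P \<or> b \<in> P)"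

lemma prm_primeideal:
 assumes A: "subring A R" and P: "prm A P" shows "primeideal P (subr A)" proof (rule primeidealI)
 show "ideal P (subr A)" using ideal_iff_smod[OF A] P by (auto simp: prm_def)
 show "cring (subr A)" by (rule cring_subr[OF A])
 show "carrier (subr A) \<noteq> P" using P subringE(3)[OF A] by (auto simp: prm_def)
qed (use P in \<open>auto simp: prm_def\<close>)

lemma maxl_prm:
 assumes A: "subring A R" and n: "maxl A n" shows "prm A n" proof -
 have s: "smod A n" "n \<subset> A" using n by (auto simp: maxl_def)
 have "\<one> \<notin> n" proof
  assume "\<one> \<in> n"
  then have "scale \<one> A <= n" by (rule cyclic_least[OF A s(1)])
  then show False using scale_one[OF subringE(1)[OF A]] s(2) by auto
 qed
 then show ?thesis unfolding prm_def using s maxl_prime[OF A n] by blast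
qed

lemma ideal_smult_single:
 assumes A: "subring A R" and X: "smod A X" and a: "a \<in> A"
 shows "ideal_smult (subr A) (as_module R X) {a} X = scale a X"
  "ideal_smult (subr A) (as_module R X) {} X = {\<zero>}" proof -
 have AR: "A <= carrier R" using subringE(1)[OF A] .
 have s: "smod A (scale a X)" "scale a X <= X"
  using smod_scale[OF X _ AR] a AR smodD(4)[OF X a] by (auto simp: mem_scale)
 have "smod A {\<zero>}" using AR by (intro smodI) auto
 then show "ideal_smult (subr A) (as_module R X) {} X = {\<zero>}"
  unfolding ideal_smult_def module_span_def submodule_as_module[OF A X] using smodD(2) smodD(2)[OF X] by auto
 show "ideal_smult (subr A) (as_module R X) {a} X = scale a X"
  unfolding ideal_smult_def module_span_def submodule_as_module[OF A X] using s by (auto simp: scale_def)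
qed

lemma regular_sequenceD:
 assumes A: "subring A R" and X: "smod A X" and xs: "regular_sequence (subr A) (as_module R X) xs"
 shows "0 < length xs ==> x \<in> X ==> (xs ! 0) \<otimes> x = \<zero> ==> x = \<zero>"
  "1 < length xs ==> x \<in> X ==> (xs ! 1) \<otimes> x \<in> scale (xs ! 0) X ==> x \<in> scale (xs ! 0) X"
proof -
 have xA: "set xs <= A" and
  reg: "\<And>i v. i < length xs ==> v \<in> X ==> (xs ! i) \<otimes> v \<in> ideal_smult (subr A) (as_module R X) (set (take i xs)) X
   ==> v \<in> ideal_smult (subr A) (as_module R X) (set (take i xs)) X"
  using xs unfolding regular_sequence_def by auto
 show "0 < length xs ==> x \<in> X ==> (xs ! 0) \<otimes> x = \<zero> ==> x = \<zero>"
  using reg[of 0 x] ideal_smult_single(2)[OF A X, of "xs ! 0"] xA by (auto simp: subset_iff)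
 assume l: "1 < length xs"
 then have "set (take 1 xs) = {xs ! 0}" "xs ! 0 \<in> A" using xA by (cases xs; auto)+
 then show "x \<in> X ==> (xs ! 1) \<otimes> x \<in> scale (xs ! 0) X ==> x \<in> scale (xs ! 0) X"
  using reg[OF l, of x] ideal_smult_single(1)[OF A X] by simp
qed

end

locale noeth_subring = cring R for R (structure) +
 fixes A assumes A: "subring A R" and noe: "noetherian_ring (subr A)"
begin

lemma AR: "A <= carrier R" using subringE(1)[OF A] .
lemma AE: "\<one> \<in> A" "a \<in> A ==> b \<in> A ==> a \<otimes> b \<in> A" "a \<in> A ==> b \<in> A ==> a \<oplus> b \<in> A" "a \<in> A ==> a \<in> carrier R"
 using subringE(3,6,7)[OF A] AR by auto
lemma sA: "smod A A" using smod_self[OF A] .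

lemma sub_induct [consumes 2, case_names step]:
 assumes J: "smod A J" "J <= A"
  and step: "\<And>J. smod A J ==> J <= A ==> (\<And>J'. smod A J' ==> J' <= A ==> J \<subset> J' ==> P J') ==> P J"
 shows "P J" proof (rule noetherian_ring.ideal_induct[OF noe, of P])
 show "ideal J (subr A)" using J ideal_iff_smod[OF A] by blast
 show "P J" if "ideal J (subr A)" "\<And>J'. ideal J' (subr A) ==> J \<subset> J' ==> P J'" for J
  using that step[of J] unfolding ideal_iff_smod[OF A] by blast
qed

text \<open>Noetherian induction reaches an ideal that is maximal among those missing
  \<open>M\<close>, and such an ideal is prime.\<close>

lemma prime_avoiding:
 assumes M: "M <= A" "\<one> \<in> M" "\<And>a b. a \<in> M ==> b \<in> M ==> a \<otimes> b \<in> M" and J: "smod A J" "J <= A" "J \<inter> M = {}"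
 shows "\<exists>P. prm A P \<and> J <= P \<and> P \<inter> M = {}" using J
proof (induction rule: sub_induct)
 case (step J)
 show ?case
 proof (cases "\<exists>J'. smod A J' \<and> J' <= A \<and> J \<subset> J' \<and> J' \<inter> M = {}")
  case True
  then show ?thesis using step.IH by (meson psubset_imp_subset subset_trans)
 next
  case False
  have meet: "\<exists>p\<in>J. \<exists>r\<in>A. p \<oplus> r \<otimes> a \<in> M" if a: "a \<in> A" "a \<notin> J" for a
  proof -
   have ac: "a \<in> carrier R" using a AE by blast
   let ?J = "J \<boxplus> scale a A"
   have "smod A ?J" "?J <= A" using smod_add[OF step.hyps(1) smod_cyclic(1)[OF A ac] AR]
    set_add_least[OF sA step.hyps(2) cyclic_least[OF A sA a(1)]] by auto
   moreover have "J \<subset> ?J"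
    using set_add_upper[OF step.hyps(1) smod_cyclic(1)[OF A ac]] smod_cyclic(2)[OF A ac] a by blast
   ultimately obtain y where y: "y \<in> ?J" "y \<in> M" using False by blast
   then show ?thesis using mem_cyclic[OF A ac] unfolding mem_set_add by metis
  qed
  have "a \<in> J \<or> b \<in> J" if ab: "a \<in> A" "b \<in> A" "a \<otimes> b \<in> J" for a b
  proof (rule ccontr)
   assume "\<not> ?thesis"
   then obtain p r p' r' where p: "p \<in> J" "r \<in> A" "p \<oplus> r \<otimes> a \<in> M" and p': "p' \<in> J" "r' \<in> A" "p' \<oplus> r' \<otimes> b \<in> M"
    using meet ab by meson
   have c: "a \<in> carrier R" "b \<in> carrier R" "p \<in> carrier R" "r \<in> carrier R" "p' \<in> carrier R" "r' \<in> carrier R"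
    using ab p p' AE step.hyps by auto
   have "(p \<oplus> r \<otimes> a) \<otimes> (p' \<oplus> r' \<otimes> b) = (p' \<oplus> r' \<otimes> b) \<otimes> p \<oplus> (r \<otimes> a) \<otimes> p' \<oplus> (r \<otimes> r') \<otimes> (a \<otimes> b)"
    using c by algebra
   also have "\<dots> \<in> J" using smodD(3,4)[OF step.hyps(1)] p p' ab AE(2) M(1) by (meson subsetD)
   finally show False using M(3)[OF p(3) p'(3)] step.prems by blast
  qed
  then have "prm A J" unfolding prm_def using step.hyps step.prems M(2) by blast
  then show ?thesis using step.prems by blast
 qed
qed

lemma maxl_above:
 assumes "smod A J" "J <= A" "\<one> \<notin> J" shows "\<exists>n. maxl A n \<and> J <= n"
 using assms proof (induction rule: sub_induct)
 case (step J)
 show ?case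
 proof (cases "\<exists>J'. smod A J' \<and> J' <= A \<and> J \<subset> J' \<and> \<one> \<notin> J'")
  case True
  then show ?thesis using step.IH by (meson psubset_imp_subset subset_trans)
 next
  case False
  have "X = J" if X: "smod A X" "J <= X" "X \<subset> A" for X proof (rule ccontr)
   assume "X \<noteq> J"
   then have "\<one> \<in> X" using False X by blast
   then have "A <= X" using cyclic_least[OF A X(1)] scale_one[OF AR] by metis
   then show False using X(3) by blast
  qed
  then have "maxl A J" unfolding maxl_def using step AE(1) by blast
  then show ?thesis by blast
 qed
qed

end

locale local_dim1 = noeth_subring +
 fixes m s
 assumes m: "maxl A n \<longleftrightarrow> n = m" and dim: "krull_dim (subr A) = 1"
  and s_m: "s \<in> m" and s_nzd: "x \<in> A ==> s \<otimes> x = \<zero> ==> x = \<zero>"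
begin

lemma mA: "smod A m" "m \<subset> A" using m[of m] by (auto simp: maxl_def)
lemma sA': "s \<in> A" using s_m mA by blast

text \<open>Since \<open>b\<close> is regular, the products \<open>tb^k\<close> with
  \<open>t\<close> outside \<open>P\<close> are never zero. A prime that misses all of them lies
  strictly below \<open>P\<close>, so \<open>P\<close> different from \<open>m\<close> would give a
  chain of primes of length two.\<close>

lemma prime_eq_max:
 assumes P: "prm A P" "b \<in> P" and b: "\<And>x. x \<in> A ==> b \<otimes> x = \<zero> ==> x = \<zero>"
 shows "P = m" proof (rule ccontr)
 assume ne: "P \<noteq> m"
 have P': "smod A P" "P <= A" "\<one> \<notin> P" using P(1) by (auto simp: prm_def)
 have "P <= m" using maxl_above[OF P'] m by blast
 have bA: "b \<in> A" "b \<in> carrier R" using P P' AR by auto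
 let ?M = "{t \<otimes> b [^] (k::nat) | t k. t \<in> A - P}"
 have Tm: "t \<otimes> u \<in> A - P" if "t \<in> A - P" "u \<in> A - P" for t u using that P(1) AE(2) by (auto simp: prm_def)
 have pow: "b [^] (k::nat) \<in> A" for k by (induction k) (use AE bA in auto)
 have nz: "t = \<zero>" if "t \<in> A" "t \<otimes> b [^] (k::nat) = \<zero>" for t k using that
 proof (induction k)
  case (Suc k)
  have "b \<otimes> (t \<otimes> b [^] k) = t \<otimes> b [^] Suc k" using Suc.prems AE(4) bA by (simp add: m_ac)
  then show ?case using b[of "t \<otimes> b [^] k"] Suc AE(2) pow by auto
 qed (use AE in auto)
 have "\<exists>P0. prm A P0 \<and> {\<zero>} <= P0 \<and> P0 \<inter> ?M = {}"
 proof (rule prime_avoiding)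
  show "?M <= A" using AE(2) pow by blast
  show "\<one> \<in> ?M" using AE(1) P'(3) by (intro CollectI exI[of _ \<one>] exI[of _ 0]) auto
  show "x \<otimes> y \<in> ?M" if xy: "x \<in> ?M" "y \<in> ?M" for x y proof -
   obtain t k u l where t: "t \<in> A - P" "x = t \<otimes> b [^] (k::nat)" "u \<in> A - P" "y = u \<otimes> b [^] (l::nat)" using xy by blast
   have c: "t \<in> carrier R" "u \<in> carrier R" "b [^] k \<in> carrier R" "b [^] l \<in> carrier R" using t AE bA by auto
   have "x \<otimes> y = (t \<otimes> u) \<otimes> (b [^] k \<otimes> b [^] l)" unfolding t using c by algebra
   then have "x \<otimes> y = (t \<otimes> u) \<otimes> b [^] (k + l)" using bA by (simp add: nat_pow_mult)
   then show ?thesis using Tm t by blast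
  qed
  show "smod A {\<zero>}" using AR by (intro smodI) auto
  show "{\<zero>} \<inter> ?M = {}" using nz smodD(2)[OF P'(1)] by fastforce
 qed (use smodD(2)[OF sA] in auto)
 then obtain P0 where P0: "prm A P0" "P0 \<inter> ?M = {}" by blast
 have "t \<in> ?M" if "t \<in> A - P" for t using that AE(4) by (intro CollectI exI[of _ t] exI[of _ 0]) auto
 then have sub: "P0 <= P" using P0 by (auto simp: prm_def)
 have "b \<in> ?M" using AE(1) P'(3) bA by (intro CollectI exI[of _ \<one>] exI[of _ 1]) auto
 then have lt: "P0 \<subset> P" "P \<subset> m" using sub P0(2) P(2) ne \<open>P <= m\<close> by auto
 define C where "C i = (if i = 0 then P0 else if i = 1 then P else m)" for i :: nat
 have "primeideal P0 (subr A)" "primeideal P (subr A)" "primeideal m (subr A)"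
  using prm_primeideal[OF A] P0(1) P(1) maxl_prm[OF A, of m] m[of m] by auto
 then have "\<forall>i\<le>2. primeideal (C i) (subr A)" by (simp add: C_def)
 moreover have "\<forall>i<2. C i \<subset> C (Suc i)" proof (intro allI impI)
  show "C i \<subset> C (Suc i)" if "i < 2" for i using lt that by (cases i) (auto simp: C_def)
 qed
 ultimately have "enat 2 <= krull_dim (subr A)" unfolding krull_dim_def by (intro Sup_upper) blast
 then show False using dim by (simp add: one_enat_def)
qed

text \<open>A prime above \<open>aA\<close> contains the regular element \<open>a\<close>, so it
  equals \<open>m\<close> and contains \<open>b\<close>; hence no prime above \<open>aA\<close>
  misses the powers of \<open>b\<close>.\<close>

lemma power_mem:
 assumes a: "a \<in> A" "\<And>x. x \<in> A ==> a \<otimes> x = \<zero> ==> x = \<zero>" and b: "b \<in> m"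
 shows "\<exists>k::nat. b [^] k \<in> scale a A" proof (rule ccontr)
 assume "\<nexists>k::nat. b [^] k \<in> scale a A"
 then have dis: "scale a A \<inter> range (\<lambda>k::nat. b [^] k) = {}" by blast
 have bA: "b \<in> A" "b \<in> carrier R" using b mA AR by auto
 have "\<exists>P. prm A P \<and> scale a A <= P \<and> P \<inter> range (\<lambda>k::nat. b [^] k) = {}"
 proof (rule prime_avoiding[OF _ _ _ smod_cyclic(1)[OF A] cyclic_least[OF A sA a(1)] dis])
  have "b [^] (k::nat) \<in> A" for k by (induction k) (use AE bA in auto)
  then show "range (\<lambda>k::nat. b [^] k) <= A" by blast
  show "\<one> \<in> range (\<lambda>k::nat. b [^] k)" by (rule image_eqI[of _ _ 0]) auto
 qed (use a AR bA nat_pow_mult[OF bA(2)] in auto)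
 then obtain P where P: "prm A P" "scale a A <= P" "P \<inter> range (\<lambda>k::nat. b [^] k) = {}" by blast
 have "a \<in> P" using P(2) smod_cyclic(2)[OF A AE(4)[OF a(1)]] by blast
 then have "P = m" using prime_eq_max[OF P(1) _ a(2)] by blast
 then have "b [^] (1::nat) \<in> P" using b bA by simp
 then show False using P(3) by blast
qed

text \<open>Noetherian induction. A prime \<open>J\<close> is \<open>m\<close>. Otherwise, unless
  \<open>J = A\<close>, some product \<open>ab\<close> of elements outside \<open>J\<close> lies in
  \<open>J\<close>; then \<open>A/J\<close> is made up of \<open>A/(J + aA)\<close> and a copy of
  \<open>A/(J : a)\<close>, and both ideals are larger than \<open>J\<close>.\<close>

lemma len_finite_if_nzd:
 assumes J: "smod A J" "J <= A" "s \<in> J" shows "len A A J \<noteq> \<infinity>" using J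
proof (induction rule: sub_induct)
 case (step J)
 show ?case proof (cases "prm A J")
  case True
  then have "J = m" using prime_eq_max[OF _ step.prems s_nzd] by blast
  let ?f = "\<lambda>T. if T = J then 0 else 1 :: enat"
  have "len A A J + ?f J <= ?f A"
   by (rule len_rank[OF sA step.hyps]) (use m[of J] \<open>J = m\<close> in \<open>auto simp: maxl_def\<close>)
  then have "len A A J <= 1" by (auto split: if_splits)
  then show ?thesis by (cases "len A A J") auto
 next
  case False
  show ?thesis proof (cases "\<one> \<in> J")
   case True
   then have "A <= J" using cyclic_least[OF A step.hyps(1)] scale_one[OF AR] by metis
   then have "J = A" using step.hyps by blast
   then show ?thesis by (simp add: len_self)
  next
   case n1: False
   obtain a b where ab: "a \<in> A" "b \<in> A" "a \<otimes> b \<in> J" "a \<notin> J" "b \<notin> J"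
    using False n1 step.hyps unfolding prm_def by blast
   have ac: "a \<in> carrier R" "b \<in> carrier R" using ab AE by auto
   let ?J = "J \<boxplus> scale a A" and ?K = "{r \<in> A. r \<otimes> a \<in> J}"
   note JD = smodD[OF step.hyps(1)]
   have J': "smod A ?J" "?J <= A" using smod_add[OF step.hyps(1) smod_cyclic(1)[OF A ac(1)] AR]
    set_add_least[OF sA step.hyps(2) cyclic_least[OF A sA ab(1)]] by auto
   have up: "J <= ?J" "a \<in> ?J"
    using set_add_upper[OF step.hyps(1) smod_cyclic(1)[OF A ac(1)]] smod_cyclic(2)[OF A ac(1)] by auto
   then have "J \<subset> ?J" "s \<in> ?J" using ab step.prems by auto
   then have 1: "len A A ?J \<noteq> \<infinity>" using step.IH[OF J'] by blast
   have sK: "smod A {r \<in> A. r \<otimes> a \<in> T}" if "smod A T" for T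
    using smodD[OF that] smodD[OF sA] AR ac by (intro smodI) (auto simp: l_distr m_assoc subset_iff)
   have "b \<in> ?K" using ab m_comm ac by simp
   moreover have JK: "J <= ?K" using JD(4,5) step.hyps(2) ab(1) m_comm[of _ a] ac by auto
   ultimately have "J \<subset> ?K" "s \<in> ?K" using ab step.prems by auto
   then have 2: "len A A ?K \<noteq> \<infinity>" using step.IH[OF sK[OF step.hyps(1)]] by blast
   have dec: "\<exists>j\<in>J. \<exists>r\<in>A. x = j \<oplus> r \<otimes> a" if "x \<in> ?J" for x
    using that mem_cyclic[OF A ac(1)] unfolding mem_set_add by metis
   have "len A ?J J <= len A A ?K"
   proof (rule len_map[where \<Phi> = "\<lambda>T. {r \<in> A. r \<otimes> a \<in> T}"])
    fix T T' assume T: "smod A T" "smod A T'" "J <= T" "T \<subset> T'" "T' <= ?J"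
    obtain x where x: "x \<in> T'" "x \<notin> T" using T by blast
    then obtain j r where jr: "j \<in> J" "r \<in> A" "x = j \<oplus> r \<otimes> a" using dec T(5) by blast
    have c: "j \<in> carrier R" "r \<in> carrier R" using jr JD(5) AE by auto
    have "x \<ominus> j = r \<otimes> a" unfolding jr(3) using c ac by algebra
    then have "r \<otimes> a \<in> T'" using smod_minus[OF T(2) A x(1), of j] jr(1) T by auto
    moreover have "r \<otimes> a \<notin> T" using smodD(3)[OF T(1), of j "r \<otimes> a"] jr x T(3) by blast
    ultimately show "{r \<in> A. r \<otimes> a \<in> T} \<subset> {r \<in> A. r \<otimes> a \<in> T'}" using T(4) jr(2) by blast
   qed (use sK in auto)
   then have "len A ?J J \<noteq> \<infinity>" using 2 by (cases "len A ?J J") auto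
   moreover have "len A A J = len A A ?J + len A ?J J" by (rule len_add) (use A sA J' step.hyps up in auto)
   ultimately show ?thesis using 1 by (auto simp: plus_eq_infty_iff_enat)
  qed
 qed
qed

text \<open>Dimension one enters through \<open>power_mem\<close>: a denominator is regular and
  therefore divides a power of \<open>s\<close>.\<close>

lemma curve_local:
 assumes u: "\<And>b. b \<in> A ==> (\<And>x. x \<in> A ==> b \<otimes> x = \<zero> ==> x = \<zero>) ==> b \<in> Units R"
  and frac: "\<And>q. q \<in> carrier R ==> \<exists>a\<in>A. \<exists>b\<in>A. (\<forall>x\<in>A. b \<otimes> x = \<zero> --> x = \<zero>) \<and> q = a \<otimes> inv b"
 shows "curve R A s" proof (intro curve.intro curve_axioms.intro cring_axioms A sA')
 show "s \<in> Units R" using u[OF sA'] s_nzd by blast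
 show "s \<in> n" if "maxl A n" for n using that m s_m by blast
 show "len A A (scale s A) \<noteq> \<infinity>"
  using len_finite_if_nzd[OF smod_cyclic(1)[OF A] cyclic_least[OF A sA sA'] smod_cyclic(2)[OF A]] AE(4) sA' by blast
 show "\<exists>F. finite F \<and> F <= J \<and> (\<forall>X. smod A X \<and> F <= X --> J <= X)" if J: "smod A J" "J <= A" for J
 proof -
  have iJ: "ideal J (subr A)" using J ideal_iff_smod[OF A] by blast
  interpret B: cring "subr A" by (rule cring_subr[OF A])
  obtain F where F: "F <= A" "finite F" "J = Idl\<^bsub>subr A\<^esub> F" using noetherian_ring.finetely_gen[OF noe iJ] by auto
  have "J <= X" if X: "smod A X" "F <= X" for X proof -
   have "ideal (X \<inter> A) (subr A)" using ideal_iff_smod[OF A] smod_inter[OF X(1) sA] by blast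
   then have "Idl\<^bsub>subr A\<^esub> F <= X \<inter> A" using B.genideal_minimal X(2) F(1) by blast
   then show ?thesis using F(3) by blast
  qed
  moreover have "F <= J" using B.genideal_self[of F] F by simp
  ultimately show ?thesis using F(2) by blast
 qed
 fix q assume q: "q \<in> carrier R"
 obtain a b where ab: "a \<in> A" "b \<in> A" "\<And>x. x \<in> A ==> b \<otimes> x = \<zero> ==> x = \<zero>" "q = a \<otimes> inv b" using frac[OF q] by blast
 have bu: "b \<in> Units R" using u ab by blast
 obtain k :: nat where "s [^] k \<in> scale b A" using power_mem[OF ab(2,3) s_m] by blast
 then obtain c where c: "c \<in> A" "s [^] k = b \<otimes> c" by (auto simp: mem_scale)
 have cc: "a \<in> carrier R" "b \<in> carrier R" "c \<in> carrier R" "inv b \<in> carrier R" using ab c AE bu by auto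
 have "s [^] k \<otimes> q = (inv b \<otimes> (b \<otimes> c)) \<otimes> a" unfolding c(2) ab(4) using cc by algebra
 then have "s [^] k \<otimes> q = c \<otimes> a" using bu cc by simp
 then have "s [^] k \<otimes> q \<in> A" using AE(2) c(1) ab(1) by simp
 then show "\<exists>k::nat. s [^] k \<otimes> q \<in> A" ..
qed

end

locale local_curve = curve Q A s + D: local_dim1 Q A m s for Q (structure) and A s m
begin

text \<open>The element \<open>s\<close> alone is a regular sequence. After a first element
  \<open>a\<close> no second element \<open>b\<close> is possible: a power of \<open>b\<close> lies
  in \<open>aA\<close> and kills \<open>X/aX\<close>, so regularity of \<open>b\<close> would give
  \<open>X = aX\<close>, against Nakayama's lemma.\<close>

lemma maximal_cohen_macaulay_frac:
 assumes X: "frac X" shows "maximal_cohen_macaulay R0 (as_module Q X)" proof -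
 note sX = frac_smod[OF X] and Xc = frac_carrier[OF X]
 have mm: "max_ideal R0 = m" unfolding max_ideal_def maximalideal_iff_maxl[OF A] D.m by simp
 have nA: "x = \<zero>" if "x \<in> carrier Q" "s \<otimes> x = \<zero>" for x
  using that Units_l_cancel[OF s_unit, of x \<zero>] s_closed by simp
 obtain k :: nat where k: "s [^] k \<in> X" using X unfolding frac_def by blast
 have X0: "X \<noteq> {\<zero>}" proof
  assume "X = {\<zero>}"
  then have "inv (s [^] k) \<otimes> s [^] k = \<zero>" using k spow_unit[of k] by auto
  then have "\<one> = \<zero>" using spow_unit[of k] by simp
  then show False using smodD(2)[OF D.mA(1)] maxl_prm[OF A, of m] D.m unfolding prm_def by simp
 qed
 have nak: "scale a X \<noteq> X" if "a \<in> m" for a proof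
  assume eq: "scale a X = X"
  have z: "smod A {\<zero>}" using AQ by (intro smodI) auto
  have zX: "{\<zero>} \<subset> X" using X0 smodD(2)[OF sX] by blast
  obtain M n where "smod A M" "M \<subset> X" "maxl A n" "\<And>a x. a \<in> n ==> x \<in> X ==> a \<otimes> x \<in> M"
   using nakayama_maxl[OF X sX order_refl z zX] by metis
  then have "scale a X <= M" using that D.m by (auto simp: mem_scale)
  then show False using \<open>M \<subset> X\<close> eq by blast
 qed
 have fg: "finitely_generated R0 (as_module Q X)" proof -
  obtain F where F: "finite F" "F <= X" "\<And>Y. smod A Y ==> F <= Y ==> X <= Y"
   using finitely_gen[OF X sX order_refl] by blast
  have "module_span R0 (as_module Q X) F = X"
   unfolding module_span_def submodule_as_module[OF A sX] using F(2,3) sX by blast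
  then show ?thesis unfolding finitely_generated_def using F(1,2) module_as_module[OF A sX] by auto
 qed
 have "regular_sequence R0 (as_module Q X) [s]" unfolding regular_sequence_def
  using ideal_smult_single[OF A sX s_A] nak[OF D.s_m] nA s_A Xc by auto
 then have "enat 1 <= depth R0 (as_module Q X)"
  unfolding depth_def mm using D.s_m by (intro Sup_upper) (auto intro!: exI[of _ "[s]"])
 moreover have "length xs <= 1" if xs: "regular_sequence R0 (as_module Q X) xs" "set xs <= m" for xs
 proof (rule ccontr)
  assume l: "\<not> length xs <= 1"
  let ?a = "xs ! 0" and ?b = "xs ! 1"
  have "xs \<noteq> []" using l by auto
  then have ab: "?a \<in> m" "?b \<in> m" using xs(2) l nth_mem[of 0 xs] nth_mem[of 1 xs] by auto
  then have c: "?a \<in> A" "?b \<in> A" "?a \<in> carrier Q" "?b \<in> carrier Q" using D.mA AQ by auto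
  note reg = regular_sequenceD[OF A sX xs(1)]
  have nzd: "x = \<zero>" if x: "x \<in> A" "?a \<otimes> x = \<zero>" for x proof -
   have xc: "x \<in> carrier Q" using x AQ by blast
   have "?a \<otimes> (x \<otimes> s [^] k) = (?a \<otimes> x) \<otimes> s [^] k" using c xc spow_closed by (simp add: m_assoc)
   then have "?a \<otimes> (x \<otimes> s [^] k) = \<zero>" using x spow_closed by simp
   then have "x \<otimes> s [^] k = \<zero>" using reg(1)[of "x \<otimes> s [^] k"] \<open>xs \<noteq> []\<close> smodD(4)[OF sX x(1) k] by auto
   then have "inv (s [^] k) \<otimes> (s [^] k \<otimes> x) = \<zero>" using xc spow_closed spow_unit by (simp add: m_comm)
   then show ?thesis using xc spow_unit by simp
  qed
  obtain j :: nat where j: "?b [^] j \<in> scale ?a A" using D.power_mem[OF c(1) nzd ab(2)] by blast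
  have "x \<in> scale ?a X" if "x \<in> X" "?b [^] (j::nat) \<otimes> x \<in> scale ?a X" for x j using that
  proof (induction j arbitrary: x)
   case (Suc j)
   have "?b [^] j \<otimes> (?b \<otimes> x) \<in> scale ?a X" using Suc.prems c Xc by (auto simp: m_assoc subset_iff)
   then have "?b \<otimes> x \<in> scale ?a X" using Suc.IH smodD(4)[OF sX c(2)] Suc.prems by blast
   then show ?case using reg(2) l Suc.prems by simp
  qed (use Xc in auto)
  moreover have "?b [^] j \<otimes> x \<in> scale ?a X" if x: "x \<in> X" for x proof -
   obtain d where d: "d \<in> A" "?b [^] j = ?a \<otimes> d" using j by (auto simp: mem_scale)
   have "?b [^] j \<otimes> x = ?a \<otimes> (d \<otimes> x)" unfolding d(2) using c d(1) x Xc AQ by (auto simp: m_assoc subset_iff)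
   then show ?thesis using scaleI[OF smodD(4)[OF sX d(1) x]] by simp
  qed
  ultimately have "X <= scale ?a X" by blast
  then show False using nak[OF ab(1)] smodD(4)[OF sX c(1)] by (auto simp: mem_scale)
 qed
 then have "depth R0 (as_module Q X) <= enat 1" unfolding depth_def mm by (intro Sup_least) auto
 ultimately show ?thesis unfolding maximal_cohen_macaulay_def D.dim using fg X0 by (simp add: one_enat_def)
qed

end

subsection \<open>The theorem\<close>

context curve begin

text \<open>A common denominator of the generators serves for all of \<open>X\<close>.\<close>

lemma frac_if_finitely_generated:
 assumes X: "smod A X" "\<one> \<in> X" and fg: "finitely_generated R0 (as_module Q X)" shows "frac X" proof -
 obtain F where F: "F <= X" "finite F" "module_span R0 (as_module Q X) F = X"
  using fg unfolding finitely_generated_def by auto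
 obtain k :: nat where k: "\<And>x. x \<in> F ==> s [^] k \<otimes> x \<in> A"
  using common_denominator[OF F(2)] F(1) smodD(1)[OF X(1)] by blast
 have "smod A {x \<in> X. s [^] k \<otimes> x \<in> A}" using smod_mult_preimage[OF AQ X(1) smod_A spow_closed] .
 then have "module_span R0 (as_module Q X) F <= {x \<in> X. s [^] k \<otimes> x \<in> A}"
  unfolding module_span_def submodule_as_module[OF A X(1)] using k F(1) by (intro Inter_lower) auto
 then have "scale (s [^] k) X <= A" unfolding F(3) by (auto simp: mem_scale)
 moreover have "s [^] (0::nat) \<in> X" using X(2) by simp
 ultimately show ?thesis unfolding frac_def using X(1) by blast
qed

end

context local_curve begin

lemma ulrich_module_iff:
 assumes J: "frac J" "J <= A" and M: "frac M"
 shows "ulrich_module R0 J (as_module Q M) \<longleftrightarrow>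
  (\<exists>N. \<forall>n\<ge>N. len A (ipow J n \<cdot> M) (ipow J (Suc n) \<cdot> M) = len A M (J \<cdot> M))"
proof -
 obtain k :: nat where k: "s [^] k \<in> J" using J unfolding frac_def by blast
 have "x = \<zero>" if "x \<in> A" "s [^] k \<otimes> x = \<zero>" for x
  using that Units_l_cancel[OF spow_unit, of x \<zero> k] A_closed spow_closed by simp
 then have "s [^] k \<in> J \<inter> nonzerodivisors R0" using k spow_A by (simp add: nonzerodivisors_def)
 then have "J \<inter> nonzerodivisors R0 \<noteq> {}" by blast
 moreover have "ideal J R0" using ideal_iff_smod[OF A] frac_smod[OF J(1)] J(2) by blast
 ultimately show ?thesis
  unfolding ulrich_module_def using maximal_cohen_macaulay_frac[OF M] multiplicity_iff_ulr[OF J M] by blast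
qed

end

theorem theorem3:
  fixes R Q S :: "'a ring" and \<omega> I :: "'a set"
  assumes "cohen_macaulay_local_ring R"
    and "krull_dim R = 1"
    and "canonical_ideal R \<omega>"
    and "total_ring_of_fractions R Q"
    and "finite_birational_extension R Q S"
    and "reflexive_module R (self_module S)"
    and "I = conductor R Q S"
  shows "(gorenstein_ring S \<longleftrightarrow>
            ulrich_module R I (as_module R I) \<and> ulrich_module R \<omega> (as_module R I)) \<and>
         (ulrich_module R I (as_module R I) \<and> ulrich_module R \<omega> (as_module R I) \<longleftrightarrow>
            module_isomorphic R (as_module R I) (as_module R (I \<cdot>\<^bsub>R\<^esub> I)) \<and>
            module_isomorphic R (as_module R (I \<cdot>\<^bsub>R\<^esub> I)) (as_module R (I \<cdot>\<^bsub>R\<^esub> \<omega>)))"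
proof -
 define A B where "A = carrier R" and "B = carrier S"
 note cm = assms(1) and dim = assms(2) and can = assms(3) and tot = assms(4) and bir = assms(5) and ref = assms(6) and I_def = assms(7)
 have R_def: "R = Q\<lparr>carrier := A\<rparr>" and S_def: "S = Q\<lparr>carrier := B\<rparr>"
  using tot bir unfolding total_ring_of_fractions_def finite_birational_extension_def subring_of_def A_def B_def by blast+
 interpret Q: cring Q using tot unfolding total_ring_of_fractions_def by blast
 have A: "subring A Q" using tot unfolding total_ring_of_fractions_def subring_of_def R_def by simp
 have B: "subring B Q" "A <= B" using bir unfolding finite_birational_extension_def subring_of_def S_def R_def by auto
 have AQ: "A <= carrier Q" using subringE(1)[OF A] .
 have noe: "noetherian_ring R" and loc: "\<exists>!m. maximalideal m R" and dep: "depth R (as_module Q A) = 1"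
  using cm dim unfolding cohen_macaulay_local_ring_def noetherian_local_ring_def R_def by auto
 define m where "m = max_ideal R"
 have m: "Q.maxl A n \<longleftrightarrow> n = m" for n
  using theI'[OF loc] loc Q.maximalideal_iff_maxl[OF A] unfolding m_def max_ideal_def R_def by metis
 have "\<not> depth R (as_module Q A) <= 0" using dep by simp
 then obtain xs where xs: "regular_sequence R (as_module Q A) xs" "set xs <= m" "\<not> enat (length xs) <= 0"
  unfolding depth_def m_def Sup_le_iff by blast
 \<comment> \<open>The parameter: the first element of a regular sequence in \<open>m\<close>, which
   is nonempty because the depth is one.\<close>
 define s where "s = xs ! 0"
 have len: "0 < length xs" using xs(3) by (cases xs) (auto simp: zero_enat_def)
 have s_m: "s \<in> m" using xs(2) len by (auto simp: s_def)
 have s_nzd: "x = \<zero>\<^bsub>Q\<^esub>" if "x \<in> A" "s \<otimes>\<^bsub>Q\<^esub> x = \<zero>\<^bsub>Q\<^esub>" for x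
  using Q.regular_sequenceD(1)[OF A Q.smod_self[OF A] xs(1)[unfolded R_def] len] that by (simp add: s_def)
 interpret D: local_dim1 Q A m s
 proof (intro local_dim1.intro noeth_subring.intro noeth_subring_axioms.intro local_dim1_axioms.intro Q.cring_axioms A)
  show "noetherian_ring (Q.subr A)" "krull_dim (Q.subr A) = 1" using noe dim by (simp_all add: R_def)
 qed (fact m s_m s_nzd)+
 have nzd: "nonzerodivisors R = {b \<in> A. \<forall>x\<in>A. b \<otimes>\<^bsub>Q\<^esub> x = \<zero>\<^bsub>Q\<^esub> --> x = \<zero>\<^bsub>Q\<^esub>}"
  by (simp add: nonzerodivisors_def R_def)
 have "curve Q A s" proof (rule D.curve_local)
  show "b \<in> Units Q" if "b \<in> A" "\<And>x. x \<in> A ==> b \<otimes>\<^bsub>Q\<^esub> x = \<zero>\<^bsub>Q\<^esub> ==> x = \<zero>\<^bsub>Q\<^esub>" for b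
  proof -
   have "b \<in> nonzerodivisors R" using that unfolding nzd by blast
   then show ?thesis using tot unfolding total_ring_of_fractions_def by blast
  qed
  have "carrier Q = {a \<otimes>\<^bsub>Q\<^esub> inv\<^bsub>Q\<^esub> b | a b. a \<in> A \<and> b \<in> nonzerodivisors R}"
   using tot unfolding total_ring_of_fractions_def by (simp add: R_def)
  then show "\<exists>a\<in>A. \<exists>b\<in>A. (\<forall>x\<in>A. b \<otimes>\<^bsub>Q\<^esub> x = \<zero>\<^bsub>Q\<^esub> --> x = \<zero>\<^bsub>Q\<^esub>) \<and> q = a \<otimes>\<^bsub>Q\<^esub> inv\<^bsub>Q\<^esub> b" if "q \<in> carrier Q" for q
   using that unfolding nzd by blast
 qed
 then interpret C: local_curve Q A s m by (intro local_curve.intro D.local_dim1_axioms)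
 have sB: "Q.smod A B" using Q.smod_subring[OF Q.smod_self[OF B(1)] B(2)] .
 have fB: "C.frac B" by (rule C.frac_if_finitely_generated[OF sB subringE(3)[OF B(1)]])
   (use bir in \<open>simp add: finite_birational_extension_def R_def S_def\<close>)
 interpret O: overring Q A s B by (intro overring.intro overring_axioms.intro C.curve_axioms B fB)
 have W: "Q.smod A \<omega>" "\<omega> <= A" using can Q.ideal_iff_smod[OF A] unfolding canonical_ideal_def R_def by auto
 \<comment> \<open>The regular element \<open>b\<close> of \<open>\<omega>\<close> divides a power
   of \<open>s\<close>, which therefore lies in \<open>\<omega>\<close>.\<close>
 have fW: "C.frac \<omega>" proof -
  obtain b where b: "b \<in> \<omega>" "b \<in> nonzerodivisors R" using can unfolding canonical_ideal_def by blast
  then obtain k :: nat where "s [^]\<^bsub>Q\<^esub> k \<in> Q.scale b A" using D.power_mem[of b s] s_m unfolding nzd by blast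
  then have "s [^]\<^bsub>Q\<^esub> k \<in> \<omega>" using Q.cyclic_least[OF A W(1) b(1)] by blast
  moreover have "Q.scale (s [^]\<^bsub>Q\<^esub> (0::nat)) \<omega> <= A" using Q.scale_one[of \<omega>] W AQ by simp
  ultimately show ?thesis unfolding C.frac_def using W(1) by blast
 qed
 have dW: "C.dualizing \<omega>" by (rule C.canonical_dualizing[OF _ fW])
   (use m can dim in \<open>auto simp: m_def canonical_ideal_def R_def\<close>)
 have I: "I = Q.colon A B" by (simp add: I_def conductor_def Q.colon_def R_def S_def)
 have refl: "Q.colon A I = B" unfolding I
  by (rule C.reflexive_double_colon[OF fB subringE(3)[OF B(1)]]) (use ref in \<open>simp add: R_def S_def\<close>)
 note fI = O.frac_I(1)[OF dW I refl W(2)] and IA = O.frac_I(3)[OF dW I refl W(2)]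
 have cI: "I <= carrier Q" "\<omega> <= carrier Q" using IA W AQ by auto
 have ulr: "ulrich_module R I (as_module R I) \<longleftrightarrow> O.ulr I I" "ulrich_module R \<omega> (as_module R I) \<longleftrightarrow> O.ulr \<omega> I"
  unfolding O.ulr_def[OF dW] R_def as_module_simps
  by (rule C.ulrich_module_iff[OF fI IA fI], rule C.ulrich_module_iff[OF fW W(2) fI])
 have gor: "gorenstein_ring S \<longleftrightarrow> O.CS.dualizing B" unfolding S_def by (rule O.CS.gorenstein_ring_iff)
 have iso: "module_isomorphic R (as_module R X) (as_module R Y) \<longleftrightarrow> (\<exists>q\<in>Units Q. Y = Q.scale q X)"
  if "C.frac X" "C.frac Y" for X Y using C.module_isomorphic_iff[OF that] by (simp add: R_def)
 have prd: "X \<cdot>\<^bsub>R\<^esub> Y = X \<cdot>\<^bsub>Q\<^esub> Y" for X Y unfolding R_def by (rule ideal_prod_carrier_update)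
 have isoI: "module_isomorphic R (as_module R I) (as_module R (I \<cdot>\<^bsub>R\<^esub> I)) \<longleftrightarrow> (\<exists>q\<in>Units Q. I \<cdot>\<^bsub>Q\<^esub> I = Q.scale q I)"
  "module_isomorphic R (as_module R (I \<cdot>\<^bsub>R\<^esub> I)) (as_module R (I \<cdot>\<^bsub>R\<^esub> \<omega>))
   \<longleftrightarrow> (\<exists>q\<in>Units Q. I \<cdot>\<^bsub>Q\<^esub> \<omega> = Q.scale q (I \<cdot>\<^bsub>Q\<^esub> I))"
  unfolding prd using iso C.frac_prod fI fW by blast+
 have WI: "\<omega> \<cdot>\<^bsub>Q\<^esub> I = I \<cdot>\<^bsub>Q\<^esub> \<omega>" using Q.prod_comm[OF cI(2,1)] .
 \<comment> \<open>From \<open>I^2 = qI\<close> and \<open>\<omega>I = rI\<close> the second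
   isomorphism is multiplication by \<open>r q^-1\<close>; in \<open>2\<close> the factors
   \<open>r\<close> and \<open>q\<close> are multiplied again to recover \<open>\<omega>I\<close> as
   a multiple of \<open>I\<close>. With \<open>3\<close> the circle of implications closes.\<close>
 have 1: "(\<exists>q\<in>Units Q. I \<cdot>\<^bsub>Q\<^esub> I = Q.scale q I) \<and> (\<exists>q\<in>Units Q. I \<cdot>\<^bsub>Q\<^esub> \<omega> = Q.scale q (I \<cdot>\<^bsub>Q\<^esub> I))"
  if G: "O.CS.dualizing B" proof -
  obtain q r where q: "q \<in> Units Q" "I \<cdot>\<^bsub>Q\<^esub> I = Q.scale q I" and r: "r \<in> Units Q" "\<omega> \<cdot>\<^bsub>Q\<^esub> I = Q.scale r I"
   using O.gorenstein_imp_scale[OF dW I refl W(2) G] by blast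
  have c: "q \<in> carrier Q" "r \<in> carrier Q" "inv\<^bsub>Q\<^esub> q \<in> carrier Q" using q r by auto
  have "Q.scale (r \<otimes>\<^bsub>Q\<^esub> inv\<^bsub>Q\<^esub> q) (I \<cdot>\<^bsub>Q\<^esub> I) = Q.scale r I"
   unfolding q(2) using Q.scale_scale[of I] Q.scale_inv(2)[OF cI(1) q(1)] c cI Q.m_assoc q(1) by simp
  then show ?thesis using q r WI by (metis Q.Units_inv_Units Q.Units_m_closed)
 qed
 have 2: "O.ulr I I \<and> O.ulr \<omega> I"
  if H: "\<exists>q\<in>Units Q. I \<cdot>\<^bsub>Q\<^esub> I = Q.scale q I" "\<exists>q\<in>Units Q. I \<cdot>\<^bsub>Q\<^esub> \<omega> = Q.scale q (I \<cdot>\<^bsub>Q\<^esub> I)"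
 proof -
  obtain q r where q: "q \<in> Units Q" "I \<cdot>\<^bsub>Q\<^esub> I = Q.scale q I" and r: "r \<in> Units Q" "I \<cdot>\<^bsub>Q\<^esub> \<omega> = Q.scale r (I \<cdot>\<^bsub>Q\<^esub> I)"
   using H by blast
  have "\<omega> \<cdot>\<^bsub>Q\<^esub> I = Q.scale (r \<otimes>\<^bsub>Q\<^esub> q) I" unfolding WI r(2) q(2) using Q.scale_scale[OF cI(1)] q(1) r(1) by (simp add: Q.Units_closed)
  then show ?thesis using O.ulr_if_scale[OF dW fI fI q] O.ulr_if_scale[OF dW fW fI] q r by blast
 qed
 have 3: "O.CS.dualizing B" if "O.ulr I I" "O.ulr \<omega> I"
  using O.ulrich_imp_gorenstein[OF dW I refl W(2) that] .
 show ?thesis unfolding ulr gor isoI using 1 2 3 by blast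
qed

end
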